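(* For every $\mu>0$ and every $(x,y)\in D((-A)^{1/2}Q^{-1})\times D(Q^{-1})$, $$V^\mu(x,y)=\left|(-A)^{1/2}Q^{-1}x\right|_H^2+2F(x)+\mu\left|Q^{-1}y\right|_H^2.$$ Moreover, for every $x\in D((-A)^{1/2}Q^{-1})$, $$V(x)=\left|(-A)^{1/2}Q^{-1}x\right|_H^2+2F(x).$$ In particular, for every $\mu>0$ and every such $x$, $$V_\mu(x):=\inf_{y\in H^{-1}}V^\mu(x,y)=V^\mu(x,0)=V(x).$$
   Context: **Setting.** Let $\mathcal{O}\subset\mathbb{R}^d$ ($d\ge 1$) be a bounded domain with regular boundary, $H=L^2(\mathcal{O})$, and let $A$ be the realization of the Laplacian in $H$ with Dirichlet boundary conditions. Let $\{e_k\}_{k\in\mathbb{N}}$ be a complete orthonormal basis of $H$ with $Ae_k=-\alpha_k e_k$, $0<\alpha_1\le\alpha_k\le\alpha_{k+1}$. For $\delta\in\mathbb{R}$, $H^\delta$ is the completion of $C_0^\infty(\mathcal{O})$ in the norm $|u|_{H^\delta}^2=\sum_k\alpha_k^\delta\langle u,e_k\rangle_H^2$. Set $\mathcal{H}_\delta=H^\delta\times H^{\delta-1}$ and $\mathcal{H}=\mathcal{H}_0=H\times H^{-1}$. $\Pi_1$ denotes projection onto the first component. **Assumption on $Q$.** $Q$ is a bounded linear operator on $H$, diagonal in the basis $\{e_k\}$, $Qe_k=\lambda_ke_k$, with $\sum_{k}\lambda_k^2/\alpha_k<+\infty$. $Q^{-1}$ is the inverse (pseudo-inverse, if some $\lambda_k=0$)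 of $Q$, with domain $D(Q^{-1})=\mathrm{Im}(Q)\subset H$, and $D((-A)^{1/2}Q^{-1})=\{x\in D(Q^{-1}): Q^{-1}x\in D((-A)^{1/2})\}$. **Assumption on $F$.** $F:H\to\mathbb{R}$ is of class $C^1$, $F(0)=0$, $F(x)\ge0$ and $\langle DF(x),x\rangle_H\ge0$ for all $x\in H$, and there is $\kappa\geq 0$ with $|DF(x)-DF(y)|_H\le\kappa|x-y|_H$ for all $x,y\in H$, where $DF(x)\in H$ is the gradient. **Wave equation quasi-potential.** For $\mu>0$, $A_\mu(u,v)=\left(v,\tfrac1\mu Au-\tfrac1\mu v\right)$ with domain $D(A_\mu)=\mathcal{H}_1$ in $\mathcal{H}$; it generates a $C_0$-semigroup $S_\mu(t)$ on $\mathcal{H}$. $Q_\mu v=\tfrac1\mu(0,Qv)$. For $T>0$, $z_0\in\mathcal{H}$ and $\psi\in L^2((0,T);H)$, let $z^\mu_{z_0,\psi}\in C([0,T];\mathcal{H})$ be the unique solution of $$z(t)=S_\mu(t)z_0-\int_{0}^tS_\mu(t-s)Q_\mu Q\,DF(\Pi_1z(s))\,ds+\int_{0}^tS_\mu(t-s)Q_\mu\psi(s)\,ds .$$ For $z\in C([0,T];\mathcal{H})$, $I^\mu_{0,T}(z)=\tfrac12\inf\{|\psi|^2_{L^2((0,T);H)}: z=z^\mu_{z(0),\psi}\}$ (with $\inf\emptyset=+\infty$), and $$V^\mu(x,y)=\inf\left\{I^\mu_{0,T}(z):\ T>0,\ z\in C([0,T];\mathcal{H}),\ z(0)=0,\ z(T)=(x,y)\right\},\quad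 (x,y)\in\mathcal{H}.$$ **Heat equation quasi-potential.** For $T>0$, $u_0\in H$ and $\psi\in L^2((0,T);H)$, let $\varphi_{u_0,\psi}\in C([0,T];H)$ be the unique solution of $$\varphi(t)=e^{tA}u_0-\int_0^te^{(t-s)A}Q^2DF(\varphi(s))\,ds+\int_0^te^{(t-s)A}Q\psi(s)\,ds.$$ For $\varphi\in C([0,T];H)$, $I_{0,T}(\varphi)=\tfrac12\inf\{|\psi|^2_{L^2((0,T);H)}:\varphi=\varphi_{\varphi(0),\psi}\}$ (with $\inf\emptyset=+\infty$), and $$V(x)=\inf\left\{I_{0,T}(\varphi):\ T>0,\ \varphi\in C([0,T];H),\ \varphi(0)=0,\ \varphi(T)=x\right\},\quad x\in H.$$ *)

theory Defs
  imports "HOL-Analysis.Analysis"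
begin

text \<open>
  Conventions. The space \<open>H = L\<^sup>2(\<Omega>)\<close> is a Hilbert space type \<open>'h\<close> together with a map \<open>J\<close> that
  sends a vector to a representing function on \<open>\<Omega>\<close> (\<open>L2_model\<close>). The space \<open>H\<^sup>-\<^sup>1\<close> is a
  Hilbert space type \<open>'m\<close> together with the inclusion \<open>\<iota> :: 'h \<Rightarrow> 'm\<close> of \<open>H\<close> (\<open>H_completion\<close>).
  Hence \<open>H \<times> H\<^sup>-\<^sup>1\<close> is the product type \<open>'h \<times> 'm\<close>, with the library's topology and Bochner integral.
  Unbounded operators are given by their graphs. Eigenvalues are indexed from 0.
\<close>

section \<open>Domains and test functions\<close>

text \<open>Near each boundary point the domain is the strict subgraph, in some direction \<open>n\<close>, of a
  Lipschitz function of the component orthogonal to \<open>n\<close>.\<close>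

definition lipschitz_boundary :: "'a::euclidean_space set \<Rightarrow> bool" where
  "lipschitz_boundary \<Omega> \<longleftrightarrow>
    (\<forall>p\<in>frontier \<Omega>. \<exists>n r L g. norm n = 1 \<and> r > 0 \<and> lipschitz_on L UNIV (g :: 'a \<Rightarrow> real) \<and>
       (\<forall>x\<in>ball p r. x \<in> \<Omega> \<longleftrightarrow> inner x n < g (x - inner x n *\<^sub>R n)))"

definition bounded_domain :: "'a::euclidean_space set \<Rightarrow> bool" where
  "bounded_domain \<Omega> \<longleftrightarrow> open \<Omega> \<and> connected \<Omega> \<and> \<Omega> \<noteq> {} \<and> bounded \<Omega>"

definition partial :: "'a::euclidean_space \<Rightarrow> ('a \<Rightarrow> real) \<Rightarrow> 'a \<Rightarrow> real" where
  "partial i f x = frechet_derivative f (at x) i"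

primrec C_k :: "nat \<Rightarrow> ('a::euclidean_space \<Rightarrow> real) \<Rightarrow> bool" where
  "C_k 0 f \<longleftrightarrow> continuous_on UNIV f"
| "C_k (Suc k) f \<longleftrightarrow> (\<forall>x. f differentiable (at x)) \<and> (\<forall>i\<in>Basis. C_k k (partial i f))"

definition test_function :: "'a::euclidean_space set \<Rightarrow> ('a \<Rightarrow> real) \<Rightarrow> bool" where
  "test_function \<Omega> \<phi> \<longleftrightarrow>
    (\<forall>k. C_k k \<phi>) \<and> (\<exists>K. compact K \<and> K \<subseteq> \<Omega> \<and> (\<forall>x. x \<notin> K \<longrightarrow> \<phi> x = 0))"

definition laplacian :: "('a::euclidean_space \<Rightarrow> real) \<Rightarrow> 'a \<Rightarrow> real" where
  "laplacian \<phi> x = (\<Sum>i\<in>Basis. partial i (partial i \<phi>) x)"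


section \<open>The space \<open>L\<^sup>2(\<Omega>)\<close> and the Dirichlet Laplacian\<close>

definition square_integrable_on :: "('a::euclidean_space \<Rightarrow> real) \<Rightarrow> 'a set \<Rightarrow> bool" where
  "square_integrable_on f \<Omega> \<longleftrightarrow>
    f \<in> borel_measurable (lebesgue_on \<Omega>) \<and> integrable (lebesgue_on \<Omega>) (\<lambda>x. (f x)\<^sup>2)"

definition L2_model :: "'a::euclidean_space set \<Rightarrow> ('h::real_inner \<Rightarrow> 'a \<Rightarrow> real) \<Rightarrow> bool" where
  "L2_model \<Omega> J \<longleftrightarrow>
    (\<forall>u. square_integrable_on (J u) \<Omega>) \<and>
    (\<forall>f. square_integrable_on f \<Omega> \<longrightarrow> (\<exists>u. AE x in lebesgue_on \<Omega>. J u x = f x)) \<and>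
    (\<forall>a b u v. AE x in lebesgue_on \<Omega>. J (a *\<^sub>R u + b *\<^sub>R v) x = a * J u x + b * J v x) \<and>
    (\<forall>u v. inner u v = (\<integral>x. J u x * J v x \<partial>lebesgue_on \<Omega>))"

definition test_vectors :: "'a::euclidean_space set \<Rightarrow> ('h::real_inner \<Rightarrow> 'a \<Rightarrow> real) \<Rightarrow> 'h set" where
  "test_vectors \<Omega> J = {u. \<exists>\<phi>. test_function \<Omega> \<phi> \<and> (AE x in lebesgue_on \<Omega>. J u x = \<phi> x)}"

text \<open>The closure of the test functions in the usual first-order Sobolev norm.\<close>

definition in_H10 :: "'a::euclidean_space set \<Rightarrow> ('a \<Rightarrow> real) \<Rightarrow> bool" where
  "in_H10 \<Omega> f \<longleftrightarrow>
    square_integrable_on f \<Omega> \<and>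
    (\<exists>\<phi> :: nat \<Rightarrow> 'a \<Rightarrow> real. (\<forall>n. test_function \<Omega> (\<phi> n)) \<and>
       (\<lambda>n. \<integral>x. (\<phi> n x - f x)\<^sup>2 \<partial>lebesgue_on \<Omega>) \<longlonglongrightarrow> 0 \<and>
       (\<forall>\<epsilon>>0. \<exists>N. \<forall>m\<ge>N. \<forall>n\<ge>N. \<forall>i\<in>Basis.
          (\<integral>x. (partial i (\<phi> m) x - partial i (\<phi> n) x)\<^sup>2 \<partial>lebesgue_on \<Omega>) < \<epsilon>))"

text \<open>Graph of \<open>A\<close>: \<open>u \<in> H\<^sub>0\<^sup>1(\<Omega>)\<close> and the distributional Laplacian of \<open>u\<close> is \<open>f \<in> L\<^sup>2(\<Omega>)\<close>.\<close>

definition dirichlet_laplacian ::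
  "'a::euclidean_space set \<Rightarrow> ('h::real_inner \<Rightarrow> 'a \<Rightarrow> real) \<Rightarrow> ('h \<times> 'h) set" where
  "dirichlet_laplacian \<Omega> J = {(u, f). in_H10 \<Omega> (J u) \<and>
     (\<forall>\<phi>. test_function \<Omega> \<phi> \<longrightarrow>
        (\<integral>x. J u x * laplacian \<phi> x \<partial>lebesgue_on \<Omega>) = (\<integral>x. J f x * \<phi> x \<partial>lebesgue_on \<Omega>))}"

definition dirichlet_eigenbasis ::
  "'a::euclidean_space set \<Rightarrow> ('h::real_inner \<Rightarrow> 'a \<Rightarrow> real) \<Rightarrow> (nat \<Rightarrow> 'h) \<Rightarrow> (nat \<Rightarrow> real) \<Rightarrow> bool" where
  "dirichlet_eigenbasis \<Omega> J e \<alpha> \<longleftrightarrow>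
    (\<forall>i j. inner (e i) (e j) = (if i = j then 1 else 0)) \<and>
    closure (span (range e)) = UNIV \<and>
    (\<forall>k. (e k, - \<alpha> k *\<^sub>R e k) \<in> dirichlet_laplacian \<Omega> J) \<and>
    0 < \<alpha> 0 \<and> (\<forall>k. \<alpha> k \<le> \<alpha> (Suc k))"


section \<open>The scale \<open>H\<^sup>\<delta>\<close>\<close>

definition H_norm :: "(nat \<Rightarrow> 'h::real_inner) \<Rightarrow> (nat \<Rightarrow> real) \<Rightarrow> real \<Rightarrow> 'h \<Rightarrow> real" where
  "H_norm e \<alpha> \<delta> u = sqrt (\<Sum>k. (\<alpha> k powr \<delta>) * (inner u (e k))\<^sup>2)"

text \<open>For \<open>\<delta> \<ge> 0\<close> the completion of the test functions is realised as a subset of \<open>H\<close>.\<close>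

definition H_space ::
  "'a::euclidean_space set \<Rightarrow> ('h::real_inner \<Rightarrow> 'a \<Rightarrow> real) \<Rightarrow> (nat \<Rightarrow> 'h) \<Rightarrow> (nat \<Rightarrow> real) \<Rightarrow> real \<Rightarrow> 'h set" where
  "H_space \<Omega> J e \<alpha> \<delta> = {u. \<exists>w :: nat \<Rightarrow> 'h. (\<forall>n. w n \<in> test_vectors \<Omega> J) \<and> w \<longlonglongrightarrow> u \<and>
     (\<forall>\<epsilon>>0. \<exists>N. \<forall>m\<ge>N. \<forall>n\<ge>N. H_norm e \<alpha> \<delta> (w m - w n) < \<epsilon>)}"

text \<open>For \<open>\<delta> \<le> 0\<close> it is a complete space \<open>'m\<close> containing \<open>H\<close> through \<open>\<iota>\<close>.\<close>

definition H_completion ::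
  "'a::euclidean_space set \<Rightarrow> ('h::real_inner \<Rightarrow> 'a \<Rightarrow> real) \<Rightarrow> (nat \<Rightarrow> 'h) \<Rightarrow> (nat \<Rightarrow> real) \<Rightarrow> real \<Rightarrow>
   ('h \<Rightarrow> 'm::{real_inner, complete_space}) \<Rightarrow> bool" where
  "H_completion \<Omega> J e \<alpha> \<delta> \<iota> \<longleftrightarrow>
    bounded_linear \<iota> \<and> (\<forall>u. norm (\<iota> u) = H_norm e \<alpha> \<delta> u) \<and> closure (\<iota> ` test_vectors \<Omega> J) = UNIV"

text \<open>The extension of \<open>A\<close> to an operator from \<open>H\<^sup>1\<close> to \<open>H\<^sup>-\<^sup>1\<close>; the series converges in \<open>H\<^sup>-\<^sup>1\<close>.\<close>

definition A_ext ::
  "(nat \<Rightarrow> 'h::real_inner) \<Rightarrow> (nat \<Rightarrow> real) \<Rightarrow> ('h \<Rightarrow> 'm::real_normed_vector) \<Rightarrow> 'h \<Rightarrow> 'm" where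
  "A_ext e \<alpha> \<iota> u = (\<Sum>k. (- \<alpha> k * inner u (e k)) *\<^sub>R \<iota> (e k))"

definition dom_sqrt_A :: "(nat \<Rightarrow> 'h::real_inner) \<Rightarrow> (nat \<Rightarrow> real) \<Rightarrow> 'h set" where
  "dom_sqrt_A e \<alpha> = {x. summable (\<lambda>k. \<alpha> k * (inner x (e k))\<^sup>2)}"

text \<open>The operator \<open>(-A)\<^sup>1\<^sup>/\<^sup>2\<close>, meaningful on \<open>dom_sqrt_A\<close>.\<close>

definition sqrt_A :: "(nat \<Rightarrow> 'h::real_inner) \<Rightarrow> (nat \<Rightarrow> real) \<Rightarrow> 'h \<Rightarrow> 'h" where
  "sqrt_A e \<alpha> x = (\<Sum>k. (sqrt (\<alpha> k) * inner x (e k)) *\<^sub>R e k)"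

text \<open>The pseudo-inverse on \<open>range Q\<close>: the preimage orthogonal to the kernel.\<close>

definition pinv :: "('h::real_inner \<Rightarrow> 'h) \<Rightarrow> 'h \<Rightarrow> 'h" where
  "pinv Q x = (THE y. Q y = x \<and> (\<forall>n. Q n = 0 \<longrightarrow> inner y n = 0))"

definition dom_sqrt_A_pinv ::
  "(nat \<Rightarrow> 'h::real_inner) \<Rightarrow> (nat \<Rightarrow> real) \<Rightarrow> ('h \<Rightarrow> 'h) \<Rightarrow> 'h set" where
  "dom_sqrt_A_pinv e \<alpha> Q = {x \<in> range Q. pinv Q x \<in> dom_sqrt_A e \<alpha>}"


section \<open>Semigroups\<close>

definition C0_semigroup :: "(real \<Rightarrow> 'x::real_normed_vector \<Rightarrow> 'x) \<Rightarrow> bool" where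
  "C0_semigroup S \<longleftrightarrow>
    (\<forall>t\<ge>0. bounded_linear (S t)) \<and> S 0 = id \<and>
    (\<forall>s\<ge>0. \<forall>t\<ge>0. S (s + t) = S s \<circ> S t) \<and>
    (\<forall>x. ((\<lambda>t. S t x) \<longlongrightarrow> x) (at_right 0))"

definition generator :: "(real \<Rightarrow> 'x::real_normed_vector \<Rightarrow> 'x) \<Rightarrow> ('x \<times> 'x) set" where
  "generator S = {(x, y). ((\<lambda>t. (S t x - x) /\<^sub>R t) \<longlongrightarrow> y) (at_right 0)}"

text \<open>The semigroup generated by an operator is determined at times \<open>t \<ge> 0\<close>, and only these are
  used below.\<close>

definition semigroup_of :: "('x::real_normed_vector \<times> 'x) set \<Rightarrow> real \<Rightarrow> 'x \<Rightarrow> 'x" where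
  "semigroup_of G = (SOME S. C0_semigroup S \<and> generator S = G)"


section \<open>Controls\<close>

definition L2_control :: "real \<Rightarrow> (real \<Rightarrow> 'h::real_normed_vector) \<Rightarrow> bool" where
  "L2_control T \<psi> \<longleftrightarrow>
    \<psi> \<in> borel_measurable (lebesgue_on {0<..<T}) \<and>
    integrable (lebesgue_on {0<..<T}) (\<lambda>s. (norm (\<psi> s))\<^sup>2)"

definition L2_norm_sq :: "real \<Rightarrow> (real \<Rightarrow> 'h::real_normed_vector) \<Rightarrow> real" where
  "L2_norm_sq T \<psi> = (\<integral>s. (norm (\<psi> s))\<^sup>2 \<partial>lebesgue_on {0<..<T})"


section \<open>The wave equation\<close>

definition A_mu ::
  "'a::euclidean_space set \<Rightarrow> ('h::real_inner \<Rightarrow> 'a \<Rightarrow> real) \<Rightarrow> (nat \<Rightarrow> 'h) \<Rightarrow> (nat \<Rightarrow> real) \<Rightarrow>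
   ('h \<Rightarrow> 'm::real_inner) \<Rightarrow> real \<Rightarrow> (('h \<times> 'm) \<times> ('h \<times> 'm)) set" where
  "A_mu \<Omega> J e \<alpha> \<iota> \<mu> =
    {((u, \<iota> v), (v, (1 / \<mu>) *\<^sub>R A_ext e \<alpha> \<iota> u - (1 / \<mu>) *\<^sub>R \<iota> v)) | u v. u \<in> H_space \<Omega> J e \<alpha> 1}"

definition Q_mu ::
  "('h::real_inner \<Rightarrow> 'm::real_inner) \<Rightarrow> ('h \<Rightarrow> 'h) \<Rightarrow> real \<Rightarrow> 'h \<Rightarrow> 'h \<times> 'm" where
  "Q_mu \<iota> Q \<mu> v = (1 / \<mu>) *\<^sub>R (0, \<iota> (Q v))"

text \<open>\<open>z = z\<^sup>\<mu>\<close> for the initial datum \<open>z 0\<close> and the control \<open>\<psi>\<close>, as functions on \<open>[0, T]\<close>.\<close>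

definition wave_solution ::
  "'a::euclidean_space set \<Rightarrow> ('h::{real_inner, complete_space, second_countable_topology} \<Rightarrow> 'a \<Rightarrow> real) \<Rightarrow>
   (nat \<Rightarrow> 'h) \<Rightarrow> (nat \<Rightarrow> real) \<Rightarrow> ('h \<Rightarrow> 'm::{real_inner, complete_space, second_countable_topology}) \<Rightarrow>
   ('h \<Rightarrow> 'h) \<Rightarrow> ('h \<Rightarrow> 'h) \<Rightarrow> real \<Rightarrow> real \<Rightarrow> (real \<Rightarrow> 'h) \<Rightarrow> (real \<Rightarrow> 'h \<times> 'm) \<Rightarrow> bool" where
  "wave_solution \<Omega> J e \<alpha> \<iota> Q DF \<mu> T \<psi> z \<longleftrightarrow>
    continuous_on {0..T} z \<and>
    (let S = semigroup_of (A_mu \<Omega> J e \<alpha> \<iota> \<mu>) in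
     \<forall>t\<in>{0..T}. z t = S t (z 0)
        - (\<integral>s. S (t - s) (Q_mu \<iota> Q \<mu> (Q (DF (fst (z s))))) \<partial>lebesgue_on {0..t})
        + (\<integral>s. S (t - s) (Q_mu \<iota> Q \<mu> (\<psi> s)) \<partial>lebesgue_on {0..t}))"

definition wave_action ::
  "'a::euclidean_space set \<Rightarrow> ('h::{real_inner, complete_space, second_countable_topology} \<Rightarrow> 'a \<Rightarrow> real) \<Rightarrow>
   (nat \<Rightarrow> 'h) \<Rightarrow> (nat \<Rightarrow> real) \<Rightarrow> ('h \<Rightarrow> 'm::{real_inner, complete_space, second_countable_topology}) \<Rightarrow>
   ('h \<Rightarrow> 'h) \<Rightarrow> ('h \<Rightarrow> 'h) \<Rightarrow> real \<Rightarrow> real \<Rightarrow> (real \<Rightarrow> 'h \<times> 'm) \<Rightarrow> ereal" where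
  "wave_action \<Omega> J e \<alpha> \<iota> Q DF \<mu> T z =
    ereal (1 / 2) * Inf {ereal (L2_norm_sq T \<psi>) | \<psi>.
      L2_control T \<psi> \<and> wave_solution \<Omega> J e \<alpha> \<iota> Q DF \<mu> T \<psi> z}"

definition wave_quasipotential ::
  "'a::euclidean_space set \<Rightarrow> ('h::{real_inner, complete_space, second_countable_topology} \<Rightarrow> 'a \<Rightarrow> real) \<Rightarrow>
   (nat \<Rightarrow> 'h) \<Rightarrow> (nat \<Rightarrow> real) \<Rightarrow> ('h \<Rightarrow> 'm::{real_inner, complete_space, second_countable_topology}) \<Rightarrow>
   ('h \<Rightarrow> 'h) \<Rightarrow> ('h \<Rightarrow> 'h) \<Rightarrow> real \<Rightarrow> 'h \<Rightarrow> 'm \<Rightarrow> ereal" where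
  "wave_quasipotential \<Omega> J e \<alpha> \<iota> Q DF \<mu> x y =
    Inf {wave_action \<Omega> J e \<alpha> \<iota> Q DF \<mu> T z | T z.
      0 < T \<and> continuous_on {0..T} z \<and> z 0 = 0 \<and> z T = (x, y)}"


section \<open>The heat equation\<close>

definition heat_solution ::
  "'a::euclidean_space set \<Rightarrow> ('h::{real_inner, complete_space, second_countable_topology} \<Rightarrow> 'a \<Rightarrow> real) \<Rightarrow>
   ('h \<Rightarrow> 'h) \<Rightarrow> ('h \<Rightarrow> 'h) \<Rightarrow> real \<Rightarrow> (real \<Rightarrow> 'h) \<Rightarrow> (real \<Rightarrow> 'h) \<Rightarrow> bool" where
  "heat_solution \<Omega> J Q DF T \<psi> \<phi> \<longleftrightarrow>
    continuous_on {0..T} \<phi> \<and>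
    (let S = semigroup_of (dirichlet_laplacian \<Omega> J) in
     \<forall>t\<in>{0..T}. \<phi> t = S t (\<phi> 0)
        - (\<integral>s. S (t - s) (Q (Q (DF (\<phi> s)))) \<partial>lebesgue_on {0..t})
        + (\<integral>s. S (t - s) (Q (\<psi> s)) \<partial>lebesgue_on {0..t}))"

definition heat_action ::
  "'a::euclidean_space set \<Rightarrow> ('h::{real_inner, complete_space, second_countable_topology} \<Rightarrow> 'a \<Rightarrow> real) \<Rightarrow>
   ('h \<Rightarrow> 'h) \<Rightarrow> ('h \<Rightarrow> 'h) \<Rightarrow> real \<Rightarrow> (real \<Rightarrow> 'h) \<Rightarrow> ereal" where
  "heat_action \<Omega> J Q DF T \<phi> =
    ereal (1 / 2) * Inf {ereal (L2_norm_sq T \<psi>) | \<psi>.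
      L2_control T \<psi> \<and> heat_solution \<Omega> J Q DF T \<psi> \<phi>}"

definition heat_quasipotential ::
  "'a::euclidean_space set \<Rightarrow> ('h::{real_inner, complete_space, second_countable_topology} \<Rightarrow> 'a \<Rightarrow> real) \<Rightarrow>
   ('h \<Rightarrow> 'h) \<Rightarrow> ('h \<Rightarrow> 'h) \<Rightarrow> 'h \<Rightarrow> ereal" where
  "heat_quasipotential \<Omega> J Q DF x =
    Inf {heat_action \<Omega> J Q DF T \<phi> | T \<phi>.
      0 < T \<and> continuous_on {0..T} \<phi> \<and> \<phi> 0 = 0 \<and> \<phi> T = x}"

end

theory Submission
  imports Defs
begin

text \<open>
  Every controlled path that starts at rest has the form \<open>Q p\<close>, where \<open>p\<close> solves
  \<open>\<mu> p'' + p' = A p - Q DF (Q p) + \<psi>\<close> (with \<open>\<mu> = 0\<close> for the heat equation). With \<open>q = p'\<close> and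
  \<open>E = |(-A)\<^sup>1\<^sup>/\<^sup>2 p|\<^sup>2 + \<mu> |q|\<^sup>2 + 2 F (Q p)\<close> the energy balance reads
  \<open>E' = 2 \<langle>\<psi>, q\<rangle> - 2 |q|\<^sup>2 = |\<psi>|\<^sup>2 / 2 - |\<psi> - 2 q|\<^sup>2 / 2\<close>, so that the cost of a path is at least \<open>E\<close> at its
  end point. Equality would require \<open>\<psi> = 2 q\<close>, which is the time reversal of the uncontrolled equation. Since
  \<open>F \<circ> Q\<close> has nonnegative radial derivative, the uncontrolled path from any point tends to rest, and a short
  bridge of small cost makes it reach rest exactly; reversing it gives paths whose cost is arbitrarily close to \<open>E\<close>.
  The pseudo-inverse selects the preimage under \<open>Q\<close> with the least energy.
\<close>

text \<open>No existence theorem for the nonlinear equation is used. Along a given path the gradient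
  term is a square-integrable forcing, so everything reduces to scalar linear equations in the
  eigenbasis; the uncontrolled path is replaced by one of small control cost, obtained by freezing
  the gradient on short intervals. Velocities are only square-integrable in time, for
  \<open>\<mu> = 0\<close> only defined almost everywhere, so all identities are kept in integrated
  form. The energy balance controls the velocity alone; a virial identity, through the sign of the
  radial derivative, controls the time integral of the stiffness. Together they bound the time
  integral of the energy independently of the horizon, so a long path must come close to rest. The
  semigroups are arbitrary choices among those with a prescribed generator, and the Laplacian is
  given through test functions. Mild solutions become computable only once the generators are shown
  to be maximal diagonal operators and a semigroup with such a generator is shown to be
  unique.\<close>

section \<open>Calculus on intervals\<close>

text \<open>The hypothesis makes every difference quotient of \<open>\<Psi>\<close> at most a
  constant times an increment of the continuous function \<open>H\<close>, so the derivative is 0 at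
  every point. Integral identities are proved below by applying this to their defect, which avoids
  differentiation almost everywhere.\<close>

lemma const_of_superlinear:
  fixes \<Psi> H :: "real \<Rightarrow> real"
  assumes bd: "\<And>a b. 0 \<le> a \<Longrightarrow> a \<le> b \<Longrightarrow> b \<le> T \<Longrightarrow> \<bar>\<Psi> b - \<Psi> a\<bar> \<le> C * (b - a) * (H b - H a)"
    and H: "continuous_on {0..T} H" and t: "t \<in> {0..T}"
  shows "\<Psi> t = \<Psi> 0"
proof -
  have "(\<Psi> has_field_derivative 0) (at x within {0..T})" if x: "x \<in> {0..T}" for x
    unfolding has_field_derivative_iff
  proof (rule Lim_null_comparison)
    show "\<forall>\<^sub>F y in at x within {0..T}. norm ((\<Psi> y - \<Psi> x) / (y - x)) \<le> \<bar>C\<bar> * \<bar>H y - H x\<bar>"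
      unfolding eventually_at_filter
    proof (rule always_eventually, intro allI impI)
      fix y assume y: "y \<noteq> x" "y \<in> {0..T}"
      have "\<bar>\<Psi> y - \<Psi> x\<bar> \<le> \<bar>C\<bar> * \<bar>H y - H x\<bar> * \<bar>y - x\<bar>"
      proof (cases "x \<le> y")
        case True
        have "\<bar>\<Psi> y - \<Psi> x\<bar> \<le> \<bar>C * (y - x) * (H y - H x)\<bar>"
          using bd[of x y] x y True by (intro order_trans[OF _ abs_ge_self]) auto
        then show ?thesis by (simp add: abs_mult mult_ac)
      next
        case False
        have "\<bar>\<Psi> x - \<Psi> y\<bar> \<le> \<bar>C * (x - y) * (H x - H y)\<bar>"
          using bd[of y x] x y False by (intro order_trans[OF _ abs_ge_self]) auto
        then show ?thesis by (simp add: abs_mult mult_ac abs_minus_commute)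
      qed
      then show "norm ((\<Psi> y - \<Psi> x) / (y - x)) \<le> \<bar>C\<bar> * \<bar>H y - H x\<bar>"
        using y by (simp add: field_simps abs_mult)
    qed
    have "(H \<longlongrightarrow> H x) (at x within {0..T})"
      using H x by (auto simp: continuous_on_def)
    then have "((\<lambda>y. \<bar>C\<bar> * \<bar>H y - H x\<bar>) \<longlongrightarrow> \<bar>C\<bar> * \<bar>H x - H x\<bar>) (at x within {0..T})"
      by (intro tendsto_intros)
    then show "((\<lambda>y. \<bar>C\<bar> * \<bar>H y - H x\<bar>) \<longlongrightarrow> 0) (at x within {0..T})" by simp
  qed
  then obtain c where "\<forall>x\<in>{0..T}. \<Psi> x = c"
    using has_field_derivative_zero_constant[of "{0..T}" \<Psi>] by auto
  with t show ?thesis by auto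
qed

section \<open>Lebesgue integrals over subintervals and under shifts and reflections\<close>

lemma integrable_lebesgue_on_sub:
  fixes f :: "real \<Rightarrow> real"
  assumes "integrable (lebesgue_on {a..d}) f" "a \<le> b" "c \<le> d"
  shows "integrable (lebesgue_on {b..c}) f"
proof -
  have "f absolutely_integrable_on {a..d}"
    using assms(1) by (simp add: set_integrable_def integrable_restrict_space)
  then have "f absolutely_integrable_on {b..c}"
    by (rule absolutely_integrable_on_subinterval) (use assms in auto)
  then show ?thesis by (simp add: set_integrable_def integrable_restrict_space)
qed

lemma integral_lebesgue_on_split:
  fixes f :: "real \<Rightarrow> real"
  assumes "integrable (lebesgue_on {a..c}) f" "a \<le> b" "b \<le> c"
  shows "integral\<^sup>L (lebesgue_on {a..c}) f
    = integral\<^sup>L (lebesgue_on {a..b}) f + integral\<^sup>L (lebesgue_on {b..c}) f"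
proof -
  have "integrable (lebesgue_on {a..b}) f" "integrable (lebesgue_on {b..c}) f"
    using assms by (auto intro: integrable_lebesgue_on_sub)
  then show ?thesis
    using assms Henstock_Kurzweil_Integration.integral_combine[of a b c f]
    by (simp add: lebesgue_integral_eq_integral integrable_on_lebesgue_on)
qed

lemma integral_lebesgue_on_point [simp]:
  fixes f :: "real \<Rightarrow> real"
  shows "integral\<^sup>L (lebesgue_on {a}) f = 0"
proof -
  have "AE x in lebesgue. x \<notin> {a}" by (rule AE_not_in) simp
  then have "AE x in lebesgue. indicator {a} x *\<^sub>R f x = 0" by (rule eventually_mono) simp
  then have "(\<integral>x. indicator {a} x *\<^sub>R f x \<partial>lebesgue) = 0" by (rule integral_eq_zero_AE)
  then show ?thesis by (subst integral_restrict_space) simp_all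
qed

lemma integral_subinterval_le:
  fixes f :: "real \<Rightarrow> real"
  assumes f: "integrable (lebesgue_on {a..d}) f" and "a \<le> b" "b \<le> c" "c \<le> d" and pos: "\<And>s. 0 \<le> f s"
  shows "(\<integral>s. f s \<partial>lebesgue_on {b..c}) \<le> (\<integral>s. f s \<partial>lebesgue_on {a..d})"
proof -
  have "integrable (lebesgue_on {a..c}) f" using assms by (auto intro: integrable_lebesgue_on_sub)
  then have "integral\<^sup>L (lebesgue_on {a..d}) f = integral\<^sup>L (lebesgue_on {a..b}) f
      + integral\<^sup>L (lebesgue_on {b..c}) f + integral\<^sup>L (lebesgue_on {c..d}) f"
    using integral_lebesgue_on_split[of a d f c] integral_lebesgue_on_split[of a c f b] assms by simp
  moreover have "0 \<le> integral\<^sup>L (lebesgue_on {x..y}) f" for x y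
    using pos by (simp add: Bochner_Integration.integral_nonneg)
  ultimately show ?thesis by (simp add: add_increasing)
qed

lemma measurable_lebesgue_on_sub:
  assumes "f \<in> borel_measurable (lebesgue_on S)" "R \<subseteq> S"
  shows "f \<in> borel_measurable (lebesgue_on R)"
  using measurable_restrict_mono[OF assms] .

lemma affine_measurable_lebesgue:
  assumes "c \<noteq> 0" shows "(\<lambda>x::real. t + c * x) \<in> lebesgue \<rightarrow>\<^sub>M lebesgue"
  using lebesgue_affine_measurable[where c= "\<lambda>x::real. c"] assms by simp

lemma measurable_lebesgue_on_shift:
  fixes f :: "real \<Rightarrow> 'b::topological_space"
  assumes "f \<in> borel_measurable (lebesgue_on {a..b})"
  shows "(\<lambda>s. f (s - t)) \<in> borel_measurable (lebesgue_on {a + t..b + t})"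
proof -
  have "(\<lambda>s. - t + 1 * s) \<in> lebesgue_on {a + t..b + t} \<rightarrow>\<^sub>M lebesgue_on {a..b}"
    by (rule measurable_restrict_space3[OF affine_measurable_lebesgue]) auto
  from measurable_compose[OF this assms] show ?thesis by simp
qed

lemma measurable_lebesgue_on_reflect:
  fixes f :: "real \<Rightarrow> 'b::topological_space"
  assumes "f \<in> borel_measurable (lebesgue_on {a..b})"
  shows "(\<lambda>s. f (t - s)) \<in> borel_measurable (lebesgue_on {t - b..t - a})"
proof -
  have "(\<lambda>s. t + (-1) * s) \<in> lebesgue_on {t - b..t - a} \<rightarrow>\<^sub>M lebesgue_on {a..b}"
    by (rule measurable_restrict_space3[OF affine_measurable_lebesgue]) auto
  from measurable_compose[OF this assms] show ?thesis by simp
qed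

lemma has_bochner_integral_shift:
  fixes f :: "real \<Rightarrow> real"
  assumes "has_bochner_integral (lebesgue_on {a..b}) f i"
  shows "has_bochner_integral (lebesgue_on {a + t..b + t}) (\<lambda>s. f (s - t)) i"
proof -
  have "has_bochner_integral lebesgue (\<lambda>x. indicator {a..b} x *\<^sub>R f x) i"
    using assms by (simp add: has_bochner_integral_restrict_space)
  then have "has_bochner_integral lebesgue (\<lambda>x. indicator {a..b} (-t + 1 * x) *\<^sub>R f (-t + 1 * x)) (i /\<^sub>R \<bar>1\<bar>)"
    by (subst (asm) has_bochner_integral_lebesgue_real_affine_iff[of 1 _ _ "-t"]) auto
  moreover have "indicat_real {a..b} (-t + 1 * x) = indicator {a + t..b + t} x" for x
    by (auto simp: indicator_def)
  ultimately show ?thesis by (simp add: has_bochner_integral_restrict_space)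
qed

lemma has_bochner_integral_reflect:
  fixes f :: "real \<Rightarrow> real"
  assumes "has_bochner_integral (lebesgue_on {a..b}) f i"
  shows "has_bochner_integral (lebesgue_on {t - b..t - a}) (\<lambda>s. f (t - s)) i"
proof -
  have "has_bochner_integral lebesgue (\<lambda>x. indicator {a..b} x *\<^sub>R f x) i"
    using assms by (simp add: has_bochner_integral_restrict_space)
  then have "has_bochner_integral lebesgue (\<lambda>x. indicator {a..b} (t + (-1) * x) *\<^sub>R f (t + (-1) * x)) (i /\<^sub>R \<bar>-1\<bar>)"
    by (subst (asm) has_bochner_integral_lebesgue_real_affine_iff[of "-1" _ _ "t"]) auto
  moreover have "indicat_real {a..b} (t + (-1) * x) = indicator {t - b..t - a} x" for x
    by (auto simp: indicator_def)
  ultimately show ?thesis by (simp add: has_bochner_integral_restrict_space)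
qed

lemma integrable_continuous_lebesgue_on:
  fixes f :: "real \<Rightarrow> real"
  assumes "continuous_on {a..b} f"
  shows "integrable (lebesgue_on {a..b}) f"
  using absolutely_integrable_continuous_real[OF assms]
  by (simp add: set_integrable_def integrable_restrict_space)

lemma integrable_lebesgue_on_mult_continuous:
  fixes f c :: "real \<Rightarrow> real"
  assumes f: "integrable (lebesgue_on {a..b}) f" and c: "continuous_on {a..b} c"
  shows "integrable (lebesgue_on {a..b}) (\<lambda>s. c s * f s)"
proof -
  have "bounded (c ` {a..b})" by (intro compact_imp_bounded compact_continuous_image c) auto
  then obtain M where "\<forall>y\<in>c ` {a..b}. norm y \<le> M"
    unfolding bounded_iff by blast
  then have M: "\<And>s. s \<in> {a..b} \<Longrightarrow> \<bar>c s\<bar> \<le> M" by simp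
  have cm: "c \<in> borel_measurable (lebesgue_on {a..b})"
    by (rule continuous_imp_measurable_on_sets_lebesgue[OF c]) auto
  show ?thesis
  proof (rule Bochner_Integration.integrable_bound[where f = "\<lambda>s. M * \<bar>f s\<bar>"])
    show "integrable (lebesgue_on {a..b}) (\<lambda>s. M * \<bar>f s\<bar>)" using f by simp
    show "(\<lambda>s. c s * f s) \<in> borel_measurable (lebesgue_on {a..b})" using cm f by measurable
    show "AE x in lebesgue_on {a..b}. norm (c x * f x) \<le> norm (M * \<bar>f x\<bar>)"
    proof (rule AE_I2)
      fix x assume "x \<in> space (lebesgue_on {a..b})"
      then have "\<bar>c x\<bar> \<le> M" using M by auto
      then show "norm (c x * f x) \<le> norm (M * \<bar>f x\<bar>)"
        by (auto simp: abs_mult intro!: mult_right_mono)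
    qed
  qed
qed

section \<open>Square-integrable functions of time\<close>

definition L2on :: "real \<Rightarrow> (real \<Rightarrow> 'b::real_normed_vector) \<Rightarrow> bool" where
  "L2on T f \<longleftrightarrow> f \<in> borel_measurable (lebesgue_on {0..T}) \<and>
     integrable (lebesgue_on {0..T}) (\<lambda>s. (norm (f s))\<^sup>2)"

lemma L2on_sub: "L2on T f \<Longrightarrow> t \<le> T \<Longrightarrow> L2on t f"
  unfolding L2on_def
  by (auto intro: integrable_lebesgue_on_sub measurable_lebesgue_on_sub[where S = "{0..T}"])

lemma L2on_inner:
  fixes f g :: "real \<Rightarrow> 'b::{real_inner, second_countable_topology}"
  assumes "L2on T f" "L2on T g"
  shows "integrable (lebesgue_on {0..T}) (\<lambda>s. inner (f s) (g s))"
proof (rule Bochner_Integration.integrable_bound[where f = "\<lambda>s. (norm (f s))\<^sup>2 + (norm (g s))\<^sup>2"])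
  show "integrable (lebesgue_on {0..T}) (\<lambda>s. (norm (f s))\<^sup>2 + (norm (g s))\<^sup>2)"
    using assms by (simp add: L2on_def)
  show "(\<lambda>s. inner (f s) (g s)) \<in> borel_measurable (lebesgue_on {0..T})"
    using assms by (auto simp: L2on_def)
  have "norm (inner x y) \<le> norm ((norm x)\<^sup>2 + (norm y)\<^sup>2)" for x y :: 'b
  proof -
    have "2 * (norm x * norm y) \<le> (norm x)\<^sup>2 + (norm y)\<^sup>2"
      using sum_squares_bound[of "norm x" "norm y"] by simp
    moreover have "0 \<le> norm x * norm y" by simp
    ultimately show ?thesis using Cauchy_Schwarz_ineq2[of x y] by simp
  qed
  then show "AE x in lebesgue_on {0..T}. norm (inner (f x) (g x)) \<le> norm ((norm (f x))\<^sup>2 + (norm (g x))\<^sup>2)"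
    by simp
qed

lemma L2on_mult:
  fixes f g :: "real \<Rightarrow> real"
  assumes "L2on T f" "L2on T g" shows "integrable (lebesgue_on {0..T}) (\<lambda>s. f s * g s)"
  using L2on_inner[OF assms] by simp

lemma L2on_const: "L2on T (\<lambda>_. c)"
proof -
  have "integrable (lebesgue_on {0..T}) (\<lambda>_. (norm c)\<^sup>2)"
    by (rule integrable_continuous_lebesgue_on) auto
  then show ?thesis by (auto simp: L2on_def)
qed

lemma L2on_continuous:
  fixes f :: "real \<Rightarrow> 'b::real_normed_vector"
  assumes "continuous_on {0..T} f" shows "L2on T f"
  unfolding L2on_def
  by (auto intro!: continuous_imp_measurable_on_sets_lebesgue integrable_continuous_lebesgue_on
      continuous_intros assms)

lemma L2on_bounded_linear:
  assumes f: "L2on T f" and A: "bounded_linear A"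
  shows "L2on T (\<lambda>s. A (f s))"
proof -
  obtain K where K: "\<And>x. norm (A x) \<le> norm x * K" using bounded_linear.bounded[OF A] by auto
  have m: "(\<lambda>s. A (f s)) \<in> borel_measurable (lebesgue_on {0..T})"
    using f unfolding L2on_def
    by (auto intro: borel_measurable_continuous_on[OF bounded_linear.continuous_on[OF A continuous_on_id]])
  have "integrable (lebesgue_on {0..T}) (\<lambda>s. (norm (A (f s)))\<^sup>2)"
  proof (rule Bochner_Integration.integrable_bound[where f = "\<lambda>s. K\<^sup>2 * (norm (f s))\<^sup>2"])
    show "integrable (lebesgue_on {0..T}) (\<lambda>s. K\<^sup>2 * (norm (f s))\<^sup>2)"
      using f by (simp add: L2on_def)
    show "(\<lambda>s. (norm (A (f s)))\<^sup>2) \<in> borel_measurable (lebesgue_on {0..T})" using m by measurable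
    show "AE x in lebesgue_on {0..T}. norm ((norm (A (f x)))\<^sup>2) \<le> norm (K\<^sup>2 * (norm (f x))\<^sup>2)"
    proof (rule AE_I2)
      fix x
      have "(norm (A (f x)))\<^sup>2 \<le> (norm (f x) * K)\<^sup>2" by (rule power_mono[OF K]) simp
      then show "norm ((norm (A (f x)))\<^sup>2) \<le> norm (K\<^sup>2 * (norm (f x))\<^sup>2)"
        by (simp add: power_mult_distrib mult.commute)
    qed
  qed
  with m show ?thesis by (simp add: L2on_def)
qed

lemma L2on_add:
  fixes f g :: "real \<Rightarrow> 'b::{real_normed_vector, second_countable_topology}"
  assumes "L2on T f" "L2on T g" shows "L2on T (\<lambda>s. f s + g s)"
  unfolding L2on_def
proof
  show m: "(\<lambda>s. f s + g s) \<in> borel_measurable (lebesgue_on {0..T})"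
    using assms by (auto simp: L2on_def)
  show "integrable (lebesgue_on {0..T}) (\<lambda>s. (norm (f s + g s))\<^sup>2)"
  proof (rule Bochner_Integration.integrable_bound[where f = "\<lambda>s. 2 * (norm (f s))\<^sup>2 + 2 * (norm (g s))\<^sup>2"])
    show "integrable (lebesgue_on {0..T}) (\<lambda>s. 2 * (norm (f s))\<^sup>2 + 2 * (norm (g s))\<^sup>2)"
      using assms by (simp add: L2on_def)
    show "(\<lambda>s. (norm (f s + g s))\<^sup>2) \<in> borel_measurable (lebesgue_on {0..T})" using m by measurable
    show "AE x in lebesgue_on {0..T}. norm ((norm (f x + g x))\<^sup>2) \<le> norm (2 * (norm (f x))\<^sup>2 + 2 * (norm (g x))\<^sup>2)"
    proof (rule AE_I2)
      fix x
      have "(norm (f x + g x))\<^sup>2 \<le> (norm (f x) + norm (g x))\<^sup>2"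
        by (rule power_mono[OF norm_triangle_ineq]) simp
      also have "\<dots> \<le> 2 * (norm (f x))\<^sup>2 + 2 * (norm (g x))\<^sup>2"
        using sum_squares_bound[of "norm (f x)" "norm (g x)"] by (simp add: power2_sum)
      finally show "norm ((norm (f x + g x))\<^sup>2) \<le> norm (2 * (norm (f x))\<^sup>2 + 2 * (norm (g x))\<^sup>2)"
        by simp
    qed
  qed
qed

lemma L2on_scaleR: "L2on T f \<Longrightarrow> L2on T (\<lambda>s. c *\<^sub>R f s)"
  by (rule L2on_bounded_linear[OF _ bounded_linear_scaleR_right])

lemma L2on_diff:
  fixes f g :: "real \<Rightarrow> 'b::{real_normed_vector, second_countable_topology}"
  assumes "L2on T f" "L2on T g" shows "L2on T (\<lambda>s. f s - g s)"
  using L2on_add[OF assms(1) L2on_scaleR[OF assms(2), of "-1"]] by simp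

lemma L2on_minus: "L2on T f \<Longrightarrow> L2on T (\<lambda>s. - f s)"
  using L2on_scaleR[of T f "-1"] by simp

lemma L2on_cmult: "L2on T f \<Longrightarrow> L2on T (\<lambda>s. c * f s)" for c :: real
  using L2on_scaleR[of T f c] by simp

lemma L2on_inner_const:
  "L2on T f \<Longrightarrow> L2on T (\<lambda>s. inner (f s) x)"
  by (rule L2on_bounded_linear[OF _ bounded_linear_inner_left])

lemma L2on_integrable:
  fixes f :: "real \<Rightarrow> real"
  assumes "L2on T f" shows "integrable (lebesgue_on {0..T}) f"
  using L2on_mult[OF assms L2on_const[of T 1]] by simp

lemma L2on_mult_continuous:
  fixes c :: "real \<Rightarrow> real" and f :: "real \<Rightarrow> 'b::{real_normed_vector, second_countable_topology}"
  assumes f: "L2on T f" and c: "continuous_on {0..T} c" shows "L2on T (\<lambda>s. c s *\<^sub>R f s)"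
proof -
  have "integrable (lebesgue_on {0..T}) (\<lambda>s. (c s)\<^sup>2 * (norm (f s))\<^sup>2)"
    using f by (intro integrable_lebesgue_on_mult_continuous continuous_intros c) (auto simp: L2on_def)
  moreover have "c \<in> borel_measurable (lebesgue_on {0..T})"
    by (rule continuous_imp_measurable_on_sets_lebesgue[OF c]) auto
  ultimately show ?thesis using f by (auto simp: L2on_def power_mult_distrib)
qed

lemma L2on_reflect:
  assumes "L2on T f" shows "L2on T (\<lambda>s. f (T - s))"
proof -
  have "integrable (lebesgue_on {T - T..T - 0}) (\<lambda>s. (norm (f (T - s)))\<^sup>2)"
    using assms has_bochner_integral_reflect[of 0 T "\<lambda>s. (norm (f s))\<^sup>2" _ T]
    by (auto simp: L2on_def has_bochner_integral_iff)
  moreover have "(\<lambda>s. f (T - s)) \<in> borel_measurable (lebesgue_on {T - T..T - 0})"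
    using assms by (intro measurable_lebesgue_on_reflect) (auto simp: L2on_def)
  ultimately show ?thesis by (simp add: L2on_def)
qed

lemma integral_reflect_0:
  fixes f :: "real \<Rightarrow> real"
  assumes "integrable (lebesgue_on {0..T}) f" "t \<in> {0..T}"
  shows "(\<integral>s. f (T - s) \<partial>lebesgue_on {0..t}) = (\<integral>s. f s \<partial>lebesgue_on {T - t..T})"
proof -
  have "integrable (lebesgue_on {T - t..T}) f"
    using assms by (auto intro: integrable_lebesgue_on_sub)
  then have "has_bochner_integral (lebesgue_on {T - t..T}) f (\<integral>s. f s \<partial>lebesgue_on {T - t..T})"
    by (rule has_bochner_integral_integrable)
  from has_bochner_integral_reflect[OF this, of T] show ?thesis
    by (simp add: has_bochner_integral_integral_eq)
qed

text \<open>The increment itself is the test vector; Young's inequality then replaces Cauchy-Schwarz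
  in time. Relating \<open>V\<close> to \<open>U\<close> only against fixed vectors keeps all
  integrals scalar.\<close>

lemma L2_increment_bound:
  fixes U V :: "real \<Rightarrow> 'h::{real_inner, second_countable_topology}"
  assumes V: "L2on T V" and ab: "0 \<le> a" "a \<le> b" "b \<le> T"
    and UV: "\<And>x. inner (U b - U a) x = (\<integral>s. inner (V s) x \<partial>lebesgue_on {a..b})"
  shows "(norm (U b - U a))\<^sup>2 \<le> (b - a) * (\<integral>s. (norm (V s))\<^sup>2 \<partial>lebesgue_on {a..b})"
proof (cases "a = b")
  case False
  then have h: "b - a > 0" using ab by simp
  let ?d = "U b - U a" and ?N = "\<integral>s. (norm (V s))\<^sup>2 \<partial>lebesgue_on {a..b}"
  have i1: "integrable (lebesgue_on {a..b}) (\<lambda>s. inner (V s) ?d)"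
    using L2on_integrable[OF L2on_inner_const[OF V]] ab by (auto intro: integrable_lebesgue_on_sub)
  have i2: "integrable (lebesgue_on {a..b}) (\<lambda>s. (norm (V s))\<^sup>2)"
    using V ab by (auto simp: L2on_def intro: integrable_lebesgue_on_sub)
  have i3: "integrable (lebesgue_on {a..b}) (\<lambda>s. c)" for c :: real
    by (rule integrable_continuous_lebesgue_on) auto
  have "(norm ?d)\<^sup>2 = (\<integral>s. inner (V s) ?d \<partial>lebesgue_on {a..b})"
    using UV[of ?d] by (simp add: power2_norm_eq_inner)
  also have "\<dots> \<le> (\<integral>s. (b - a) / 2 * (norm (V s))\<^sup>2 + (norm ?d)\<^sup>2 / (2 * (b - a)) \<partial>lebesgue_on {a..b})"
  proof (rule integral_mono[OF i1])
    show "integrable (lebesgue_on {a..b}) (\<lambda>s. (b - a) / 2 * (norm (V s))\<^sup>2 + (norm ?d)\<^sup>2 / (2 * (b - a)))"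
      using i2 i3 by (intro Bochner_Integration.integrable_add integrable_mult_right) auto
    fix s
    have "inner (V s) ?d \<le> norm (V s) * norm ?d" by (rule norm_cauchy_schwarz)
    also have "\<dots> \<le> (b - a) / 2 * (norm (V s))\<^sup>2 + (norm ?d)\<^sup>2 / (2 * (b - a))"
    proof -
      \<comment> \<open>The weight \<open>b - a\<close> makes the second term integrate to half of
        the left-hand side of the claim, so that it can be absorbed.\<close>
      have "0 \<le> ((b - a) * norm (V s) - norm ?d)\<^sup>2 / (2 * (b - a))" using h by simp
      also have "\<dots> = (b - a) / 2 * (norm (V s))\<^sup>2 + (norm ?d)\<^sup>2 / (2 * (b - a)) - norm (V s) * norm ?d"
        using h by (simp add: power2_eq_square field_simps)
      finally show ?thesis by simp
    qed
    finally show "inner (V s) ?d \<le> (b - a) / 2 * (norm (V s))\<^sup>2 + (norm ?d)\<^sup>2 / (2 * (b - a))" .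
  qed
  also have "\<dots> = (b - a) / 2 * ?N + (\<integral>s. (norm ?d)\<^sup>2 / (2 * (b - a)) \<partial>lebesgue_on {a..b})"
    using i2 i3 by (subst Bochner_Integration.integral_add) auto
  also have "(\<integral>s. (norm ?d)\<^sup>2 / (2 * (b - a)) \<partial>lebesgue_on {a..b}) = (b - a) * ((norm ?d)\<^sup>2 / (2 * (b - a)))"
    using h by (subst lebesgue_integral_eq_integral[OF i3]) auto
  also have "\<dots> = (norm ?d)\<^sup>2 / 2" using h by (simp del: right_diff_distrib_numeral)
  finally show ?thesis by (simp add: field_simps)
qed simp

text \<open>The increment bound makes \<open>U\<close> Hoelder continuous with exponent one
  half.\<close>

lemma L2_primitive_continuous:
  fixes U V :: "real \<Rightarrow> 'h::{real_inner, second_countable_topology}"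
  assumes V: "L2on T V"
    and UV: "\<And>a b x. 0 \<le> a \<Longrightarrow> a \<le> b \<Longrightarrow> b \<le> T \<Longrightarrow>
      inner (U b - U a) x = (\<integral>s. inner (V s) x \<partial>lebesgue_on {a..b})"
  shows "continuous_on {0..T} U"
proof -
  define K where "K = (\<integral>s. (norm (V s))\<^sup>2 \<partial>lebesgue_on {0..T})"
  have V2: "integrable (lebesgue_on {0..T}) (\<lambda>s. (norm (V s))\<^sup>2)" using V by (simp add: L2on_def)
  have le: "(norm (U b - U a))\<^sup>2 \<le> (b - a) * K" if "0 \<le> a" "a \<le> b" "b \<le> T" for a b
  proof -
    have "(\<integral>s. (norm (V s))\<^sup>2 \<partial>lebesgue_on {a..b}) \<le> K"
      unfolding K_def by (rule integral_subinterval_le[OF V2]) (use that in auto)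
    then show ?thesis
      using L2_increment_bound[OF V that UV[OF that]] that
      by (meson diff_ge_0_iff_ge mult_left_mono order_trans)
  qed
  have sym: "dist (U x) (U y) \<le> sqrt (\<bar>y - x\<bar> * K)" if "x \<in> {0..T}" "y \<in> {0..T}" for x y
  proof (cases "x \<le> y")
    case True
    then show ?thesis using le[of x y] that by (simp add: real_le_rsqrt dist_norm norm_minus_commute)
  next
    case False
    then show ?thesis using le[of y x] that by (simp add: real_le_rsqrt dist_norm norm_minus_commute)
  qed
  show ?thesis unfolding continuous_on_def
  proof
    fix x assume x: "x \<in> {0..T}"
    have "((\<lambda>y. sqrt (\<bar>y - x\<bar> * K)) \<longlongrightarrow> sqrt (\<bar>x - x\<bar> * K)) (at x within {0..T})"
      by (intro tendsto_intros)
    then have lim: "((\<lambda>y. sqrt (\<bar>y - x\<bar> * K)) \<longlongrightarrow> 0) (at x within {0..T})" by simp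
    have "\<forall>\<^sub>F y in at x within {0..T}. norm (U y - U x) \<le> sqrt (\<bar>y - x\<bar> * K)"
      using x sym[OF _ x] unfolding eventually_at_filter
      by (intro always_eventually) (auto simp: dist_norm norm_minus_commute abs_minus_commute)
    from Lim_null_comparison[OF this lim] show "(U \<longlongrightarrow> U x) (at x within {0..T})"
      by (simp add: LIM_zero_iff)
  qed
qed

text \<open>Mean value theorem on the segment from \<open>x\<close> to \<open>y\<close>; the
  Lipschitz bound on the gradient is applied at the intermediate point, which gives
  \<open>\<kappa>\<close> instead of the sharp \<open>\<kappa> / 2\<close>.\<close>

lemma lipschitz_gradient_taylor:
  fixes F :: "'h::real_inner \<Rightarrow> real"
  assumes F: "\<And>x. GDERIV F x :> DF x"
    and lip: "\<And>x y. norm (DF x - DF y) \<le> \<kappa> * norm (x - y)" and \<kappa>: "\<kappa> \<ge> 0"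
  shows "\<bar>F y - F x - inner (DF x) (y - x)\<bar> \<le> \<kappa> * (norm (y - x))\<^sup>2"
proof -
  define \<phi> where "\<phi> t = F (x + t *\<^sub>R (y - x))" for t
  have d: "(\<phi> has_real_derivative inner (y - x) (DF (x + t *\<^sub>R (y - x)))) (at t)" for t
  proof -
    have "((\<lambda>t. F (x + t *\<^sub>R (y - x))) has_derivative (\<lambda>h. inner (h *\<^sub>R (y - x)) (DF (x + t *\<^sub>R (y - x))))) (at t)"
      by (rule has_derivative_compose[where g = F, OF _ F[unfolded gderiv_def]])
         (auto intro!: derivative_eq_intros)
    moreover have "(\<lambda>h. inner (h *\<^sub>R (y - x)) (DF (x + t *\<^sub>R (y - x)))) = (*) (inner (y - x) (DF (x + t *\<^sub>R (y - x))))"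
      by (rule ext) simp
    ultimately show ?thesis
      unfolding has_field_derivative_def \<phi>_def by (simp only:)
  qed
  then obtain z where z: "0 < z" "z < 1" "\<phi> 1 - \<phi> 0 = inner (y - x) (DF (x + z *\<^sub>R (y - x)))"
    using MVT2[of 0 1 \<phi>, OF _ d] by auto
  have "\<bar>F y - F x - inner (DF x) (y - x)\<bar> = \<bar>inner (y - x) (DF (x + z *\<^sub>R (y - x)) - DF x)\<bar>"
    using z by (simp add: \<phi>_def inner_diff_right inner_commute)
  also have "\<dots> \<le> norm (y - x) * norm (DF (x + z *\<^sub>R (y - x)) - DF x)"
    by (rule Cauchy_Schwarz_ineq2)
  also have "\<dots> \<le> norm (y - x) * (\<kappa> * norm (y - x))"
  proof (rule mult_left_mono)
    have "norm (DF (x + z *\<^sub>R (y - x)) - DF x) \<le> \<kappa> * norm (z *\<^sub>R (y - x))"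
      using lip[of "x + z *\<^sub>R (y - x)" x] by simp
    also have "\<dots> \<le> \<kappa> * norm (y - x)" using z \<kappa>
      by (intro mult_left_mono) (simp_all add: mult_left_le_one_le)
    finally show "norm (DF (x + z *\<^sub>R (y - x)) - DF x) \<le> \<kappa> * norm (y - x)" .
  qed simp
  finally show ?thesis by (simp add: power2_eq_square mult_ac)
qed

text \<open>On a short interval the gradient is frozen at the left end. Both the Taylor remainder of
  \<open>F\<close> and the error of freezing are at most \<open>\<kappa>\<close> times the length
  times the increment of the primitive \<open>H\<close> of the squared speed, so
  \<open>const_of_superlinear\<close> applies to the defect \<open>\<Psi>\<close>.\<close>

lemma chain_rule_L2:
  fixes U V :: "real \<Rightarrow> 'h::{real_inner, second_countable_topology}"
  assumes V: "L2on T V"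
    and UV: "\<And>a b x. 0 \<le> a \<Longrightarrow> a \<le> b \<Longrightarrow> b \<le> T \<Longrightarrow>
      inner (U b - U a) x = (\<integral>s. inner (V s) x \<partial>lebesgue_on {a..b})"
    and F: "\<And>x. GDERIV F x :> DF x"
    and lip: "\<And>x y. norm (DF x - DF y) \<le> \<kappa> * norm (x - y)" and \<kappa>: "\<kappa> \<ge> 0"
    and t: "t \<in> {0..T}"
  shows "F (U t) - F (U 0) = (\<integral>s. inner (DF (U s)) (V s) \<partial>lebesgue_on {0..t})"
proof -
  have V2: "integrable (lebesgue_on {0..T}) (\<lambda>s. (norm (V s))\<^sup>2)" using V by (simp add: L2on_def)
  define H where "H t = (\<integral>s. (norm (V s))\<^sup>2 \<partial>lebesgue_on {0..t})" for t
  have H: "continuous_on {0..T} H"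
    unfolding H_def by (rule indefinite_integral_continuous_real[OF V2])
  have Hd: "H b - H a = (\<integral>s. (norm (V s))\<^sup>2 \<partial>lebesgue_on {a..b})" if "0 \<le> a" "a \<le> b" "b \<le> T" for a b
    using integral_lebesgue_on_split[OF integrable_lebesgue_on_sub[OF V2, of 0 b], of a] that
    by (simp add: H_def)
  have contU: "continuous_on {0..T} U" by (rule L2_primitive_continuous[OF V UV])
  have contDF: "continuous_on UNIV DF"
  proof (rule lipschitz_on_continuous_on)
    show "\<kappa>-lipschitz_on UNIV DF" using lip \<kappa> by (auto simp: lipschitz_on_def dist_norm)
  qed
  have DFU: "L2on T (\<lambda>s. DF (U s))"
    by (intro L2on_continuous continuous_on_compose2[OF contDF contU]) auto
  have int: "integrable (lebesgue_on {0..T}) (\<lambda>s. inner (DF (U s)) (V s))"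
    by (rule L2on_inner[OF DFU V])
  define \<Psi> where "\<Psi> t = F (U t) - (\<integral>s. inner (DF (U s)) (V s) \<partial>lebesgue_on {0..t})" for t
  have "\<Psi> t = \<Psi> 0"
  proof (rule const_of_superlinear[OF _ H t, where C = "2 * \<kappa>"])
    fix a b assume ab: "0 \<le> a" "a \<le> b" "b \<le> T"
    define D where "D = H b - H a"
    have inc: "(norm (U s - U a))\<^sup>2 \<le> (b - a) * D" if s: "s \<in> {a..b}" for s
    proof -
      have "(norm (U s - U a))\<^sup>2 \<le> (s - a) * (H s - H a)"
        using L2_increment_bound[OF V ab(1), where b = s and U = U] UV[of a s] Hd[of a s] s ab by auto
      also have "\<dots> \<le> (b - a) * D" unfolding D_def
      proof (rule mult_mono)
        have "H b - H s \<ge> 0" using Hd[of s b] s ab by simp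
        then show "H s - H a \<le> H b - H a" by simp
        show "0 \<le> H s - H a" using Hd[of a s] s ab by simp
      qed (use s ab in auto)
      finally show ?thesis .
    qed
    have D0: "D \<ge> 0" unfolding D_def using Hd[OF ab] by simp
    have ia: "integrable (lebesgue_on {a..b}) (\<lambda>s. inner (DF (U s)) (V s))"
      using integrable_lebesgue_on_sub[OF int] ab by simp
    have ic: "integrable (lebesgue_on {a..b}) (\<lambda>s. inner (DF (U a)) (V s))"
      using L2on_integrable[OF L2on_inner_const[OF V, of "DF (U a)"]] ab
      by (auto simp: inner_commute intro: integrable_lebesgue_on_sub)
    have iV: "integrable (lebesgue_on {a..b}) (\<lambda>s. (norm (V s))\<^sup>2)"
      using integrable_lebesgue_on_sub[OF V2] ab by simp
    have i1: "integrable (lebesgue_on {a..b}) (\<lambda>s. c)" for c :: real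
      by (rule integrable_continuous_lebesgue_on) auto
    have "\<Psi> b - \<Psi> a = F (U b) - F (U a) - (\<integral>s. inner (DF (U s)) (V s) \<partial>lebesgue_on {a..b})"
      using integral_lebesgue_on_split[OF integrable_lebesgue_on_sub[OF int, of 0 b], of a] ab
      by (simp add: \<Psi>_def)
    also have "\<dots> = (F (U b) - F (U a) - inner (DF (U a)) (U b - U a))
        - (\<integral>s. inner (DF (U s)) (V s) - inner (DF (U a)) (V s) \<partial>lebesgue_on {a..b})"
      using UV[OF ab, of "DF (U a)"] ia ic by (simp add: inner_commute)
    finally have eq: "\<Psi> b - \<Psi> a = \<dots>" .
    have e1: "\<bar>F (U b) - F (U a) - inner (DF (U a)) (U b - U a)\<bar> \<le> \<kappa> * ((b - a) * D)"
      using lipschitz_gradient_taylor[OF F lip \<kappa>, of "U b" "U a"] inc[of b] ab \<kappa>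
      by (meson atLeastAtMost_iff mult_left_mono order_refl order_trans)
    have "\<bar>\<integral>s. inner (DF (U s)) (V s) - inner (DF (U a)) (V s) \<partial>lebesgue_on {a..b}\<bar>
        \<le> (\<integral>s. \<bar>inner (DF (U s)) (V s) - inner (DF (U a)) (V s)\<bar> \<partial>lebesgue_on {a..b})"
      by (rule integral_abs_bound)
    also have "\<dots> \<le> (\<integral>s. \<kappa> / 2 * (D + (b - a) * (norm (V s))\<^sup>2) \<partial>lebesgue_on {a..b})"
    proof (rule integral_mono)
      show "integrable (lebesgue_on {a..b}) (\<lambda>s. \<bar>inner (DF (U s)) (V s) - inner (DF (U a)) (V s)\<bar>)"
        using ia ic by simp
      show "integrable (lebesgue_on {a..b}) (\<lambda>s. \<kappa> / 2 * (D + (b - a) * (norm (V s))\<^sup>2))"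
        using iV i1 by (intro integrable_mult_right Bochner_Integration.integrable_add) auto
      fix s assume "s \<in> space (lebesgue_on {a..b})"
      then have s: "s \<in> {a..b}" by simp
      have "\<bar>inner (DF (U s)) (V s) - inner (DF (U a)) (V s)\<bar> \<le> norm (DF (U s) - DF (U a)) * norm (V s)"
        by (metis Cauchy_Schwarz_ineq2 inner_diff_left)
      also have "\<dots> \<le> \<kappa> * (norm (U s - U a) * norm (V s))"
        using mult_right_mono[OF lip[of "U s" "U a"], of "norm (V s)"] by (simp add: mult_ac)
      \<comment> \<open>Splitting the product evenly with the weight \<open>sqrt (b - a)\<close>
        makes both halves integrate to the same \<open>(b - a) * D\<close>, the second because
        \<open>D\<close> is the integral of the squared speed.\<close>
      also have "\<dots> \<le> \<kappa> * ((D + (b - a) * (norm (V s))\<^sup>2) / 2)"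
      proof (rule mult_left_mono[OF _ \<kappa>])
        have "norm (U s - U a) * norm (V s) \<le> sqrt ((b - a) * D) * norm (V s)"
          using inc[OF s] by (intro mult_right_mono real_le_rsqrt) auto
        also have "\<dots> = sqrt D * (sqrt (b - a) * norm (V s))" by (simp add: real_sqrt_mult)
        also have "\<dots> \<le> ((sqrt D)\<^sup>2 + (sqrt (b - a) * norm (V s))\<^sup>2) / 2"
          using sum_squares_bound[of "sqrt D" "sqrt (b - a) * norm (V s)"] by simp
        also have "\<dots> = (D + (b - a) * (norm (V s))\<^sup>2) / 2"
          using D0 ab by (simp add: power_mult_distrib)
        finally show "norm (U s - U a) * norm (V s) \<le> (D + (b - a) * (norm (V s))\<^sup>2) / 2" .
      qed
      finally show "\<bar>inner (DF (U s)) (V s) - inner (DF (U a)) (V s)\<bar> \<le> \<kappa> / 2 * (D + (b - a) * (norm (V s))\<^sup>2)"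
        by simp
    qed
    also have "\<dots> = \<kappa> / 2 * ((\<integral>s. D \<partial>lebesgue_on {a..b}) + (b - a) * D)"
      using iV i1 Hd[OF ab] by (simp add: D_def)
    also have "(\<integral>s. D \<partial>lebesgue_on {a..b}) = (b - a) * D"
      using ab by (subst lebesgue_integral_eq_integral[OF i1]) auto
    finally have e2: "\<bar>\<integral>s. inner (DF (U s)) (V s) - inner (DF (U a)) (V s) \<partial>lebesgue_on {a..b}\<bar>
      \<le> \<kappa> / 2 * ((b - a) * D + (b - a) * D)" .
    have "\<kappa> / 2 * (x + x) = \<kappa> * x" for x by simp
    from e2[unfolded this] have e2': "\<bar>\<integral>s. inner (DF (U s)) (V s) - inner (DF (U a)) (V s) \<partial>lebesgue_on {a..b}\<bar>
      \<le> \<kappa> * ((b - a) * D)" .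
    show "\<bar>\<Psi> b - \<Psi> a\<bar> \<le> 2 * \<kappa> * (b - a) * (H b - H a)"
      unfolding eq D_def[symmetric] using order_trans[OF abs_triangle_ineq4 add_mono[OF e1 e2']]
      by (simp only: mult.assoc mult_2 distrib_right)
  qed
  then show ?thesis by (simp add: \<Psi>_def)
qed

text \<open>Integration by parts is the chain rule for the quadratic function \<open>(x, y) \<mapsto> x y\<close>.\<close>

lemma product_rule_L2:
  fixes f g f' g' :: "real \<Rightarrow> real"
  assumes f': "L2on T f'" and g': "L2on T g'"
    and f: "\<And>t. t \<in> {0..T} \<Longrightarrow> f t = f 0 + (\<integral>s. f' s \<partial>lebesgue_on {0..t})"
    and g: "\<And>t. t \<in> {0..T} \<Longrightarrow> g t = g 0 + (\<integral>s. g' s \<partial>lebesgue_on {0..t})"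
    and t: "t \<in> {0..T}"
  shows "f t * g t = f 0 * g 0 + (\<integral>s. f s * g' s + f' s * g s \<partial>lebesgue_on {0..t})"
proof -
  let ?F = "\<lambda>x :: real \<times> real. fst x * snd x" and ?D = "\<lambda>x :: real \<times> real. (snd x, fst x)"
  have V: "L2on T (\<lambda>s. (f' s, g' s))"
  proof -
    have "L2on T (\<lambda>s. (f' s, 0::real) + (0::real, g' s))"
      by (intro L2on_add L2on_bounded_linear[OF f'] L2on_bounded_linear[OF g'] bounded_linear_Pair
          bounded_linear_ident bounded_linear_zero)
    then show ?thesis by simp
  qed
  have inc: "h b - h a = (\<integral>s. h' s \<partial>lebesgue_on {a..b})"
    if "0 \<le> a" "a \<le> b" "b \<le> T" "L2on T h'"
      "\<And>t. t \<in> {0..T} \<Longrightarrow> h t = h 0 + (\<integral>s. h' s \<partial>lebesgue_on {0..t})" for a b h and h' :: "real \<Rightarrow> real"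
    using integral_lebesgue_on_split[OF integrable_lebesgue_on_sub[OF L2on_integrable[OF that(4)], of 0 b], of a]
      that(1-3) that(5)[of a] that(5)[of b] by simp
  have "?F (f t, g t) - ?F (f 0, g 0) = (\<integral>s. inner (?D (f s, g s)) (f' s, g' s) \<partial>lebesgue_on {0..t})"
  proof (rule chain_rule_L2[OF V _ _ _ _ t, where \<kappa> = 1])
    fix a b and x :: "real \<times> real" assume ab: "0 \<le> a" "a \<le> b" "b \<le> T"
    have "integrable (lebesgue_on {a..b}) f'" "integrable (lebesgue_on {a..b}) g'"
      using ab f' g' by (auto intro: integrable_lebesgue_on_sub L2on_integrable)
    then show "inner ((f b, g b) - (f a, g a)) x = (\<integral>s. inner (f' s, g' s) x \<partial>lebesgue_on {a..b})"
      using inc[OF ab f' f] inc[OF ab g' g] by (simp add: inner_prod_def)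
  next
    fix x :: "real \<times> real"
    show "GDERIV ?F x :> ?D x"
      unfolding gderiv_def by (auto intro!: derivative_eq_intros simp: inner_prod_def)
  next
    fix x y :: "real \<times> real"
    \<comment> \<open>The gradient of the product swaps the two coordinates and is therefore an
      isometry.\<close>
    show "norm (?D x - ?D y) \<le> 1 * norm (x - y)"
      by (simp add: norm_Pair add.commute norm_prod_def)
  qed simp
  then show ?thesis by (simp add: mult_ac inner_prod_def add.commute)
qed

section \<open>Convolution with a smooth kernel\<close>

lemma integral_mult_bound:
  fixes c h :: "real \<Rightarrow> real"
  assumes h: "integrable (lebesgue_on {a..b}) h" and c: "continuous_on {a..b} c"
    and M: "\<And>s. s \<in> {a..b} \<Longrightarrow> \<bar>c s\<bar> \<le> M"
  shows "\<bar>\<integral>s. c s * h s \<partial>lebesgue_on {a..b}\<bar> \<le> M * (\<integral>s. \<bar>h s\<bar> \<partial>lebesgue_on {a..b})"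
proof -
  have "\<bar>\<integral>s. c s * h s \<partial>lebesgue_on {a..b}\<bar> \<le> (\<integral>s. \<bar>c s * h s\<bar> \<partial>lebesgue_on {a..b})"
    by (rule integral_abs_bound)
  also have "\<dots> \<le> (\<integral>s. M * \<bar>h s\<bar> \<partial>lebesgue_on {a..b})"
  proof (rule integral_mono)
    show "integrable (lebesgue_on {a..b}) (\<lambda>s. \<bar>c s * h s\<bar>)"
      by (intro integrable_abs integrable_lebesgue_on_mult_continuous[OF h c])
    show "integrable (lebesgue_on {a..b}) (\<lambda>s. M * \<bar>h s\<bar>)" using h by simp
    show "\<bar>c s * h s\<bar> \<le> M * \<bar>h s\<bar>" if "s \<in> space (lebesgue_on {a..b})" for s
      using M[of s] that by (simp add: abs_mult mult_right_mono)
  qed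
  finally show ?thesis by simp
qed

text \<open>Two effects: the forcing on \<open>{a..b}\<close> enters newly, and on
  \<open>{0..a}\<close> the kernel is shifted by \<open>b - a\<close>, which the mean value theorem
  bounds by \<open>M * (b - a)\<close>.\<close>

lemma convolution_increment:
  fixes \<sigma> \<sigma>' h :: "real \<Rightarrow> real"
  assumes d: "\<And>t. (\<sigma> has_real_derivative \<sigma>' t) (at t)"
    and M: "\<And>t. t \<in> {0..T} \<Longrightarrow> \<bar>\<sigma> t\<bar> \<le> M" "\<And>t. t \<in> {0..T} \<Longrightarrow> \<bar>\<sigma>' t\<bar> \<le> M"
    and h: "integrable (lebesgue_on {0..T}) h" and ab: "0 \<le> a" "a \<le> b" "b \<le> T"
  shows "\<bar>(\<integral>s. \<sigma> (b - s) * h s \<partial>lebesgue_on {0..b}) - (\<integral>s. \<sigma> (a - s) * h s \<partial>lebesgue_on {0..a})\<bar>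
    \<le> M * ((\<integral>s. \<bar>h s\<bar> \<partial>lebesgue_on {a..b}) + (b - a) * (\<integral>s. \<bar>h s\<bar> \<partial>lebesgue_on {0..T}))"
proof -
  have cs: "continuous_on UNIV \<sigma>"
    using d by (meson DERIV_isCont continuous_at_imp_continuous_on)
  have c: "continuous_on S (\<lambda>s. \<sigma> (x - s))" for S x
    by (rule continuous_on_compose2[OF cs]) (auto intro!: continuous_intros)
  have hs: "integrable (lebesgue_on {x..y}) h" if "0 \<le> x" "y \<le> T" for x y
    using integrable_lebesgue_on_sub[OF h] that by simp
  have M0: "0 \<le> M" using M(1)[of a] ab by force
  have sp: "(\<integral>s. \<sigma> (b - s) * h s \<partial>lebesgue_on {0..b})
      = (\<integral>s. \<sigma> (b - s) * h s \<partial>lebesgue_on {0..a}) + (\<integral>s. \<sigma> (b - s) * h s \<partial>lebesgue_on {a..b})"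
    using ab by (intro integral_lebesgue_on_split integrable_lebesgue_on_mult_continuous hs c) auto
  have "(\<integral>s. \<sigma> (b - s) * h s \<partial>lebesgue_on {0..a}) - (\<integral>s. \<sigma> (a - s) * h s \<partial>lebesgue_on {0..a})
     = (\<integral>s. (\<sigma> (b - s) - \<sigma> (a - s)) * h s \<partial>lebesgue_on {0..a})"
    using ab by (subst Bochner_Integration.integral_diff[symmetric])
      (auto intro!: integrable_lebesgue_on_mult_continuous hs c simp: left_diff_distrib)
  moreover have "\<bar>\<integral>s. (\<sigma> (b - s) - \<sigma> (a - s)) * h s \<partial>lebesgue_on {0..a}\<bar>
      \<le> (M * (b - a)) * (\<integral>s. \<bar>h s\<bar> \<partial>lebesgue_on {0..a})"
  proof (rule integral_mult_bound)
    fix s assume s: "s \<in> {0..a}"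
    show "\<bar>\<sigma> (b - s) - \<sigma> (a - s)\<bar> \<le> M * (b - a)"
    proof (cases "a = b")
      case False
      then obtain z where z: "a - s < z" "z < b - s" "\<sigma> (b - s) - \<sigma> (a - s) = (b - s - (a - s)) * \<sigma>' z"
        using MVT2[of "a - s" "b - s" \<sigma> \<sigma>'] d ab by auto
      then show ?thesis using M(2)[of z] s ab by (simp add: abs_mult mult.commute mult_right_mono)
    qed simp
  qed (use ab in \<open>auto intro!: hs continuous_intros c\<close>)
  moreover have "(\<integral>s. \<bar>h s\<bar> \<partial>lebesgue_on {0..a}) \<le> (\<integral>s. \<bar>h s\<bar> \<partial>lebesgue_on {0..T})"
  proof -
    have "0 \<le> (\<integral>s. \<bar>h s\<bar> \<partial>lebesgue_on {a..T})" by simp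
    then show ?thesis using integral_lebesgue_on_split[of 0 T "\<lambda>s. \<bar>h s\<bar>" a] h ab by auto
  qed
  then have "(M * (b - a)) * (\<integral>s. \<bar>h s\<bar> \<partial>lebesgue_on {0..a}) \<le> (M * (b - a)) * (\<integral>s. \<bar>h s\<bar> \<partial>lebesgue_on {0..T})"
    using M0 ab by (intro mult_left_mono) auto
  moreover have "\<bar>\<integral>s. \<sigma> (b - s) * h s \<partial>lebesgue_on {a..b}\<bar> \<le> M * (\<integral>s. \<bar>h s\<bar> \<partial>lebesgue_on {a..b})"
    using ab by (intro integral_mult_bound hs c M(1)) auto
  ultimately show ?thesis unfolding sp by (simp add: distrib_left mult_ac)
qed

text \<open>Formally the derivative of the convolution is \<open>\<tau> 0 * h\<close> plus the
  convolution with \<open>\<tau>'\<close>; for merely integrable \<open>h\<close> this is an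
  integral identity. Its defect over \<open>{a..b}\<close> splits into three errors: replacing the
  kernel by its value at 0 on the new piece, the second-order Taylor error of the kernel on the old
  piece, and the oscillation of the convolution with \<open>\<tau>'\<close>.\<close>

lemma convolution_primitive:
  fixes \<tau> \<tau>' \<tau>'' h :: "real \<Rightarrow> real"
  assumes d1: "\<And>t. (\<tau> has_real_derivative \<tau>' t) (at t)"
    and d2: "\<And>t. (\<tau>' has_real_derivative \<tau>'' t) (at t)"
    and c2: "continuous_on UNIV \<tau>''"
    and h: "integrable (lebesgue_on {0..T}) h"
  shows "continuous_on {0..T} (\<lambda>r. \<integral>s. \<tau>' (r - s) * h s \<partial>lebesgue_on {0..r})" (is ?c)
    and "t \<in> {0..T} \<Longrightarrow> (\<integral>s. \<tau> (t - s) * h s \<partial>lebesgue_on {0..t}) = \<tau> 0 * (\<integral>s. h s \<partial>lebesgue_on {0..t})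
    + (\<integral>r. (\<integral>s. \<tau>' (r - s) * h s \<partial>lebesgue_on {0..r}) \<partial>lebesgue_on {0..t})"
proof -
  have cont: "continuous_on S \<tau>" "continuous_on S \<tau>'" "continuous_on S \<tau>''" for S
    using d1 d2 c2 by (meson DERIV_isCont continuous_at_imp_continuous_on continuous_on_subset subset_UNIV)+
  have "bounded (\<tau> ` {0..T} \<union> \<tau>' ` {0..T} \<union> \<tau>'' ` {0..T})"
    unfolding bounded_Un by (intro conjI compact_imp_bounded compact_continuous_image cont) auto
  then obtain M where M': "\<forall>y\<in>\<tau> ` {0..T} \<union> \<tau>' ` {0..T} \<union> \<tau>'' ` {0..T}. norm y \<le> M"
    unfolding bounded_iff by blast
  have M: "\<And>t. t \<in> {0..T} \<Longrightarrow> \<bar>\<tau> t\<bar> \<le> M" "\<And>t. t \<in> {0..T} \<Longrightarrow> \<bar>\<tau>' t\<bar> \<le> M"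
    "\<And>t. t \<in> {0..T} \<Longrightarrow> \<bar>\<tau>'' t\<bar> \<le> M"
    using M' by auto
  define A where "A = (\<integral>s. \<bar>h s\<bar> \<partial>lebesgue_on {0..T})"
  \<comment> \<open>The linear term serves the old piece \<open>{0..a}\<close>: the mass of
    \<open>h\<close> there is not small, and the errors made there carry the factor
    \<open>(b - a) * A\<close> instead of an increment of the primitive of
    \<open>\<bar>h\<bar>\<close>.\<close>
  define H where "H t = (\<integral>s. \<bar>h s\<bar> \<partial>lebesgue_on {0..t}) + t * A" for t
  define K K1 where "K t = (\<integral>s. \<tau> (t - s) * h s \<partial>lebesgue_on {0..t})"
    and "K1 t = (\<integral>s. \<tau>' (t - s) * h s \<partial>lebesgue_on {0..t})" for t
  have A0: "A \<ge> 0" by (simp add: A_def)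
  have ah: "integrable (lebesgue_on {0..T}) (\<lambda>s. \<bar>h s\<bar>)" using h by simp
  have H: "continuous_on {0..T} H"
    unfolding H_def by (intro continuous_intros indefinite_integral_continuous_real[OF ah])
  have Hd: "H b - H a = (\<integral>s. \<bar>h s\<bar> \<partial>lebesgue_on {a..b}) + (b - a) * A" if "0 \<le> a" "a \<le> b" "b \<le> T" for a b
    using integral_lebesgue_on_split[OF integrable_lebesgue_on_sub[OF ah, of 0 b], of a] that
    by (simp add: H_def left_diff_distrib)
  have hs: "integrable (lebesgue_on {x..y}) h" if "0 \<le> x" "y \<le> T" for x y
    using integrable_lebesgue_on_sub[OF h] that by simp
  have K1: "\<bar>K1 b - K1 a\<bar> \<le> M * (H b - H a)" if "0 \<le> a" "a \<le> b" "b \<le> T" for a b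
    using convolution_increment[OF d2 M(2,3) h that] unfolding Hd[OF that] K1_def A_def by auto
  have "continuous_on {0..T} K1"
    unfolding continuous_on_def
  proof
    fix x assume x: "x \<in> {0..T}"
    have "((\<lambda>y. \<bar>M\<bar> * \<bar>H y - H x\<bar>) \<longlongrightarrow> \<bar>M\<bar> * \<bar>H x - H x\<bar>) (at x within {0..T})"
      using H x by (intro tendsto_intros) (auto simp: continuous_on_def)
    then have lim: "((\<lambda>y. \<bar>M\<bar> * \<bar>H y - H x\<bar>) \<longlongrightarrow> 0) (at x within {0..T})" by simp
    have "norm (K1 y - K1 x) \<le> \<bar>M\<bar> * \<bar>H y - H x\<bar>" if "y \<in> {0..T}" for y
    proof (cases "x \<le> y")
      case True then show ?thesis using K1[of x y] x that abs_ge_self[of "M * (H y - H x)"] by (auto simp: abs_mult abs_minus_commute)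
    next
      case False then show ?thesis using K1[of y x] x that abs_ge_self[of "M * (H x - H y)"] by (auto simp: abs_mult abs_minus_commute)
    qed
    then have "\<forall>\<^sub>F y in at x within {0..T}. norm (K1 y - K1 x) \<le> \<bar>M\<bar> * \<bar>H y - H x\<bar>"
      unfolding eventually_at_filter by (intro always_eventually) auto
    from Lim_null_comparison[OF this lim] show "(K1 \<longlongrightarrow> K1 x) (at x within {0..T})"
      by (simp add: LIM_zero_iff)
  qed
  then show ?c by (simp add: K1_def[abs_def])
  note cK1 = \<open>continuous_on {0..T} K1\<close>
  have iK1: "integrable (lebesgue_on {x..y}) K1" if "0 \<le> x" "y \<le> T" for x y
    using that by (intro integrable_continuous_lebesgue_on continuous_on_subset[OF cK1]) auto
  assume t: "t \<in> {0..T}"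
  define \<Psi> where "\<Psi> t = K t - \<tau> 0 * (\<integral>s. h s \<partial>lebesgue_on {0..t}) - (\<integral>r. K1 r \<partial>lebesgue_on {0..t})" for t
  have "\<Psi> t = \<Psi> 0"
  proof (rule const_of_superlinear[OF _ H t, where C = "3 * M"])
    fix a b assume ab: "0 \<le> a" "a \<le> b" "b \<le> T"
    have M0: "0 \<le> M" using M(1)[of a] ab by force
    have c: "continuous_on S (\<lambda>s. \<tau> (x - s))" "continuous_on S (\<lambda>s. \<tau>' (x - s))" for S x
      by (rule continuous_on_compose2[OF cont(1)[of UNIV]] continuous_on_compose2[OF cont(2)[of UNIV]];
          auto intro!: continuous_intros)+
    note ic = integrable_lebesgue_on_mult_continuous[OF hs]
    have s1: "K b = (\<integral>s. \<tau> (b - s) * h s \<partial>lebesgue_on {0..a}) + (\<integral>s. \<tau> (b - s) * h s \<partial>lebesgue_on {a..b})"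
      unfolding K_def using ab by (intro integral_lebesgue_on_split ic c) auto
    have s2: "(\<integral>s. h s \<partial>lebesgue_on {0..b}) = (\<integral>s. h s \<partial>lebesgue_on {0..a}) + (\<integral>s. h s \<partial>lebesgue_on {a..b})"
      using ab by (intro integral_lebesgue_on_split hs) auto
    have s3: "(\<integral>s. K1 s \<partial>lebesgue_on {0..b}) = (\<integral>s. K1 s \<partial>lebesgue_on {0..a}) + (\<integral>s. K1 s \<partial>lebesgue_on {a..b})"
      using ab by (intro integral_lebesgue_on_split iK1) auto
    have e1: "(\<integral>s. \<tau> (b - s) * h s \<partial>lebesgue_on {a..b}) - \<tau> 0 * (\<integral>s. h s \<partial>lebesgue_on {a..b})
        = (\<integral>s. (\<tau> (b - s) - \<tau> 0) * h s \<partial>lebesgue_on {a..b})"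
      using ab hs[of a b] ic[of a b, OF _ _ c(1)] by (simp add: left_diff_distrib)
    have e2: "(\<integral>s. \<tau> (b - s) * h s \<partial>lebesgue_on {0..a}) - K a - (b - a) * K1 a
        = (\<integral>s. (\<tau> (b - s) - \<tau> (a - s) - (b - a) * \<tau>' (a - s)) * h s \<partial>lebesgue_on {0..a})"
      using ab ic[of 0 a, OF _ _ c(1), of a] ic[of 0 a, OF _ _ c(1), of b] ic[of 0 a, OF _ _ c(2), of a]
      by (simp add: left_diff_distrib K_def K1_def mult.assoc)
    have e3: "(b - a) * K1 a - (\<integral>s. K1 s \<partial>lebesgue_on {a..b}) = (\<integral>s. (K1 a - K1 s) * 1 \<partial>lebesgue_on {a..b})"
    proof -
      have i1: "integrable (lebesgue_on {a..b}) (\<lambda>s. c)" for c :: real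
        by (rule integrable_continuous_lebesgue_on) auto
      have "(\<integral>s. K1 a \<partial>lebesgue_on {a..b}) = (b - a) * K1 a"
        using ab by (subst lebesgue_integral_eq_integral[OF i1]) auto
      moreover have "(\<integral>s. K1 a - K1 s \<partial>lebesgue_on {a..b}) = (\<integral>s. K1 a \<partial>lebesgue_on {a..b}) - (\<integral>s. K1 s \<partial>lebesgue_on {a..b})"
        using iK1[of a b] ab by (intro Bochner_Integration.integral_diff i1) auto
      ultimately show ?thesis by (simp only: mult_1_right)
    qed
    have b1: "\<bar>\<integral>s. (\<tau> (b - s) - \<tau> 0) * h s \<partial>lebesgue_on {a..b}\<bar> \<le> (M * (b - a)) * (\<integral>s. \<bar>h s\<bar> \<partial>lebesgue_on {a..b})"
    proof (rule integral_mult_bound)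
      fix s assume s: "s \<in> {a..b}"
      show "\<bar>\<tau> (b - s) - \<tau> 0\<bar> \<le> M * (b - a)"
      proof (cases "s = b")
        case False
        then obtain z where z: "0 < z" "z < b - s" "\<tau> (b - s) - \<tau> 0 = (b - s - 0) * \<tau>' z"
          using MVT2[of 0 "b - s" \<tau> \<tau>'] d1 s by auto
        have "(b - s) * \<bar>\<tau>' z\<bar> \<le> (b - a) * M" using M(2)[of z] s ab z by (intro mult_mono) auto
        then show ?thesis using z s by (simp add: abs_mult mult.commute)
      qed (use M0 ab in simp)
    qed (use ab in \<open>auto intro!: hs continuous_intros c\<close>)
    have b2: "\<bar>\<integral>s. (\<tau> (b - s) - \<tau> (a - s) - (b - a) * \<tau>' (a - s)) * h s \<partial>lebesgue_on {0..a}\<bar>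
      \<le> (M * (b - a)\<^sup>2) * (\<integral>s. \<bar>h s\<bar> \<partial>lebesgue_on {0..a})"
    proof (rule integral_mult_bound)
      fix s assume s: "s \<in> {0..a}"
      show "\<bar>\<tau> (b - s) - \<tau> (a - s) - (b - a) * \<tau>' (a - s)\<bar> \<le> M * (b - a)\<^sup>2"
      proof (cases "a = b")
        case False
        then obtain z where z: "a - s < z" "z < b - s" "\<tau> (b - s) - \<tau> (a - s) = (b - s - (a - s)) * \<tau>' z"
          using MVT2[of "a - s" "b - s" \<tau> \<tau>'] d1 ab by auto
        obtain y where y: "a - s < y" "y < z" "\<tau>' z - \<tau>' (a - s) = (z - (a - s)) * \<tau>'' y"
          using MVT2[of "a - s" z \<tau>' \<tau>''] d2 z by auto
        have "\<tau> (b - s) - \<tau> (a - s) - (b - a) * \<tau>' (a - s) = (b - a) * ((z - (a - s)) * \<tau>'' y)"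
          unfolding y(3)[symmetric] z(3) by (simp add: algebra_simps)
        moreover have "(b - a) * ((z - (a - s)) * \<bar>\<tau>'' y\<bar>) \<le> (b - a) * ((b - a) * M)"
          using M(3)[of y] s ab z y by (intro mult_mono mult_left_mono) auto
        ultimately show ?thesis using z y ab by (simp add: abs_mult power2_eq_square mult_ac)
      qed simp
    qed (use ab in \<open>auto intro!: hs continuous_intros c\<close>)
    have b3: "\<bar>\<integral>s. (K1 a - K1 s) * 1 \<partial>lebesgue_on {a..b}\<bar> \<le> (M * (H b - H a)) * (\<integral>s. \<bar>1::real\<bar> \<partial>lebesgue_on {a..b})"
    proof (rule integral_mult_bound)
      fix s assume s: "s \<in> {a..b}"
      have "\<bar>K1 a - K1 s\<bar> \<le> M * (H s - H a)" using K1[of a s] s ab by (simp add: abs_minus_commute)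
      also have "\<dots> \<le> M * (H b - H a)"
      proof (rule mult_left_mono[OF _ M0])
        have "H b - H s \<ge> 0" using Hd[of s b] s ab A0 by simp
        then show "H s - H a \<le> H b - H a" by simp
      qed
      finally show "\<bar>K1 a - K1 s\<bar> \<le> M * (H b - H a)" .
    next
      show "integrable (lebesgue_on {a..b}) (\<lambda>s. 1 :: real)"
        by (rule integrable_continuous_lebesgue_on) auto
      show "continuous_on {a..b} (\<lambda>s. K1 a - K1 s)"
        using ab by (intro continuous_intros continuous_on_subset[OF cK1]) auto
    qed
    have i1: "(\<integral>s. \<bar>1::real\<bar> \<partial>lebesgue_on {a..b}) = b - a"
      using ab by (simp add: measure_restrict_space)
    have le0: "(\<integral>s. \<bar>h s\<bar> \<partial>lebesgue_on {0..a}) \<le> A"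
    proof -
      have "0 \<le> (\<integral>s. \<bar>h s\<bar> \<partial>lebesgue_on {a..T})" by simp
      then show ?thesis using integral_lebesgue_on_split[OF ah, of a] ab unfolding A_def by auto
    qed
    have "(M * (b - a)\<^sup>2) * (\<integral>s. \<bar>h s\<bar> \<partial>lebesgue_on {0..a}) \<le> (M * (b - a)\<^sup>2) * A"
      using M0 le0 by (intro mult_left_mono) auto
    also have "\<dots> = M * (b - a) * ((b - a) * A)" by (simp add: power2_eq_square)
    also have "\<dots> \<le> M * (b - a) * (H b - H a)"
      using M0 ab unfolding Hd[OF ab] by (intro mult_left_mono) auto
    finally have b2': "(M * (b - a)\<^sup>2) * (\<integral>s. \<bar>h s\<bar> \<partial>lebesgue_on {0..a}) \<le> M * (b - a) * (H b - H a)" .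
    have b1': "(M * (b - a)) * (\<integral>s. \<bar>h s\<bar> \<partial>lebesgue_on {a..b}) \<le> M * (b - a) * (H b - H a)"
      using M0 ab A0 unfolding Hd[OF ab] by (intro mult_left_mono) auto
    have "\<Psi> b - \<Psi> a = ((\<integral>s. \<tau> (b - s) * h s \<partial>lebesgue_on {a..b}) - \<tau> 0 * (\<integral>s. h s \<partial>lebesgue_on {a..b}))
      + ((\<integral>s. \<tau> (b - s) * h s \<partial>lebesgue_on {0..a}) - K a - (b - a) * K1 a)
      + ((b - a) * K1 a - (\<integral>s. K1 s \<partial>lebesgue_on {a..b}))"
      unfolding \<Psi>_def s1 s2 s3 by (simp add: algebra_simps)
    then have dec: "\<Psi> b - \<Psi> a = (\<integral>s. (\<tau> (b - s) - \<tau> 0) * h s \<partial>lebesgue_on {a..b})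
      + (\<integral>s. (\<tau> (b - s) - \<tau> (a - s) - (b - a) * \<tau>' (a - s)) * h s \<partial>lebesgue_on {0..a})
      + (\<integral>s. (K1 a - K1 s) * 1 \<partial>lebesgue_on {a..b})"
      unfolding e1 e2 e3 .
    have b3': "\<bar>\<integral>s. (K1 a - K1 s) * 1 \<partial>lebesgue_on {a..b}\<bar> \<le> M * (b - a) * (H b - H a)"
      using b3 unfolding i1 by (simp only: mult_ac)
    have "\<bar>x + y + z\<bar> \<le> 3 * P" if "\<bar>x\<bar> \<le> P" "\<bar>y\<bar> \<le> P" "\<bar>z\<bar> \<le> P" for x y z P :: real
      using that by linarith
    from this[OF order_trans[OF b1 b1'] order_trans[OF b2 b2'] b3']
    show "\<bar>\<Psi> b - \<Psi> a\<bar> \<le> 3 * M * (b - a) * (H b - H a)"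
      unfolding dec by (simp only: mult.assoc)
  qed
  then show "(\<integral>s. \<tau> (t - s) * h s \<partial>lebesgue_on {0..t}) = \<tau> 0 * (\<integral>s. h s \<partial>lebesgue_on {0..t})
    + (\<integral>r. (\<integral>s. \<tau>' (r - s) * h s \<partial>lebesgue_on {0..r}) \<partial>lebesgue_on {0..t})"
    by (simp add: \<Psi>_def K_def K1_def)
qed

section \<open>Orthonormal bases\<close>

text \<open>Completeness enters as the sort \<open>complete_space\<close>, so the limit in
  \<open>has_bochner_integral\<close> is produced directly: approximating simple functions stay
  below \<open>2 * g\<close>, dominated convergence makes their distance to \<open>f\<close> vanish,
  hence their integrals form a Cauchy sequence.\<close>

lemma integrable_complete:
  fixes f :: "'a \<Rightarrow> 'b::{real_normed_vector, complete_space, second_countable_topology}"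
  assumes f[measurable]: "f \<in> borel_measurable M" and g: "integrable M g"
    and le: "\<And>x. x \<in> space M \<Longrightarrow> norm (f x) \<le> g x"
  shows "integrable M f"
proof -
  obtain s where s: "\<And>i. simple_function M (s i)"
    and lim: "\<And>x. x \<in> space M \<Longrightarrow> (\<lambda>i. s i x) \<longlonglongrightarrow> f x"
    and bd: "\<And>i x. x \<in> space M \<Longrightarrow> norm (s i x) \<le> 2 * norm (f x)"
    using borel_measurable_implies_sequence_metric[OF f, of 0] by (simp add: dist_norm) metis
  have sm[measurable]: "s i \<in> borel_measurable M" for i
    by (rule borel_measurable_simple_function[OF s])
  have bd2: "norm (s i x) \<le> 2 * g x" if "x \<in> space M" for i x
    using bd[OF that, of i] le[OF that] by linarith
  have fin: "(\<integral>\<^sup>+x. ennreal (2 * g x) \<partial>M) < \<infinity>"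
  proof -
    have "integrable M (\<lambda>x. 2 * g x)" using g by simp
    then have "(\<integral>\<^sup>+x. norm (2 * g x) \<partial>M) < \<infinity>" unfolding integrable_iff_bounded by blast
    moreover have "(\<integral>\<^sup>+x. ennreal (2 * g x) \<partial>M) \<le> (\<integral>\<^sup>+x. norm (2 * g x) \<partial>M)"
      by (intro nn_integral_mono) (auto intro!: ennreal_leI)
    ultimately show ?thesis by (rule le_less_trans[rotated])
  qed
  have gm[measurable]: "g \<in> borel_measurable M" using g by simp
  have sb: "Bochner_Integration.simple_bochner_integrable M (s i)" for i
  proof (rule simple_bochner_integrableI_bounded[OF s])
    have "(\<integral>\<^sup>+x. norm (s i x) \<partial>M) \<le> (\<integral>\<^sup>+x. ennreal (2 * g x) \<partial>M)"
      by (intro nn_integral_mono ennreal_leI bd2)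
    then show "(\<integral>\<^sup>+x. norm (s i x) \<partial>M) < \<infinity>" using fin by (rule le_less_trans)
  qed
  have L: "(\<lambda>i. \<integral>\<^sup>+x. norm (f x - s i x) \<partial>M) \<longlonglongrightarrow> 0"
    using fin lim by (intro nn_integral_dominated_convergence_norm[where w = "\<lambda>x. 2 * g x"])
      (auto intro!: AE_I2 bd2)
  let ?y = "\<lambda>i. Bochner_Integration.simple_bochner_integral M (s i)"
  have "Cauchy ?y"
  proof (rule CauchyI')
    fix \<epsilon> :: real assume "\<epsilon> > 0"
    then have "0 < ennreal (\<epsilon> / 2)" by simp
    from order_tendstoD(2)[OF L this] obtain n0
      where n0: "\<And>n. n \<ge> n0 \<Longrightarrow> (\<integral>\<^sup>+x. norm (f x - s n x) \<partial>M) < ennreal (\<epsilon> / 2)"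
      by (auto simp: eventually_sequentially)
    have "norm (?y m - ?y n) < \<epsilon>" if "n0 \<le> m" "m < n" for m n
    proof -
      have "ennreal (norm (?y m - ?y n)) < ennreal (\<epsilon> / 2) + ennreal (\<epsilon> / 2)"
        using simple_bochner_integral_bounded[OF f sb sb, of m n] n0[of m] n0[of n] that
        by (meson add_strict_mono less_imp_le_nat order.strict_trans1 order_trans)
      also have "\<dots> = ennreal \<epsilon>" using \<open>\<epsilon> > 0\<close> by (simp flip: ennreal_plus)
      finally show ?thesis by (simp add: ennreal_less_iff)
    qed
    then show "\<exists>k. \<forall>m\<ge>k. \<forall>n>m. dist (?y m) (?y n) < \<epsilon>" unfolding dist_norm by blast
  qed
  then obtain x where "?y \<longlonglongrightarrow> x" using Cauchy_convergent convergent_def by blast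
  then have "has_bochner_integral M f x" using f sb L by (rule has_bochner_integral.intros[rotated 3])
  then show ?thesis by (rule integrable.intros)
qed

locale hilbert_basis =
  fixes e :: "nat \<Rightarrow> 'h::{real_inner, complete_space, second_countable_topology}"
  assumes ortho: "\<And>i j. inner (e i) (e j) = (if i = j then 1 else 0)"
    and total: "closure (span (range e)) = UNIV"
begin

definition proj :: "nat \<Rightarrow> 'h \<Rightarrow> 'h" where
  "proj N x = (\<Sum>k<N. inner x (e k) *\<^sub>R e k)"

lemma inner_comb: "inner (\<Sum>k<N. c k *\<^sub>R e k) (e j) = (if j < N then c j else 0)"
  by (simp add: inner_sum_left ortho if_distrib sum.delta cong: if_cong)

lemma proj_coord: "inner (proj N x) (e j) = (if j < N then inner x (e j) else 0)"
  by (simp add: proj_def inner_comb)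

lemma norm_comb: "(norm (\<Sum>k<N. c k *\<^sub>R e k))\<^sup>2 = (\<Sum>k<N. (c k)\<^sup>2)"
  by (simp only: power2_norm_eq_inner inner_sum_right inner_scaleR_right inner_comb)
     (simp add: power2_eq_square)

lemma norm_proj: "(norm (proj N x))\<^sup>2 = (\<Sum>k<N. (inner x (e k))\<^sup>2)"
  by (simp add: proj_def norm_comb)

lemma inner_proj: "inner (proj N x) y = (\<Sum>k<N. inner x (e k) * inner y (e k))"
  by (simp add: proj_def inner_sum_left) (simp add: inner_commute)

lemma norm_diff_proj: "(norm (x - proj N x))\<^sup>2 = (norm x)\<^sup>2 - (\<Sum>k<N. (inner x (e k))\<^sup>2)"
proof -
  have "(norm (x - proj N x))\<^sup>2 = (norm x)\<^sup>2 - 2 * inner (proj N x) x + (norm (proj N x))\<^sup>2"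
    by (simp add: power2_norm_eq_inner inner_diff_left inner_diff_right inner_commute)
  moreover have "inner (proj N x) x = (\<Sum>k<N. (inner x (e k))\<^sup>2)"
    by (simp add: inner_proj power2_eq_square)
  ultimately show ?thesis by (simp only: norm_proj)
qed

lemma norm_diff_proj_le: "norm (x - proj N x) \<le> norm x"
  by (rule power2_le_imp_le) (auto simp: norm_diff_proj sum_nonneg)

lemma proj_diff: "proj N (x - y) = proj N x - proj N y"
  by (simp add: proj_def inner_diff_left scaleR_left_diff_distrib sum_subtractf)

lemma proj_span: "y \<in> span (range e) \<Longrightarrow> \<exists>N0. \<forall>N\<ge>N0. proj N y = y"
proof (induction rule: span_induct_alt)
  case base then show ?case by (simp add: proj_def)
next
  case (step c x y)
  then obtain k N0 where k: "x = e k" and N0: "\<And>N. N \<ge> N0 \<Longrightarrow> proj N y = y" by auto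
  have "proj N (c *\<^sub>R x + y) = c *\<^sub>R x + y" if "N \<ge> max N0 (Suc k)" for N
  proof -
    have "proj N (e k) = e k"
      using that by (simp add: proj_def ortho if_distrib[of "\<lambda>z. z *\<^sub>R _"] sum.delta cong: if_cong)
    then have "proj N (c *\<^sub>R x + y) = c *\<^sub>R e k + proj N y"
      by (simp add: proj_def inner_add_left scaleR_left_distrib sum.distrib k flip: scaleR_scaleR scaleR_sum_right)
    then show ?thesis using N0 that k by simp
  qed
  then show ?case by blast
qed

text \<open>The maps \<open>x - proj N x\<close> are contractions, and on the dense span they vanish
  for large \<open>N\<close>.\<close>

lemma proj_tendsto: "(\<lambda>N. proj N x) \<longlonglongrightarrow> x"
proof (rule LIMSEQ_I)
  fix \<epsilon> :: real assume "\<epsilon> > 0"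
  have "x \<in> closure (span (range e))" using total by simp
  then obtain y where y: "y \<in> span (range e)" "dist y x < \<epsilon>"
    using \<open>\<epsilon> > 0\<close> closure_approachable by blast
  then obtain N0 where N0: "\<And>N. N \<ge> N0 \<Longrightarrow> proj N y = y" using proj_span by blast
  have "norm (proj N x - x) < \<epsilon>" if "N \<ge> N0" for N
  proof -
    have "x - proj N x = (x - y) - proj N (x - y)" using N0[OF that] by (simp add: proj_diff)
    then have "norm (x - proj N x) \<le> norm (x - y)" by (metis norm_diff_proj_le)
    then show ?thesis using y by (simp add: dist_norm norm_minus_commute)
  qed
  then show "\<exists>N0. \<forall>N\<ge>N0. norm (proj N x - x) < \<epsilon>" by blast
qed

lemma inner_sums: "(\<lambda>k. inner x (e k) * inner y (e k)) sums inner x y"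
  unfolding sums_def inner_proj[symmetric] by (intro tendsto_intros proj_tendsto)

lemma parseval: "(\<lambda>k. (inner x (e k))\<^sup>2) sums (norm x)\<^sup>2"
  using inner_sums[of x x] by (simp add: power2_eq_square power2_norm_eq_inner[symmetric])

lemma coord_summable: "summable (\<lambda>k. (inner x (e k))\<^sup>2)"
  using parseval sums_summable by blast

lemma norm_sq_suminf: "(norm x)\<^sup>2 = (\<Sum>k. (inner x (e k))\<^sup>2)"
  using parseval sums_unique by blast

lemma bessel: "(\<Sum>k<N. (inner x (e k))\<^sup>2) \<le> (norm x)\<^sup>2"
  using sum_le_suminf[OF coord_summable, of "{..<N}" x] by (simp add: norm_sq_suminf)

lemma coord_eqI: "(\<And>k. inner x (e k) = inner y (e k)) \<Longrightarrow> x = y"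
  using LIMSEQ_unique[OF proj_tendsto[of x]] proj_tendsto[of y] by (simp add: proj_def)

text \<open>Squared norms of increments of the partial sums \<open>X\<close> are increments of the
  convergent sequence \<open>s\<close>.\<close>

lemma riesz_fischer:
  assumes "summable (\<lambda>k. (c k)\<^sup>2)" shows "\<exists>x. \<forall>k. inner x (e k) = c k"
proof -
  define X where "X N = (\<Sum>k<N. c k *\<^sub>R e k)" for N
  define s where "s N = (\<Sum>k<N. (c k)\<^sup>2)" for N
  have d: "(norm (X n - X m))\<^sup>2 = s n - s m" if "m \<le> n" for m n
  proof -
    have "X n - X m = (\<Sum>k<n. (if k < m then 0 else c k) *\<^sub>R e k)"
    proof -
      have "X m = (\<Sum>k<n. (if k < m then c k else 0) *\<^sub>R e k)"
        unfolding X_def using that by (intro sum.mono_neutral_cong_left) auto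
      then show ?thesis unfolding X_def
        by (simp add: sum_subtractf[symmetric] if_distrib scaleR_left_diff_distrib[symmetric] cong: if_cong)
          (intro sum.cong, auto)
    qed
    then have "(norm (X n - X m))\<^sup>2 = (\<Sum>k<n. (if k < m then 0 else c k)\<^sup>2)" by (simp only: norm_comb)
    also have "\<dots> = s n - s m"
    proof -
      have "s m = (\<Sum>k<n. if k < m then (c k)\<^sup>2 else 0)"
        unfolding s_def using that by (intro sum.mono_neutral_cong_left) auto
      then show ?thesis unfolding s_def by (simp add: sum_subtractf[symmetric]) (intro sum.cong, auto)
    qed
    finally show ?thesis .
  qed
  have "Cauchy s" using assms unfolding s_def summable_iff_convergent by (rule convergent_Cauchy)
  have "Cauchy X"
  proof (rule CauchyI')
    fix \<epsilon> :: real assume "\<epsilon> > 0"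
    then obtain M where M: "\<And>m n. m \<ge> M \<Longrightarrow> n \<ge> M \<Longrightarrow> norm (s m - s n) < \<epsilon>\<^sup>2"
      using CauchyD[OF \<open>Cauchy s\<close>, of "\<epsilon>\<^sup>2"] by auto
    have "norm (X m - X n) < \<epsilon>" if "M \<le> m" "m < n" for m n
    proof -
      have "(norm (X n - X m))\<^sup>2 < \<epsilon>\<^sup>2" using d[of m n] M[of n m] that by auto
      then show ?thesis using \<open>\<epsilon> > 0\<close> by (simp add: power2_less_imp_less norm_minus_commute)
    qed
    then show "\<exists>M. \<forall>m\<ge>M. \<forall>n>m. dist (X m) (X n) < \<epsilon>" unfolding dist_norm by blast
  qed
  then obtain x where x: "X \<longlonglongrightarrow> x" using Cauchy_convergent convergent_def by blast
  have "inner x (e k) = c k" for k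
  proof (rule LIMSEQ_unique)
    show "(\<lambda>N. inner (X N) (e k)) \<longlonglongrightarrow> inner x (e k)" by (intro tendsto_intros x)
    have "eventually (\<lambda>N. inner (X N) (e k) = c k) sequentially"
      using eventually_gt_at_top[of k] by eventually_elim (simp add: X_def inner_comb)
    then show "(\<lambda>N. inner (X N) (e k)) \<longlonglongrightarrow> c k" by (rule tendsto_eventually)
  qed
  then show ?thesis by blast
qed

text \<open>Meaningful only for square-summable \<open>c\<close>; its value for any other
  \<open>c\<close> is arbitrary and never inspected.\<close>

definition vec :: "(nat \<Rightarrow> real) \<Rightarrow> 'h" where
  "vec c = (SOME x. \<forall>k. inner x (e k) = c k)"

lemma vec_coord: "summable (\<lambda>k. (c k)\<^sup>2) \<Longrightarrow> inner (vec c) (e k) = c k"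
  using someI_ex[OF riesz_fischer, of c] unfolding vec_def by blast

lemma norm_vec: "summable (\<lambda>k. (c k)\<^sup>2) \<Longrightarrow> (norm (vec c))\<^sup>2 = (\<Sum>k. (c k)\<^sup>2)"
  using vec_coord by (simp add: norm_sq_suminf)

lemma vec_bound: 
  assumes "\<And>k. \<bar>c k\<bar> \<le> C * \<bar>inner x (e k)\<bar>"
  shows "summable (\<lambda>k. (c k)\<^sup>2)" and "(norm (vec c))\<^sup>2 \<le> C\<^sup>2 * (norm x)\<^sup>2"
proof -
  have le: "(c k)\<^sup>2 \<le> C\<^sup>2 * (inner x (e k))\<^sup>2" for k
    using power_mono[OF assms[of k], of 2] by (simp add: power_mult_distrib)
  have s: "summable (\<lambda>k. C\<^sup>2 * (inner x (e k))\<^sup>2)" by (intro summable_mult coord_summable)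
  show sc: "summable (\<lambda>k. (c k)\<^sup>2)" by (rule summable_comparison_test'[OF s, of 0]) (use le in auto)
  have "(\<Sum>k. (c k)\<^sup>2) \<le> (\<Sum>k. C\<^sup>2 * (inner x (e k))\<^sup>2)" by (rule suminf_le[OF le sc s])
  then show "(norm (vec c))\<^sup>2 \<le> C\<^sup>2 * (norm x)\<^sup>2"
    by (simp add: norm_vec[OF sc] norm_sq_suminf[of x] suminf_mult[OF coord_summable])
qed

section \<open>Vector-valued functions in coordinates\<close>

lemma measurable_coords:
  assumes [measurable]: "\<And>k. (\<lambda>s. inner (f s) (e k)) \<in> borel_measurable M"
  shows "f \<in> borel_measurable M"
proof (rule borel_measurable_LIMSEQ_metric)
  show "(\<lambda>s. proj N (f s)) \<in> borel_measurable M" for N unfolding proj_def by measurable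
qed (rule proj_tendsto)

text \<open>The summable majorant does not depend on \<open>t\<close>, so the projections converge
  uniformly on \<open>S\<close>: the squared tail at any \<open>t\<close> is at most the tail of
  \<open>M\<close>.\<close>

lemma continuous_coords:
  fixes f :: "'t::topological_space \<Rightarrow> 'h"
  assumes c: "\<And>k. continuous_on S (\<lambda>t. inner (f t) (e k))"
    and M: "summable M" "\<And>k t. t \<in> S \<Longrightarrow> (inner (f t) (e k))\<^sup>2 \<le> M k"
  shows "continuous_on S f"
proof (cases "S = {}")
  case False
  then obtain t0 where t0: "t0 \<in> S" by blast
  have M0: "0 \<le> M k" for k using M(2)[OF t0, of k] by (meson order_trans zero_le_power2)
  show ?thesis
  proof (rule uniform_limit_theorem)
    show "\<forall>\<^sub>F N in sequentially. continuous_on S (\<lambda>t. proj N (f t))"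
      unfolding proj_def by (intro always_eventually allI continuous_intros c)
    show "uniform_limit S (\<lambda>N t. proj N (f t)) f sequentially"
    proof (rule uniform_limitI)
      fix \<epsilon> :: real assume "\<epsilon> > 0"
      have "(\<lambda>N. \<Sum>k<N. M k) \<longlonglongrightarrow> suminf M" using M(1) by (rule summable_LIMSEQ)
      from LIMSEQ_D[OF this, of "\<epsilon>\<^sup>2"] \<open>\<epsilon> > 0\<close> obtain N0
        where N0: "\<And>N. N \<ge> N0 \<Longrightarrow> norm ((\<Sum>k<N. M k) - suminf M) < \<epsilon>\<^sup>2" by auto
      have "dist (proj N (f t)) (f t) < \<epsilon>" if "N \<ge> N0" "t \<in> S" for N t
      proof -
        have sm: "summable (\<lambda>k. M k - (inner (f t) (e k))\<^sup>2)"
          by (intro summable_diff M coord_summable)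
        have "(\<Sum>k<N. M k - (inner (f t) (e k))\<^sup>2) \<le> (\<Sum>k. M k - (inner (f t) (e k))\<^sup>2)"
          by (rule sum_le_suminf[OF sm]) (use M(2) that in auto)
        then have "(norm (f t - proj N (f t)))\<^sup>2 \<le> suminf M - (\<Sum>k<N. M k)"
          by (simp add: norm_diff_proj norm_sq_suminf[of "f t"] suminf_diff[OF M(1) coord_summable, symmetric] sum_subtractf)
        also have "\<dots> < \<epsilon>\<^sup>2" using N0[OF that(1)] by simp
        finally show ?thesis using \<open>\<epsilon> > 0\<close> by (simp add: power2_less_imp_less dist_norm norm_minus_commute)
      qed
      then show "\<forall>\<^sub>F N in sequentially. \<forall>t\<in>S. dist (proj N (f t)) (f t) < \<epsilon>"
        unfolding eventually_sequentially by blast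
    qed
  qed simp
qed simp

text \<open>Sum and time integral are exchanged by dominated convergence for the partial sums
  \<open>inner (proj N (f s)) (g s)\<close>, which stay below
  \<open>(norm (f s))\<^sup>2 + (norm (g s))\<^sup>2\<close>.\<close>

lemma L2on_parseval:
  assumes f: "L2on T f" and g: "L2on T g"
  shows "(\<lambda>k. \<integral>s. inner (f s) (e k) * inner (g s) (e k) \<partial>lebesgue_on {0..T})
    sums (\<integral>s. inner (f s) (g s) \<partial>lebesgue_on {0..T})"
proof -
  have fk: "L2on T (\<lambda>s. inner (f s) (e k))" and gk: "L2on T (\<lambda>s. inner (g s) (e k))" for k
    using f g by (auto intro: L2on_inner_const)
  have i: "integrable (lebesgue_on {0..T}) (\<lambda>s. inner (f s) (e k) * inner (g s) (e k))" for k
    by (rule L2on_mult[OF fk gk])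
  have "(\<lambda>N. \<integral>s. inner (proj N (f s)) (g s) \<partial>lebesgue_on {0..T})
    \<longlonglongrightarrow> (\<integral>s. inner (f s) (g s) \<partial>lebesgue_on {0..T})"
  proof (rule integral_dominated_convergence[where w = "\<lambda>s. (norm (f s))\<^sup>2 + (norm (g s))\<^sup>2"])
    show "integrable (lebesgue_on {0..T}) (\<lambda>s. (norm (f s))\<^sup>2 + (norm (g s))\<^sup>2)"
      using f g by (simp add: L2on_def)
    show "(\<lambda>s. inner (f s) (g s)) \<in> borel_measurable (lebesgue_on {0..T})"
      using L2on_inner[OF f g] by simp
    show "(\<lambda>s. inner (proj N (f s)) (g s)) \<in> borel_measurable (lebesgue_on {0..T})" for N
      unfolding inner_proj using i by (intro borel_measurable_sum) auto
    show "AE s in lebesgue_on {0..T}. (\<lambda>N. inner (proj N (f s)) (g s)) \<longlonglongrightarrow> inner (f s) (g s)"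
      by (intro AE_I2 tendsto_intros proj_tendsto)
    have "norm (inner (proj N x) y) \<le> (norm x)\<^sup>2 + (norm y)\<^sup>2" for N x y
    proof -
      have "norm (proj N x) \<le> norm x"
        by (rule power2_le_imp_le) (auto simp: norm_proj bessel)
      then have "norm (inner (proj N x) y) \<le> norm x * norm y"
        using Cauchy_Schwarz_ineq2[of "proj N x" y]
        by (metis mult_right_mono norm_ge_zero order_trans real_norm_def)
      moreover have "2 * (norm x * norm y) \<le> (norm x)\<^sup>2 + (norm y)\<^sup>2"
        using sum_squares_bound[of "norm x" "norm y"] by simp
      moreover have "0 \<le> norm x * norm y" by simp
      ultimately show ?thesis by linarith
    qed
    then show "AE s in lebesgue_on {0..T}. norm (inner (proj N (f s)) (g s)) \<le> (norm (f s))\<^sup>2 + (norm (g s))\<^sup>2" for N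
      by simp
  qed
  then show ?thesis unfolding sums_def inner_proj using i by simp
qed

text \<open>The extended sum \<open>E\<close> of the squared coordinates has finite integral, hence
  is finite almost everywhere; at the exceptional times the path is set to 0. The last conclusion
  fixes the value at each time with square-summable coordinates, which is how velocities at single
  times keep a meaning for \<open>\<mu> \<noteq> 0\<close>.\<close>

lemma L2on_riesz_fischer:
  assumes c: "\<And>k. L2on T (c k)"
    and B: "\<And>N. (\<Sum>k<N. \<integral>s. (c k s)\<^sup>2 \<partial>lebesgue_on {0..T}) \<le> B"
  obtains f where "L2on T f" "\<And>k. AE s in lebesgue_on {0..T}. inner (f s) (e k) = c k s"
    "\<And>s k. summable (\<lambda>k. (c k s)\<^sup>2) \<Longrightarrow> inner (f s) (e k) = c k s"
proof -
  let ?M = "lebesgue_on {0..T}"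
  define E where "E s = (\<Sum>k. ennreal ((c k s)\<^sup>2))" for s
  have cm[measurable]: "c k \<in> borel_measurable ?M" for k using c by (simp add: L2on_def)
  have c2: "integrable ?M (\<lambda>s. (c k s)\<^sup>2)" for k using c[of k] by (simp add: L2on_def)
  have Em[measurable]: "E \<in> borel_measurable ?M" unfolding E_def by measurable
  have E: "(\<integral>\<^sup>+s. E s \<partial>?M) \<le> ennreal B"
  proof -
    have "(\<integral>\<^sup>+s. E s \<partial>?M) = (\<Sum>k. \<integral>\<^sup>+s. ennreal ((c k s)\<^sup>2) \<partial>?M)"
      unfolding E_def by (rule nn_integral_suminf) measurable
    also have "\<dots> = (\<Sum>k. ennreal (\<integral>s. (c k s)\<^sup>2 \<partial>?M))"
      by (intro arg_cong[where f = suminf] ext nn_integral_eq_integral c2) simp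
    also have "\<dots> \<le> ennreal B"
    proof (rule suminf_le_const)
      fix N
      have "(\<Sum>k<N. ennreal (\<integral>s. (c k s)\<^sup>2 \<partial>?M)) = ennreal (\<Sum>k<N. \<integral>s. (c k s)\<^sup>2 \<partial>?M)"
        by (rule sum_ennreal) simp
      also have "\<dots> \<le> ennreal B" by (intro ennreal_leI B)
      finally show "(\<Sum>k<N. ennreal (\<integral>s. (c k s)\<^sup>2 \<partial>?M)) \<le> ennreal B" .
    qed simp
    finally show ?thesis .
  qed
  have sE: "summable (\<lambda>k. (c k s)\<^sup>2) \<longleftrightarrow> E s \<noteq> \<infinity>" for s
  proof
    assume "summable (\<lambda>k. (c k s)\<^sup>2)"
    then show "E s \<noteq> \<infinity>" unfolding E_def by (subst suminf_ennreal2) auto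
  next
    assume "E s \<noteq> \<infinity>"
    then show "summable (\<lambda>k. (c k s)\<^sup>2)"
      unfolding E_def by (intro summable_suminf_not_top) auto
  qed
  define f where "f s = (if E s = \<infinity> then 0 else vec (\<lambda>k. c k s))" for s
  have fc: "inner (f s) (e k) = (if E s = \<infinity> then 0 else c k s)" for s k
    using vec_coord[of "\<lambda>k. c k s"] sE by (simp add: f_def)
  have fm[measurable]: "f \<in> borel_measurable ?M"
    by (rule measurable_coords) (unfold fc, measurable)
  have "(\<integral>\<^sup>+s. (norm (f s))\<^sup>2 \<partial>?M) \<le> (\<integral>\<^sup>+s. E s \<partial>?M)"
  proof (rule nn_integral_mono)
    fix s
    show "ennreal ((norm (f s))\<^sup>2) \<le> E s"
    proof (cases "E s = \<infinity>")
      case False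
      then have s: "summable (\<lambda>k. (c k s)\<^sup>2)" by (simp add: sE)
      then have "(norm (f s))\<^sup>2 = (\<Sum>k. (c k s)\<^sup>2)" using False by (simp add: f_def norm_vec)
      then show ?thesis unfolding E_def using s by (simp add: suminf_ennreal2)
    qed simp
  qed
  also have "\<dots> < \<infinity>" using E by (rule le_less_trans) simp
  finally have "integrable ?M (\<lambda>s. (norm (f s))\<^sup>2)" by (intro integrableI_bounded) auto
  then have L: "L2on T f" by (simp add: L2on_def)
  have "AE s in ?M. E s \<noteq> \<infinity>"
    using E by (intro nn_integral_noteq_infinite) (auto simp: top_unique)
  then have "AE s in ?M. inner (f s) (e k) = c k s" for k by eventually_elim (simp add: fc)
  with L show thesis using fc sE by (intro that[of f]) auto
qed

end

section \<open>A single damped mode\<close>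

lemma integral_derivative_lebesgue_on:
  fixes F f :: "real \<Rightarrow> real"
  assumes "a \<le> b" "\<And>t. (F has_real_derivative f t) (at t)" "continuous_on UNIV f"
  shows "(\<integral>s. f s \<partial>lebesgue_on {a..b}) = F b - F a"
proof -
  have "(f has_integral F b - F a) {a..b}"
    using assms by (intro fundamental_theorem_of_calculus)
      (auto simp: has_real_derivative_iff_has_vector_derivative[symmetric] intro: has_field_derivative_at_within)
  moreover have "integrable (lebesgue_on {a..b}) f"
    by (rule integrable_continuous_lebesgue_on) (rule continuous_on_subset[OF assms(3)], simp)
  ultimately show ?thesis by (simp add: lebesgue_integral_eq_integral integral_unique)
qed

lemma L2on_cong:
  assumes "L2on T f" "\<And>s. s \<in> {0..T} \<Longrightarrow> f s = f' s"
  shows "L2on T f'"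
proof -
  have "integrable (lebesgue_on {0..T}) (\<lambda>s. (norm (f' s))\<^sup>2)
      \<longleftrightarrow> integrable (lebesgue_on {0..T}) (\<lambda>s. (norm (f s))\<^sup>2)"
    by (intro Bochner_Integration.integrable_cong) (auto simp: assms(2))
  then show ?thesis using assms measurable_lebesgue_cong[of "{0..T}" f f' borel] by (simp add: L2on_def)
qed

lemma integral_lebesgue_on_cong:
  "(\<And>s. s \<in> S \<Longrightarrow> f s = g s) \<Longrightarrow> (\<integral>s. f s \<partial>lebesgue_on S) = (\<integral>s. g s \<partial>lebesgue_on S)"
  by (intro Bochner_Integration.integral_cong) auto

lemma AE_lebesgue_on_sub:
  assumes "AE s in lebesgue_on {0..T::real}. P s" "t \<le> T"
  shows "AE s in lebesgue_on {0..t}. P s"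
proof -
  have "AE s in lebesgue. s \<in> {0..T} \<longrightarrow> P s" using assms(1) by (subst (asm) AE_restrict_space_iff) auto
  then have "AE s in lebesgue. s \<in> {0..t} \<longrightarrow> P s" by eventually_elim (use assms(2) in auto)
  then show ?thesis by (subst AE_restrict_space_iff) auto
qed

lemma L2on_zero_AE:
  fixes f :: "real \<Rightarrow> real"
  assumes "L2on T f"
  shows "(\<integral>s. (f s)\<^sup>2 \<partial>lebesgue_on {0..T}) = 0 \<longleftrightarrow> (AE s in lebesgue_on {0..T}. f s = 0)"
  using assms integral_nonneg_eq_0_iff_AE[of "lebesgue_on {0..T}" "\<lambda>s. (f s)\<^sup>2"]
  by (simp add: L2on_def)

text \<open>The equation \<open>\<mu> p'' + p' + a p = g\<close> in integrated form with \<open>q = p'\<close>. The case \<open>\<mu> = 0\<close> is the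
  heat equation, where \<open>q\<close> is only defined almost everywhere.\<close>

definition mode ::
  "real \<Rightarrow> real \<Rightarrow> real \<Rightarrow> (real \<Rightarrow> real) \<Rightarrow> (real \<Rightarrow> real) \<Rightarrow> (real \<Rightarrow> real) \<Rightarrow> bool" where
  "mode \<mu> a T p q g \<longleftrightarrow> L2on T q \<and> L2on T g \<and>
     (\<forall>t\<in>{0..T}. p t = p 0 + (\<integral>s. q s \<partial>lebesgue_on {0..t})) \<and>
     (\<forall>t\<in>{0..T}. \<mu> * q t = \<mu> * q 0 + (\<integral>s. g s - a * p s - q s \<partial>lebesgue_on {0..t})) \<and>
     (\<mu> = 0 \<longrightarrow> (\<integral>s. (g s - a * p s - q s)\<^sup>2 \<partial>lebesgue_on {0..T}) = 0)"

lemma modeD: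
  assumes "mode \<mu> a T p q g"
  shows "L2on T q" "L2on T g"
    "t \<in> {0..T} \<Longrightarrow> p t = p 0 + (\<integral>s. q s \<partial>lebesgue_on {0..t})"
    "t \<in> {0..T} \<Longrightarrow> \<mu> * q t = \<mu> * q 0 + (\<integral>s. g s - a * p s - q s \<partial>lebesgue_on {0..t})"
    "\<mu> = 0 \<Longrightarrow> (\<integral>s. (g s - a * p s - q s)\<^sup>2 \<partial>lebesgue_on {0..T}) = 0"
  using assms unfolding mode_def by blast+

section \<open>Identities and a priori bounds for one mode\<close>

lemma modeI:
  assumes "L2on T q" "L2on T g"
    "\<And>t. t \<in> {0..T} \<Longrightarrow> p t = p 0 + (\<integral>s. q s \<partial>lebesgue_on {0..t})"
    "\<And>t. t \<in> {0..T} \<Longrightarrow> \<mu> * q t = \<mu> * q 0 + (\<integral>s. g s - a * p s - q s \<partial>lebesgue_on {0..t})"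
    "\<mu> = 0 \<Longrightarrow> (\<integral>s. (g s - a * p s - q s)\<^sup>2 \<partial>lebesgue_on {0..T}) = 0"
  shows "mode \<mu> a T p q g"
  using assms unfolding mode_def by blast

lemma mode_continuous:
  assumes "mode \<mu> a T p q g" shows "continuous_on {0..T} p"
proof -
  have "continuous_on {0..T} (\<lambda>t. p 0 + (\<integral>s. q s \<partial>lebesgue_on {0..t}))"
    by (intro continuous_intros indefinite_integral_continuous_real L2on_integrable modeD(1)[OF assms])
  then show ?thesis
    by (rule continuous_on_eq) (rule modeD(3)[OF assms, symmetric])
qed

lemma mode_L2:
  assumes "mode \<mu> a T p q g"
  shows "L2on T p" "L2on T q" "L2on T g" "L2on T (\<lambda>s. g s - a * p s - q s)"
    "L2on T (\<lambda>s. g s - q s)" "L2on T (\<lambda>s. g s - a * p s)"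
proof -
  show p: "L2on T p" by (rule L2on_continuous[OF mode_continuous[OF assms]])
  show q: "L2on T q" and g: "L2on T g" by (rule modeD[OF assms])+
  show "L2on T (\<lambda>s. g s - a * p s - q s)" "L2on T (\<lambda>s. g s - q s)" "L2on T (\<lambda>s. g s - a * p s)"
    by (intro L2on_diff L2on_cmult p q g)+
qed

lemma mode_continuous_velocity:
  assumes "mode \<mu> a T p q g" "\<mu> \<noteq> 0" shows "continuous_on {0..T} q"
proof -
  have "continuous_on {0..T} (\<lambda>t. (\<mu> * q 0 + (\<integral>s. g s - a * p s - q s \<partial>lebesgue_on {0..t})) / \<mu>)"
    using assms(2) by (auto intro!: continuous_intros indefinite_integral_continuous_real L2on_integrable mode_L2(4)[OF assms(1)])
  then show ?thesis
  proof (rule continuous_on_eq)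
    fix t assume "t \<in> {0..T}"
    then have *: "\<mu> * q t = \<mu> * q 0 + (\<integral>s. g s - a * p s - q s \<partial>lebesgue_on {0..t})"
      using modeD[OF assms(1)] by blast
    show "(\<mu> * q 0 + (\<integral>s. g s - a * p s - q s \<partial>lebesgue_on {0..t})) / \<mu> = q t"
      unfolding *[symmetric] using assms(2) by simp
  qed
qed

lemma mode_heat_AE:
  assumes "mode 0 a T p q g" shows "AE s in lebesgue_on {0..T}. q s = g s - a * p s"
proof -
  have "AE s in lebesgue_on {0..T}. g s - a * p s - q s = 0"
    using L2on_zero_AE[OF mode_L2(4)[OF assms]] modeD(5)[OF assms] by simp
  then show ?thesis by eventually_elim simp
qed

text \<open>Product rule for \<open>p * p\<close>, \<open>q * q\<close> and \<open>q * p\<close>.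
  The last two differentiate the velocity, which the equation presents as a primitive only for
  \<open>\<mu> \<noteq> 0\<close>.\<close>

lemma mode_primitives:
  assumes m: "mode \<mu> a T p q g" and t: "t \<in> {0..T}"
  shows "(p t)\<^sup>2 = (p 0)\<^sup>2 + (\<integral>s. 2 * (p s * q s) \<partial>lebesgue_on {0..t})"
    and "\<mu> \<noteq> 0 \<Longrightarrow> \<mu> * (q t)\<^sup>2 = \<mu> * (q 0)\<^sup>2 + (\<integral>s. 2 * ((g s - a * p s - q s) * q s) \<partial>lebesgue_on {0..t})"
    and "\<mu> \<noteq> 0 \<Longrightarrow> \<mu> * (q t * p t) = \<mu> * (q 0 * p 0)
      + (\<integral>s. \<mu> * (q s)\<^sup>2 + (g s - a * p s - q s) * p s \<partial>lebesgue_on {0..t})"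
proof -
  note L = mode_L2[OF m]
  have p: "p t = p 0 + (\<integral>s. q s \<partial>lebesgue_on {0..t})" if "t \<in> {0..T}" for t
    using modeD[OF m] that by blast
  show "(p t)\<^sup>2 = (p 0)\<^sup>2 + (\<integral>s. 2 * (p s * q s) \<partial>lebesgue_on {0..t})"
    using product_rule_L2[OF L(2) L(2) p p t] by (simp add: power2_eq_square mult.commute)
  assume \<mu>: "\<mu> \<noteq> 0"
  \<comment> \<open>The acceleration, solved for from the equation.\<close>
  define w where "w s = (g s - a * p s - q s) / \<mu>" for s
  have w: "L2on T w" unfolding w_def using L2on_cmult[OF L(4), of "1 / \<mu>"] by simp
  have q: "q t = q 0 + (\<integral>s. w s \<partial>lebesgue_on {0..t})" if "t \<in> {0..T}" for t
  proof -
    have "\<mu> * q t = \<mu> * q 0 + (\<integral>s. g s - a * p s - q s \<partial>lebesgue_on {0..t})"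
      using modeD[OF m] that by blast
    also have "(\<integral>s. g s - a * p s - q s \<partial>lebesgue_on {0..t}) = \<mu> * (\<integral>s. w s \<partial>lebesgue_on {0..t})"
      using \<mu> by (simp add: w_def)
    finally have "\<mu> * q t = \<mu> * (q 0 + (\<integral>s. w s \<partial>lebesgue_on {0..t}))" by (simp only: distrib_left)
    then show ?thesis using \<mu> mult_left_cancel by blast
  qed
  have "q t * q t = q 0 * q 0 + (\<integral>s. q s * w s + w s * q s \<partial>lebesgue_on {0..t})"
    by (rule product_rule_L2[OF w w q q t])
  then have "\<mu> * (q t)\<^sup>2 = \<mu> * (q 0)\<^sup>2 + \<mu> * (\<integral>s. q s * w s + w s * q s \<partial>lebesgue_on {0..t})"
    by (simp add: power2_eq_square distrib_left)
  also have "\<mu> * (\<integral>s. q s * w s + w s * q s \<partial>lebesgue_on {0..t})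
      = (\<integral>s. \<mu> * (q s * w s + w s * q s) \<partial>lebesgue_on {0..t})" by simp
  also have "\<dots> = (\<integral>s. 2 * ((g s - a * p s - q s) * q s) \<partial>lebesgue_on {0..t})"
    by (intro integral_lebesgue_on_cong) (use \<mu> in \<open>simp add: w_def field_simps\<close>)
  finally show "\<mu> * (q t)\<^sup>2 = \<mu> * (q 0)\<^sup>2 + (\<integral>s. 2 * ((g s - a * p s - q s) * q s) \<partial>lebesgue_on {0..t})" .
  have "q t * p t = q 0 * p 0 + (\<integral>s. q s * q s + w s * p s \<partial>lebesgue_on {0..t})"
    by (rule product_rule_L2[OF w L(2) q p t])
  then have "\<mu> * (q t * p t) = \<mu> * (q 0 * p 0) + \<mu> * (\<integral>s. q s * q s + w s * p s \<partial>lebesgue_on {0..t})"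
    by (simp add: distrib_left)
  also have "\<mu> * (\<integral>s. q s * q s + w s * p s \<partial>lebesgue_on {0..t})
      = (\<integral>s. \<mu> * (q s * q s + w s * p s) \<partial>lebesgue_on {0..t})" by simp
  also have "\<dots> = (\<integral>s. \<mu> * (q s)\<^sup>2 + (g s - a * p s - q s) * p s \<partial>lebesgue_on {0..t})"
    by (intro integral_lebesgue_on_cong) (use \<mu> in \<open>simp add: w_def field_simps power2_eq_square\<close>)
  finally show "\<mu> * (q t * p t) = \<mu> * (q 0 * p 0)
      + (\<integral>s. \<mu> * (q s)\<^sup>2 + (g s - a * p s - q s) * p s \<partial>lebesgue_on {0..t})" .
qed

text \<open>The equation is multiplied by twice the velocity. For \<open>\<mu> = 0\<close> the
  kinetic term is absent and \<open>a * p s\<close> is replaced by \<open>g s - q s\<close> for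
  almost every \<open>s\<close>.\<close>

lemma mode_energy:
  assumes m: "mode \<mu> a T p q g" and t: "t \<in> {0..T}"
  shows "a * (p t)\<^sup>2 + \<mu> * (q t)\<^sup>2 = a * (p 0)\<^sup>2 + \<mu> * (q 0)\<^sup>2
    + 2 * (\<integral>s. (g s - q s) * q s \<partial>lebesgue_on {0..t})"
proof -
  note L = mode_L2[OF m, THEN L2on_sub, of t]
  have e: "a * (p t)\<^sup>2 = a * (p 0)\<^sup>2 + (\<integral>s. a * (2 * (p s * q s)) \<partial>lebesgue_on {0..t})"
    using mode_primitives(1)[OF m t] by (simp add: distrib_left)
  show ?thesis
  proof (cases "\<mu> = 0")
    case True
    have "AE s in lebesgue_on {0..t}. a * (2 * (p s * q s)) = 2 * ((g s - q s) * q s)"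
      using AE_lebesgue_on_sub[OF mode_heat_AE[OF m[unfolded True]], of t] t
      by (auto elim!: eventually_mono)
    then have "(\<integral>s. a * (2 * (p s * q s)) \<partial>lebesgue_on {0..t}) = (\<integral>s. 2 * ((g s - q s) * q s) \<partial>lebesgue_on {0..t})"
      using L t by (intro integral_cong_AE) (auto simp: L2on_def)
    then show ?thesis using e True by simp
  next
    case False
    have i1: "integrable (lebesgue_on {0..t}) (\<lambda>s. a * (2 * (p s * q s)))"
      using L2on_mult[OF L(1,2)] t by auto
    have i2: "integrable (lebesgue_on {0..t}) (\<lambda>s. 2 * ((g s - a * p s - q s) * q s))"
      using L2on_mult[OF L(4,2)] t by (intro integrable_mult_right) auto
    have "(\<integral>s. a * (2 * (p s * q s)) \<partial>lebesgue_on {0..t}) + (\<integral>s. 2 * ((g s - a * p s - q s) * q s) \<partial>lebesgue_on {0..t})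
      = (\<integral>s. 2 * ((g s - q s) * q s) \<partial>lebesgue_on {0..t})"
      using i1 i2 by (subst Bochner_Integration.integral_add[symmetric])
        (auto intro!: integral_lebesgue_on_cong simp: algebra_simps)
    then show ?thesis using e mode_primitives(2)[OF m t False] by simp
  qed
qed

text \<open>The equation is multiplied by the position instead of the velocity. This produces the
  time integral of \<open>a * (p s)\<^sup>2\<close>, on which the energy identity says
  nothing.\<close>

lemma mode_virial:
  assumes m: "mode \<mu> a T p q g" and t: "t \<in> {0..T}"
  shows "\<mu> * (q t * p t) + (p t)\<^sup>2 / 2 = \<mu> * (q 0 * p 0) + (p 0)\<^sup>2 / 2
    + (\<integral>s. \<mu> * (q s)\<^sup>2 + p s * g s \<partial>lebesgue_on {0..t}) - (\<integral>s. a * (p s)\<^sup>2 \<partial>lebesgue_on {0..t})"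
proof -
  note L = mode_L2[OF m, THEN L2on_sub, of t]
  have e: "(p t)\<^sup>2 / 2 = (p 0)\<^sup>2 / 2 + (\<integral>s. p s * q s \<partial>lebesgue_on {0..t})"
    using mode_primitives(1)[OF m t] by simp
  have i0: "integrable (lebesgue_on {0..t}) (\<lambda>s. p s * q s)" "integrable (lebesgue_on {0..t}) (\<lambda>s. p s * g s)"
    "integrable (lebesgue_on {0..t}) (\<lambda>s. (p s)\<^sup>2)" "integrable (lebesgue_on {0..t}) (\<lambda>s. (q s)\<^sup>2)"
    "integrable (lebesgue_on {0..t}) (\<lambda>s. (g s - a * p s - q s) * p s)"
    using L2on_mult[OF L(1,2)] L2on_mult[OF L(1,3)] L(1,2) L2on_mult[OF L(4,1)] t by (auto simp: L2on_def)
  show ?thesis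
  proof (cases "\<mu> = 0")
    case True
    have "AE s in lebesgue_on {0..t}. p s * q s = p s * g s - a * (p s)\<^sup>2"
      using AE_lebesgue_on_sub[OF mode_heat_AE[OF m[unfolded True]], of t] t
      by (auto elim!: eventually_mono simp: right_diff_distrib' power2_eq_square simp del: diff_eq_eq eq_diff_eq)
    then have "(\<integral>s. p s * q s \<partial>lebesgue_on {0..t}) = (\<integral>s. p s * g s - a * (p s)\<^sup>2 \<partial>lebesgue_on {0..t})"
      using i0 by (intro integral_cong_AE) auto
    then show ?thesis using e True i0 by simp
  next
    case False
    have "(\<integral>s. \<mu> * (q s)\<^sup>2 + (g s - a * p s - q s) * p s \<partial>lebesgue_on {0..t}) + (\<integral>s. p s * q s \<partial>lebesgue_on {0..t})
      = (\<integral>s. (\<mu> * (q s)\<^sup>2 + (g s - a * p s - q s) * p s) + p s * q s \<partial>lebesgue_on {0..t})"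
      using i0 by (intro Bochner_Integration.integral_add[symmetric]) auto
    also have "\<dots> = (\<integral>s. (\<mu> * (q s)\<^sup>2 + p s * g s) - a * (p s)\<^sup>2 \<partial>lebesgue_on {0..t})"
      by (intro integral_lebesgue_on_cong) (simp add: algebra_simps power2_eq_square)
    also have "\<dots> = (\<integral>s. \<mu> * (q s)\<^sup>2 + p s * g s \<partial>lebesgue_on {0..t}) - (\<integral>s. a * (p s)\<^sup>2 \<partial>lebesgue_on {0..t})"
      using i0 by (intro Bochner_Integration.integral_diff) auto
    finally show ?thesis using e mode_primitives(3)[OF m t False] by linarith
  qed
qed

text \<open>Energy identity together with \<open>0 \<le> (g s - q s)\<^sup>2\<close>. No constant
  depends on \<open>a\<close>, so the bound can be summed over all modes.\<close>

lemma mode_bound: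
  assumes m: "mode \<mu> a T p q g" and t: "t \<in> {0..T}"
  shows "a * (p t)\<^sup>2 + \<mu> * (q t)\<^sup>2 + (\<integral>s. (q s)\<^sup>2 \<partial>lebesgue_on {0..t})
    \<le> a * (p 0)\<^sup>2 + \<mu> * (q 0)\<^sup>2 + (\<integral>s. (g s)\<^sup>2 \<partial>lebesgue_on {0..t})"
proof -
  note L = mode_L2[OF m, THEN L2on_sub, of t]
  have i: "integrable (lebesgue_on {0..t}) (\<lambda>s. (q s)\<^sup>2)" "integrable (lebesgue_on {0..t}) (\<lambda>s. (g s)\<^sup>2)"
    "integrable (lebesgue_on {0..t}) (\<lambda>s. (g s - q s) * q s)"
    using L L2on_mult[OF L(5,2)] t by (auto simp: L2on_def)
  have "2 * (\<integral>s. (g s - q s) * q s \<partial>lebesgue_on {0..t}) + (\<integral>s. (q s)\<^sup>2 \<partial>lebesgue_on {0..t})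
    = (\<integral>s. 2 * ((g s - q s) * q s) + (q s)\<^sup>2 \<partial>lebesgue_on {0..t})" using i by simp
  also have "\<dots> \<le> (\<integral>s. (g s)\<^sup>2 \<partial>lebesgue_on {0..t})"
  proof (rule integral_mono)
    fix s show "2 * ((g s - q s) * q s) + (q s)\<^sup>2 \<le> (g s)\<^sup>2"
      using zero_le_power2[of "g s - q s"] by (simp add: power2_eq_square algebra_simps)
  qed (use i in auto)
  finally show ?thesis using mode_energy[OF m t] by simp
qed

lemma mode_add:
  assumes m1: "mode \<mu> a T p1 q1 g1" and m2: "mode \<mu> a T p2 q2 g2"
  shows "mode \<mu> a T (\<lambda>s. p1 s + c * p2 s) (\<lambda>s. q1 s + c * q2 s) (\<lambda>s. g1 s + c * g2 s)"
proof (rule modeI)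
  note L1 = mode_L2[OF m1] and L2 = mode_L2[OF m2]
  show "L2on T (\<lambda>s. q1 s + c * q2 s)" "L2on T (\<lambda>s. g1 s + c * g2 s)"
    by (intro L2on_add L2on_cmult L1 L2)+
  fix t assume t: "t \<in> {0..T}"
  have i: "integrable (lebesgue_on {0..t}) q1" "integrable (lebesgue_on {0..t}) q2"
    "integrable (lebesgue_on {0..t}) (\<lambda>s. g1 s - a * p1 s - q1 s)"
    "integrable (lebesgue_on {0..t}) (\<lambda>s. g2 s - a * p2 s - q2 s)"
    using t by (auto intro!: L2on_integrable L2on_sub[OF L1(2)] L2on_sub[OF L2(2)] L2on_sub[OF L1(4)] L2on_sub[OF L2(4)])
  have e: "p1 t = p1 0 + (\<integral>s. q1 s \<partial>lebesgue_on {0..t})" "p2 t = p2 0 + (\<integral>s. q2 s \<partial>lebesgue_on {0..t})"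
    "\<mu> * q1 t = \<mu> * q1 0 + (\<integral>s. g1 s - a * p1 s - q1 s \<partial>lebesgue_on {0..t})"
    "\<mu> * q2 t = \<mu> * q2 0 + (\<integral>s. g2 s - a * p2 s - q2 s \<partial>lebesgue_on {0..t})"
    using modeD[OF m1] modeD[OF m2] t by blast+
  have "(\<integral>s. q1 s + c * q2 s \<partial>lebesgue_on {0..t}) = (\<integral>s. q1 s \<partial>lebesgue_on {0..t}) + c * (\<integral>s. q2 s \<partial>lebesgue_on {0..t})"
    using i by simp
  then show "p1 t + c * p2 t = p1 0 + c * p2 0 + (\<integral>s. q1 s + c * q2 s \<partial>lebesgue_on {0..t})"
    unfolding e(1,2) by (simp add: distrib_left)
  have "(\<integral>s. g1 s + c * g2 s - a * (p1 s + c * p2 s) - (q1 s + c * q2 s) \<partial>lebesgue_on {0..t})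
    = (\<integral>s. (g1 s - a * p1 s - q1 s) + c * (g2 s - a * p2 s - q2 s) \<partial>lebesgue_on {0..t})"
    by (intro integral_lebesgue_on_cong) (simp add: algebra_simps)
  also have "\<dots> = (\<integral>s. g1 s - a * p1 s - q1 s \<partial>lebesgue_on {0..t}) + c * (\<integral>s. g2 s - a * p2 s - q2 s \<partial>lebesgue_on {0..t})"
    using i by (subst Bochner_Integration.integral_add) auto
  finally have "(\<integral>s. g1 s + c * g2 s - a * (p1 s + c * p2 s) - (q1 s + c * q2 s) \<partial>lebesgue_on {0..t}) = \<dots>" .
  moreover have "\<mu> * (q1 t + c * q2 t) = \<mu> * q1 t + c * (\<mu> * q2 t)" by (simp add: algebra_simps)
  ultimately show "\<mu> * (q1 t + c * q2 t) = \<mu> * (q1 0 + c * q2 0)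
      + (\<integral>s. g1 s + c * g2 s - a * (p1 s + c * p2 s) - (q1 s + c * q2 s) \<partial>lebesgue_on {0..t})"
    unfolding e(3,4) by (simp add: algebra_simps)
next
  assume "\<mu> = 0"
  have "L2on T (\<lambda>s. g1 s + c * g2 s - a * (p1 s + c * p2 s) - (q1 s + c * q2 s))"
    by (intro L2on_add L2on_diff L2on_cmult mode_L2(1,2,3)[OF m1] mode_L2(1,2,3)[OF m2])
  moreover have "AE s in lebesgue_on {0..T}. q1 s = g1 s - a * p1 s" "AE s in lebesgue_on {0..T}. q2 s = g2 s - a * p2 s"
    using mode_heat_AE m1 m2 \<open>\<mu> = 0\<close> by blast+
  then have "AE s in lebesgue_on {0..T}. g1 s + c * g2 s - a * (p1 s + c * p2 s) - (q1 s + c * q2 s) = 0"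
    by eventually_elim algebra
  ultimately show "(\<integral>s. (g1 s + c * g2 s - a * (p1 s + c * p2 s) - (q1 s + c * q2 s))\<^sup>2 \<partial>lebesgue_on {0..T}) = 0"
    using L2on_zero_AE by blast
qed

text \<open>The difference has zero forcing and zero initial energy. For \<open>\<mu> = 0\<close>
  the velocity at a single time carries no information and is left free.\<close>

lemma mode_unique:
  assumes m1: "mode \<mu> a T p1 q1 g" and m2: "mode \<mu> a T p2 q2 g" and a: "a > 0" "\<mu> \<ge> 0"
    and init: "p1 0 = p2 0" "\<mu> \<noteq> 0 \<Longrightarrow> q1 0 = q2 0" and t: "t \<in> {0..T}"
  shows "p1 t = p2 t" "\<mu> \<noteq> 0 \<Longrightarrow> q1 t = q2 t"
proof -
  have "mode \<mu> a T (\<lambda>s. p1 s - p2 s) (\<lambda>s. q1 s - q2 s) (\<lambda>s. 0)"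
    using mode_add[OF m1 m2, of "-1"] by simp
  from mode_bound[OF this t] have "a * (p1 t - p2 t)\<^sup>2 + \<mu> * (q1 t - q2 t)\<^sup>2
      + (\<integral>s. (q1 s - q2 s)\<^sup>2 \<partial>lebesgue_on {0..t}) \<le> \<mu> * (q1 0 - q2 0)\<^sup>2"
    unfolding init(1) by simp
  moreover have "\<mu> * (q1 0 - q2 0)\<^sup>2 = 0" using init by auto
  moreover have "0 \<le> (\<integral>s. (q1 s - q2 s)\<^sup>2 \<partial>lebesgue_on {0..t})" by simp
  moreover have "0 \<le> a * (p1 t - p2 t)\<^sup>2" "0 \<le> \<mu> * (q1 t - q2 t)\<^sup>2" using a by auto
  ultimately have "a * (p1 t - p2 t)\<^sup>2 = 0" "\<mu> * (q1 t - q2 t)\<^sup>2 = 0" by linarith+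
  then show "p1 t = p2 t" "\<mu> \<noteq> 0 \<Longrightarrow> q1 t = q2 t" using a by auto
qed

text \<open>The factor \<open>exp (- \<gamma> * t)\<close> with
  \<open>\<gamma> = 1 / (2 * \<mu>)\<close> removes the damping term and leaves
  \<open>sn'' = D * sn\<close>: hyperbolic, linear or trigonometric according to the sign of
  \<open>D\<close>, that is, overdamped, critical or underdamped.\<close>

lemma wave_kernel_exists:
  assumes "\<mu> > 0"
  shows "\<exists>\<beta> \<beta>' :: real \<Rightarrow> real. (\<forall>t. (\<beta> has_real_derivative \<beta>' t) (at t)) \<and>
    (\<forall>t. (\<beta>' has_real_derivative - (\<beta>' t + a * \<beta> t) / \<mu>) (at t)) \<and> \<beta> 0 = 0 \<and> \<beta>' 0 = 1"
proof -
  define \<gamma> D where "\<gamma> = 1 / (2 * \<mu>)" and "D = 1 / (4 * \<mu>\<^sup>2) - a / \<mu>"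
  have "\<exists>sn cs :: real \<Rightarrow> real. (\<forall>t. (sn has_real_derivative cs t) (at t)) \<and>
      (\<forall>t. (cs has_real_derivative D * sn t) (at t)) \<and> sn 0 = 0 \<and> cs 0 = 1"
  proof (cases "D = 0")
    case True
    then show ?thesis by (intro exI[of _ "\<lambda>t. t"] exI[of _ "\<lambda>t. 1"]) (auto intro!: derivative_eq_intros)
  next
    case D0: False
    define w where "w = sqrt \<bar>D\<bar>"
    have w: "w > 0" "w * w = \<bar>D\<bar>" using D0 by (auto simp: w_def)
    show ?thesis
    proof (cases "D > 0")
      case True
      then have "D = w * w" using w by simp
      then show ?thesis using w
        by (intro exI[of _ "\<lambda>t. sinh (w * t) / w"] exI[of _ "\<lambda>t. cosh (w * t)"])
          (auto intro!: derivative_eq_intros)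
    next
      case f: False
      then have "D = - (w * w)" using w by linarith
      then have "D * (x / w) = - (x * w)" for x using w(1) by (simp only:) (simp add: field_simps)
      then show ?thesis using w(1)
        by (intro exI[of _ "\<lambda>t. sin (w * t) / w"] exI[of _ "\<lambda>t. cos (w * t)"])
          (auto intro!: derivative_eq_intros)
    qed
  qed
  then obtain sn cs :: "real \<Rightarrow> real" where d: "\<And>t. (sn has_real_derivative cs t) (at t)"
    "\<And>t. (cs has_real_derivative D * sn t) (at t)" and i: "sn 0 = 0" "cs 0 = 1" by blast
  have D: "\<gamma> * \<gamma> + D = (\<gamma> - a) / \<mu>" "2 * \<gamma> = 1 / \<mu>"
    using assms by (auto simp: \<gamma>_def D_def field_simps power2_eq_square)
  have "((\<lambda>t. exp (- \<gamma> * t) * sn t) has_real_derivative exp (- \<gamma> * t) * (cs t - \<gamma> * sn t)) (at t)" for t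
    by (auto intro!: derivative_eq_intros d simp: algebra_simps)
  moreover have "((\<lambda>t. exp (- \<gamma> * t) * (cs t - \<gamma> * sn t)) has_real_derivative
     - (exp (- \<gamma> * t) * (cs t - \<gamma> * sn t) + a * (exp (- \<gamma> * t) * sn t)) / \<mu>) (at t)" for t
  proof -
    have "((\<lambda>t. exp (- \<gamma> * t) * (cs t - \<gamma> * sn t)) has_real_derivative
       exp (- \<gamma> * t) * ((\<gamma> * \<gamma> + D) * sn t - (2 * \<gamma>) * cs t)) (at t)"
      by (auto intro!: derivative_eq_intros d simp: algebra_simps)
    also have "exp (- \<gamma> * t) * ((\<gamma> * \<gamma> + D) * sn t - (2 * \<gamma>) * cs t)
      = - (exp (- \<gamma> * t) * (cs t - \<gamma> * sn t) + a * (exp (- \<gamma> * t) * sn t)) / \<mu>"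
      unfolding D using assms by (simp add: field_simps)
    finally show ?thesis .
  qed
  ultimately show ?thesis using i
    by (intro exI[of _ "\<lambda>t. exp (- \<gamma> * t) * sn t"] exI[of _ "\<lambda>t. exp (- \<gamma> * t) * (cs t - \<gamma> * sn t)"]) auto
qed

text \<open>The impulse response and its derivative, chosen as one pair; afterwards only the
  differential equation and the initial values are used, never the sign of the discriminant.\<close>

definition wave_kernel :: "real \<Rightarrow> real \<Rightarrow> (real \<Rightarrow> real) \<times> (real \<Rightarrow> real)" where
  "wave_kernel \<mu> a = (SOME (\<beta>, \<beta>'). (\<forall>t. (\<beta> has_real_derivative \<beta>' t) (at t)) \<and>
    (\<forall>t. (\<beta>' has_real_derivative - (\<beta>' t + a * \<beta> t) / \<mu>) (at t)) \<and> \<beta> 0 = 0 \<and> \<beta>' 0 = 1)"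

abbreviation "kern \<mu> a \<equiv> fst (wave_kernel \<mu> a)"
abbreviation "kern' \<mu> a \<equiv> snd (wave_kernel \<mu> a)"

lemma wave_kernel:
  assumes "\<mu> > 0"
  shows "(kern \<mu> a has_real_derivative kern' \<mu> a t) (at t)"
    "(kern' \<mu> a has_real_derivative - (kern' \<mu> a t + a * kern \<mu> a t) / \<mu>) (at t)"
    "kern \<mu> a 0 = 0" "kern' \<mu> a 0 = 1"
proof -
  define P where "P z \<longleftrightarrow> (\<forall>t. (fst z has_real_derivative snd z t) (at t)) \<and>
    (\<forall>t. (snd z has_real_derivative - (snd z t + a * fst z t) / \<mu>) (at t)) \<and> fst z 0 = 0 \<and> snd z 0 = 1"
    for z :: "(real \<Rightarrow> real) \<times> (real \<Rightarrow> real)"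
  obtain \<beta> \<beta>' where "P (\<beta>, \<beta>')"
    using wave_kernel_exists[OF assms, of a] unfolding P_def fst_conv snd_conv by blast
  then have "P (Eps P)" by (rule someI)
  moreover have "wave_kernel \<mu> a = Eps P"
    unfolding wave_kernel_def P_def[abs_def] case_prod_beta ..
  ultimately have "P (wave_kernel \<mu> a)" by simp
  then show "(kern \<mu> a has_real_derivative kern' \<mu> a t) (at t)"
    "(kern' \<mu> a has_real_derivative - (kern' \<mu> a t + a * kern \<mu> a t) / \<mu>) (at t)"
    "kern \<mu> a 0 = 0" "kern' \<mu> a 0 = 1"
    unfolding P_def by blast+
qed

lemma continuous_kern:
  assumes "\<mu> > 0" shows "continuous_on S (kern \<mu> a)" "continuous_on S (kern' \<mu> a)"
  by (rule continuous_at_imp_continuous_on, rule ballI, rule DERIV_isCont, rule wave_kernel[OF assms])+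

lemma integrable_convolution:
  fixes h \<tau> :: "real \<Rightarrow> real"
  assumes "integrable (lebesgue_on {0..t}) h" "continuous_on UNIV \<tau>"
  shows "integrable (lebesgue_on {0..t}) (\<lambda>s. \<tau> (t - s) * h s)"
proof (rule integrable_lebesgue_on_mult_continuous[OF assms(1)])
  show "continuous_on {0..t} (\<lambda>s. \<tau> (t - s))"
    by (rule continuous_on_compose2[OF assms(2)]) (auto intro!: continuous_intros)
qed

text \<open>Duhamel's formula, by two uses of \<open>convolution_primitive\<close>:
  \<open>kern \<mu> a 0 = 0\<close> makes the velocity the convolution with
  \<open>kern' \<mu> a\<close>, and \<open>kern' \<mu> a 0 = 1\<close> brings out the forcing. The
  kernel equation turns the remaining convolution into \<open>- (q + a * p) / \<mu>\<close>.\<close>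

lemma mode_convolution_wave:
  assumes \<mu>: "\<mu> > 0" and g: "L2on T g"
  shows "mode \<mu> a T (\<lambda>t. \<integral>s. kern \<mu> a (t - s) * (g s / \<mu>) \<partial>lebesgue_on {0..t})
    (\<lambda>t. \<integral>s. kern' \<mu> a (t - s) * (g s / \<mu>) \<partial>lebesgue_on {0..t}) g"
proof -
  define p q where "p t = (\<integral>s. kern \<mu> a (t - s) * (g s / \<mu>) \<partial>lebesgue_on {0..t})"
    and "q t = (\<integral>s. kern' \<mu> a (t - s) * (g s / \<mu>) \<partial>lebesgue_on {0..t})" for t
  let ?k2 = "\<lambda>t. - (kern' \<mu> a t + a * kern \<mu> a t) / \<mu>"
  \<comment> \<open>Third derivative of the kernel: the second use of
    \<open>convolution_primitive\<close> has \<open>kern' \<mu> a\<close> as its kernel and asks for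
    two derivatives of it.\<close>
  let ?k3 = "\<lambda>t. - (?k2 t + a * kern' \<mu> a t) / \<mu>"
  note k = wave_kernel[OF \<mu>, of a]
  have gi: "L2on T (\<lambda>s. g s / \<mu>)" using L2on_cmult[OF g, of "1 / \<mu>"] by simp
  note h = L2on_integrable[OF gi]
  have c2: "continuous_on S ?k2" for S by (intro continuous_intros continuous_kern \<mu>) (use \<mu> in auto)
  have c3: "continuous_on S ?k3" for S by (intro continuous_intros continuous_kern \<mu>) (use \<mu> in auto)
  have d3: "(?k2 has_real_derivative ?k3 t) (at t)" for t
    by (intro DERIV_cdivide DERIV_minus DERIV_add DERIV_cmult k)
  note A = convolution_primitive[OF k(1) k(2) c2 h, folded p_def q_def]
    and B = convolution_primitive[OF k(2) d3 c3 h, folded q_def]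
  have q: "L2on T q" using L2on_continuous[OF A(1)] by simp
  have p0: "p 0 = 0" by (simp add: p_def)
  have q0: "q 0 = 0" by (simp add: q_def)
  have p: "p t = p 0 + (\<integral>s. q s \<partial>lebesgue_on {0..t})" if "t \<in> {0..T}" for t
    using A(2)[OF that] by (simp add: k p0)
  have cp: "continuous_on {0..T} p"
  proof (rule continuous_on_eq[OF _ p[symmetric]])
    show "continuous_on {0..T} (\<lambda>t. p 0 + (\<integral>s. q s \<partial>lebesgue_on {0..t}))"
      by (intro continuous_intros indefinite_integral_continuous_real L2on_integrable q)
  qed
  have ev: "(\<integral>s. ?k2 (r - s) * (g s / \<mu>) \<partial>lebesgue_on {0..r}) = (-1 / \<mu>) * (q r + a * p r)" if "r \<in> {0..T}" for r
  proof -
    have hr: "integrable (lebesgue_on {0..r}) (\<lambda>s. g s / \<mu>)" using L2on_integrable[OF L2on_sub[OF gi]] that by auto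
    note i1 = integrable_convolution[OF hr continuous_kern(1)[OF \<mu>], of a]
      and i2 = integrable_convolution[OF hr continuous_kern(2)[OF \<mu>], of a]
    have "(\<integral>s. ?k2 (r - s) * (g s / \<mu>) \<partial>lebesgue_on {0..r})
      = (\<integral>s. (-1 / \<mu>) * (kern' \<mu> a (r - s) * (g s / \<mu>) + a * (kern \<mu> a (r - s) * (g s / \<mu>))) \<partial>lebesgue_on {0..r})"
      by (intro integral_lebesgue_on_cong) (use \<mu> in \<open>simp add: field_simps\<close>)
    also have "\<dots> = (-1 / \<mu>) * (\<integral>s. kern' \<mu> a (r - s) * (g s / \<mu>) + a * (kern \<mu> a (r - s) * (g s / \<mu>)) \<partial>lebesgue_on {0..r})"
      by (rule integral_mult_right_zero)
    also have "(\<integral>s. kern' \<mu> a (r - s) * (g s / \<mu>) + a * (kern \<mu> a (r - s) * (g s / \<mu>)) \<partial>lebesgue_on {0..r})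
        = q r + (\<integral>s. a * (kern \<mu> a (r - s) * (g s / \<mu>)) \<partial>lebesgue_on {0..r})"
      unfolding q_def by (rule Bochner_Integration.integral_add[OF i2 integrable_mult_right[OF i1]])
    also have "(\<integral>s. a * (kern \<mu> a (r - s) * (g s / \<mu>)) \<partial>lebesgue_on {0..r}) = a * p r"
      unfolding p_def by (rule integral_mult_right_zero)
    finally show ?thesis .
  qed
  have eq: "\<mu> * q t = \<mu> * q 0 + (\<integral>s. g s - a * p s - q s \<partial>lebesgue_on {0..t})" if t: "t \<in> {0..T}" for t
  proof -
    have ig: "integrable (lebesgue_on {0..t}) g" using L2on_integrable[OF L2on_sub[OF g]] t by auto
    have iw: "integrable (lebesgue_on {0..t}) (\<lambda>r. q r + a * p r)"
      using t by (intro Bochner_Integration.integrable_add integrable_mult_right integrable_continuous_lebesgue_on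
          continuous_on_subset[OF A(1)] continuous_on_subset[OF cp]) auto
    have "(\<integral>r. (\<integral>s. ?k2 (r - s) * (g s / \<mu>) \<partial>lebesgue_on {0..r}) \<partial>lebesgue_on {0..t})
        = (\<integral>r. (-1 / \<mu>) * (q r + a * p r) \<partial>lebesgue_on {0..t})"
      by (intro integral_lebesgue_on_cong ev) (use t in auto)
    also have "\<dots> = (-1 / \<mu>) * (\<integral>r. q r + a * p r \<partial>lebesgue_on {0..t})" by (rule integral_mult_right_zero)
    finally have "q t = (\<integral>s. g s \<partial>lebesgue_on {0..t}) / \<mu> + (-1 / \<mu>) * (\<integral>r. q r + a * p r \<partial>lebesgue_on {0..t})"
      using B(2)[OF t] by (simp add: k(4))
    then have "\<mu> * q t = (\<integral>s. g s \<partial>lebesgue_on {0..t}) - (\<integral>r. q r + a * p r \<partial>lebesgue_on {0..t})"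
      using \<mu> by (simp add: field_simps)
    also have "\<dots> = (\<integral>s. g s - (q s + a * p s) \<partial>lebesgue_on {0..t})"
      by (rule Bochner_Integration.integral_diff[OF ig iw, symmetric])
    also have "\<dots> = (\<integral>s. g s - a * p s - q s \<partial>lebesgue_on {0..t})"
      by (intro integral_lebesgue_on_cong) simp
    finally show ?thesis by (simp add: q0)
  qed
  have "mode \<mu> a T p q g" by (rule modeI[OF q g p eq]) (use \<mu> in auto)
  then show ?thesis by (simp add: p_def[abs_def] q_def[abs_def])
qed

text \<open>The velocity is defined by the equation itself, so the condition for
  \<open>\<mu> = 0\<close> holds at every time; what is left is that \<open>p\<close> is its
  primitive.\<close>

lemma mode_convolution_heat:
  fixes a :: real
  assumes g: "L2on T g"
  defines "p \<equiv> \<lambda>t. \<integral>s. exp (- a * (t - s)) * g s \<partial>lebesgue_on {0..t}"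
  shows "mode 0 a T p (\<lambda>t. g t - a * p t) g"
proof -
  note h = L2on_integrable[OF g]
  have d: "((\<lambda>t. exp (- a * t)) has_real_derivative - a * exp (- a * t)) (at t)"
    "((\<lambda>t. - a * exp (- a * t)) has_real_derivative a * a * exp (- a * t)) (at t)" for t
    by (auto intro!: derivative_eq_intros)
  have "continuous_on UNIV (\<lambda>t. a * a * exp (- a * t))" by (intro continuous_intros)
  note A = convolution_primitive[OF d this h]
  have inner: "(\<integral>s. - a * exp (- a * (r - s)) * g s \<partial>lebesgue_on {0..r}) = - a * p r" for r
    unfolding p_def by (simp only: mult.assoc integral_mult_right_zero)
  have e: "p t = (\<integral>s. g s \<partial>lebesgue_on {0..t}) + (\<integral>r. - a * p r \<partial>lebesgue_on {0..t})" if "t \<in> {0..T}" for t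
    using A(2)[OF that] unfolding inner by (simp add: p_def)
  have ap: "continuous_on {0..T} (\<lambda>r. - a * p r)" using A(1) unfolding inner .
  have La: "L2on T (\<lambda>r. - a * p r)" by (rule L2on_continuous[OF ap])
  have q: "L2on T (\<lambda>t. g t - a * p t)" using L2on_add[OF g La] by simp
  have p0: "p 0 = 0" by (simp add: p_def)
  have pt: "p t = p 0 + (\<integral>s. g s - a * p s \<partial>lebesgue_on {0..t})" if t: "t \<in> {0..T}" for t
  proof -
    have "integrable (lebesgue_on {0..t}) g" "integrable (lebesgue_on {0..t}) (\<lambda>r. - a * p r)"
      by (rule L2on_integrable[OF L2on_sub[OF g]] L2on_integrable[OF L2on_sub[OF La]], use t in simp)+
    from Bochner_Integration.integral_add[OF this]
    have "(\<integral>s. g s + - a * p s \<partial>lebesgue_on {0..t}) = p t" unfolding e[OF t] .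
    then show ?thesis unfolding p0 by simp
  qed
  show ?thesis by (rule modeI[OF q g pt]) simp_all
qed

text \<open>\<open>kern' + kern / \<mu>\<close> is the homogeneous solution with position 1 and
  velocity 0 at time 0, \<open>kern\<close> the one with position 0 and velocity 1.\<close>

lemma mode_free_wave:
  assumes \<mu>: "\<mu> > 0"
  shows "mode \<mu> a T (\<lambda>t. x * (kern' \<mu> a t + kern \<mu> a t / \<mu>) + y * kern \<mu> a t)
    (\<lambda>t. x * (- a * kern \<mu> a t / \<mu>) + y * kern' \<mu> a t) (\<lambda>_. 0)" (is "mode _ _ _ ?p ?q _")
proof -
  note k = wave_kernel[OF \<mu>, of a]
  have cq: "continuous_on S ?q" for S by (intro continuous_intros continuous_kern \<mu>) (use \<mu> in auto)
  have cr: "continuous_on S (\<lambda>s. 0 - a * ?p s - ?q s)" for S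
    by (intro continuous_intros continuous_kern \<mu>) (use \<mu> in auto)
  have "(?p has_real_derivative ?q t) (at t)" for t
    by (rule derivative_eq_intros k refl | use \<mu> in \<open>simp add: field_simps\<close>)+
  moreover have "((\<lambda>t. \<mu> * ?q t) has_real_derivative (0 - a * ?p t - ?q t)) (at t)" for t
    by (rule derivative_eq_intros k refl | use \<mu> in \<open>simp add: field_simps\<close>)+
  note d = this calculation
  show ?thesis
  proof (rule modeI)
    fix t assume "t \<in> {0..T}"
    then have t: "0 \<le> t" by simp
    show "?p t = ?p 0 + (\<integral>s. ?q s \<partial>lebesgue_on {0..t})"
      unfolding integral_derivative_lebesgue_on[of 0 t ?p, OF t d(2) cq] by simp
    show "\<mu> * ?q t = \<mu> * ?q 0 + (\<integral>s. 0 - a * ?p s - ?q s \<partial>lebesgue_on {0..t})"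
      unfolding integral_derivative_lebesgue_on[of 0 t "\<lambda>t. \<mu> * ?q t", OF t d(1) cr] by simp
  next
    show "L2on T ?q" "L2on T (\<lambda>_. 0 :: real)" by (rule L2on_continuous[OF cq] L2on_const)+
  qed (use \<mu> in simp)
qed

lemma mode_free_heat:
  "mode 0 a T (\<lambda>t. x * exp (- a * t)) (\<lambda>t. - a * (x * exp (- a * t))) (\<lambda>_. 0)" (is "mode _ _ _ ?p ?q _")
proof -
  have cq: "continuous_on S ?q" for S by (intro continuous_intros)
  have "(?p has_real_derivative ?q t) (at t)" for t
    by (auto intro!: derivative_eq_intros)
  note d = this
  show ?thesis
  proof (rule modeI)
    fix t assume "t \<in> {0..T}"
    then have t: "0 \<le> t" by simp
    show "?p t = ?p 0 + (\<integral>s. ?q s \<partial>lebesgue_on {0..t})"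
      unfolding integral_derivative_lebesgue_on[of 0 t ?p, OF t d cq] by simp
  next
    show "L2on T ?q" "L2on T (\<lambda>_. 0 :: real)" by (rule L2on_continuous[OF cq] L2on_const)+
  qed simp_all
qed

lemma mode_exists:
  assumes \<mu>: "\<mu> \<ge> 0" and g: "L2on T g"
  shows "\<exists>p q. mode \<mu> a T p q g \<and> p 0 = x \<and> (\<mu> \<noteq> 0 \<longrightarrow> q 0 = y)"
proof (cases "\<mu> = 0")
  case True
  define P where "P t = (\<integral>s. exp (- a * (t - s)) * g s \<partial>lebesgue_on {0..t})" for t
  have "mode 0 a T (\<lambda>s. P s + 1 * (x * exp (- a * s))) (\<lambda>s. g s - a * P s + 1 * (- a * (x * exp (- a * s)))) (\<lambda>s. g s + 1 * 0)"
    unfolding P_def by (rule mode_add[OF mode_convolution_heat[OF g] mode_free_heat])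
  then have "mode \<mu> a T (\<lambda>s. P s + 1 * (x * exp (- a * s))) (\<lambda>s. g s - a * P s + 1 * (- a * (x * exp (- a * s)))) g"
    unfolding True by (simp only: mult_zero_right add_0_right)
  moreover have "P 0 + 1 * (x * exp (- a * 0)) = x" by (simp add: P_def)
  ultimately show ?thesis using True
    by (intro exI[of _ "\<lambda>s. P s + 1 * (x * exp (- a * s))"]
        exI[of _ "\<lambda>s. g s - a * P s + 1 * (- a * (x * exp (- a * s)))"]) (simp only: simp_thms)
next
  case False
  then have \<mu>': "\<mu> > 0" using \<mu> by simp
  define P where "P t = (\<integral>s. kern \<mu> a (t - s) * (g s / \<mu>) \<partial>lebesgue_on {0..t})" for t
  define R where "R t = (\<integral>s. kern' \<mu> a (t - s) * (g s / \<mu>) \<partial>lebesgue_on {0..t})" for t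
  define P' where "P' t = x * (kern' \<mu> a t + kern \<mu> a t / \<mu>) + y * kern \<mu> a t" for t
  define R' where "R' t = x * (- a * kern \<mu> a t / \<mu>) + y * kern' \<mu> a t" for t
  have "mode \<mu> a T (\<lambda>s. P s + 1 * P' s) (\<lambda>s. R s + 1 * R' s) (\<lambda>s. g s + 1 * 0)"
    unfolding P_def R_def P'_def R'_def by (rule mode_add[OF mode_convolution_wave[OF \<mu>' g] mode_free_wave[OF \<mu>']])
  then have "mode \<mu> a T (\<lambda>s. P s + 1 * P' s) (\<lambda>s. R s + 1 * R' s) g"
    by (simp only: mult_zero_right add_0_right)
  moreover have "P 0 + 1 * P' 0 = x" "R 0 + 1 * R' 0 = y"
    by (simp_all add: P_def P'_def R_def R'_def wave_kernel[OF \<mu>'])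
  ultimately show ?thesis
    by (intro exI[of _ "\<lambda>s. P s + 1 * P' s"] exI[of _ "\<lambda>s. R s + 1 * R' s"]) (simp only: simp_thms)
qed

lemma L2on_measurable: "L2on T f \<Longrightarrow> f \<in> borel_measurable (lebesgue_on {0..T})"
  by (simp add: L2on_def)

text \<open>Velocities rebuilt from coordinates agree with the scalar ones only almost everywhere;
  for \<open>\<mu> \<noteq> 0\<close> their pointwise values enter the equation and must agree
  everywhere.\<close>

lemma mode_cong:
  assumes m: "mode \<mu> a T p q g" and p': "\<And>t. t \<in> {0..T} \<Longrightarrow> p' t = p t"
    and q': "L2on T q'" "AE t in lebesgue_on {0..T}. q' t = q t" "\<And>t. \<mu> \<noteq> 0 \<Longrightarrow> t \<in> {0..T} \<Longrightarrow> q' t = q t"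
    and T: "0 \<le> T"
  shows "mode \<mu> a T p' q' g"
proof (rule modeI)
  have 0: "0 \<in> {0..T}" using T by simp
  show "L2on T q'" "L2on T g" using q' modeD(2)[OF m] by simp_all
  have p'L: "L2on T p'" by (rule L2on_cong[OF mode_L2(1)[OF m]]) (simp add: p')
  note L = mode_L2[OF m]
  fix t assume t: "t \<in> {0..T}"
  have tT: "t \<le> T" using t by simp
  note ms = L2on_sub[OF q'(1) tT] L2on_sub[OF L(1) tT] L2on_sub[OF L(2) tT] L2on_sub[OF L(3) tT] L2on_sub[OF p'L tT]
  have mq: "(\<integral>s. q' s \<partial>lebesgue_on {0..t}) = (\<integral>s. q s \<partial>lebesgue_on {0..t})"
    by (rule integral_cong_AE) (use ms AE_lebesgue_on_sub[OF q'(2) tT] in \<open>simp_all add: L2on_def\<close>)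
  show "p' t = p' 0 + (\<integral>s. q' s \<partial>lebesgue_on {0..t})"
    unfolding mq p'[OF t] p'[OF 0] by (rule modeD(3)[OF m t])
  have "(\<integral>s. g s - a * p' s - q' s \<partial>lebesgue_on {0..t}) = (\<integral>s. g s - a * p s - q s \<partial>lebesgue_on {0..t})"
  proof (rule integral_cong_AE)
    show "(\<lambda>s. g s - a * p' s - q' s) \<in> borel_measurable (lebesgue_on {0..t})"
      "(\<lambda>s. g s - a * p s - q s) \<in> borel_measurable (lebesgue_on {0..t})"
      by (intro L2on_measurable L2on_diff L2on_cmult ms)+
    have "AE s in lebesgue_on {0..t}. p' s = p s" by (rule AE_I2) (use p' tT in simp)
    with AE_lebesgue_on_sub[OF q'(2) tT]
    show "AE s in lebesgue_on {0..t}. g s - a * p' s - q' s = g s - a * p s - q s"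
      by eventually_elim simp
  qed
  then show "\<mu> * q' t = \<mu> * q' 0 + (\<integral>s. g s - a * p' s - q' s \<partial>lebesgue_on {0..t})"
    using modeD(4)[OF m t] q'(3)[OF _ t] q'(3)[OF _ 0] by (cases "\<mu> = 0") simp_all
next
  assume \<mu>: "\<mu> = 0"
  have p'L: "L2on T p'" by (rule L2on_cong[OF mode_L2(1)[OF m]]) (simp add: p')
  have "(\<integral>s. (g s - a * p' s - q' s)\<^sup>2 \<partial>lebesgue_on {0..T}) = (\<integral>s. (g s - a * p s - q s)\<^sup>2 \<partial>lebesgue_on {0..T})"
  proof (rule integral_cong_AE)
    show "(\<lambda>s. (g s - a * p' s - q' s)\<^sup>2) \<in> borel_measurable (lebesgue_on {0..T})"
      "(\<lambda>s. (g s - a * p s - q s)\<^sup>2) \<in> borel_measurable (lebesgue_on {0..T})"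
      by (intro borel_measurable_power L2on_measurable L2on_diff L2on_cmult mode_L2[OF m] p'L q'(1))+
    have "AE s in lebesgue_on {0..T}. p' s = p s" by (rule AE_I2) (use p' in simp)
    with q'(2) show "AE s in lebesgue_on {0..T}. (g s - a * p' s - q' s)\<^sup>2 = (g s - a * p s - q s)\<^sup>2"
      by eventually_elim simp
  qed
  then show "(\<integral>s. (g s - a * p' s - q' s)\<^sup>2 \<partial>lebesgue_on {0..T}) = 0" using modeD(5)[OF m \<mu>] by simp
qed

lemma mode_restrict:
  assumes m: "mode \<mu> a T p q g" and S: "S \<le> T"
  shows "mode \<mu> a S p q g"
proof (rule modeI)
  show "L2on S q" "L2on S g" by (rule L2on_sub[OF modeD(1)[OF m] S] L2on_sub[OF modeD(2)[OF m] S])+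
  show "p t = p 0 + (\<integral>s. q s \<partial>lebesgue_on {0..t})" if "t \<in> {0..S}" for t
    by (rule modeD(3)[OF m]) (use that S in simp)
  show "\<mu> * q t = \<mu> * q 0 + (\<integral>s. g s - a * p s - q s \<partial>lebesgue_on {0..t})" if "t \<in> {0..S}" for t
    by (rule modeD(4)[OF m]) (use that S in simp)
  assume \<mu>: "\<mu> = 0"
  have "AE s in lebesgue_on {0..S}. g s - a * p s - q s = 0"
    using AE_lebesgue_on_sub[OF mode_heat_AE[OF m[unfolded \<mu>]] S] by eventually_elim simp
  then show "(\<integral>s. (g s - a * p s - q s)\<^sup>2 \<partial>lebesgue_on {0..S}) = 0"
    using L2on_zero_AE[OF L2on_sub[OF mode_L2(4)[OF m] S]] by simp
qed

lemma integral_reflect_full: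
  fixes f :: "real \<Rightarrow> real"
  assumes "integrable (lebesgue_on {0..T}) f" "t \<in> {0..T}"
  shows "(\<integral>s. f (T - s) \<partial>lebesgue_on {0..t}) = (\<integral>s. f s \<partial>lebesgue_on {0..T}) - (\<integral>s. f s \<partial>lebesgue_on {0..T - t})"
  using integral_reflect_0[OF assms] integral_lebesgue_on_split[OF assms(1), of "T - t"] assms(2) by simp

text \<open>Time reversal turns damping into forcing: the forcing changes by twice the velocity.\<close>

lemma mode_reverse:
  assumes m: "mode \<mu> a T p q g" and T: "0 \<le> T"
  shows "mode \<mu> a T (\<lambda>t. p (T - t)) (\<lambda>t. - q (T - t)) (\<lambda>t. g (T - t) - 2 * q (T - t))"
proof (rule modeI)
  note L = mode_L2[OF m] and R = mode_L2[OF m, THEN L2on_reflect]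
  show "L2on T (\<lambda>t. - q (T - t))" "L2on T (\<lambda>t. g (T - t) - 2 * q (T - t))"
    by (rule L2on_minus[OF R(2)] L2on_diff[OF R(3) L2on_cmult[OF R(2)]])+
  have TT: "T \<in> {0..T}" using T by simp
  have r: "g (T - s) - 2 * q (T - s) - a * p (T - s) - - q (T - s) = (\<lambda>s. g s - a * p s - q s) (T - s)" for s
    by simp
  fix t assume t: "t \<in> {0..T}"
  then have t': "T - t \<in> {0..T}" by auto
  have "(\<integral>s. - q (T - s) \<partial>lebesgue_on {0..t}) = - ((\<integral>s. q s \<partial>lebesgue_on {0..T}) - (\<integral>s. q s \<partial>lebesgue_on {0..T - t}))"
    using integral_reflect_full[OF L2on_integrable[OF L(2)] t] by simp
  then show "p (T - t) = p (T - 0) + (\<integral>s. - q (T - s) \<partial>lebesgue_on {0..t})"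
    using modeD(3)[OF m t'] modeD(3)[OF m TT] by simp
  show "\<mu> * - q (T - t) = \<mu> * - q (T - 0)
      + (\<integral>s. g (T - s) - 2 * q (T - s) - a * p (T - s) - - q (T - s) \<partial>lebesgue_on {0..t})"
    unfolding r integral_reflect_full[OF L2on_integrable[OF L(4)] t]
    using modeD(4)[OF m t'] modeD(4)[OF m TT] by simp
next
  assume \<mu>: "\<mu> = 0"
  have r: "(g (T - s) - 2 * q (T - s) - a * p (T - s) - - q (T - s))\<^sup>2 = (\<lambda>s. (g s - a * p s - q s)\<^sup>2) (T - s)" for s
    by simp
  have "integrable (lebesgue_on {0..T}) (\<lambda>s. (g s - a * p s - q s)\<^sup>2)"
    using mode_L2(4)[OF m] by (simp add: L2on_def)
  from integral_reflect_full[OF this, of T]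
  show "(\<integral>s. (g (T - s) - 2 * q (T - s) - a * p (T - s) - - q (T - s))\<^sup>2 \<partial>lebesgue_on {0..T}) = 0"
    unfolding r using modeD(5)[OF m \<mu>] T by simp
qed

section \<open>Concatenation of paths\<close>

definition join :: "real \<Rightarrow> (real \<Rightarrow> 'b) \<Rightarrow> (real \<Rightarrow> 'b) \<Rightarrow> real \<Rightarrow> 'b" where
  "join S f g s = (if s \<le> S then f s else g (s - S))"

lemma has_bochner_integral_join:
  fixes f g :: "real \<Rightarrow> real"
  assumes f: "integrable (lebesgue_on {0..S}) f" and g: "integrable (lebesgue_on {0..t}) g"
    and "0 \<le> S" "0 \<le> t"
  shows "has_bochner_integral (lebesgue_on {0..S + t}) (join S f g)
    ((\<integral>s. f s \<partial>lebesgue_on {0..S}) + (\<integral>s. g s \<partial>lebesgue_on {0..t}))"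
proof -
  let ?A = "\<integral>s. f s \<partial>lebesgue_on {0..S}" and ?B = "\<integral>s. g s \<partial>lebesgue_on {0..t}"
  let ?f = "\<lambda>x. indicator {0..S} x *\<^sub>R f x" and ?g = "\<lambda>x. indicator {S..S + t} x *\<^sub>R g (x - S)"
  let ?j = "\<lambda>x. indicator {0..S + t} x *\<^sub>R join S f g x"
  have h1: "has_bochner_integral lebesgue ?f ?A"
    using has_bochner_integral_integrable[OF f] by (simp add: has_bochner_integral_restrict_space)
  have "has_bochner_integral (lebesgue_on {0 + S..t + S}) (\<lambda>s. g (s - S)) ?B"
    by (rule has_bochner_integral_shift[OF has_bochner_integral_integrable[OF g]])
  then have h2: "has_bochner_integral lebesgue ?g ?B"
    by (simp add: has_bochner_integral_restrict_space add.commute)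
  have m1: "?f \<in> borel_measurable lebesgue" and m2: "?g \<in> borel_measurable lebesgue"
    using h1 h2 by (auto dest: borel_measurable_has_bochner_integral)
  have js: "?j = (\<lambda>x. ?f x + indicator {S<..} x * ?g x)"
    using assms(3,4) by (auto simp: join_def indicator_def fun_eq_iff)
  have mj: "?j \<in> borel_measurable lebesgue"
    unfolding js by (intro borel_measurable_add m1 borel_measurable_times m2 borel_measurable_indicator) simp
  \<comment> \<open>The two closed intervals overlap in \<open>S\<close>, the only point where the
    sum of the integrands may differ from \<open>join\<close>.\<close>
  have "AE x in lebesgue. x \<notin> {S}" by (rule AE_not_in) simp
  then have "AE x in lebesgue. ?f x + ?g x = ?j x"
    by (rule eventually_mono) (use assms(3,4) in \<open>auto simp: join_def indicator_def\<close>)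
  with has_bochner_integral_add[OF h1 h2] m1 m2 mj have "has_bochner_integral lebesgue ?j (?A + ?B)"
    by (subst has_bochner_integral_cong_AE[symmetric, where f = "\<lambda>x. ?f x + ?g x"]) (auto intro!: borel_measurable_add)
  then show ?thesis by (simp add: has_bochner_integral_restrict_space)
qed

lemma integral_join:
  fixes f g :: "real \<Rightarrow> real"
  assumes f: "integrable (lebesgue_on {0..S}) f" and g: "integrable (lebesgue_on {0..t}) g"
    and "0 \<le> S" "0 \<le> t"
  shows "(\<integral>s. join S f g s \<partial>lebesgue_on {0..S + t})
    = (\<integral>s. f s \<partial>lebesgue_on {0..S}) + (\<integral>s. g s \<partial>lebesgue_on {0..t})"
  using has_bochner_integral_join[OF assms] by (rule has_bochner_integral_integral_eq)

lemma measurable_join: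
  assumes f: "f \<in> borel_measurable (lebesgue_on {0..S})" and g: "g \<in> borel_measurable (lebesgue_on {0..T})"
    and "0 \<le> S" "0 \<le> T"
  shows "join S f g \<in> borel_measurable (lebesgue_on {0..S + T})"
proof (rule measurable_piecewise_restrict[where C = "{{0..S}, {S<..S + T}}"])
  have "(\<lambda>s. g (s - S)) \<in> borel_measurable (lebesgue_on {0 + S..T + S})" by (rule measurable_lebesgue_on_shift[OF g])
  then have "(\<lambda>s. g (s - S)) \<in> borel_measurable (lebesgue_on {S<..S + T})"
    by (rule measurable_lebesgue_on_sub) auto
  then have 2: "join S f g \<in> borel_measurable (lebesgue_on {S<..S + T})"
    by (subst measurable_lebesgue_cong[of _ _ "\<lambda>s. g (s - S)"]) (auto simp: join_def)
  have 1: "join S f g \<in> borel_measurable (lebesgue_on {0..S})"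
    using f by (subst measurable_lebesgue_cong[of _ _ f]) (auto simp: join_def)
  fix \<Omega> assume "\<Omega> \<in> {{0..S}, {S<..S + T}}"
  then consider "\<Omega> = {0..S}" | "\<Omega> = {S<..S + T}" by auto
  then show "join S f g \<in> borel_measurable (restrict_space (lebesgue_on {0..S + T}) \<Omega>)"
  proof cases
    case c: 1
    have "{0..S + T} \<inter> \<Omega> = {0..S}" using c assms(3,4) by auto
    then show ?thesis using 1 by (subst restrict_restrict_space) (auto simp: c)
  next
    case c: 2
    have "{0..S + T} \<inter> \<Omega> = {S<..S + T}" using c assms(3,4) by auto
    then show ?thesis using 2 by (subst restrict_restrict_space) (auto simp: c)
  qed
qed (use assms(3,4) in \<open>auto simp: sets_restrict_space_iff\<close>)

lemma L2on_join:
  assumes f: "L2on S f" and g: "L2on T g" and "0 \<le> S" "0 \<le> T"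
  shows "L2on (S + T) (join S f g)"
proof -
  have "has_bochner_integral (lebesgue_on {0..S + T}) (join S (\<lambda>s. (norm (f s))\<^sup>2) (\<lambda>s. (norm (g s))\<^sup>2))
     ((\<integral>s. (norm (f s))\<^sup>2 \<partial>lebesgue_on {0..S}) + (\<integral>s. (norm (g s))\<^sup>2 \<partial>lebesgue_on {0..T}))"
    using assms by (intro has_bochner_integral_join) (simp_all add: L2on_def)
  moreover have "join S (\<lambda>s. (norm (f s))\<^sup>2) (\<lambda>s. (norm (g s))\<^sup>2) = (\<lambda>s. (norm (join S f g s))\<^sup>2)"
    by (auto simp: join_def fun_eq_iff)
  ultimately show ?thesis
    using measurable_join[of f S g T] assms unfolding L2on_def has_bochner_integral_iff by simp
qed

text \<open>At the junction \<open>join\<close> takes the value of the first path, so the second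
  must start there with the same position and, if the equation sees it, the same velocity.\<close>

lemma mode_join:
  assumes m1: "mode \<mu> a S p1 q1 g1" and m2: "mode \<mu> a T p2 q2 g2" and ST: "0 \<le> S" "0 \<le> T"
    and p: "p2 0 = p1 S" and q: "\<mu> \<noteq> 0 \<Longrightarrow> q2 0 = q1 S"
  shows "mode \<mu> a (S + T) (join S p1 p2) (join S q1 q2) (join S g1 g2)"
proof (rule modeI)
  note L1 = mode_L2[OF m1] and L2 = mode_L2[OF m2]
  show "L2on (S + T) (join S q1 q2)" "L2on (S + T) (join S g1 g2)"
    by (rule L2on_join[OF L1(2) L2(2) ST] L2on_join[OF L1(3) L2(3) ST])+
  have SS: "S \<in> {0..S}" using ST by simp
  have j0: "join S f1 f2 0 = f1 0" for f1 f2 :: "real \<Rightarrow> real" using ST by (simp add: join_def)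
  have r: "join S g1 g2 s - a * join S p1 p2 s - join S q1 q2 s
      = join S (\<lambda>s. g1 s - a * p1 s - q1 s) (\<lambda>s. g2 s - a * p2 s - q2 s) s" for s by (simp add: join_def)
  have lo: "(\<integral>s. join S f1 f2 s \<partial>lebesgue_on {0..t}) = (\<integral>s. f1 s \<partial>lebesgue_on {0..t})"
    if "t \<le> S" for t and f1 f2 :: "real \<Rightarrow> real"
    by (rule integral_lebesgue_on_cong) (use that in \<open>simp add: join_def\<close>)
  have hi: "(\<integral>s. join S f1 f2 s \<partial>lebesgue_on {0..t}) = (\<integral>s. f1 s \<partial>lebesgue_on {0..S}) + (\<integral>s. f2 s \<partial>lebesgue_on {0..t - S})"
    if "S < t" "t \<le> S + T" "L2on S f1" "L2on T f2" for t and f1 f2 :: "real \<Rightarrow> real"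
  proof -
    have "integrable (lebesgue_on {0..t - S}) f2"
      by (rule L2on_integrable[OF L2on_sub[OF that(4)]]) (use that in simp)
    from integral_join[OF L2on_integrable[OF that(3)] this ST(1)] show ?thesis using that by simp
  qed
  fix t assume t: "t \<in> {0..S + T}"
  show "join S p1 p2 t = join S p1 p2 0 + (\<integral>s. join S q1 q2 s \<partial>lebesgue_on {0..t})"
  proof (cases "t \<le> S")
    case True
    then show ?thesis unfolding lo[OF True] j0 using modeD(3)[OF m1, of t] t by (simp add: join_def)
  next
    case False
    then have "t - S \<in> {0..T}" using t by simp
    from modeD(3)[OF m2 this] show ?thesis using False t modeD(3)[OF m1 SS] p
      by (subst hi[OF _ _ L1(2) L2(2)]) (simp_all add: j0, simp add: join_def)
  qed
  show "\<mu> * join S q1 q2 t = \<mu> * join S q1 q2 0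
      + (\<integral>s. join S g1 g2 s - a * join S p1 p2 s - join S q1 q2 s \<partial>lebesgue_on {0..t})"
    unfolding r
  proof (cases "t \<le> S")
    case True
    then show "\<mu> * join S q1 q2 t = \<mu> * join S q1 q2 0
        + (\<integral>s. join S (\<lambda>s. g1 s - a * p1 s - q1 s) (\<lambda>s. g2 s - a * p2 s - q2 s) s \<partial>lebesgue_on {0..t})"
      unfolding lo[OF True] j0 using modeD(4)[OF m1, of t] t by (simp add: join_def)
  next
    case False
    then have tS: "t - S \<in> {0..T}" using t by simp
    have "\<mu> * q2 0 = \<mu> * q1 S" using q by (cases "\<mu> = 0") simp_all
    with modeD(4)[OF m2 tS] modeD(4)[OF m1 SS]
    show "\<mu> * join S q1 q2 t = \<mu> * join S q1 q2 0
        + (\<integral>s. join S (\<lambda>s. g1 s - a * p1 s - q1 s) (\<lambda>s. g2 s - a * p2 s - q2 s) s \<partial>lebesgue_on {0..t})"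
      using False t by (subst hi[OF _ _ L1(4) L2(4)]) (simp_all add: j0, simp add: join_def)
  qed
next
  assume \<mu>: "\<mu> = 0"
  have r: "(join S g1 g2 s - a * join S p1 p2 s - join S q1 q2 s)\<^sup>2
      = join S (\<lambda>s. (g1 s - a * p1 s - q1 s)\<^sup>2) (\<lambda>s. (g2 s - a * p2 s - q2 s)\<^sup>2) s" for s by (simp add: join_def)
  have i: "integrable (lebesgue_on {0..S}) (\<lambda>s. (g1 s - a * p1 s - q1 s)\<^sup>2)"
    "integrable (lebesgue_on {0..T}) (\<lambda>s. (g2 s - a * p2 s - q2 s)\<^sup>2)"
    using mode_L2(4)[OF m1] mode_L2(4)[OF m2] by (simp_all add: L2on_def)
  show "(\<integral>s. (join S g1 g2 s - a * join S p1 p2 s - join S q1 q2 s)\<^sup>2 \<partial>lebesgue_on {0..S + T}) = 0"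
    unfolding r integral_join[OF i ST] modeD(5)[OF m1 \<mu>] modeD(5)[OF m2 \<mu>] by simp
qed

text \<open>The equation for \<open>p\<close> cancels every term with an undifferentiated cutoff, in
  particular the one containing \<open>a\<close>. The forcing is thus bounded by position and
  velocity uniformly over the spectrum.\<close>

lemma mode_cutoff:
  assumes m: "mode \<mu> a T p q (\<lambda>_. 0)"
    and d: "\<And>t. (\<theta> has_real_derivative \<theta>' t) (at t)" "\<And>t. (\<theta>' has_real_derivative \<theta>'' t) (at t)"
    and c: "continuous_on UNIV \<theta>''"
  shows "mode \<mu> a T (\<lambda>t. \<theta> t * p t) (\<lambda>t. \<theta>' t * p t + \<theta> t * q t)
    (\<lambda>t. \<mu> * (\<theta>'' t * p t + 2 * (\<theta>' t * q t)) + \<theta>' t * p t)"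
proof -
  have c1: "continuous_on S \<theta>" and c2: "continuous_on S \<theta>'" for S
    by (rule continuous_at_imp_continuous_on, rule ballI, rule DERIV_isCont, rule d)+
  have c3: "continuous_on S \<theta>''" for S by (rule continuous_on_subset[OF c]) simp
  note L = mode_L2[OF m]
  have mult: "L2on T (\<lambda>s. b s * f s)" if "continuous_on {0..T} b" "L2on T f" for b f :: "real \<Rightarrow> real"
    using L2on_mult_continuous[OF that(2,1)] by simp
  have prim: "\<theta> t = \<theta> 0 + (\<integral>s. \<theta>' s \<partial>lebesgue_on {0..t})" "\<theta>' t = \<theta>' 0 + (\<integral>s. \<theta>'' s \<partial>lebesgue_on {0..t})"
    if "t \<in> {0..T}" for t
    using integral_derivative_lebesgue_on[of 0 t \<theta> \<theta>', OF _ d(1) c2]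
      integral_derivative_lebesgue_on[of 0 t \<theta>' \<theta>'', OF _ d(2) c3] that by simp_all
  have L1: "L2on T \<theta>'" "L2on T \<theta>''" by (rule L2on_continuous[OF c2] L2on_continuous[OF c3])+
  note M = mult[OF c1 L(1)] mult[OF c1 L(2)] mult[OF c2 L(1)] mult[OF c2 L(2)] mult[OF c3 L(1)] mult[OF c1 L(4)]
  show ?thesis
  proof (rule modeI)
    show "L2on T (\<lambda>t. \<theta>' t * p t + \<theta> t * q t)" by (rule L2on_add[OF M(3,2)])
    show "L2on T (\<lambda>t. \<mu> * (\<theta>'' t * p t + 2 * (\<theta>' t * q t)) + \<theta>' t * p t)"
      by (intro L2on_add L2on_cmult M)
    fix t assume t: "t \<in> {0..T}"
    have tT: "t \<le> T" using t by simp
    have i: "integrable (lebesgue_on {0..t}) f" if "L2on T f" for f :: "real \<Rightarrow> real"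
      by (rule L2on_integrable[OF L2on_sub[OF that tT]])
    have "\<theta> t * p t = \<theta> 0 * p 0 + (\<integral>s. \<theta> s * q s + \<theta>' s * p s \<partial>lebesgue_on {0..t})"
      by (rule product_rule_L2[OF L1(1) L(2) prim(1) modeD(3)[OF m] t])
    then show "\<theta> t * p t = \<theta> 0 * p 0 + (\<integral>s. \<theta>' s * p s + \<theta> s * q s \<partial>lebesgue_on {0..t})"
      by (simp add: add.commute)
    have a1: "\<theta>' t * p t = \<theta>' 0 * p 0 + (\<integral>s. \<theta>' s * q s + \<theta>'' s * p s \<partial>lebesgue_on {0..t})"
      by (rule product_rule_L2[OF L1(2) L(2) prim(2) modeD(3)[OF m] t])
    have a2: "\<theta> t * (\<mu> * q t) = \<theta> 0 * (\<mu> * q 0)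
        + (\<integral>s. \<theta> s * (0 - a * p s - q s) + \<theta>' s * (\<mu> * q s) \<partial>lebesgue_on {0..t})"
      by (rule product_rule_L2[OF L1(1) L(4) prim(1) modeD(4)[OF m] t])
    have "\<mu> * (\<theta>' t * p t + \<theta> t * q t) = \<mu> * (\<theta>' t * p t) + \<theta> t * (\<mu> * q t)" by (simp add: algebra_simps)
    also have "\<dots> = \<mu> * (\<theta>' 0 * p 0 + \<theta> 0 * q 0) + (\<mu> * (\<integral>s. \<theta>' s * q s + \<theta>'' s * p s \<partial>lebesgue_on {0..t})
        + (\<integral>s. \<theta> s * (0 - a * p s - q s) + \<theta>' s * (\<mu> * q s) \<partial>lebesgue_on {0..t}))"
      unfolding a1 a2 by (simp add: algebra_simps)
    also have "\<mu> * (\<integral>s. \<theta>' s * q s + \<theta>'' s * p s \<partial>lebesgue_on {0..t})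
        = (\<integral>s. \<mu> * (\<theta>' s * q s + \<theta>'' s * p s) \<partial>lebesgue_on {0..t})" by (rule integral_mult_right_zero[symmetric])
    also have "\<dots> + (\<integral>s. \<theta> s * (0 - a * p s - q s) + \<theta>' s * (\<mu> * q s) \<partial>lebesgue_on {0..t})
       = (\<integral>s. \<mu> * (\<theta>' s * q s + \<theta>'' s * p s) + (\<theta> s * (0 - a * p s - q s) + \<theta>' s * (\<mu> * q s)) \<partial>lebesgue_on {0..t})"
      by (intro Bochner_Integration.integral_add[symmetric] i L2on_cmult L2on_add M mult[OF c2 L2on_cmult[OF L(2)]])
    also have "\<dots> = (\<integral>s. \<mu> * (\<theta>'' s * p s + 2 * (\<theta>' s * q s)) + \<theta>' s * p s - a * (\<theta> s * p s)
        - (\<theta>' s * p s + \<theta> s * q s) \<partial>lebesgue_on {0..t})"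
      by (rule integral_lebesgue_on_cong) (simp add: algebra_simps)
    finally show "\<mu> * (\<theta>' t * p t + \<theta> t * q t) = \<mu> * (\<theta>' 0 * p 0 + \<theta> 0 * q 0)
        + (\<integral>s. \<mu> * (\<theta>'' s * p s + 2 * (\<theta>' s * q s)) + \<theta>' s * p s - a * (\<theta> s * p s)
        - (\<theta>' s * p s + \<theta> s * q s) \<partial>lebesgue_on {0..t})" .
  next
    assume \<mu>: "\<mu> = 0"
    have "AE s in lebesgue_on {0..T}. (\<mu> * (\<theta>'' s * p s + 2 * (\<theta>' s * q s)) + \<theta>' s * p s - a * (\<theta> s * p s)
        - (\<theta>' s * p s + \<theta> s * q s))\<^sup>2 = 0"
      using mode_heat_AE[OF m[unfolded \<mu>]] by eventually_elim (simp add: \<mu> algebra_simps)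
    then show "(\<integral>s. (\<mu> * (\<theta>'' s * p s + 2 * (\<theta>' s * q s)) + \<theta>' s * p s - a * (\<theta> s * p s)
        - (\<theta>' s * p s + \<theta> s * q s))\<^sup>2 \<partial>lebesgue_on {0..T}) = 0"
      by (rule integral_eq_zero_AE)
  qed
qed

section \<open>Damped paths in the Hilbert space\<close>

locale spectral = hilbert_basis e for e :: "nat \<Rightarrow> 'h::{real_inner, complete_space, second_countable_topology}" +
  fixes \<alpha> :: "nat \<Rightarrow> real"
  assumes \<alpha>_pos0: "0 < \<alpha> 0" and \<alpha>_mono: "\<And>k. \<alpha> k \<le> \<alpha> (Suc k)"
begin

lemma \<alpha>_ge: "\<alpha> 0 \<le> \<alpha> k"
  by (rule lift_Suc_mono_le[of \<alpha>]) (use \<alpha>_mono in auto)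

lemma \<alpha>_pos: "0 < \<alpha> k" using \<alpha>_ge[of k] \<alpha>_pos0 by linarith

text \<open>On the form domain this is the squared norm of \<open>sqrt_A e \<alpha> x\<close>
  (\<open>norm_sqrt_A\<close>), kept as a series so that it can be summed mode by mode.\<close>

definition stiff :: "'h \<Rightarrow> real" where
  "stiff x = (\<Sum>k. \<alpha> k * (inner x (e k))\<^sup>2)"

definition energy :: "real \<Rightarrow> 'h \<Rightarrow> 'h \<Rightarrow> real" where
  "energy \<mu> x v = stiff x + \<mu> * (norm v)\<^sup>2"

text \<open>The equation is imposed mode by mode, since \<open>A\<close> applied to \<open>p\<close>
  need not be a vector of \<open>'h\<close>; membership in \<open>dom_sqrt_A\<close> at all times
  gives \<open>stiff (p t)\<close> its meaning.\<close>

definition damped :: "real \<Rightarrow> real \<Rightarrow> (real \<Rightarrow> 'h) \<Rightarrow> (real \<Rightarrow> 'h) \<Rightarrow> (real \<Rightarrow> 'h) \<Rightarrow> bool" where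
  "damped \<mu> T p q g \<longleftrightarrow> 0 \<le> T \<and> L2on T q \<and> L2on T g \<and> (\<forall>t\<in>{0..T}. p t \<in> dom_sqrt_A e \<alpha>) \<and>
    (\<forall>k. mode \<mu> (\<alpha> k) T (\<lambda>s. inner (p s) (e k)) (\<lambda>s. inner (q s) (e k)) (\<lambda>s. inner (g s) (e k)))"

lemma dom_iff: "x \<in> dom_sqrt_A e \<alpha> \<longleftrightarrow> summable (\<lambda>k. \<alpha> k * (inner x (e k))\<^sup>2)"
  by (simp add: dom_sqrt_A_def)

lemma dom_scaleR: "x \<in> dom_sqrt_A e \<alpha> \<Longrightarrow> c *\<^sub>R x \<in> dom_sqrt_A e \<alpha>"
  unfolding dom_iff using summable_mult[of "\<lambda>k. \<alpha> k * (inner x (e k))\<^sup>2" "c\<^sup>2"]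
  by (simp add: power_mult_distrib mult_ac)

lemma stiff_sums: "x \<in> dom_sqrt_A e \<alpha> \<Longrightarrow> (\<lambda>k. \<alpha> k * (inner x (e k))\<^sup>2) sums stiff x"
  unfolding dom_iff stiff_def by (rule summable_sums)

lemma stiff_ge: "x \<in> dom_sqrt_A e \<alpha> \<Longrightarrow> \<alpha> 0 * (norm x)\<^sup>2 \<le> stiff x"
  by (rule sums_le[OF _ sums_mult[OF parseval] stiff_sums]) (simp_all add: mult_right_mono \<alpha>_ge)

lemma stiff_nonneg: "x \<in> dom_sqrt_A e \<alpha> \<Longrightarrow> 0 \<le> stiff x"
  using stiff_ge[of x] \<alpha>_pos0 by (meson less_imp_le mult_nonneg_nonneg order_trans zero_le_power2)

lemma stiff_0 [simp]: "stiff 0 = 0" by (simp add: stiff_def)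

lemma dom_0 [simp]: "0 \<in> dom_sqrt_A e \<alpha>" by (simp add: dom_iff)

lemma norm_le_energy: "x \<in> dom_sqrt_A e \<alpha> \<Longrightarrow> 0 \<le> \<mu> \<Longrightarrow> (norm x)\<^sup>2 \<le> energy \<mu> x v / \<alpha> 0"
proof -
  assume x: "x \<in> dom_sqrt_A e \<alpha>" and \<mu>: "0 \<le> \<mu>"
  have "\<alpha> 0 * (norm x)\<^sup>2 \<le> energy \<mu> x v"
    using stiff_ge[OF x] \<mu> by (simp add: energy_def add_increasing2)
  then show ?thesis using \<alpha>_pos0 by (simp add: field_simps)
qed

lemma energy_nonneg: "x \<in> dom_sqrt_A e \<alpha> \<Longrightarrow> 0 \<le> \<mu> \<Longrightarrow> 0 \<le> energy \<mu> x v"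
  by (simp add: energy_def stiff_nonneg)

lemma dampedD:
  assumes "damped \<mu> T p q g"
  shows "0 \<le> T" "L2on T q" "L2on T g" "\<And>t. t \<in> {0..T} \<Longrightarrow> p t \<in> dom_sqrt_A e \<alpha>"
    "\<And>k. mode \<mu> (\<alpha> k) T (\<lambda>s. inner (p s) (e k)) (\<lambda>s. inner (q s) (e k)) (\<lambda>s. inner (g s) (e k))"
  using assms unfolding damped_def by blast+

text \<open>Sum of \<open>mode_energy\<close> over the modes; \<open>L2on_parseval\<close> resums
  the work term.\<close>

lemma damped_energy:
  assumes d: "damped \<mu> T p q g" and t: "t \<in> {0..T}"
  shows "energy \<mu> (p t) (q t) = energy \<mu> (p 0) (q 0) + 2 * (\<integral>s. inner (g s - q s) (q s) \<partial>lebesgue_on {0..t})"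
proof -
  have en: "(\<lambda>k. \<alpha> k * (inner (p r) (e k))\<^sup>2 + \<mu> * (inner (q r) (e k))\<^sup>2) sums energy \<mu> (p r) (q r)"
    if "r \<in> {0..T}" for r
    unfolding energy_def by (rule sums_add[OF stiff_sums[OF dampedD(4)[OF d that]] sums_mult[OF parseval]])
  have tT: "t \<le> T" and z: "0 \<in> {0..T}" using t by auto
  have "(\<lambda>k. \<integral>s. inner (g s - q s) (e k) * inner (q s) (e k) \<partial>lebesgue_on {0..t})
      sums (\<integral>s. inner (g s - q s) (q s) \<partial>lebesgue_on {0..t})"
    by (rule L2on_parseval[OF L2on_diff[OF L2on_sub[OF dampedD(3)[OF d] tT] L2on_sub[OF dampedD(2)[OF d] tT]]
          L2on_sub[OF dampedD(2)[OF d] tT]])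
  from sums_add[OF en[OF z] sums_mult[OF this, of 2]]
  have "(\<lambda>k. \<alpha> k * (inner (p t) (e k))\<^sup>2 + \<mu> * (inner (q t) (e k))\<^sup>2) sums
     (energy \<mu> (p 0) (q 0) + 2 * (\<integral>s. inner (g s - q s) (q s) \<partial>lebesgue_on {0..t}))"
    unfolding mode_energy[OF dampedD(5)[OF d] t] inner_diff_left .
  with en[OF t] show ?thesis by (rule sums_unique2)
qed

text \<open>Weak form of \<open>p' = q\<close>, summed from the modes by Parseval. It is the form in
  which \<open>chain_rule_L2\<close> takes its curves.\<close>

lemma damped_increment:
  assumes d: "damped \<mu> T p q g" and ab: "0 \<le> a" "a \<le> b" "b \<le> T"
  shows "inner (p b - p a) x = (\<integral>s. inner (q s) x \<partial>lebesgue_on {a..b})"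
proof -
  have from0: "inner (p t) x = inner (p 0) x + (\<integral>s. inner (q s) x \<partial>lebesgue_on {0..t})" if t: "t \<in> {0..T}" for t
  proof -
    have tT: "t \<le> T" using t by simp
    have "(\<lambda>k. inner (p 0) (e k) * inner x (e k) + (\<integral>s. inner (q s) (e k) * inner x (e k) \<partial>lebesgue_on {0..t}))
       sums (inner (p 0) x + (\<integral>s. inner (q s) x \<partial>lebesgue_on {0..t}))"
      by (rule sums_add[OF inner_sums L2on_parseval[OF L2on_sub[OF dampedD(2)[OF d] tT] L2on_const]])
    moreover have "inner (p 0) (e k) * inner x (e k) + (\<integral>s. inner (q s) (e k) * inner x (e k) \<partial>lebesgue_on {0..t})
        = inner (p t) (e k) * inner x (e k)" for k
      unfolding modeD(3)[OF dampedD(5)[OF d] t] by (simp add: distrib_right)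
    ultimately have "(\<lambda>k. inner (p t) (e k) * inner x (e k)) sums (inner (p 0) x + (\<integral>s. inner (q s) x \<partial>lebesgue_on {0..t}))"
      by simp
    with inner_sums show ?thesis by (rule sums_unique2)
  qed
  have "integrable (lebesgue_on {0..b}) (\<lambda>s. inner (q s) x)"
    by (rule L2on_integrable[OF L2on_inner_const[OF L2on_sub[OF dampedD(2)[OF d] ab(3)]]])
  from integral_lebesgue_on_split[OF this ab(1,2)] show ?thesis
    using from0[of a] from0[of b] ab by (simp add: inner_diff_left)
qed

lemma damped_continuous: "damped \<mu> T p q g \<Longrightarrow> continuous_on {0..T} p"
  by (rule L2_primitive_continuous[OF dampedD(2) damped_increment])

lemma damped_norm_increment:
  assumes d: "damped \<mu> T p q g" and s: "s \<in> {0..T}"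
  shows "(norm (p s - p 0))\<^sup>2 \<le> T * (\<integral>s. (norm (q s))\<^sup>2 \<partial>lebesgue_on {0..T})"
proof -
  have q: "integrable (lebesgue_on {0..T}) (\<lambda>s. (norm (q s))\<^sup>2)" using dampedD(2)[OF d] by (simp add: L2on_def)
  have "(norm (p s - p 0))\<^sup>2 \<le> (s - 0) * (\<integral>s. (norm (q s))\<^sup>2 \<partial>lebesgue_on {0..s})"
    using s by (intro L2_increment_bound[OF dampedD(2)[OF d]] damped_increment[OF d]) auto
  also have "\<dots> \<le> T * (\<integral>s. (norm (q s))\<^sup>2 \<partial>lebesgue_on {0..T})"
    using s by (intro mult_mono integral_subinterval_le[OF q]) auto
  finally show ?thesis .
qed

text \<open>\<open>mode_bound\<close> dominates the squared velocity coordinates by a summable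
  sequence independent of \<open>t\<close>. This makes the wave path continuous in the product
  space.\<close>

lemma damped_velocity_continuous:
  assumes d: "damped \<mu> T p q g" and \<mu>: "\<mu> > 0"
  shows "continuous_on {0..T} q"
proof (rule continuous_coords)
  let ?M = "\<lambda>k. (\<alpha> k * (inner (p 0) (e k))\<^sup>2 + \<mu> * (inner (q 0) (e k))\<^sup>2
      + (\<integral>s. inner (g s) (e k) * inner (g s) (e k) \<partial>lebesgue_on {0..T})) / \<mu>"
  have z: "0 \<in> {0..T}" using dampedD(1)[OF d] by simp
  show "summable ?M"
    by (intro summable_divide summable_add summable_mult coord_summable sums_summable[OF stiff_sums[OF dampedD(4)[OF d z]]]
        sums_summable[OF L2on_parseval[OF dampedD(3)[OF d] dampedD(3)[OF d]]])
  show "continuous_on {0..T} (\<lambda>t. inner (q t) (e k))" for k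
    using mode_continuous_velocity[OF dampedD(5)[OF d]] \<mu> by simp
  fix k t assume t: "t \<in> {0..T}"
  let ?q = "\<lambda>s. inner (q s) (e k)" and ?g = "\<lambda>s. inner (g s) (e k)"
  have "integrable (lebesgue_on {0..T}) (\<lambda>s. (?g s)\<^sup>2)"
    using L2on_inner_const[OF dampedD(3)[OF d], of "e k"] by (simp add: L2on_def)
  then have "(\<integral>s. (?g s)\<^sup>2 \<partial>lebesgue_on {0..t}) \<le> (\<integral>s. (?g s)\<^sup>2 \<partial>lebesgue_on {0..T})"
    using t by (intro integral_subinterval_le) auto
  moreover have "0 \<le> \<alpha> k * (inner (p t) (e k))\<^sup>2" using \<alpha>_pos[of k] by simp
  moreover have "0 \<le> (\<integral>s. (?q s)\<^sup>2 \<partial>lebesgue_on {0..t})" by simp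
  ultimately have "\<mu> * (?q t)\<^sup>2 \<le> \<alpha> k * (inner (p 0) (e k))\<^sup>2 + \<mu> * (?q 0)\<^sup>2 + (\<integral>s. (?g s)\<^sup>2 \<partial>lebesgue_on {0..T})"
    using mode_bound[OF dampedD(5)[OF d] t, of k] by linarith
  then show "(?q t)\<^sup>2 \<le> ?M k" using \<mu> by (simp add: field_simps power2_eq_square)
qed

text \<open>Integrability is obtained indirectly: by the energy balance the stiffness is a
  continuous function of time minus \<open>\<mu>\<close> times the squared speed. It then dominates
  its own partial sums, which gives the second claim.\<close>

lemma stiff_integral:
  assumes d: "damped \<mu> T p q g"
  shows "integrable (lebesgue_on {0..T}) (\<lambda>s. stiff (p s))"
    and "(\<lambda>k. \<integral>s. \<alpha> k * (inner (p s) (e k))\<^sup>2 \<partial>lebesgue_on {0..T}) sums (\<integral>s. stiff (p s) \<partial>lebesgue_on {0..T})"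
proof -
  let ?M = "lebesgue_on {0..T}"
  have q2: "integrable ?M (\<lambda>s. (norm (q s))\<^sup>2)" using dampedD(2)[OF d] by (simp add: L2on_def)
  have gi: "integrable ?M (\<lambda>s. inner (g s - q s) (q s))"
    by (rule L2on_inner[OF L2on_diff[OF dampedD(3)[OF d] dampedD(2)[OF d]] dampedD(2)[OF d]])
  define E where "E t = energy \<mu> (p 0) (q 0) + 2 * (\<integral>s. inner (g s - q s) (q s) \<partial>lebesgue_on {0..t})" for t
  have "continuous_on {0..T} E" unfolding E_def
    by (intro continuous_intros indefinite_integral_continuous_real gi)
  then have Ei: "integrable ?M E" by (rule integrable_continuous_lebesgue_on)
  have "integrable ?M (\<lambda>s. E s - \<mu> * (norm (q s))\<^sup>2)" using Ei q2 by simp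
  moreover have "E s - \<mu> * (norm (q s))\<^sup>2 = stiff (p s)" if "s \<in> {0..T}" for s
    using damped_energy[OF d that] by (simp add: E_def energy_def)
  ultimately show i: "integrable ?M (\<lambda>s. stiff (p s))"
    by (subst Bochner_Integration.integrable_cong[of _ _ _ "\<lambda>s. E s - \<mu> * (norm (q s))\<^sup>2"]) auto
  have ik: "integrable ?M (\<lambda>s. \<alpha> k * (inner (p s) (e k))\<^sup>2)" for k
    using mode_L2(1)[OF dampedD(5)[OF d], of k] by (simp add: L2on_def)
  have "(\<lambda>N. \<integral>s. (\<Sum>k<N. \<alpha> k * (inner (p s) (e k))\<^sup>2) \<partial>?M) \<longlonglongrightarrow> (\<integral>s. stiff (p s) \<partial>?M)"
  proof (rule integral_dominated_convergence[where w = "\<lambda>s. stiff (p s)"])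
    show "(\<lambda>s. stiff (p s)) \<in> borel_measurable ?M" using i by simp
    show "(\<lambda>s. \<Sum>k<N. \<alpha> k * (inner (p s) (e k))\<^sup>2) \<in> borel_measurable ?M" for N
      by (intro borel_measurable_sum borel_measurable_integrable[OF ik])
    show "AE s in ?M. (\<lambda>N. \<Sum>k<N. \<alpha> k * (inner (p s) (e k))\<^sup>2) \<longlonglongrightarrow> stiff (p s)"
      using stiff_sums[OF dampedD(4)[OF d]] by (intro AE_I2) (simp add: sums_def)
    show "AE s in ?M. norm (\<Sum>k<N. \<alpha> k * (inner (p s) (e k))\<^sup>2) \<le> stiff (p s)" for N
    proof (rule AE_I2)
      fix s assume "s \<in> space ?M"
      then have s: "summable (\<lambda>k. \<alpha> k * (inner (p s) (e k))\<^sup>2)" using dampedD(4)[OF d, of s] by (simp add: dom_iff)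
      have pos: "0 \<le> \<alpha> k * (inner (p s) (e k))\<^sup>2" for k using \<alpha>_pos[of k] by simp
      show "norm (\<Sum>k<N. \<alpha> k * (inner (p s) (e k))\<^sup>2) \<le> stiff (p s)"
        using sum_le_suminf[OF s, of "{..<N}"] pos by (simp add: stiff_def sum_nonneg)
    qed
  qed fact
  then show "(\<lambda>k. \<integral>s. \<alpha> k * (inner (p s) (e k))\<^sup>2 \<partial>?M) sums (\<integral>s. stiff (p s) \<partial>?M)"
    unfolding sums_def using ik by simp
qed

lemma damped_virial:
  assumes d: "damped \<mu> T p q g"
  shows "\<mu> * inner (q T) (p T) + (norm (p T))\<^sup>2 / 2 = \<mu> * inner (q 0) (p 0) + (norm (p 0))\<^sup>2 / 2
    + (\<integral>s. \<mu> * (norm (q s))\<^sup>2 + inner (p s) (g s) \<partial>lebesgue_on {0..T}) - (\<integral>s. stiff (p s) \<partial>lebesgue_on {0..T})"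
proof -
  let ?M = "lebesgue_on {0..T}"
  have T: "T \<in> {0..T}" using dampedD(1)[OF d] by simp
  have pL: "L2on T p" by (rule L2on_continuous[OF damped_continuous[OF d]])
  note L = dampedD(2,3)[OF d]
  have q2: "integrable ?M (\<lambda>s. (norm (q s))\<^sup>2)" using L by (simp add: L2on_def)
  have pg: "integrable ?M (\<lambda>s. inner (p s) (g s))" by (rule L2on_inner[OF pL L(2)])
  have b: "(\<lambda>k. \<mu> * (inner (q t) (e k) * inner (p t) (e k)) + (inner (p t) (e k))\<^sup>2 / 2)
     sums (\<mu> * inner (q t) (p t) + (norm (p t))\<^sup>2 / 2)" for t
    by (intro sums_add sums_mult sums_divide inner_sums parseval)
  have "(\<lambda>k. \<mu> * (\<integral>s. inner (q s) (e k) * inner (q s) (e k) \<partial>?M) + (\<integral>s. inner (p s) (e k) * inner (g s) (e k) \<partial>?M))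
     sums (\<mu> * (\<integral>s. inner (q s) (q s) \<partial>?M) + (\<integral>s. inner (p s) (g s) \<partial>?M))"
    by (intro sums_add sums_mult L2on_parseval L pL)
  moreover have "\<mu> * (\<integral>s. inner (q s) (e k) * inner (q s) (e k) \<partial>?M) + (\<integral>s. inner (p s) (e k) * inner (g s) (e k) \<partial>?M)
     = (\<integral>s. \<mu> * (inner (q s) (e k))\<^sup>2 + inner (p s) (e k) * inner (g s) (e k) \<partial>?M)" for k
  proof -
    have "integrable ?M (\<lambda>s. (inner (q s) (e k))\<^sup>2)" using L2on_inner_const[OF L(1), of "e k"] by (simp add: L2on_def)
    moreover have "integrable ?M (\<lambda>s. inner (p s) (e k) * inner (g s) (e k))"
      by (rule L2on_mult[OF L2on_inner_const[OF pL] L2on_inner_const[OF L(2)]])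
    ultimately show ?thesis by (simp add: power2_eq_square)
  qed
  moreover have "\<mu> * (\<integral>s. inner (q s) (q s) \<partial>?M) + (\<integral>s. inner (p s) (g s) \<partial>?M)
     = (\<integral>s. \<mu> * (norm (q s))\<^sup>2 + inner (p s) (g s) \<partial>?M)"
    using q2 pg by (simp add: power2_norm_eq_inner)
  ultimately have "(\<lambda>k. \<integral>s. \<mu> * (inner (q s) (e k))\<^sup>2 + inner (p s) (e k) * inner (g s) (e k) \<partial>?M)
     sums (\<integral>s. \<mu> * (norm (q s))\<^sup>2 + inner (p s) (g s) \<partial>?M)" by simp
  from sums_diff[OF sums_add[OF b[of 0] this] stiff_integral(2)[OF d]]
  have "(\<lambda>k. \<mu> * (inner (q T) (e k) * inner (p T) (e k)) + (inner (p T) (e k))\<^sup>2 / 2) sums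
    (\<mu> * inner (q 0) (p 0) + (norm (p 0))\<^sup>2 / 2
    + (\<integral>s. \<mu> * (norm (q s))\<^sup>2 + inner (p s) (g s) \<partial>?M) - (\<integral>s. stiff (p s) \<partial>?M))"
    unfolding mode_virial[OF dampedD(5)[OF d] T] .
  with b[of T] show ?thesis by (rule sums_unique2)
qed

text \<open>Every mode is solved separately. \<open>mode_bound\<close> and the summability of the
  data give one summable majorant \<open>?B\<close>, which makes the stiffness of the position
  finite and the velocity square-integrable; \<open>L2on_riesz_fischer\<close> assembles the
  velocity.\<close>

lemma damped_exists:
  assumes \<mu>: "0 \<le> \<mu>" and T: "0 \<le> T" and g: "L2on T g" and x: "x \<in> dom_sqrt_A e \<alpha>"
  obtains p q where "damped \<mu> T p q g" "p 0 = x" "\<mu> \<noteq> 0 \<Longrightarrow> q 0 = y"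
proof -
  let ?g = "\<lambda>k s. inner (g s) (e k)"
  have "\<forall>k. \<exists>pq. mode \<mu> (\<alpha> k) T (fst pq) (snd pq) (?g k) \<and> fst pq 0 = inner x (e k) \<and>
      (\<mu> \<noteq> 0 \<longrightarrow> snd pq 0 = inner y (e k))"
  proof
    fix k
    obtain p q where "mode \<mu> (\<alpha> k) T p q (?g k)" "p 0 = inner x (e k)" "\<mu> \<noteq> 0 \<longrightarrow> q 0 = inner y (e k)"
      using mode_exists[OF \<mu> L2on_inner_const[OF g, of "e k"], of "\<alpha> k" "inner x (e k)" "inner y (e k)"] by auto
    then show "\<exists>pq. mode \<mu> (\<alpha> k) T (fst pq) (snd pq) (?g k) \<and> fst pq 0 = inner x (e k) \<and>
      (\<mu> \<noteq> 0 \<longrightarrow> snd pq 0 = inner y (e k))" by (intro exI[of _ "(p, q)"]) simp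
  qed
  then obtain pq where pq: "\<And>k. mode \<mu> (\<alpha> k) T (fst (pq k)) (snd (pq k)) (?g k)"
    "\<And>k. fst (pq k) 0 = inner x (e k)" "\<And>k. \<mu> \<noteq> 0 \<Longrightarrow> snd (pq k) 0 = inner y (e k)"
    using choice by metis
  define P R where "P k = fst (pq k)" and "R k = snd (pq k)" for k
  have m: "mode \<mu> (\<alpha> k) T (P k) (R k) (?g k)" for k using pq(1) by (simp add: P_def R_def)
  have P0: "P k 0 = inner x (e k)" and R0: "\<mu> \<noteq> 0 \<Longrightarrow> R k 0 = inner y (e k)" for k
    using pq(2,3) by (simp_all add: P_def R_def)
  \<comment> \<open>The right-hand side of \<open>mode_bound\<close> on the whole interval; for
    \<open>\<mu> = 0\<close> the prescribed velocity \<open>y\<close> drops out through its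
    factor.\<close>
  let ?B = "\<lambda>k. \<alpha> k * (inner x (e k))\<^sup>2 + \<mu> * (inner y (e k))\<^sup>2 + (\<integral>s. ?g k s * ?g k s \<partial>lebesgue_on {0..T})"
  have sB: "summable ?B"
    by (intro summable_add summable_mult coord_summable sums_summable[OF stiff_sums[OF x]]
        sums_summable[OF L2on_parseval[OF g g]])
  have bd: "\<alpha> k * (P k t)\<^sup>2 + \<mu> * (R k t)\<^sup>2 + (\<integral>s. (R k s)\<^sup>2 \<partial>lebesgue_on {0..t}) \<le> ?B k" if t: "t \<in> {0..T}" for k t
  proof -
    have "integrable (lebesgue_on {0..T}) (\<lambda>s. (?g k s)\<^sup>2)"
      using L2on_inner_const[OF g, of "e k"] by (simp add: L2on_def)
    then have "(\<integral>s. (?g k s)\<^sup>2 \<partial>lebesgue_on {0..t}) \<le> (\<integral>s. (?g k s)\<^sup>2 \<partial>lebesgue_on {0..T})"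
      using t by (intro integral_subinterval_le) auto
    moreover have "\<mu> * (R k 0)\<^sup>2 = \<mu> * (inner y (e k))\<^sup>2" using R0 by (cases "\<mu> = 0") simp_all
    ultimately show ?thesis using mode_bound[OF m t, of k] unfolding P0 power2_eq_square by linarith
  qed
  have parts: "\<alpha> k * (P k t)\<^sup>2 \<le> ?B k" "\<mu> * (R k t)\<^sup>2 \<le> ?B k" "(\<integral>s. (R k s)\<^sup>2 \<partial>lebesgue_on {0..t}) \<le> ?B k"
    if t: "t \<in> {0..T}" for k t
  proof -
    have "0 \<le> \<alpha> k * (P k t)\<^sup>2" "0 \<le> \<mu> * (R k t)\<^sup>2" "0 \<le> (\<integral>s. (R k s)\<^sup>2 \<partial>lebesgue_on {0..t})"
      using \<alpha>_pos[of k] \<mu> by simp_all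
    then show "\<alpha> k * (P k t)\<^sup>2 \<le> ?B k" "\<mu> * (R k t)\<^sup>2 \<le> ?B k" "(\<integral>s. (R k s)\<^sup>2 \<partial>lebesgue_on {0..t}) \<le> ?B k"
      using bd[OF t, of k] by linarith+
  qed
  have sP: "summable (\<lambda>k. \<alpha> k * (P k t)\<^sup>2)" if t: "t \<in> {0..T}" for t
    by (rule summable_comparison_test'[OF sB, of 0]) (use parts(1)[OF t] \<alpha>_pos in \<open>simp add: less_imp_le\<close>)
  have sP2: "summable (\<lambda>k. (P k t)\<^sup>2)" if t: "t \<in> {0..T}" for t
  proof (rule summable_comparison_test'[OF summable_divide[OF sP[OF t], of "\<alpha> 0"], of 0])
    fix k
    have "\<alpha> 0 * (P k t)\<^sup>2 \<le> \<alpha> k * (P k t)\<^sup>2" by (rule mult_right_mono[OF \<alpha>_ge]) simp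
    then show "norm ((P k t)\<^sup>2) \<le> \<alpha> k * (P k t)\<^sup>2 / \<alpha> 0" using \<alpha>_pos0 by (simp add: field_simps)
  qed
  have sR2: "summable (\<lambda>k. (R k t)\<^sup>2)" if t: "t \<in> {0..T}" "\<mu> \<noteq> 0" for t
  proof (rule summable_comparison_test'[OF summable_divide[OF sB, of \<mu>], of 0])
    fix k
    show "norm ((R k t)\<^sup>2) \<le> ?B k / \<mu>" using parts(2)[OF t(1), of k] \<mu> t(2) by (simp add: pos_le_divide_eq mult.commute)
  qed
  have TT: "T \<in> {0..T}" using T by simp
  have pos: "0 \<le> ?B k" for k
    using parts(1)[OF TT, of k] \<alpha>_pos[of k] by (meson less_imp_le mult_nonneg_nonneg order_trans zero_le_power2)
  obtain q where q: "L2on T q" "\<And>k. AE s in lebesgue_on {0..T}. inner (q s) (e k) = R k s"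
    "\<And>s k. summable (\<lambda>k. (R k s)\<^sup>2) \<Longrightarrow> inner (q s) (e k) = R k s"
  proof (rule L2on_riesz_fischer[of T R "suminf ?B"])
    show "L2on T (R k)" for k by (rule mode_L2(2)[OF m])
    fix N
    have "(\<Sum>k<N. \<integral>s. (R k s)\<^sup>2 \<partial>lebesgue_on {0..T}) \<le> (\<Sum>k<N. ?B k)"
      by (rule sum_mono) (rule parts(3)[OF TT])
    also have "\<dots> \<le> suminf ?B" by (rule sum_le_suminf[OF sB]) (simp_all only: pos finite_lessThan)
    finally show "(\<Sum>k<N. \<integral>s. (R k s)\<^sup>2 \<partial>lebesgue_on {0..T}) \<le> suminf ?B" .
  qed (rule that)
  define p where "p t = vec (\<lambda>k. P k t)" for t
  have pc: "inner (p t) (e k) = P k t" if "t \<in> {0..T}" for t k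
    unfolding p_def by (rule vec_coord[OF sP2[OF that]])
  have "damped \<mu> T p q g"
    unfolding damped_def
  proof (intro conjI allI ballI)
    show "p t \<in> dom_sqrt_A e \<alpha>" if "t \<in> {0..T}" for t
      unfolding dom_iff pc[OF that] by (rule sP[OF that])
    show "mode \<mu> (\<alpha> k) T (\<lambda>s. inner (p s) (e k)) (\<lambda>s. inner (q s) (e k)) (?g k)" for k
      by (rule mode_cong[OF m pc L2on_inner_const[OF q(1)] q(2) q(3)[OF sR2] T])
  qed (use T q(1) g in simp_all)
  moreover have "p 0 = x" by (rule coord_eqI) (use T in \<open>simp add: pc P0\<close>)
  moreover have "q 0 = y" if "\<mu> \<noteq> 0"
    by (rule coord_eqI) (use T q(3)[OF sR2] R0 that in simp)
  ultimately show thesis by (rule that)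
qed

lemma damped_restrict:
  assumes d: "damped \<mu> T p q g" and "0 \<le> S" "S \<le> T"
  shows "damped \<mu> S p q g"
  unfolding damped_def
proof (intro conjI allI ballI)
  show "mode \<mu> (\<alpha> k) S (\<lambda>s. inner (p s) (e k)) (\<lambda>s. inner (q s) (e k)) (\<lambda>s. inner (g s) (e k))" for k
    by (rule mode_restrict[OF dampedD(5)[OF d] assms(3)])
  show "p t \<in> dom_sqrt_A e \<alpha>" if "t \<in> {0..S}" for t using dampedD(4)[OF d, of t] that assms(3) by simp
qed (use assms L2on_sub[OF dampedD(2)[OF d]] L2on_sub[OF dampedD(3)[OF d]] in simp_all)

lemma damped_reverse:
  assumes d: "damped \<mu> T p q g"
  shows "damped \<mu> T (\<lambda>t. p (T - t)) (\<lambda>t. - q (T - t)) (\<lambda>t. g (T - t) - 2 *\<^sub>R q (T - t))"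
  unfolding damped_def
proof (intro conjI allI ballI)
  note L = dampedD(2,3)[OF d, THEN L2on_reflect]
  show "L2on T (\<lambda>t. - q (T - t))" "L2on T (\<lambda>t. g (T - t) - 2 *\<^sub>R q (T - t))"
    by (rule L2on_minus[OF L(1)] L2on_diff[OF L(2) L2on_scaleR[OF L(1)]])+
  show "p (T - t) \<in> dom_sqrt_A e \<alpha>" if "t \<in> {0..T}" for t by (rule dampedD(4)[OF d]) (use that in auto)
  show "mode \<mu> (\<alpha> k) T (\<lambda>s. inner (p (T - s)) (e k)) (\<lambda>s. inner (- q (T - s)) (e k))
     (\<lambda>s. inner (g (T - s) - 2 *\<^sub>R q (T - s)) (e k))" for k
    using mode_reverse[OF dampedD(5)[OF d, of k] dampedD(1)[OF d]] by (simp add: inner_diff_left)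
qed (rule dampedD(1)[OF d])

lemma damped_join:
  assumes d1: "damped \<mu> S p1 q1 g1" and d2: "damped \<mu> T p2 q2 g2"
    and p: "p2 0 = p1 S" and q: "\<mu> \<noteq> 0 \<Longrightarrow> q2 0 = q1 S"
  shows "damped \<mu> (S + T) (join S p1 p2) (join S q1 q2) (join S g1 g2)"
  unfolding damped_def
proof (intro conjI allI ballI)
  note ST = dampedD(1)[OF d1] dampedD(1)[OF d2]
  show "0 \<le> S + T" using ST by simp
  show "L2on (S + T) (join S q1 q2)" "L2on (S + T) (join S g1 g2)"
    by (rule L2on_join[OF dampedD(2)[OF d1] dampedD(2)[OF d2] ST] L2on_join[OF dampedD(3)[OF d1] dampedD(3)[OF d2] ST])+
  show "join S p1 p2 t \<in> dom_sqrt_A e \<alpha>" if "t \<in> {0..S + T}" for t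
    using dampedD(4)[OF d1, of t] dampedD(4)[OF d2, of "t - S"] that by (simp add: join_def)
  have j: "(\<lambda>s. inner (join S f1 f2 s) x) = join S (\<lambda>s. inner (f1 s) x) (\<lambda>s. inner (f2 s) x)"
    for f1 f2 :: "real \<Rightarrow> 'h" and x by (auto simp: join_def fun_eq_iff)
  show "mode \<mu> (\<alpha> k) (S + T) (\<lambda>s. inner (join S p1 p2 s) (e k)) (\<lambda>s. inner (join S q1 q2 s) (e k))
      (\<lambda>s. inner (join S g1 g2 s) (e k))" for k
    unfolding j by (rule mode_join[OF dampedD(5)[OF d1] dampedD(5)[OF d2] ST]) (use p q in simp_all)
qed

text \<open>Identifies a damped path from rest with an explicit scalar solution for the same
  forcing; this is the link to the convolutions in the mild formulation.\<close>

lemma damped_unique_coords: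
  assumes d: "damped \<mu> T p q g" and "0 \<le> \<mu>" and "p 0 = 0" "\<mu> \<noteq> 0 \<Longrightarrow> q 0 = 0"
    and m: "mode \<mu> (\<alpha> k) T P R (\<lambda>s. inner (g s) (e k))" "P 0 = 0" "\<mu> \<noteq> 0 \<Longrightarrow> R 0 = 0" and t: "t \<in> {0..T}"
  shows "inner (p t) (e k) = P t" "\<mu> \<noteq> 0 \<Longrightarrow> inner (q t) (e k) = R t"
  using mode_unique[OF dampedD(5)[OF d] m(1) \<alpha>_pos assms(2) _ _ t] assms(3,4) m(2,3) by simp_all

end

section \<open>Steering to rest\<close>

text \<open>\<open>\<mu>\<close> may vanish, so that heat and wave equation are treated together.
  For \<open>\<mu> = 0\<close> velocities at single times are left free, which explains the guards
  \<open>\<mu> \<noteq> 0\<close> below.\<close>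

locale gradient_system = spectral e \<alpha>
  for e :: "nat \<Rightarrow> 'h::{real_inner, complete_space, second_countable_topology}" and \<alpha> +
  fixes \<Phi> :: "'h \<Rightarrow> real" and G :: "'h \<Rightarrow> 'h" and \<kappa> \<mu> :: real
  assumes grad: "\<And>x. GDERIV \<Phi> x :> G x"
    and lip: "\<And>x y. norm (G x - G y) \<le> \<kappa> * norm (x - y)" and \<kappa>: "0 \<le> \<kappa>"
    and \<Phi>_0 [simp]: "\<Phi> 0 = 0" and \<Phi>_nonneg: "\<And>x. 0 \<le> \<Phi> x"
    and radial: "\<And>x. 0 \<le> inner (G x) x"
    and \<mu>: "0 \<le> \<mu>"
begin

text \<open>Squared norm of the control: the forcing is \<open>g = \<psi> - G p\<close>, so
  \<open>g + G p\<close> recovers \<open>\<psi>\<close>.\<close>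

definition residual :: "real \<Rightarrow> (real \<Rightarrow> 'h) \<Rightarrow> (real \<Rightarrow> 'h) \<Rightarrow> real" where
  "residual T p g = (\<integral>s. (norm (g s + G (p s)))\<^sup>2 \<partial>lebesgue_on {0..T})"

definition total :: "'h \<Rightarrow> 'h \<Rightarrow> real" where
  "total x v = energy \<mu> x v + 2 * \<Phi> x"

section \<open>Energy balance and the lower bound for the cost\<close>

lemma continuous_G: "continuous_on S G"
  by (rule lipschitz_on_continuous_on[of \<kappa>]) (auto simp: lipschitz_on_def dist_norm \<kappa> lip)

text \<open>The origin is a global minimum of \<open>\<Phi>\<close>.\<close>

lemma G_0: "G 0 = 0"
proof -
  have "(\<Phi> has_derivative (\<lambda>h. inner h (G 0))) (at 0)" using grad[of 0] by (simp add: gderiv_def)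
  then have "(\<lambda>h. inner h (G 0)) = (\<lambda>h. 0)"
    by (rule differential_zero_maxmin[of 0 UNIV \<Phi>, rotated 2]) (auto simp: \<Phi>_nonneg)
  then have "inner (G 0) (G 0) = 0" by (rule fun_cong)
  then show ?thesis by simp
qed

lemma norm_G: "norm (G x) \<le> \<kappa> * norm x"
  using lip[of x 0] by (simp add: G_0)

lemma L2on_path: "damped \<mu> T p q g \<Longrightarrow> L2on T p"
  by (rule L2on_continuous[OF damped_continuous])

lemma L2on_G_path: "damped \<mu> T p q g \<Longrightarrow> L2on T (\<lambda>s. G (p s))"
  by (intro L2on_continuous continuous_on_compose2[OF continuous_G damped_continuous]) auto

lemma L2on_residual: "damped \<mu> T p q g \<Longrightarrow> L2on T (\<lambda>s. g s + G (p s))"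
  by (rule L2on_add[OF dampedD(3) L2on_G_path])

text \<open>The chain rule converts the work of the gradient force into the increment of
  \<open>2 * \<Phi>\<close>; what remains is the work of the control and the dissipation.\<close>

lemma total_balance:
  assumes d: "damped \<mu> T p q g" and t: "t \<in> {0..T}"
  shows "total (p t) (q t) = total (p 0) (q 0)
    + 2 * (\<integral>s. inner (g s + G (p s)) (q s) \<partial>lebesgue_on {0..t}) - 2 * (\<integral>s. (norm (q s))\<^sup>2 \<partial>lebesgue_on {0..t})"
proof -
  let ?M = "lebesgue_on {0..t}"
  have dt: "damped \<mu> t p q g" by (rule damped_restrict[OF d]) (use t in auto)
  note L = dampedD(2,3)[OF dt]
  have i: "integrable ?M (\<lambda>s. inner (g s) (q s))" "integrable ?M (\<lambda>s. inner (q s) (q s))"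
    "integrable ?M (\<lambda>s. inner (G (p s)) (q s))"
    by (rule L2on_inner[OF L(2,1)] L2on_inner[OF L(1,1)] L2on_inner[OF L2on_G_path[OF dt] L(1)])+
  have "\<Phi> (p t) - \<Phi> (p 0) = (\<integral>s. inner (G (p s)) (q s) \<partial>?M)"
    by (rule chain_rule_L2[OF dampedD(2)[OF d] damped_increment[OF d] grad lip \<kappa> t])
  then show ?thesis
    using damped_energy[OF d t] i by (simp add: total_def inner_diff_left inner_add_left power2_norm_eq_inner)
qed

lemma lower_bound:
  assumes d: "damped \<mu> T p q g" and "p 0 = 0" "\<mu> \<noteq> 0 \<Longrightarrow> q 0 = 0"
  shows "total (p T) (q T) \<le> residual T p g / 2"
proof -
  let ?M = "lebesgue_on {0..T}"
  have T: "T \<in> {0..T}" using dampedD(1)[OF d] by simp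
  have z: "total (p 0) (q 0) = 0" unfolding total_def energy_def using assms by (cases "\<mu> = 0") simp_all
  have i: "integrable ?M (\<lambda>s. inner (g s + G (p s)) (q s))" "integrable ?M (\<lambda>s. (norm (q s))\<^sup>2)"
    "integrable ?M (\<lambda>s. (norm (g s + G (p s)))\<^sup>2)"
    using L2on_inner[OF L2on_residual[OF d] dampedD(2)[OF d]] dampedD(2)[OF d] L2on_residual[OF d]
    by (simp_all add: L2on_def)
  have "total (p T) (q T) = (\<integral>s. 2 * inner (g s + G (p s)) (q s) - 2 * (norm (q s))\<^sup>2 \<partial>?M)"
    using total_balance[OF d T] i by (simp add: z)
  also have "\<dots> \<le> (\<integral>s. (norm (g s + G (p s)))\<^sup>2 / 2 \<partial>?M)"
  proof (rule integral_mono)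
    have "2 * inner a b - 2 * (norm b)\<^sup>2 \<le> (norm a)\<^sup>2 / 2" for a b :: 'h
    proof -
      have "0 \<le> (norm (a - 2 *\<^sub>R b))\<^sup>2 / 2" by simp
      also have "\<dots> = (norm a)\<^sup>2 / 2 - 2 * inner a b + 2 * (norm b)\<^sup>2"
        by (simp add: power2_norm_eq_inner inner_diff_left inner_diff_right inner_commute[of b a])
      finally show ?thesis by linarith
    qed
    then show "2 * inner (g s + G (p s)) (q s) - 2 * (norm (q s))\<^sup>2 \<le> (norm (g s + G (p s)))\<^sup>2 / 2" for s .
  qed (use i in simp_all)
  finally show ?thesis by (simp add: residual_def)
qed

text \<open>On a short interval the nonlinearity is frozen at its initial value, so that the equation is linear
  and the error is controlled by the dissipation.\<close>

lemma step:
  assumes h: "0 \<le> h" and a: "a \<in> dom_sqrt_A e \<alpha>"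
  obtains p q g where "damped \<mu> h p q g" "p 0 = a" "\<mu> \<noteq> 0 \<Longrightarrow> q 0 = b"
    "residual h p g \<le> (\<kappa> * h)\<^sup>2 * (\<integral>s. (norm (q s))\<^sup>2 \<partial>lebesgue_on {0..h})"
proof -
  obtain p q where d: "damped \<mu> h p q (\<lambda>_. - G a)" and p0: "p 0 = a" and q0: "\<mu> \<noteq> 0 \<Longrightarrow> q 0 = b"
    using damped_exists[OF \<mu> h L2on_const a, of "- G a" b] by blast
  let ?N = "\<integral>s. (norm (q s))\<^sup>2 \<partial>lebesgue_on {0..h}"
  \<comment> \<open>The squared displacement is at most \<open>h\<close> times the dissipation;
    integrating it over the step brings the second factor \<open>h\<close>.\<close>
  have "residual h p (\<lambda>_. - G a) \<le> (\<integral>s. \<kappa>\<^sup>2 * (h * ?N) \<partial>lebesgue_on {0..h})"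
    unfolding residual_def
  proof (rule integral_mono)
    show "integrable (lebesgue_on {0..h}) (\<lambda>s. (norm (- G a + G (p s)))\<^sup>2)"
      using L2on_residual[OF d] by (simp add: L2on_def)
    show "integrable (lebesgue_on {0..h}) (\<lambda>s. \<kappa>\<^sup>2 * (h * ?N))"
      by (rule integrable_continuous_lebesgue_on) simp
    fix s assume "s \<in> space (lebesgue_on {0..h})"
    then have s: "s \<in> {0..h}" by simp
    have "(norm (- G a + G (p s)))\<^sup>2 \<le> (\<kappa> * norm (p s - p 0))\<^sup>2"
      using lip[of "p s" a] by (intro power_mono) (simp_all add: p0)
    also have "\<dots> = \<kappa>\<^sup>2 * (norm (p s - p 0))\<^sup>2" by (rule power_mult_distrib)
    also have "\<dots> \<le> \<kappa>\<^sup>2 * (h * ?N)" by (rule mult_left_mono[OF damped_norm_increment[OF d s]]) simp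
    finally show "(norm (- G a + G (p s)))\<^sup>2 \<le> \<kappa>\<^sup>2 * (h * ?N)" .
  qed
  also have "\<dots> = (\<kappa> * h)\<^sup>2 * ?N" using h by (simp add: measure_restrict_space power2_eq_square mult_ac)
  finally show thesis using that[OF d p0 q0] by blast
qed

section \<open>Long paths from short steps\<close>

lemma residual_join:
  assumes d1: "damped \<mu> S p1 q1 g1" and d2: "damped \<mu> T p2 q2 g2"
  shows "residual (S + T) (join S p1 p2) (join S g1 g2) = residual S p1 g1 + residual T p2 g2"
proof -
  have "(norm (join S g1 g2 s + G (join S p1 p2 s)))\<^sup>2
      = join S (\<lambda>s. (norm (g1 s + G (p1 s)))\<^sup>2) (\<lambda>s. (norm (g2 s + G (p2 s)))\<^sup>2) s" for s
    by (simp add: join_def)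
  then show ?thesis unfolding residual_def
    using L2on_residual[OF d1] L2on_residual[OF d2] dampedD(1)[OF d1] dampedD(1)[OF d2]
    by (simp add: integral_join L2on_def)
qed

lemma dissipation_join:
  assumes d1: "damped \<mu> S p1 q1 g1" and d2: "damped \<mu> T p2 q2 g2"
  shows "(\<integral>s. (norm (join S q1 q2 s))\<^sup>2 \<partial>lebesgue_on {0..S + T})
    = (\<integral>s. (norm (q1 s))\<^sup>2 \<partial>lebesgue_on {0..S}) + (\<integral>s. (norm (q2 s))\<^sup>2 \<partial>lebesgue_on {0..T})"
proof -
  have "(norm (join S q1 q2 s))\<^sup>2 = join S (\<lambda>s. (norm (q1 s))\<^sup>2) (\<lambda>s. (norm (q2 s))\<^sup>2) s" for s
    by (simp add: join_def)
  then show ?thesis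
    using dampedD(2)[OF d1] dampedD(2)[OF d2] dampedD(1)[OF d1] dampedD(1)[OF d2]
    by (simp add: integral_join L2on_def)
qed

text \<open>Residual and dissipation are both additive under \<open>join\<close>, so the factor
  \<open>(\<kappa> * h)\<^sup>2\<close> of a single step survives for any number of steps. With
  \<open>Suc n\<close> the path has at least one step.\<close>

lemma steps:
  assumes h: "0 \<le> h" and a: "a \<in> dom_sqrt_A e \<alpha>"
  shows "\<exists>p q g. damped \<mu> (real (Suc n) * h) p q g \<and> p 0 = a \<and> (\<mu> \<noteq> 0 \<longrightarrow> q 0 = b) \<and>
    residual (real (Suc n) * h) p g \<le> (\<kappa> * h)\<^sup>2 * (\<integral>s. (norm (q s))\<^sup>2 \<partial>lebesgue_on {0..real (Suc n) * h})"
proof (induction n)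
  case 0
  obtain p q g where "damped \<mu> h p q g" "p 0 = a" "\<mu> \<noteq> 0 \<Longrightarrow> q 0 = b"
    "residual h p g \<le> (\<kappa> * h)\<^sup>2 * (\<integral>s. (norm (q s))\<^sup>2 \<partial>lebesgue_on {0..h})"
    using step[OF h a, of b] by blast
  then show ?case by (intro exI[of _ p] exI[of _ q] exI[of _ g]) simp
next
  case (Suc n)
  let ?S = "real (Suc n) * h"
  obtain p q g where d: "damped \<mu> ?S p q g" and p0: "p 0 = a" and q0: "\<mu> \<noteq> 0 \<longrightarrow> q 0 = b"
    and r: "residual ?S p g \<le> (\<kappa> * h)\<^sup>2 * (\<integral>s. (norm (q s))\<^sup>2 \<partial>lebesgue_on {0..?S})"
    using Suc.IH by blast
  have S: "0 \<le> ?S" using h by simp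
  then have "p ?S \<in> dom_sqrt_A e \<alpha>" by (intro dampedD(4)[OF d]) simp
  from step[OF h this, of "q ?S"] obtain p2 q2 g2 where d2: "damped \<mu> h p2 q2 g2"
    and p2: "p2 0 = p ?S" and q2: "\<mu> \<noteq> 0 \<Longrightarrow> q2 0 = q ?S"
    and r2: "residual h p2 g2 \<le> (\<kappa> * h)\<^sup>2 * (\<integral>s. (norm (q2 s))\<^sup>2 \<partial>lebesgue_on {0..h})" by blast
  have e: "real (Suc (Suc n)) * h = ?S + h" by (simp add: algebra_simps)
  have "residual (?S + h) (join ?S p p2) (join ?S g g2)
      \<le> (\<kappa> * h)\<^sup>2 * (\<integral>s. (norm (join ?S q q2 s))\<^sup>2 \<partial>lebesgue_on {0..?S + h})"
    unfolding residual_join[OF d d2] dissipation_join[OF d d2] using r r2 by (simp only: distrib_left add_mono)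
  moreover have "join ?S p p2 0 = a" "\<mu> \<noteq> 0 \<longrightarrow> join ?S q q2 0 = b"
    using S p0 q0 by (simp_all add: join_def)
  ultimately show ?case
    unfolding e using damped_join[OF d d2 p2 q2]
    by (intro exI[of _ "join ?S p p2"] exI[of _ "join ?S q q2"] exI[of _ "join ?S g g2"]) simp
qed

text \<open>Read off from the virial identity, in units of the initial total energy: the two
  boundary terms cost \<open>1 / 2 + (\<mu> + 1) / (2 * \<alpha> 0)\<close> each, the kinetic
  integral \<open>2 * \<mu>\<close>, the control \<open>1 / \<alpha> 0\<close>. The outer factor 2
  undoes the half of the stiffness spent in Young's inequality, and the last
  \<open>2 * \<mu>\<close> adds the kinetic part of the energy.\<close>

definition decay_const :: real where
  "decay_const = 2 * (2 * (1 / 2 + (\<mu> + 1) / (2 * \<alpha> 0)) + 2 * \<mu> + 1 / \<alpha> 0) + 2 * \<mu>"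

text \<open>The energy balance bounds the dissipation by twice the initial total energy, whatever
  the horizon. The virial identity then bounds the time integral of the stiffness, the nonlinear
  term being dropped by its sign.\<close>

lemma decay:
  assumes d: "damped \<mu> T p q g" and \<epsilon>: "0 \<le> \<epsilon>" "\<epsilon> \<le> 1 / 2"
    and r: "residual T p g \<le> \<epsilon>\<^sup>2 * (\<integral>s. (norm (q s))\<^sup>2 \<partial>lebesgue_on {0..T})"
  shows "residual T p g \<le> \<epsilon>\<^sup>2 * (2 * total (p 0) (q 0))"
    and "(\<integral>s. energy \<mu> (p s) (q s) \<partial>lebesgue_on {0..T}) \<le> decay_const * total (p 0) (q 0)"
proof -
  let ?M = "lebesgue_on {0..T}"
  define N R E0 X where "N = (\<integral>s. (norm (q s))\<^sup>2 \<partial>?M)" and "R = residual T p g" and "E0 = total (p 0) (q 0)"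
    and "X = (\<integral>s. stiff (p s) \<partial>?M)"
  have TT: "T \<in> {0..T}" "0 \<in> {0..T}" using dampedD(1)[OF d] by auto
  note pd = dampedD(4)[OF d]
  have N0: "0 \<le> N" and R0: "0 \<le> R" by (simp_all add: N_def R_def residual_def)
  have i: "integrable ?M (\<lambda>s. inner (g s + G (p s)) (q s))" "integrable ?M (\<lambda>s. (norm (q s))\<^sup>2)"
    "integrable ?M (\<lambda>s. (norm (g s + G (p s)))\<^sup>2)" "integrable ?M (\<lambda>s. inner (p s) (g s))"
    "integrable ?M (\<lambda>s. stiff (p s))"
    using L2on_inner[OF L2on_residual[OF d] dampedD(2)[OF d]] dampedD(2)[OF d] L2on_residual[OF d]
      L2on_inner[OF L2on_path[OF d] dampedD(3)[OF d]] stiff_integral(1)[OF d]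
    by (simp_all add: L2on_def)
  have "2 * (\<integral>s. inner (g s + G (p s)) (q s) \<partial>?M) \<le> R + N"
  proof -
    have "2 * (\<integral>s. inner (g s + G (p s)) (q s) \<partial>?M) = (\<integral>s. 2 * inner (g s + G (p s)) (q s) \<partial>?M)" by simp
    also have "\<dots> \<le> (\<integral>s. (norm (g s + G (p s)))\<^sup>2 + (norm (q s))\<^sup>2 \<partial>?M)"
    proof (rule integral_mono)
      have "2 * inner a b \<le> (norm a)\<^sup>2 + (norm b)\<^sup>2" for a b :: 'h
        using zero_le_power2[of "norm (a - b)"]
        by (simp add: power2_norm_eq_inner inner_diff_left inner_diff_right inner_commute[of b a])
      then show "2 * inner (g s + G (p s)) (q s) \<le> (norm (g s + G (p s)))\<^sup>2 + (norm (q s))\<^sup>2" for s .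
    qed (use i in simp_all)
    also have "\<dots> = R + N" using i by (simp add: R_def residual_def N_def)
    finally show ?thesis .
  qed
  then have bal: "total (p T) (q T) + N \<le> E0 + R"
    using total_balance[OF d TT(1)] by (simp add: N_def E0_def)
  have tot0: "0 \<le> total x v" "energy \<mu> x v \<le> total x v" if "x \<in> dom_sqrt_A e \<alpha>" for x v
    using energy_nonneg[OF that \<mu>, of v] \<Phi>_nonneg[of x] by (simp_all add: total_def)
  \<comment> \<open>\<open>\<epsilon> \<le> 1 / 2\<close> makes the residual at most a quarter of
    the dissipation, which \<open>bal\<close> absorbs on its left.\<close>
  have e4: "\<epsilon>\<^sup>2 \<le> 1 / 4" using power_mono[OF \<epsilon>(2,1), of 2] by (simp add: power2_eq_square)
  then have RN: "R \<le> N / 4" using r mult_right_mono[OF e4 N0] by (simp add: R_def N_def)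
  have NE: "N \<le> 2 * E0" and TE: "total (p T) (q T) \<le> E0"
    using bal RN tot0(1)[OF pd[OF TT(1)], of "q T"] N0 by linarith+
  have "R \<le> \<epsilon>\<^sup>2 * N" using r by (simp add: R_def N_def)
  also have "\<dots> \<le> \<epsilon>\<^sup>2 * (2 * E0)" using NE by (rule mult_left_mono) simp
  finally show "residual T p g \<le> \<epsilon>\<^sup>2 * (2 * total (p 0) (q 0))" by (simp add: R_def E0_def)
  have E0: "0 \<le> E0" unfolding E0_def by (rule tot0(1)[OF pd[OF TT(2)]])
  let ?C = "1 / 2 + (\<mu> + 1) / (2 * \<alpha> 0)"
  \<comment> \<open>Both boundary terms of the virial identity are controlled by the initial total
    energy; at the end point this needs \<open>TE\<close>, that the total energy has not
    grown.\<close>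
  have bdry: "\<bar>\<mu> * inner v x + (norm x)\<^sup>2 / 2\<bar> \<le> ?C * E0" if x: "x \<in> dom_sqrt_A e \<alpha>" and le: "total x v \<le> E0" for x v
  proof -
    have en: "energy \<mu> x v \<le> E0" using tot0(2)[OF x, of v] le by linarith
    have nx: "(norm x)\<^sup>2 \<le> E0 / \<alpha> 0"
      using norm_le_energy[OF x \<mu>, of v] divide_right_mono[OF en, of "\<alpha> 0"] \<alpha>_pos0 by linarith
    have nv: "\<mu> * (norm v)\<^sup>2 \<le> E0" using en stiff_nonneg[OF x] by (simp add: energy_def)
    have "\<bar>inner v x\<bar> \<le> ((norm v)\<^sup>2 + (norm x)\<^sup>2) / 2"
      using Cauchy_Schwarz_ineq2[of v x] sum_squares_bound[of "norm v" "norm x"] by simp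
    then have "\<mu> * \<bar>inner v x\<bar> \<le> \<mu> * (((norm v)\<^sup>2 + (norm x)\<^sup>2) / 2)" using \<mu> by (rule mult_left_mono)
    then have "\<bar>\<mu> * inner v x + (norm x)\<^sup>2 / 2\<bar> \<le> \<mu> * (((norm v)\<^sup>2 + (norm x)\<^sup>2) / 2) + (norm x)\<^sup>2 / 2"
      using \<mu> by (simp add: abs_mult abs_triangle_ineq[THEN order_trans])
    also have "\<dots> = \<mu> * (norm v)\<^sup>2 / 2 + (\<mu> + 1) / 2 * (norm x)\<^sup>2" by (simp add: field_simps)
    also have "\<dots> \<le> E0 / 2 + (\<mu> + 1) / 2 * (E0 / \<alpha> 0)"
      using nv by (intro add_mono mult_left_mono nx) (use \<mu> in simp_all)
    also have "\<dots> = ?C * E0" by (simp add: field_simps)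
    finally show ?thesis .
  qed
  have "(\<integral>s. \<mu> * (norm (q s))\<^sup>2 + inner (p s) (g s) \<partial>?M)
      \<le> (\<integral>s. \<mu> * (norm (q s))\<^sup>2 + (stiff (p s) / 2 + (norm (g s + G (p s)))\<^sup>2 / (2 * \<alpha> 0)) \<partial>?M)"
  proof (rule integral_mono)
    fix s assume "s \<in> space ?M"
    then have s: "s \<in> {0..T}" by simp
    \<comment> \<open>The gradient part has a favourable sign by \<open>radial\<close>; the control
      part is split by Young's inequality with weight \<open>\<alpha> 0\<close>, so that only half
      of the stiffness is spent.\<close>
    have "inner (p s) (g s) = inner (g s + G (p s)) (p s) - inner (G (p s)) (p s)"
      by (simp add: inner_add_left) (simp add: inner_commute)
    also have "\<dots> \<le> norm (g s + G (p s)) * norm (p s)"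
      using radial[of "p s"] norm_cauchy_schwarz[of "g s + G (p s)" "p s"] by linarith
    also have "\<dots> \<le> \<alpha> 0 * (norm (p s))\<^sup>2 / 2 + (norm (g s + G (p s)))\<^sup>2 / (2 * \<alpha> 0)"
    proof -
      have "0 \<le> (\<alpha> 0 * norm (p s) - norm (g s + G (p s)))\<^sup>2 / (2 * \<alpha> 0)" using \<alpha>_pos0 by simp
      also have "\<dots> = \<alpha> 0 * (norm (p s))\<^sup>2 / 2 + (norm (g s + G (p s)))\<^sup>2 / (2 * \<alpha> 0) - norm (g s + G (p s)) * norm (p s)"
        using \<alpha>_pos0 by (simp add: power2_eq_square field_simps)
      finally show ?thesis by linarith
    qed
    also have "\<dots> \<le> stiff (p s) / 2 + (norm (g s + G (p s)))\<^sup>2 / (2 * \<alpha> 0)"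
      using stiff_ge[OF pd[OF s]] by simp
    finally show "\<mu> * (norm (q s))\<^sup>2 + inner (p s) (g s)
      \<le> \<mu> * (norm (q s))\<^sup>2 + (stiff (p s) / 2 + (norm (g s + G (p s)))\<^sup>2 / (2 * \<alpha> 0))" by simp
  qed (use i in simp_all)
  also have "\<dots> = \<mu> * N + (X / 2 + R / (2 * \<alpha> 0))"
    using i by (simp add: N_def X_def R_def residual_def)
  finally have vir: "(\<integral>s. \<mu> * (norm (q s))\<^sup>2 + inner (p s) (g s) \<partial>?M) \<le> \<mu> * N + (X / 2 + R / (2 * \<alpha> 0))" .
  have "total (p 0) (q 0) \<le> E0" by (simp add: E0_def)
  from bdry[OF pd[OF TT(2)] this] bdry[OF pd[OF TT(1)] TE] vir damped_virial[OF d]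
  have "X / 2 \<le> 2 * (?C * E0) + \<mu> * N + R / (2 * \<alpha> 0)"
    unfolding X_def[symmetric] by linarith
  moreover have "\<mu> * N \<le> \<mu> * (2 * E0)" by (rule mult_left_mono[OF NE \<mu>])
  moreover have "R / (2 * \<alpha> 0) \<le> (2 * E0) / (2 * \<alpha> 0)"
    using RN NE E0 N0 \<alpha>_pos0 by (intro divide_right_mono) linarith+
  moreover have "x \<le> 2 * (a + b' + c')" if "x / 2 \<le> a + b + c" "b \<le> b'" "c \<le> c'" for x a b c b' c' :: real
    using that by simp
  ultimately have "X \<le> 2 * (2 * (?C * E0) + \<mu> * (2 * E0) + (2 * E0) / (2 * \<alpha> 0))" by blast
  then have "X + \<mu> * N \<le> 2 * (2 * (?C * E0) + \<mu> * (2 * E0) + (2 * E0) / (2 * \<alpha> 0)) + \<mu> * (2 * E0)"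
    using \<open>\<mu> * N \<le> \<mu> * (2 * E0)\<close> by linarith
  also have "\<dots> = decay_const * E0" using \<alpha>_pos0 by (simp add: decay_const_def field_simps)
  also have "X + \<mu> * N = (\<integral>s. energy \<mu> (p s) (q s) \<partial>?M)"
    using i by (simp add: energy_def X_def N_def)
  finally show "(\<integral>s. energy \<mu> (p s) (q s) \<partial>?M) \<le> decay_const * total (p 0) (q 0)" by (simp add: E0_def)
qed

text \<open>The steps are so short that the control stays cheap, and the horizon so long that the
  bounded time integral of the energy forces some time with energy below \<open>\<eta>\<close>; the
  path is cut there.\<close>

lemma approach:
  assumes a: "a \<in> dom_sqrt_A e \<alpha>" and \<eta>: "0 < \<eta>" and \<epsilon>: "0 < \<epsilon>"
  obtains T p q g where "damped \<mu> T p q g" "p 0 = a" "\<mu> \<noteq> 0 \<Longrightarrow> q 0 = b"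
    "energy \<mu> (p T) (q T) < \<eta>" "residual T p g \<le> \<epsilon>"
proof -
  \<comment> \<open>For \<open>\<mu> = 0\<close> the initial velocity of the path is not prescribed,
    but the energy does not depend on it.\<close>
  have en0: "energy \<mu> a v = energy \<mu> a b" if "\<mu> \<noteq> 0 \<longrightarrow> v = b" for v
    using that by (cases "\<mu> = 0") (simp_all add: energy_def)
  define E0 where "E0 = total a b"
  have E0: "0 \<le> E0" unfolding E0_def total_def using energy_nonneg[OF a \<mu>, of b] \<Phi>_nonneg[of a] by simp
  \<comment> \<open>\<open>1 / 2\<close> is the threshold of \<open>decay\<close>; the square root
    makes the bound \<open>\<delta>\<^sup>2 * (2 * E0)\<close> on the residual at most
    \<open>\<epsilon>\<close>, with \<open>+ 1\<close> covering \<open>E0 = 0\<close>.\<close>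
  define \<delta> where "\<delta> = min (1 / 2) (sqrt (\<epsilon> / (2 * E0 + 1)))"
  have \<delta>: "0 < \<delta>" "\<delta> \<le> 1 / 2" using \<epsilon> E0 by (auto simp: \<delta>_def)
  have "\<delta>\<^sup>2 \<le> (sqrt (\<epsilon> / (2 * E0 + 1)))\<^sup>2" using \<delta>(1) by (intro power_mono) (auto simp: \<delta>_def)
  also have "\<dots> = \<epsilon> / (2 * E0 + 1)" using \<epsilon> E0 by simp
  finally have "\<delta>\<^sup>2 * (2 * E0) \<le> \<epsilon> / (2 * E0 + 1) * (2 * E0)" using E0 by (intro mult_right_mono) auto
  also have "\<dots> \<le> \<epsilon>" using \<epsilon> E0 by (simp add: field_simps)
  finally have \<delta>E: "\<delta>\<^sup>2 * (2 * E0) \<le> \<epsilon>" .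
  define h where "h = \<delta> / (\<kappa> + 1)"
  have h: "0 < h" using \<delta> \<kappa> by (simp add: h_def)
  have kh: "\<kappa> * h \<le> \<delta>" "0 \<le> \<kappa> * h" using \<delta> \<kappa> by (simp_all add: h_def field_simps)
  \<comment> \<open>Horizon so long that an energy of at least \<open>\<eta>\<close> throughout
    would exceed the time integral allowed by \<open>decay\<close>.\<close>
  obtain n :: nat where n: "decay_const * E0 / (h * \<eta>) < real n" using reals_Archimedean2 by blast
  let ?T = "real (Suc n) * h"
  obtain p q g where d: "damped \<mu> ?T p q g" and p0: "p 0 = a" and q0: "\<mu> \<noteq> 0 \<longrightarrow> q 0 = b"
    and r: "residual ?T p g \<le> (\<kappa> * h)\<^sup>2 * (\<integral>s. (norm (q s))\<^sup>2 \<partial>lebesgue_on {0..?T})"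
    using steps[OF less_imp_le[OF h] a, of n b] by blast
  have "(\<kappa> * h)\<^sup>2 * (\<integral>s. (norm (q s))\<^sup>2 \<partial>lebesgue_on {0..?T}) \<le> \<delta>\<^sup>2 * (\<integral>s. (norm (q s))\<^sup>2 \<partial>lebesgue_on {0..?T})"
    using kh by (intro mult_right_mono power_mono) auto
  with r have r': "residual ?T p g \<le> \<delta>\<^sup>2 * (\<integral>s. (norm (q s))\<^sup>2 \<partial>lebesgue_on {0..?T})" by linarith
  have tot: "total (p 0) (q 0) = E0" using en0[OF q0] by (simp add: E0_def total_def p0)
  note D = decay[OF d less_imp_le[OF \<delta>(1)] \<delta>(2) r', unfolded tot]
  have T0: "0 < ?T" using h by simp
  have "\<exists>s\<in>{0..?T}. energy \<mu> (p s) (q s) < \<eta>"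
  proof (rule ccontr)
    assume "\<not> ?thesis"
    then have ge: "\<eta> \<le> energy \<mu> (p s) (q s)" if "s \<in> {0..?T}" for s using that by force
    have i: "integrable (lebesgue_on {0..?T}) (\<lambda>s. energy \<mu> (p s) (q s))"
      using stiff_integral(1)[OF d] dampedD(2)[OF d] by (simp add: energy_def L2on_def)
    have "(\<integral>s. \<eta> \<partial>lebesgue_on {0..?T}) \<le> (\<integral>s. energy \<mu> (p s) (q s) \<partial>lebesgue_on {0..?T})"
      by (rule integral_mono[OF integrable_continuous_lebesgue_on i]) (use ge in simp_all)
    moreover have "(\<integral>s. \<eta> \<partial>lebesgue_on {0..?T}) = ?T * \<eta>" using T0 by (simp add: measure_restrict_space)
    ultimately have "?T * \<eta> \<le> decay_const * E0" using D(2) by linarith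
    moreover have "decay_const * E0 < real n * (h * \<eta>)" using n h \<eta> by (simp add: pos_divide_less_eq)
    moreover have "real n * (h * \<eta>) \<le> ?T * \<eta>" using h \<eta> by (simp add: algebra_simps)
    ultimately show False by linarith
  qed
  then obtain s where s: "s \<in> {0..?T}" "energy \<mu> (p s) (q s) < \<eta>" by blast
  have ds: "damped \<mu> s p q g" by (rule damped_restrict[OF d]) (use s in auto)
  have "residual s p g \<le> residual ?T p g"
    unfolding residual_def using L2on_residual[OF d] s by (intro integral_subinterval_le) (auto simp: L2on_def)
  with D(1) \<delta>E have "residual s p g \<le> \<epsilon>" by linarith
  with ds p0 q0 s(2) show thesis by (intro that) auto
qed

text \<open>The cutoff in \<open>bridge\<close> has first and second derivatives of size at most 2
  and 6, so the control is at most \<open>6 * \<mu> + 2 + \<kappa>\<close> times the position plus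
  \<open>4 * \<mu>\<close> times the velocity. Squaring the sum costs a factor 2; the energy of the
  free path bounds the squared position with \<open>1 / \<alpha> 0\<close> and the time integral of
  the squared velocity with 1.\<close>

definition bridge_const :: real where
  "bridge_const = 2 * (6 * \<mu> + 2 + \<kappa>)\<^sup>2 / \<alpha> 0 + 2 * (4 * \<mu>)\<^sup>2"

text \<open>The free linear path is multiplied by a cutoff that vanishes together with its
  derivative at time 1. The gradient grows at most linearly (\<open>norm_G\<close>), so the cost is
  of the order of the initial energy.\<close>

lemma bridge:
  assumes a: "a \<in> dom_sqrt_A e \<alpha>"
  obtains p q g where "damped \<mu> 1 p q g" "p 0 = a" "\<mu> \<noteq> 0 \<Longrightarrow> q 0 = b"
    "p 1 = 0" "\<mu> \<noteq> 0 \<Longrightarrow> q 1 = 0" "residual 1 p g \<le> bridge_const * energy \<mu> a b"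
proof -
  obtain w v where d: "damped \<mu> 1 w v (\<lambda>_. 0)" and w0: "w 0 = a" and v0: "\<mu> \<noteq> 0 \<Longrightarrow> v 0 = b"
    using damped_exists[OF \<mu> _ L2on_const a, of 1 0 b] by auto
  define \<eta> where "\<eta> = energy \<mu> a b"
  have en0: "energy \<mu> (w 0) (v 0) = \<eta>" using w0 v0 by (cases "\<mu> = 0") (simp_all add: \<eta>_def energy_def)
  have v2: "integrable (lebesgue_on {0..t}) (\<lambda>s. (norm (v s))\<^sup>2)" if "t \<in> {0..1}" for t
    using L2on_sub[OF dampedD(2)[OF d], of t] that by (simp add: L2on_def)
  have en: "energy \<mu> (w t) (v t) = \<eta> - 2 * (\<integral>s. (norm (v s))\<^sup>2 \<partial>lebesgue_on {0..t})" if t: "t \<in> {0..1}" for t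
    using damped_energy[OF d t] by (simp add: en0 power2_norm_eq_inner)
  note wd = dampedD(4)[OF d]
  have nv: "(\<integral>s. (norm (v s))\<^sup>2 \<partial>lebesgue_on {0..1}) \<le> \<eta>"
  proof -
    have "0 \<le> (\<integral>s. (norm (v s))\<^sup>2 \<partial>lebesgue_on {0..1})" by simp
    moreover have "0 \<le> energy \<mu> (w 1) (v 1)" by (rule energy_nonneg[OF wd \<mu>]) simp
    moreover have "energy \<mu> (w 1) (v 1) = \<eta> - 2 * (\<integral>s. (norm (v s))\<^sup>2 \<partial>lebesgue_on {0..1})" by (rule en) simp
    ultimately show ?thesis by linarith
  qed
  have nw: "(norm (w t))\<^sup>2 \<le> \<eta> / \<alpha> 0" if t: "t \<in> {0..1}" for t
  proof -
    have "0 \<le> (\<integral>s. (norm (v s))\<^sup>2 \<partial>lebesgue_on {0..t})" by simp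
    then have "energy \<mu> (w t) (v t) / \<alpha> 0 \<le> \<eta> / \<alpha> 0"
      using en[OF t] \<alpha>_pos0 by (intro divide_right_mono) auto
    with norm_le_energy[OF wd[OF t] \<mu>, of "v t"] show ?thesis by linarith
  qed
  \<comment> \<open>Cubic Hermite polynomial: value 1 and slope 0 at time 0 keep the initial data,
    value 0 and slope 0 at time 1 stop both position and velocity.\<close>
  define \<theta> \<theta>' \<theta>'' :: "real \<Rightarrow> real" where "\<theta> t = 1 - 3 * t\<^sup>2 + 2 * t ^ 3" and "\<theta>' t = - 6 * t + 6 * t\<^sup>2"
    and "\<theta>'' t = - 6 + 12 * t" for t
  have d1: "(\<theta> has_real_derivative \<theta>' t) (at t)" and d2: "(\<theta>' has_real_derivative \<theta>'' t) (at t)" for t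
    unfolding \<theta>_def[abs_def] \<theta>'_def[abs_def] \<theta>''_def
    by (auto intro!: derivative_eq_intros simp: power2_eq_square)
  have c: "continuous_on S \<theta>" "continuous_on S \<theta>'" "continuous_on S \<theta>''" for S
    unfolding \<theta>_def[abs_def] \<theta>'_def[abs_def] \<theta>''_def[abs_def] by (intro continuous_intros)+
  have ends: "\<theta> 0 = 1" "\<theta>' 0 = 0" "\<theta> 1 = 0" "\<theta>' 1 = 0" by (simp_all add: \<theta>_def \<theta>'_def)
  have bnd: "\<bar>\<theta> t\<bar> \<le> 1" "\<bar>\<theta>' t\<bar> \<le> 2" "\<bar>\<theta>'' t\<bar> \<le> 6" if t: "t \<in> {0..1}" for t
  proof -
    have "\<theta> t = (1 - t)\<^sup>2 * (1 + 2 * t)" "1 - \<theta> t = t\<^sup>2 * (3 - 2 * t)"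
      by (simp_all add: \<theta>_def power2_eq_square power3_eq_cube algebra_simps)
    moreover have "0 \<le> (1 - t)\<^sup>2 * (1 + 2 * t)" "0 \<le> t\<^sup>2 * (3 - 2 * t)" using t by simp_all
    ultimately show "\<bar>\<theta> t\<bar> \<le> 1" by linarith
    have "\<theta>' t = - (6 * (t * (1 - t)))" by (simp add: \<theta>'_def power2_eq_square algebra_simps)
    moreover have "0 \<le> t * (1 - t)" using t by simp
    moreover have "t * (1 - t) \<le> 1 / 4" using zero_le_power2[of "t - 1 / 2"]
      by (simp add: power2_eq_square algebra_simps)
    ultimately show "\<bar>\<theta>' t\<bar> \<le> 2" by linarith
    show "\<bar>\<theta>'' t\<bar> \<le> 6" using t unfolding \<theta>''_def atLeastAtMost_iff by linarith
  qed
  define p q g where "p t = \<theta> t *\<^sub>R w t" and "q t = \<theta>' t *\<^sub>R w t + \<theta> t *\<^sub>R v t"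
    and "g t = \<mu> *\<^sub>R (\<theta>'' t *\<^sub>R w t + 2 *\<^sub>R (\<theta>' t *\<^sub>R v t)) + \<theta>' t *\<^sub>R w t" for t
  have L: "L2on 1 q" "L2on 1 g" unfolding q_def[abs_def] g_def[abs_def]
    by (intro L2on_add L2on_scaleR L2on_mult_continuous c L2on_path[OF d] dampedD(2)[OF d])+
  have dp: "damped \<mu> 1 p q g"
    unfolding damped_def
  proof (intro conjI allI ballI)
    show "p t \<in> dom_sqrt_A e \<alpha>" if "t \<in> {0..1}" for t unfolding p_def by (rule dom_scaleR[OF wd[OF that]])
    show "mode \<mu> (\<alpha> k) 1 (\<lambda>s. inner (p s) (e k)) (\<lambda>s. inner (q s) (e k)) (\<lambda>s. inner (g s) (e k))" for k
    proof -
      have "mode \<mu> (\<alpha> k) 1 (\<lambda>s. inner (w s) (e k)) (\<lambda>s. inner (v s) (e k)) (\<lambda>s. 0)"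
        using dampedD(5)[OF d, of k] by simp
      from mode_cutoff[OF this d1 d2 c(3)] show ?thesis by (simp add: p_def q_def g_def inner_add_left mult.assoc)
    qed
  qed (use L in simp_all)
  let ?K1 = "6 * \<mu> + 2 + \<kappa>" and ?K2 = "4 * \<mu>"
  have \<eta>0: "0 \<le> \<eta>" unfolding \<eta>_def by (rule energy_nonneg[OF a \<mu>])
  have "residual 1 p g \<le> (\<integral>s. 2 * ?K1\<^sup>2 * (\<eta> / \<alpha> 0) + 2 * ?K2\<^sup>2 * (norm (v s))\<^sup>2 \<partial>lebesgue_on {0..1})"
    unfolding residual_def
  proof (rule integral_mono)
    show "integrable (lebesgue_on {0..1}) (\<lambda>s. (norm (g s + G (p s)))\<^sup>2)"
      using L2on_residual[OF dp] by (simp add: L2on_def)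
    show "integrable (lebesgue_on {0..1}) (\<lambda>s. 2 * ?K1\<^sup>2 * (\<eta> / \<alpha> 0) + 2 * ?K2\<^sup>2 * (norm (v s))\<^sup>2)"
      by (rule Bochner_Integration.integrable_add[OF integrable_continuous_lebesgue_on[OF continuous_on_const]
            integrable_mult_right[OF v2]]) simp
    fix s :: real assume "s \<in> space (lebesgue_on {0..1})"
    then have s: "s \<in> {0..1}" by simp
    note B = bnd[OF s]
    have n1: "norm (\<theta>'' s *\<^sub>R w s) \<le> 6 * norm (w s)" "norm (2 *\<^sub>R (\<theta>' s *\<^sub>R v s)) \<le> 4 * norm (v s)"
      "norm (\<theta>' s *\<^sub>R w s) \<le> 2 * norm (w s)" "norm (p s) \<le> norm (w s)"
      using mult_right_mono[OF B(3), of "norm (w s)"] mult_right_mono[OF B(2), of "norm (v s)"]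
        mult_right_mono[OF B(2), of "norm (w s)"] mult_right_mono[OF B(1), of "norm (w s)"]
      by (simp_all add: p_def)
    have n2: "norm (\<theta>'' s *\<^sub>R w s + 2 *\<^sub>R (\<theta>' s *\<^sub>R v s)) \<le> 6 * norm (w s) + 4 * norm (v s)"
      by (rule norm_triangle_mono[OF n1(1,2)])
    have n3: "norm (\<mu> *\<^sub>R (\<theta>'' s *\<^sub>R w s + 2 *\<^sub>R (\<theta>' s *\<^sub>R v s))) \<le> \<mu> * (6 * norm (w s) + 4 * norm (v s))"
      using mult_left_mono[OF n2 \<mu>] \<mu> by simp
    have n4: "norm (G (p s)) \<le> \<kappa> * norm (w s)"
      using norm_G[of "p s"] mult_left_mono[OF n1(4) \<kappa>] by linarith
    have "norm (g s + G (p s)) \<le> \<mu> * (6 * norm (w s) + 4 * norm (v s)) + 2 * norm (w s) + \<kappa> * norm (w s)"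
      unfolding g_def by (rule norm_triangle_mono[OF norm_triangle_mono[OF n3 n1(3)] n4])
    also have "\<dots> = ?K1 * norm (w s) + ?K2 * norm (v s)" by (simp add: algebra_simps)
    finally have "(norm (g s + G (p s)))\<^sup>2 \<le> (?K1 * norm (w s) + ?K2 * norm (v s))\<^sup>2" by (rule power_mono) simp
    also have "\<dots> \<le> 2 * (?K1 * norm (w s))\<^sup>2 + 2 * (?K2 * norm (v s))\<^sup>2"
      using sum_squares_bound[of "?K1 * norm (w s)" "?K2 * norm (v s)"] unfolding power2_sum by linarith
    also have "(?K1 * norm (w s))\<^sup>2 \<le> ?K1\<^sup>2 * (\<eta> / \<alpha> 0)"
      unfolding power_mult_distrib by (rule mult_left_mono[OF nw[OF s]]) simp
    finally show "(norm (g s + G (p s)))\<^sup>2 \<le> 2 * ?K1\<^sup>2 * (\<eta> / \<alpha> 0) + 2 * ?K2\<^sup>2 * (norm (v s))\<^sup>2"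
      by (simp add: power_mult_distrib)
  qed
  also have "\<dots> = 2 * ?K1\<^sup>2 * (\<eta> / \<alpha> 0) + 2 * ?K2\<^sup>2 * (\<integral>s. (norm (v s))\<^sup>2 \<partial>lebesgue_on {0..1})"
    using v2[of 1] by (subst Bochner_Integration.integral_add)
      (auto simp: measure_restrict_space intro!: integrable_continuous_lebesgue_on)
  also have "\<dots> \<le> 2 * ?K1\<^sup>2 * (\<eta> / \<alpha> 0) + 2 * ?K2\<^sup>2 * \<eta>"
    by (intro add_left_mono mult_left_mono nv) simp
  also have "\<dots> = bridge_const * \<eta>" by (simp add: bridge_const_def algebra_simps)
  finally have "residual 1 p g \<le> bridge_const * energy \<mu> a b" by (simp add: \<eta>_def)
  moreover have "p 0 = a" "p 1 = 0" "\<mu> \<noteq> 0 \<Longrightarrow> q 0 = b" "\<mu> \<noteq> 0 \<Longrightarrow> q 1 = 0"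
    using w0 v0 by (simp_all add: p_def q_def ends)
  ultimately show thesis using that[OF dp] by blast
qed

text \<open>Half of the budget goes to the approach; its end energy is chosen against
  \<open>bridge_const\<close> so that the bridge costs at most the other half.\<close>

lemma steer_to_rest:
  assumes a: "a \<in> dom_sqrt_A e \<alpha>" and \<epsilon>: "0 < \<epsilon>"
  obtains T p q g where "0 < T" "damped \<mu> T p q g" "p 0 = a" "\<mu> \<noteq> 0 \<Longrightarrow> q 0 = b"
    "p T = 0" "\<mu> \<noteq> 0 \<Longrightarrow> q T = 0" "residual T p g \<le> \<epsilon>"
proof -
  have K: "0 \<le> bridge_const" using \<alpha>_pos0 by (simp add: bridge_const_def)
  define \<eta> where "\<eta> = \<epsilon> / (2 * (bridge_const + 1))"
  have \<eta>: "0 < \<eta>" "bridge_const * \<eta> \<le> \<epsilon> / 2" using K \<epsilon> by (simp_all add: \<eta>_def field_simps)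
  obtain S p1 q1 g1 where d1: "damped \<mu> S p1 q1 g1" and p1: "p1 0 = a" and q1: "\<mu> \<noteq> 0 \<Longrightarrow> q1 0 = b"
    and en: "energy \<mu> (p1 S) (q1 S) < \<eta>" and r1: "residual S p1 g1 \<le> \<epsilon> / 2"
    using approach[OF a \<eta>(1) half_gt_zero[OF \<epsilon>], of b] by blast
  have S: "0 \<le> S" by (rule dampedD(1)[OF d1])
  then have "p1 S \<in> dom_sqrt_A e \<alpha>" by (intro dampedD(4)[OF d1]) simp
  from bridge[OF this, of "q1 S"] obtain p2 q2 g2 where d2: "damped \<mu> 1 p2 q2 g2"
    and p2: "p2 0 = p1 S" "p2 1 = 0" and q2: "\<mu> \<noteq> 0 \<Longrightarrow> q2 0 = q1 S" "\<mu> \<noteq> 0 \<Longrightarrow> q2 1 = 0"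
    and r2: "residual 1 p2 g2 \<le> bridge_const * energy \<mu> (p1 S) (q1 S)" by blast
  have "bridge_const * energy \<mu> (p1 S) (q1 S) \<le> bridge_const * \<eta>" using en K by (intro mult_left_mono) auto
  then have "residual (S + 1) (join S p1 p2) (join S g1 g2) \<le> \<epsilon>"
    unfolding residual_join[OF d1 d2] using r1 r2 \<eta>(2) by linarith
  moreover have "join S p1 p2 0 = a" "join S p1 p2 (S + 1) = 0"
    "\<mu> \<noteq> 0 \<Longrightarrow> join S q1 q2 0 = b" "\<mu> \<noteq> 0 \<Longrightarrow> join S q1 q2 (S + 1) = 0"
    using S p1 q1 p2 q2 by (simp_all add: join_def)
  ultimately show thesis
    using S by (intro that[OF _ damped_join[OF d1 d2 p2(1) q2(1)]]) auto
qed

text \<open>The time reversal of a path to rest with residual \<open>r\<close> is a path from rest with control \<open>r - 2 q\<close>;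
  by the energy balance its cost is the total energy of the end point plus the cost of \<open>r\<close>.\<close>

lemma near_optimal_control:
  assumes a: "a \<in> dom_sqrt_A e \<alpha>" and \<epsilon>: "0 < \<epsilon>"
  obtains T p q g where "0 < T" "damped \<mu> T p q g" "p 0 = 0" "\<mu> \<noteq> 0 \<Longrightarrow> q 0 = 0"
    "p T = a" "\<mu> \<noteq> 0 \<Longrightarrow> q T = b" "residual T p g / 2 \<le> total a b + \<epsilon>"
proof -
  \<comment> \<open>Reversal changes the sign of the velocity, so the path to rest starts with
    \<open>- b\<close>.\<close>
  obtain T p q g where T: "0 < T" and d: "damped \<mu> T p q g" and p0: "p 0 = a" and q0: "\<mu> \<noteq> 0 \<Longrightarrow> q 0 = - b"
    and pT: "p T = 0" and qT: "\<mu> \<noteq> 0 \<Longrightarrow> q T = 0" and r: "residual T p g \<le> \<epsilon>"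
    using steer_to_rest[OF a \<epsilon>, of "- b"] by blast
  let ?M = "lebesgue_on {0..T}"
  have TT: "T \<in> {0..T}" using T by simp
  let ?r = "\<lambda>s. g s + G (p s)"
  have i: "integrable ?M (\<lambda>s. inner (?r s) (q s))" "integrable ?M (\<lambda>s. (norm (q s))\<^sup>2)"
    "integrable ?M (\<lambda>s. (norm (?r s))\<^sup>2)"
    using L2on_inner[OF L2on_residual[OF d] dampedD(2)[OF d]] dampedD(2)[OF d] L2on_residual[OF d]
    by (simp_all add: L2on_def)
  have tot: "total (p 0) (q 0) = total a b" "total (p T) (q T) = 0"
    unfolding total_def energy_def using p0 q0 pT qT by (cases "\<mu> = 0"; simp)+
  have "L2on T (\<lambda>s. ?r s - 2 *\<^sub>R q s)" by (rule L2on_diff[OF L2on_residual[OF d] L2on_scaleR[OF dampedD(2)[OF d]]])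
  then have i2: "integrable ?M (\<lambda>s. (norm (?r s - 2 *\<^sub>R q s))\<^sup>2)" by (simp add: L2on_def)
  have "residual T (\<lambda>t. p (T - t)) (\<lambda>t. g (T - t) - 2 *\<^sub>R q (T - t))
      = (\<integral>s. (\<lambda>s. (norm (?r s - 2 *\<^sub>R q s))\<^sup>2) (T - s) \<partial>?M)"
    unfolding residual_def by (rule integral_lebesgue_on_cong) (simp add: algebra_simps)
  also have "\<dots> = (\<integral>s. (norm (?r s - 2 *\<^sub>R q s))\<^sup>2 \<partial>?M)"
    using integral_reflect_0[OF i2 TT] by simp
  also have "\<dots> = (\<integral>s. ((norm (?r s))\<^sup>2 - 4 * inner (?r s) (q s)) + 4 * (norm (q s))\<^sup>2 \<partial>?M)"
    by (rule integral_lebesgue_on_cong)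
      (simp add: power2_norm_eq_inner inner_diff_left inner_diff_right inner_commute)
  also have "\<dots> = residual T p g - 4 * (\<integral>s. inner (?r s) (q s) \<partial>?M) + 4 * (\<integral>s. (norm (q s))\<^sup>2 \<partial>?M)"
    using i by (simp add: residual_def)
  finally have "residual T (\<lambda>t. p (T - t)) (\<lambda>t. g (T - t) - 2 *\<^sub>R q (T - t)) / 2 \<le> total a b + \<epsilon>"
    using total_balance[OF d TT] tot r \<epsilon> by linarith
  then show thesis
    using that[OF T damped_reverse[OF d]] p0 q0 pT qT by simp
qed

end

section \<open>Strongly continuous semigroups\<close>

text \<open>Uniform boundedness principle by a gliding hump instead of category: if the operator
  norms were unbounded, small steps along nearly norming vectors of ever larger operators would
  converge to a point \<open>l\<close> with unbounded orbit.\<close>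

lemma uniformly_bounded_sequence:
  fixes A :: "nat \<Rightarrow> 'a::{real_normed_vector, complete_space} \<Rightarrow> 'b::real_normed_vector"
  assumes A: "\<And>n. bounded_linear (A n)" and bd: "\<And>x. bounded (range (\<lambda>n. A n x))"
  shows "\<exists>M. \<forall>n x. norm (A n x) \<le> M * norm x"
proof (rule ccontr)
  assume no: "\<not> ?thesis"
  have "\<exists>n. M < onorm (A n)" for M
  proof (rule ccontr)
    assume "\<not> ?thesis"
    then have "norm (A n x) \<le> M * norm x" for n x
      by (meson A linorder_not_less mult_right_mono norm_ge_zero onorm order_trans)
    with no show False by blast
  qed
  \<comment> \<open>The growth \<open>4 ^ j\<close> beats the step size \<open>1 / 3 ^ j\<close>;
    the factor \<open>j + 1\<close> yields the simple divergent lower bound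
    \<open>real (j + 1) / 4\<close>.\<close>
  then obtain \<nu> where \<nu>: "\<And>j. real (j + 1) * 4 ^ j < onorm (A (\<nu> j))"
    using choice[of "\<lambda>j n. real (j + 1) * 4 ^ j < onorm (A n)"] by auto
  define T where "T j = A (\<nu> j)" for j
  have T: "bounded_linear (T j)" for j by (simp add: T_def A)
  have on: "real (j + 1) * 4 ^ j < onorm (T j)" for j using \<nu> by (simp add: T_def)
  have onp: "0 < onorm (T j)" for j using on[of j] by (rule le_less_trans[rotated]) simp
  have "\<exists>u. norm u = 1 \<and> 3 / 4 * onorm (T j) \<le> norm (T j u)" for j
  proof (rule ccontr)
    assume n: "\<not> ?thesis"
    have "norm (T j x) \<le> 3 / 4 * onorm (T j) * norm x" for x
    proof (cases "x = 0")
      case True then show ?thesis by (simp add: linear_simps(3)[OF T])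
    next
      case False
      then have "norm (x /\<^sub>R norm x) = 1" by simp
      then have "\<not> 3 / 4 * onorm (T j) \<le> norm (T j (x /\<^sub>R norm x))" using n by blast
      then have "norm (T j (x /\<^sub>R norm x)) < 3 / 4 * onorm (T j)" by linarith
      then show ?thesis using False by (simp add: linear_simps(5)[OF T] field_simps)
    qed
    then have "onorm (T j) \<le> 3 / 4 * onorm (T j)"
      by (rule onorm_bound[rotated]) (use onp[of j] in simp)
    then show False using onp[of j] by linarith
  qed
  then obtain u where u: "\<And>j. norm (u j) = 1" "\<And>j. 3 / 4 * onorm (T j) \<le> norm (T j (u j))"
    using choice[of "\<lambda>j u. norm u = 1 \<and> 3 / 4 * onorm (T j) \<le> norm (T j u)"] by auto
  define y where "y j = (1 / 3 ^ j) *\<^sub>R u j" for j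
  \<comment> \<open>The sign of each step makes the image under \<open>T j\<close> of the new point
    at least as large as that of \<open>y j\<close>: the images of \<open>x j + y j\<close> and
    \<open>x j - y j\<close> differ by twice the image of \<open>y j\<close>, so they cannot both be
    smaller.\<close>
  define x where "x = rec_nat 0 (\<lambda>j z. if norm (T j (z + y j)) \<ge> norm (T j (y j)) then z + y j else z - y j)"
  have xS: "x (Suc j) = (if norm (T j (x j + y j)) \<ge> norm (T j (y j)) then x j + y j else x j - y j)" for j
    by (simp add: x_def)
  have Tx: "norm (T j (y j)) \<le> norm (T j (x (Suc j)))" for j
  proof (cases "norm (T j (x j + y j)) \<ge> norm (T j (y j))")
    case False
    have "2 *\<^sub>R T j (y j) = T j (x j + y j) - T j (x j - y j)"
      by (simp add: linear_simps(1,2)[OF T] scaleR_2)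
    then have "2 * norm (T j (y j)) \<le> norm (T j (x j + y j)) + norm (T j (x j - y j))"
      using norm_triangle_ineq4[of "T j (x j + y j)" "T j (x j - y j)"]
      by (metis abs_numeral norm_scaleR)
    then show ?thesis using False by (simp add: xS)
  qed (simp add: xS)
  have ny: "norm (y j) = 1 / 3 ^ j" for j using u(1) by (simp add: y_def)
  have dx: "norm (x (Suc j) - x j) = 1 / 3 ^ j" for j using ny by (simp add: xS norm_minus_commute)
  have tail: "norm (x (m + n) - x m) \<le> 3 / 2 * (1 / 3 ^ m - 1 / 3 ^ (m + n))" for m n
  proof (induction n)
    case (Suc n)
    have "norm (x (m + Suc n) - x m) \<le> norm (x (Suc (m + n)) - x (m + n)) + norm (x (m + n) - x m)"
      using norm_triangle_ineq[of "x (Suc (m + n)) - x (m + n)" "x (m + n) - x m"] by simp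
    moreover have "(1::real) / 3 ^ (m + Suc n) = 1 / 3 ^ (m + n) / 3" by simp
    moreover have "A \<le> 3 / 2 * (w - y)" if "A \<le> d + b" "b \<le> 3 / 2 * (w - z)" "d = z" "y = z / 3"
      for A b d w y z :: real using that by simp
    ultimately show ?case using Suc dx[of "m + n"] by blast
  qed simp
  have tail': "norm (x n - x m) \<le> 3 / 2 * (1 / 3 ^ m)" if "m \<le> n" for m n
  proof -
    have "norm (x n - x m) \<le> 3 / 2 * (1 / 3 ^ m - 1 / 3 ^ n)" using tail[of m "n - m"] that by simp
    also have "\<dots> \<le> 3 / 2 * (1 / 3 ^ m)" by simp
    finally show ?thesis .
  qed
  have "Cauchy x"
  proof (rule CauchyI')
    fix \<epsilon> :: real assume "0 < \<epsilon>"
    then obtain M where M: "(1 / 3 :: real) ^ M < 2 / 3 * \<epsilon>"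
      using real_arch_pow_inv[of "2 / 3 * \<epsilon>" "1 / 3"] by auto
    have "dist (x m) (x n) < \<epsilon>" if "M \<le> m" "m < n" for m n
    proof -
      have "(1 / 3 :: real) ^ m \<le> (1 / 3) ^ M" using that by (intro power_decreasing) auto
      then show ?thesis using tail'[of m n] that M by (simp add: dist_norm norm_minus_commute power_one_over)
    qed
    then show "\<exists>M. \<forall>m\<ge>M. \<forall>n>m. dist (x m) (x n) < \<epsilon>" by blast
  qed
  then obtain l where l: "x \<longlonglongrightarrow> l" using Cauchy_convergent convergent_def by blast
  obtain B where B: "\<And>n. norm (A n l) \<le> B" using bd[of l] by (auto simp: bounded_iff)
  have grow: "real (j + 1) / 4 \<le> B" for j
  proof -
    \<comment> \<open>All later steps together have at most half the length of step
      \<open>j\<close>; three quarters minus one half leaves a quarter of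
      \<open>onorm (T j) / 3 ^ j\<close>.\<close>
    have "norm (l - x (Suc j)) \<le> 3 / 2 * (1 / 3 ^ Suc j)"
    proof (rule tendsto_upperbound)
      show "(\<lambda>n. norm (x n - x (Suc j))) \<longlonglongrightarrow> norm (l - x (Suc j))" by (intro tendsto_intros l)
      show "\<forall>\<^sub>F n in sequentially. norm (x n - x (Suc j)) \<le> 3 / 2 * (1 / 3 ^ Suc j)"
        using eventually_ge_at_top[of "Suc j"] by eventually_elim (rule tail')
    qed simp
    then have "norm (T j (l - x (Suc j))) \<le> onorm (T j) * (1 / (2 * 3 ^ j))"
      by (intro order_trans[OF onorm[OF T] mult_left_mono]) (simp_all add: less_imp_le[OF onp])
    moreover have "3 / 4 * onorm (T j) / 3 ^ j \<le> norm (T j (x (Suc j)))"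
      using Tx[of j] u(2)[of j] by (simp add: y_def linear_simps(5)[OF T] field_simps)
    moreover have "norm (T j (x (Suc j))) \<le> norm (T j l) + norm (T j (l - x (Suc j)))"
      using norm_triangle_ineq4[of "T j l" "T j (l - x (Suc j))"] by (simp add: linear_simps(2)[OF T])
    ultimately have "3 / 4 * onorm (T j) / 3 ^ j - onorm (T j) * (1 / (2 * 3 ^ j)) \<le> norm (T j l)" by linarith
    moreover have "3 / 4 * onorm (T j) / 3 ^ j - onorm (T j) * (1 / (2 * 3 ^ j)) = onorm (T j) / (4 * 3 ^ j)"
      by (simp add: field_simps)
    moreover have "norm (T j l) \<le> B" using B by (simp add: T_def)
    moreover have "real (j + 1) / 4 \<le> onorm (T j) / (4 * 3 ^ j)"
    proof -
      have "real (j + 1) * 3 ^ j \<le> real (j + 1) * 4 ^ j" by (intro mult_left_mono power_mono) auto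
      also have "\<dots> \<le> onorm (T j)" using on[of j] by simp
      finally show ?thesis by (simp add: field_simps)
    qed
    ultimately show ?thesis by linarith
  qed
  obtain j :: nat where "4 * B < real j" using reals_Archimedean2 by blast
  with grow[of j] show False by simp
qed

section \<open>Growth and orbits of strongly continuous semigroups\<close>

lemma C0_semigroupD:
  assumes "C0_semigroup S"
  shows "0 \<le> t \<Longrightarrow> bounded_linear (S t)" "S 0 x = x" "0 \<le> s \<Longrightarrow> 0 \<le> t \<Longrightarrow> S (s + t) x = S s (S t x)"
    "((\<lambda>t. S t x) \<longlongrightarrow> x) (at_right 0)"
  using assms unfolding C0_semigroup_def by auto

text \<open>Otherwise there are times \<open>t n\<close> tending to 0 at which the bound
  \<open>n\<close> fails, while strong continuity keeps each sequence \<open>S (t n) x\<close>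
  bounded, against the uniform boundedness principle.\<close>

lemma C0_semigroup_bounded_near_0:
  fixes S :: "real \<Rightarrow> 'x::{real_normed_vector, complete_space} \<Rightarrow> 'x"
  assumes S: "C0_semigroup S"
  shows "\<exists>\<delta>>0. \<exists>M. \<forall>t\<in>{0..\<delta>}. \<forall>x. norm (S t x) \<le> M * norm x"
proof (rule ccontr)
  assume no: "\<not> ?thesis"
  have "\<exists>t. t \<in> {0..inverse (real (Suc n))} \<and> (\<exists>x. \<not> norm (S t x) \<le> real n * norm x)" for n
  proof (rule ccontr)
    assume "\<not> ?thesis"
    then have "\<forall>t\<in>{0..inverse (real (Suc n))}. \<forall>x. norm (S t x) \<le> real n * norm x" by blast
    moreover have "0 < inverse (real (Suc n))" by simp
    ultimately show False using no by blast
  qed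
  then obtain t where t: "\<And>n. t n \<in> {0..inverse (real (Suc n))}" "\<And>n. \<exists>x. \<not> norm (S (t n) x) \<le> real n * norm x"
    using choice[of "\<lambda>n t. t \<in> {0..inverse (real (Suc n))} \<and> (\<exists>x. \<not> norm (S t x) \<le> real n * norm x)"] by blast
  have t0: "0 \<le> t n" for n using t(1)[of n] by simp
  have tl: "t \<longlonglongrightarrow> 0"
    by (rule tendsto_sandwich[OF _ _ tendsto_const LIMSEQ_inverse_real_of_nat]) (use t(1) in auto)
  have "\<exists>M. \<forall>n x. norm (S (t n) x) \<le> M * norm x"
  proof (rule uniformly_bounded_sequence)
    show "bounded_linear (S (t n))" for n by (rule C0_semigroupD(1)[OF S t0])
    fix x
    have c: "((\<lambda>r. S r x) \<longlongrightarrow> S 0 x) (at 0 within {0..})"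
    proof -
      have "at (0::real) within {0..} = at_right 0"
      proof -
        have "{0..} - {0} = {0<..} - {0::real}" by auto
        then show ?thesis by (simp only: at_within_def)
      qed
      then show ?thesis using C0_semigroupD(4)[OF S, of x] by (simp add: C0_semigroupD(2)[OF S])
    qed
    have "(\<lambda>n. S (t n) x) \<longlonglongrightarrow> S 0 x"
      using continuous_within_tendsto_compose'[of 0 "{0..}" "\<lambda>r. S r x" t sequentially] c tl t0
      by (auto simp: continuous_within)
    then show "bounded (range (\<lambda>n. S (t n) x))" by (rule convergent_imp_bounded)
  qed
  then obtain M where M: "\<And>n x. norm (S (t n) x) \<le> M * norm x" by blast
  obtain n :: nat where n: "M < real n" using reals_Archimedean2 by blast
  have "norm (S (t n) x) \<le> real n * norm x" for x
    using M[of n x] mult_right_mono[OF less_imp_le[OF n], of "norm x"] by simp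
  with t(2)[of n] show False by blast
qed

text \<open>The bound near 0 is multiplied over steps of length \<open>\<delta>\<close>; taking
  \<open>M\<close> at least 1 lets shorter times share the power \<open>M ^ n\<close>.\<close>

lemma C0_semigroup_locally_bounded:
  fixes S :: "real \<Rightarrow> 'x::{real_normed_vector, complete_space} \<Rightarrow> 'x"
  assumes S: "C0_semigroup S"
  shows "\<exists>M\<ge>0. \<forall>t\<in>{0..T}. \<forall>x. norm (S t x) \<le> M * norm x"
proof -
  obtain \<delta> M0 where \<delta>: "0 < \<delta>" and M0: "\<And>t x. t \<in> {0..\<delta>} \<Longrightarrow> norm (S t x) \<le> M0 * norm x"
    using C0_semigroup_bounded_near_0[OF S] by blast
  define M where "M = max 1 M0"
  have M: "norm (S t x) \<le> M * norm x" if "t \<in> {0..\<delta>}" for t x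
    using M0[OF that, of x] mult_right_mono[of M0 M "norm x"] by (simp add: M_def)
  have M1: "1 \<le> M" by (simp add: M_def)
  have *: "\<forall>t\<in>{0..real n * \<delta>}. \<forall>x. norm (S t x) \<le> M ^ n * norm x" for n
  proof (induction n)
    case 0 then show ?case by (simp add: C0_semigroupD(2)[OF S])
  next
    case (Suc n)
    show ?case
    proof (intro ballI allI)
      fix t x assume t: "t \<in> {0..real (Suc n) * \<delta>}"
      show "norm (S t x) \<le> M ^ Suc n * norm x"
      proof (cases "t \<le> \<delta>")
        case True
        have "M * norm x \<le> M ^ Suc n * norm x"
          using M1 power_increasing[of 1 "Suc n" M] by (intro mult_right_mono) auto
        then show ?thesis using M[of t x] True t by simp
      next
        case False
        then have r: "t - \<delta> \<in> {0..real n * \<delta>}" using t by (simp add: algebra_simps)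
        have "S t x = S (t - \<delta>) (S \<delta> x)" using C0_semigroupD(3)[OF S, of "t - \<delta>" \<delta> x] r \<delta> by simp
        also have "norm \<dots> \<le> M ^ n * norm (S \<delta> x)" using Suc r by blast
        also have "\<dots> \<le> M ^ n * (M * norm x)" using M[of \<delta> x] \<delta> M1 by (intro mult_left_mono) auto
        finally show ?thesis by (simp add: mult_ac)
      qed
    qed
  qed
  obtain n :: nat where "T / \<delta> < real n" using reals_Archimedean2 by blast
  then have "T \<le> real n * \<delta>" using \<delta> by (simp add: field_simps)
  with *[of n] have "\<forall>t\<in>{0..T}. \<forall>x. norm (S t x) \<le> M ^ n * norm x" by auto
  moreover have "0 \<le> M ^ n" using M1 by simp
  ultimately show ?thesis by blast
qed

text \<open>To the right of \<open>t\<close> the difference quotient at 0 is pushed forward by the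
  fixed operator \<open>S t\<close>. To the left the operator \<open>S r\<close> varies with
  \<open>r\<close>, so a bound uniform in \<open>r\<close> is required.\<close>

lemma C0_semigroup_orbit:
  fixes S :: "real \<Rightarrow> 'x::{real_normed_vector, complete_space} \<Rightarrow> 'x"
  assumes S: "C0_semigroup S" and xy: "(x, y) \<in> generator S" and t: "0 \<le> t"
  shows "((\<lambda>r. S r x) has_vector_derivative S t y) (at t within {0..})"
    and "(S t x, S t y) \<in> generator S"
proof -
  note D = C0_semigroupD[OF S]
  have lim: "((\<lambda>h. (S h x - x) /\<^sub>R h) \<longlongrightarrow> y) (at_right 0)" using xy by (simp add: generator_def)
  have lin: "S r (a - b) = S r a - S r b" "S r (c *\<^sub>R a) = c *\<^sub>R S r a" if "0 \<le> r" for r a b c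
    using linear_simps(2,5)[OF D(1)[OF that]] by simp_all
  obtain M where M0: "0 \<le> M" and M: "\<And>r x. r \<in> {0..t} \<Longrightarrow> norm (S r x) \<le> M * norm x"
    using C0_semigroup_locally_bounded[OF S, of t] by blast
  \<comment> \<open>One modulus for both sides; the term with \<open>S h y - y\<close> compares
    \<open>S t y\<close> with \<open>S r y\<close> when \<open>r < t\<close>.\<close>
  define \<rho> where "\<rho> h = M * (norm ((S h x - x) /\<^sub>R h - y) + norm (S h y - y))" for h
  have "(\<rho> \<longlongrightarrow> M * (norm (y - y) + norm (y - y))) (at_right 0)"
    unfolding \<rho>_def by (intro tendsto_intros lim D(4))
  then have \<rho>: "(\<rho> \<longlongrightarrow> 0) (at_right 0)" by simp
  have est: "norm ((S r x - S t x) /\<^sub>R (r - t) - S t y) \<le> \<rho> \<bar>r - t\<bar>" if r: "0 \<le> r" "r \<noteq> t" for r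
  proof (cases "t < r")
    case True
    have "S r x = S t (S (r - t) x)" using D(3)[of t "r - t" x] t True by simp
    then have "(S r x - S t x) /\<^sub>R (r - t) - S t y = S t ((S (r - t) x - x) /\<^sub>R (r - t) - y)"
      using t by (simp add: lin)
    also have "norm \<dots> \<le> M * norm ((S (r - t) x - x) /\<^sub>R (r - t) - y)" using M t by simp
    also have "\<dots> \<le> \<rho> \<bar>r - t\<bar>" using M0 True by (simp add: \<rho>_def mult_left_mono)
    finally show ?thesis .
  next
    case False
    define h where "h = t - r"
    have h: "0 < h" using False r by (simp add: h_def)
    have e: "S t z = S r (S h z)" for z using D(3)[of r h z] r h by (simp add: h_def)
    have "(S r x - S t x) /\<^sub>R (r - t) - S t y = S r ((S h x - x) /\<^sub>R h - y) - S r (S h y - y)"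
    proof -
      have "(S r x - S t x) /\<^sub>R (r - t) = (S t x - S r x) /\<^sub>R h"
      proof -
        have "r - t = - h" by (simp add: h_def)
        then show ?thesis by (simp add: scaleR_diff_right)
      qed
      then show ?thesis using r by (simp add: lin e)
    qed
    also have "norm \<dots> \<le> M * norm ((S h x - x) /\<^sub>R h - y) + M * norm (S h y - y)"
      using M r False by (intro norm_triangle_le_diff add_mono) auto
    finally show ?thesis using h by (simp add: \<rho>_def h_def distrib_left abs_minus_commute)
  qed
  show "((\<lambda>r. S r x) has_vector_derivative S t y) (at t within {0..})"
    unfolding has_vector_derivative_def has_derivative_within
  proof (intro conjI bounded_linear_scaleR_left)
    show "((\<lambda>r. (1 / norm (r - t)) *\<^sub>R (S r x - (S t x + (r - t) *\<^sub>R S t y))) \<longlongrightarrow> 0) (at t within {0..})"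
    proof (rule Lim_null_comparison)
      show "\<forall>\<^sub>F r in at t within {0..}. norm ((1 / norm (r - t)) *\<^sub>R (S r x - (S t x + (r - t) *\<^sub>R S t y))) \<le> \<rho> \<bar>r - t\<bar>"
        unfolding eventually_at_filter
      proof (rule always_eventually, intro allI impI)
        fix r assume r: "r \<noteq> t" "r \<in> {0..}"
        have "S r x - (S t x + (r - t) *\<^sub>R S t y) = (r - t) *\<^sub>R ((S r x - S t x) /\<^sub>R (r - t) - S t y)"
          using r by (simp add: scaleR_diff_right)
        then have "norm ((1 / norm (r - t)) *\<^sub>R (S r x - (S t x + (r - t) *\<^sub>R S t y)))
            = norm ((S r x - S t x) /\<^sub>R (r - t) - S t y)" using r by simp
        then show "norm ((1 / norm (r - t)) *\<^sub>R (S r x - (S t x + (r - t) *\<^sub>R S t y))) \<le> \<rho> \<bar>r - t\<bar>"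
          using est[of r] r by simp
      qed
      have "filterlim (\<lambda>r. \<bar>r - t\<bar>) (at_right 0) (at t within {0..})"
        unfolding filterlim_at
      proof
        show "\<forall>\<^sub>F r in at t within {0..}. \<bar>r - t\<bar> \<in> {0<..} \<and> \<bar>r - t\<bar> \<noteq> 0"
          unfolding eventually_at_filter by (rule always_eventually) auto
        have "((\<lambda>r. \<bar>r - t\<bar>) \<longlongrightarrow> \<bar>t - t\<bar>) (at t within {0..})" by (intro tendsto_intros)
        then show "((\<lambda>r. \<bar>r - t\<bar>) \<longlongrightarrow> 0) (at t within {0..})" by simp
      qed
      from filterlim_compose[OF \<rho> this] show "((\<lambda>r. \<rho> \<bar>r - t\<bar>) \<longlongrightarrow> 0) (at t within {0..})" .
    qed
  qed
  have "((\<lambda>h. S t ((S h x - x) /\<^sub>R h)) \<longlongrightarrow> S t y) (at_right 0)"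
    by (rule bounded_linear.tendsto[OF D(1)[OF t] lim])
  moreover have "\<forall>\<^sub>F h in at_right 0. S t ((S h x - x) /\<^sub>R h) = (S h (S t x) - S t x) /\<^sub>R h"
    using eventually_at_right_less[of 0]
  proof eventually_elim
    case (elim h)
    have "S h (S t x) = S t (S h x)" using D(3)[of h t x] D(3)[of t h x] t elim by (simp add: add.commute)
    then show ?case using t by (simp add: lin)
  qed
  ultimately show "(S t x, S t y) \<in> generator S"
    by (simp add: generator_def tendsto_cong)
qed

text \<open>Gronwall: \<open>exp (- 2 * K * t) * inner (f t) (f t)\<close> is nonincreasing when
  \<open>K\<close> bounds \<open>B\<close>.\<close>

lemma linear_ode_zero:
  fixes f :: "real \<Rightarrow> 'b::real_inner"
  assumes B: "bounded_linear B" and d: "\<And>t. 0 \<le> t \<Longrightarrow> (f has_vector_derivative B (f t)) (at t within {0..})"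
    and f0: "f 0 = 0" and t: "0 \<le> t"
  shows "f t = 0"
proof -
  obtain K where K: "\<And>x. norm (B x) \<le> norm x * K" using bounded_linear.bounded[OF B] by blast
  define w where "w s = exp (- 2 * K * s) * inner (f s) (f s)" for s
  have cf: "continuous_on {0..} f"
    using d by (intro continuous_on_vector_derivative) auto
  have "w t \<le> w 0"
  proof (cases "t = 0")
    case False
    show ?thesis
    proof (rule DERIV_nonpos_imp_decreasing_open[of 0 t w])
      show "continuous_on {0..t} w" unfolding w_def
        by (intro continuous_intros continuous_on_subset[OF cf]) auto
      fix s assume s: "0 < s" "s < t"
      have "at s within {0..} = at s" by (rule at_within_interior) (use s in simp)
      then have "(f has_vector_derivative B (f s)) (at s)" using d[of s] s by simp
      then have fd: "(f has_derivative (\<lambda>h. h *\<^sub>R B (f s))) (at s)" by (simp add: has_vector_derivative_def)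
      have "((\<lambda>s. inner (f s) (f s)) has_derivative (\<lambda>h. inner (f s) (h *\<^sub>R B (f s)) + inner (h *\<^sub>R B (f s)) (f s))) (at s)"
        by (rule has_derivative_inner[OF fd fd])
      then have nd: "((\<lambda>s. inner (f s) (f s)) has_real_derivative 2 * inner (f s) (B (f s))) (at s)"
        unfolding has_field_derivative_def
        by (rule has_derivative_eq_rhs) (simp add: fun_eq_iff inner_commute)
      have "(w has_real_derivative (exp (- 2 * K * s) * (2 * inner (f s) (B (f s)) - 2 * K * inner (f s) (f s)))) (at s)"
        unfolding w_def by (auto intro!: derivative_eq_intros nd simp: algebra_simps)
      moreover have "inner (f s) (B (f s)) \<le> K * inner (f s) (f s)"
      proof -
        have "inner (f s) (B (f s)) \<le> norm (f s) * norm (B (f s))" by (rule norm_cauchy_schwarz)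
        also have "\<dots> \<le> norm (f s) * (norm (f s) * K)" by (rule mult_left_mono[OF K]) simp
        finally show ?thesis by (simp add: power2_norm_eq_inner[symmetric] power2_eq_square mult_ac)
      qed
      ultimately show "\<exists>y. (w has_real_derivative y) (at s) \<and> y \<le> 0"
        by (intro exI conjI) (auto intro!: mult_nonneg_nonpos)
    qed (use False t in simp_all)
  qed simp
  then have "inner (f t) (f t) \<le> 0" by (simp add: w_def f0 mult_le_0_iff)
  then have "inner (f t) (f t) = 0" using inner_ge_zero[of "f t"] by linarith
  then show ?thesis by (simp only: inner_eq_zero_iff)
qed

text \<open>An isometry \<open>c\<close> onto the square-summable sequences conjugates the semigroup to the blocks \<open>U k\<close>.
  The heat and the wave semigroup have blocks of dimension one and two.\<close>

locale block_diagonal =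
  fixes c :: "'x::{real_normed_vector, complete_space} \<Rightarrow> nat \<Rightarrow> 'b::real_inner"
    and B :: "nat \<Rightarrow> 'b \<Rightarrow> 'b" and U :: "nat \<Rightarrow> real \<Rightarrow> 'b \<Rightarrow> 'b" and C :: real
  assumes c: "\<And>k. bounded_linear (\<lambda>x. c x k)"
    and norm_c: "\<And>x. (\<lambda>k. (norm (c x k))\<^sup>2) sums (norm x)\<^sup>2"
    and c_surj: "\<And>s. summable (\<lambda>k. (norm (s k))\<^sup>2) \<Longrightarrow> \<exists>x. \<forall>k. c x k = s k"
    and B: "\<And>k. bounded_linear (B k)"
    and U_0: "\<And>k b. U k 0 b = b"
    and U_deriv: "\<And>k t b. 0 \<le> t \<Longrightarrow> ((\<lambda>t. U k t b) has_vector_derivative B k (U k t b)) (at t within {0..})"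
    and U_bound: "\<And>k t b. 0 \<le> t \<Longrightarrow> norm (U k t b) \<le> C * norm b"
begin

section \<open>The diagonal semigroup and its generator\<close>

lemma c_lin: "c (x + y) k = c x k + c y k" "c (x - y) k = c x k - c y k" "c (r *\<^sub>R x) k = r *\<^sub>R c x k"
  using linear_simps(1,2,5)[OF c[of k]] by simp_all

lemma c_inject: "(\<And>k. c x k = c y k) \<Longrightarrow> x = y"
proof -
  assume "\<And>k. c x k = c y k"
  then have "(\<lambda>k. 0) sums (norm (x - y))\<^sup>2" using norm_c[of "x - y"] by (simp add: c_lin)
  then have "(norm (x - y))\<^sup>2 = 0" using sums_unique2 sums_zero by blast
  then show "x = y" by simp
qed

lemma solution_unique:
  assumes "\<And>t. 0 \<le> t \<Longrightarrow> (f has_vector_derivative B k (f t)) (at t within {0..})"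
    and "\<And>t. 0 \<le> t \<Longrightarrow> (g has_vector_derivative B k (g t)) (at t within {0..})"
    and "f 0 = g 0" "0 \<le> t"
  shows "f t = g t"
proof -
  have "f t - g t = 0"
  proof (rule linear_ode_zero[OF B[of k], of "\<lambda>t. f t - g t"])
    fix t :: real assume "0 \<le> t"
    then show "((\<lambda>t. f t - g t) has_vector_derivative B k (f t - g t)) (at t within {0..})"
      unfolding linear_simps(2)[OF B] by (intro has_vector_derivative_diff assms(1,2))
  qed (use assms in simp_all)
  then show ?thesis by simp
qed

text \<open>The semigroup law, like the linearity and the commutation below, follows because both
  sides solve the same linear equation with the same initial value.\<close>

lemma U_add_time: 
  assumes s: "0 \<le> s" and t: "0 \<le> t" shows "U k (t + s) b = U k t (U k s b)"
proof (rule solution_unique[of "\<lambda>t. U k (t + s) b" k "\<lambda>t. U k t (U k s b)"])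
  fix t :: real assume t: "0 \<le> t"
  have "((\<lambda>t. U k t b) has_vector_derivative B k (U k (t + s) b)) (at (t + s) within (\<lambda>t. t + s) ` {0..})"
    by (rule has_vector_derivative_within_subset[OF U_deriv]) (use s t in auto)
  moreover have "((\<lambda>t. t + s) has_vector_derivative 1) (at t within {0..})"
    by (auto intro!: derivative_eq_intros)
  ultimately have "((\<lambda>t. U k t b) \<circ> (\<lambda>t. t + s) has_vector_derivative 1 *\<^sub>R B k (U k (t + s) b)) (at t within {0..})"
    by (intro vector_diff_chain_within)
  then show "((\<lambda>t. U k (t + s) b) has_vector_derivative B k (U k (t + s) b)) (at t within {0..})"
    by (simp add: o_def)
qed (use U_deriv U_0 t in simp_all)

lemma U_linear: "0 \<le> t \<Longrightarrow> U k t (a + b) = U k t a + U k t b" "0 \<le> t \<Longrightarrow> U k t (r *\<^sub>R a) = r *\<^sub>R U k t a"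
proof -
  assume t: "0 \<le> t"
  show "U k t (a + b) = U k t a + U k t b"
    by (rule solution_unique[of "\<lambda>t. U k t (a + b)" k "\<lambda>t. U k t a + U k t b", OF U_deriv _ _ t])
      (auto simp: linear_simps(1)[OF B] U_0 intro!: has_vector_derivative_add U_deriv)
  show "U k t (r *\<^sub>R a) = r *\<^sub>R U k t a"
  proof (rule solution_unique[of "\<lambda>t. U k t (r *\<^sub>R a)" k "\<lambda>t. r *\<^sub>R U k t a", OF U_deriv _ _ t])
    fix t :: real assume "0 \<le> t"
    then show "((\<lambda>t. r *\<^sub>R U k t a) has_vector_derivative B k (r *\<^sub>R U k t a)) (at t within {0..})"
      unfolding linear_simps(5)[OF B]
      by (rule bounded_linear.has_vector_derivative[OF bounded_linear_scaleR_right U_deriv])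
  qed (simp_all add: U_0)
qed

lemma U_comm: "0 \<le> t \<Longrightarrow> U k t (B k b) = B k (U k t b)"
proof -
  assume t: "0 \<le> t"
  show ?thesis
  proof (rule solution_unique[of "\<lambda>t. U k t (B k b)" k "\<lambda>t. B k (U k t b)", OF U_deriv _ _ t])
    fix t :: real assume "0 \<le> t"
    then show "((\<lambda>t. B k (U k t b)) has_vector_derivative B k (B k (U k t b))) (at t within {0..})"
      by (rule bounded_linear.has_vector_derivative[OF B U_deriv])
  qed (simp_all add: U_0)
qed

lemma summable_c: "summable (\<lambda>k. (norm (c x k))\<^sup>2)"
  using norm_c sums_summable by blast

lemma dominated_square:
  assumes "\<And>k. norm (s k) \<le> D * norm (c x k)"
  shows "summable (\<lambda>k. (norm (s k))\<^sup>2)"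
proof (rule summable_comparison_test'[OF summable_mult[OF summable_c[of x], of "D\<^sup>2"], of 0])
  fix k
  show "norm ((norm (s k))\<^sup>2) \<le> D\<^sup>2 * (norm (c x k))\<^sup>2"
    using power_mono[OF assms[of k], of 2] by (simp add: power_mult_distrib)
qed

text \<open>The choice is meaningful for \<open>0 \<le> t\<close>, where \<open>U_bound\<close>
  keeps the coordinates square-summable.\<close>

definition S :: "real \<Rightarrow> 'x \<Rightarrow> 'x" where
  "S t x = (SOME y. \<forall>k. c y k = U k t (c x k))"

lemma c_S: "0 \<le> t \<Longrightarrow> c (S t x) k = U k t (c x k)"
proof -
  assume t: "0 \<le> t"
  have "\<exists>y. \<forall>k. c y k = U k t (c x k)"
    by (rule c_surj) (rule dominated_square[OF U_bound[OF t]])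
  from someI_ex[OF this] show ?thesis unfolding S_def by blast
qed

lemma norm_from_coords:
  assumes "\<And>k. norm (c y k) \<le> D * norm (c x k)" "0 \<le> D" shows "norm y \<le> D * norm x"
proof -
  have "(norm (c y k))\<^sup>2 \<le> D\<^sup>2 * (norm (c x k))\<^sup>2" for k
    using power_mono[OF assms(1)[of k], of 2] by (simp add: power_mult_distrib)
  then have "(norm y)\<^sup>2 \<le> D\<^sup>2 * (norm x)\<^sup>2" by (rule sums_le[OF _ norm_c sums_mult[OF norm_c]])
  then have "(norm y)\<^sup>2 \<le> (D * norm x)\<^sup>2" by (simp only: power_mult_distrib)
  then show ?thesis by (rule power2_le_imp_le) (simp add: assms(2))
qed

lemma norm_S: "0 \<le> t \<Longrightarrow> norm (S t x) \<le> \<bar>C\<bar> * norm x"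
proof (rule norm_from_coords)
  fix k assume t: "0 \<le> t"
  have "C * norm (c x k) \<le> \<bar>C\<bar> * norm (c x k)" by (rule mult_right_mono) auto
  then show "norm (c (S t x) k) \<le> \<bar>C\<bar> * norm (c x k)" using U_bound[OF t, of k "c x k"] c_S[OF t] by simp
qed simp

text \<open>Tannery's theorem: coordinatewise limits may be summed under a square-summable
  majorant.\<close>

lemma tendsto_from_coords:
  assumes "\<And>k. ((\<lambda>t. c (X t) k) \<longlongrightarrow> 0) F" "\<forall>\<^sub>F t in F. \<forall>k. norm (c (X t) k) \<le> D * norm (c y k)" "F \<noteq> bot"
  shows "(X \<longlongrightarrow> 0) F"
proof -
  let ?a = "\<lambda>k t. (norm (c (X t) k))\<^sup>2"
  have 1: "(?a k \<longlongrightarrow> 0) F" for k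
  proof -
    have "(?a k \<longlongrightarrow> (norm (0::'b))\<^sup>2) F" by (intro tendsto_intros assms(1))
    then show ?thesis by simp
  qed
  have 2: "\<forall>\<^sub>F (k, t) in at_top \<times>\<^sub>F F. norm (?a k t) \<le> D\<^sup>2 * (norm (c y k))\<^sup>2"
  proof -
    have "\<forall>\<^sub>F t in F. \<forall>k. norm (?a k t) \<le> D\<^sup>2 * (norm (c y k))\<^sup>2"
      using assms(2)
    proof eventually_elim
      case (elim t)
      then show ?case using power_mono[of "norm (c (X t) _)" _ 2] by (auto simp flip: power_mult_distrib)
    qed
    then show ?thesis unfolding eventually_prod_filter
      by (intro exI[of _ "\<lambda>_. True"] exI[of _ "\<lambda>t. \<forall>k. norm (?a k t) \<le> D\<^sup>2 * (norm (c y k))\<^sup>2"]) simp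
  qed
  have "((\<lambda>t. \<Sum>k. ?a k t) \<longlongrightarrow> (\<Sum>k. 0)) F"
    using tannerys_theorem[OF 1 2 summable_mult[OF summable_c] assms(3)] by blast
  moreover have "(\<Sum>k. ?a k t) = (norm (X t))\<^sup>2" for t using norm_c[of "X t"] by (rule sums_unique[symmetric])
  ultimately have "((\<lambda>t. sqrt ((norm (X t))\<^sup>2)) \<longlongrightarrow> sqrt 0) F" by (intro tendsto_real_sqrt) simp
  then show ?thesis by (simp add: tendsto_norm_zero_iff)
qed

lemma U_quotient: "((\<lambda>t. (U k t b - b) /\<^sub>R t) \<longlongrightarrow> B k b) (at_right 0)"
proof -
  have "at (0::real) within {0..} = at_right 0"
  proof -
    have "{0..} - {0} = {0<..} - {0::real}" by auto
    then show ?thesis by (simp only: at_within_def)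
  qed
  then have "((\<lambda>t. U k t b) has_vector_derivative B k b) (at_right 0)"
    using U_deriv[of 0 k b] by (simp add: U_0)
  then have "((\<lambda>t. (1 / norm (t - 0)) *\<^sub>R (U k t b - (U k 0 b + (t - 0) *\<^sub>R B k b))) \<longlongrightarrow> 0) (at_right 0)"
    unfolding has_vector_derivative_def has_derivative_within by blast
  moreover have "\<forall>\<^sub>F t in at_right 0. (1 / norm (t - 0)) *\<^sub>R (U k t b - (U k 0 b + (t - 0) *\<^sub>R B k b))
      = (U k t b - b) /\<^sub>R t - B k b"
    using eventually_at_right_less[of 0]
    by eventually_elim (simp add: U_0 scaleR_diff_right scaleR_add_right divide_inverse)
  ultimately have "((\<lambda>t. (U k t b - b) /\<^sub>R t - B k b) \<longlongrightarrow> 0) (at_right 0)"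
    by (rule Lim_transform_eventually)
  then show ?thesis by (simp add: LIM_zero_iff)
qed

text \<open>\<open>B k\<close> commutes with \<open>U k\<close>, so the speed is at most
  \<open>C * norm (B k b)\<close> at all times. This is the majorant for the difference quotients in
  \<open>generator_S\<close>.\<close>

lemma U_increment: "0 \<le> t \<Longrightarrow> norm (U k t b - b) \<le> C * norm (B k b) * t"
proof -
  assume t: "0 \<le> t"
  have "norm (U k t b - U k 0 b) \<le> C * norm (B k b) * norm (t - 0)"
  proof (rule differentiable_bound[of "{0..}" "\<lambda>t. U k t b" "\<lambda>t h. h *\<^sub>R B k (U k t b)"])
    show "convex {0::real..}" by simp
    fix s :: real assume "s \<in> {0..}"
    then have s: "0 \<le> s" by simp
    show "((\<lambda>t. U k t b) has_derivative (\<lambda>h. h *\<^sub>R B k (U k s b))) (at s within {0..})"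
      using U_deriv[OF s] by (simp add: has_vector_derivative_def)
    have le: "norm (B k (U k s b)) \<le> C * norm (B k b)" using U_bound[OF s, of k "B k b"] U_comm[OF s] by simp
    then show "onorm (\<lambda>h. h *\<^sub>R B k (U k s b)) \<le> C * norm (B k b)"
      by (intro onorm_bound order_trans[OF norm_ge_zero le]) (simp add: mult.commute mult_left_mono)
  qed (use t in simp_all)
  then show ?thesis using t by (simp add: U_0)
qed

text \<open>The maximal diagonal operator: \<open>x\<close> is in the domain as soon as the sequence
  \<open>B k (c x k)\<close> belongs to some vector.\<close>

definition G :: "('x \<times> 'x) set" where
  "G = {(x, y). \<forall>k. c y k = B k (c x k)}"

lemma semigroup_S: "C0_semigroup S"
  unfolding C0_semigroup_def
proof (intro conjI allI impI)
  fix t :: real assume t: "0 \<le> t"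
  show "bounded_linear (S t)"
  proof (rule bounded_linear_intro[where K = "\<bar>C\<bar>"])
    show "S t (x + y) = S t x + S t y" for x y by (rule c_inject) (simp add: c_S[OF t] c_lin U_linear[OF t])
    show "S t (r *\<^sub>R x) = r *\<^sub>R S t x" for r x by (rule c_inject) (simp add: c_S[OF t] c_lin U_linear[OF t])
    show "norm (S t x) \<le> norm x * \<bar>C\<bar>" for x using norm_S[OF t, of x] by (simp add: mult.commute)
  qed
next
  show "S 0 = id" by (rule ext, rule c_inject) (simp add: c_S U_0)
next
  fix s t :: real assume "0 \<le> s" "0 \<le> t"
  then show "S (s + t) = S s \<circ> S t" by (intro ext, intro c_inject) (simp add: c_S U_add_time)
next
  fix x
  have "((\<lambda>t. S t x - x) \<longlongrightarrow> 0) (at_right 0)"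
  proof (rule tendsto_from_coords[where y = x and D = "\<bar>C\<bar> + 1"])
    fix k
    have "((\<lambda>t. t *\<^sub>R ((U k t (c x k) - c x k) /\<^sub>R t)) \<longlongrightarrow> 0 *\<^sub>R B k (c x k)) (at_right 0)"
      by (intro tendsto_intros U_quotient)
    moreover have "\<forall>\<^sub>F t in at_right 0. t *\<^sub>R ((U k t (c x k) - c x k) /\<^sub>R t) = c (S t x - x) k"
      using eventually_at_right_less[of 0] by eventually_elim (simp add: c_S c_lin)
    ultimately have "((\<lambda>t. c (S t x - x) k) \<longlongrightarrow> 0 *\<^sub>R B k (c x k)) (at_right 0)" by (rule Lim_transform_eventually)
    then show "((\<lambda>t. c (S t x - x) k) \<longlongrightarrow> 0) (at_right 0)" by simp
  next
    show "\<forall>\<^sub>F t in at_right 0. \<forall>k. norm (c (S t x - x) k) \<le> (\<bar>C\<bar> + 1) * norm (c x k)"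
      using eventually_at_right_less[of 0]
    proof eventually_elim
      case (elim t)
      show ?case
      proof
        fix k
        have "norm (c (S t x - x) k) \<le> norm (U k t (c x k)) + norm (c x k)"
          using elim by (simp add: c_S c_lin norm_triangle_ineq4)
        also have "\<dots> \<le> C * norm (c x k) + norm (c x k)" using U_bound[of t k "c x k"] elim by simp
        also have "\<dots> \<le> (\<bar>C\<bar> + 1) * norm (c x k)" by (simp add: distrib_right mult_right_mono)
        finally show "norm (c (S t x - x) k) \<le> (\<bar>C\<bar> + 1) * norm (c x k)" .
      qed
    qed
  qed simp
  then show "((\<lambda>t. S t x) \<longlongrightarrow> x) (at_right 0)" by (simp add: LIM_zero_iff)
qed

text \<open>Coordinates of a limit give one inclusion. For the other, the difference quotients
  converge in each coordinate and are dominated through \<open>U_increment\<close>, so they converge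
  in norm.\<close>

lemma generator_S: "generator S = G"
proof (rule set_eqI, clarify)
  fix x y
  show "(x, y) \<in> generator S \<longleftrightarrow> (x, y) \<in> G"
  proof
    assume "(x, y) \<in> generator S"
    then have l: "((\<lambda>t. (S t x - x) /\<^sub>R t) \<longlongrightarrow> y) (at_right 0)" by (simp add: generator_def)
    have "c y k = B k (c x k)" for k
    proof (rule tendsto_unique)
      show "((\<lambda>t. c ((S t x - x) /\<^sub>R t) k) \<longlongrightarrow> c y k) (at_right 0)" by (rule bounded_linear.tendsto[OF c l])
      have "\<forall>\<^sub>F t in at_right 0. (U k t (c x k) - c x k) /\<^sub>R t = c ((S t x - x) /\<^sub>R t) k"
        using eventually_at_right_less[of 0] by eventually_elim (simp add: c_S c_lin)
      from tendsto_cong[OF this] U_quotient[of k "c x k"]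
      show "((\<lambda>t. c ((S t x - x) /\<^sub>R t) k) \<longlongrightarrow> B k (c x k)) (at_right 0)" by blast
    qed simp
    then show "(x, y) \<in> G" by (simp add: G_def)
  next
    assume "(x, y) \<in> G"
    then have y: "c y k = B k (c x k)" for k by (simp add: G_def)
    have "((\<lambda>t. (S t x - x) /\<^sub>R t - y) \<longlongrightarrow> 0) (at_right 0)"
    proof (rule tendsto_from_coords[where y = y and D = "\<bar>C\<bar> + 1"])
      fix k
      have "((\<lambda>t. (U k t (c x k) - c x k) /\<^sub>R t - c y k) \<longlongrightarrow> 0) (at_right 0)"
        unfolding y using U_quotient[of k "c x k"] by (simp add: LIM_zero_iff)
      moreover have "\<forall>\<^sub>F t in at_right 0. (U k t (c x k) - c x k) /\<^sub>R t - c y k = c ((S t x - x) /\<^sub>R t - y) k"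
        using eventually_at_right_less[of 0] by eventually_elim (simp add: c_S c_lin)
      ultimately show "((\<lambda>t. c ((S t x - x) /\<^sub>R t - y) k) \<longlongrightarrow> 0) (at_right 0)" by (rule Lim_transform_eventually)
    next
      show "\<forall>\<^sub>F t in at_right 0. \<forall>k. norm (c ((S t x - x) /\<^sub>R t - y) k) \<le> (\<bar>C\<bar> + 1) * norm (c y k)"
        using eventually_at_right_less[of 0]
      proof eventually_elim
        case (elim t)
        show ?case
        proof
          fix k
          have "norm (U k t (c x k) - c x k) / t \<le> C * norm (c y k)"
            using U_increment[of t k "c x k"] elim by (simp add: y pos_divide_le_eq)
          moreover have "norm ((U k t (c x k) - c x k) /\<^sub>R t) = norm (U k t (c x k) - c x k) / t"
            using elim by (simp add: divide_inverse mult.commute)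
          moreover have "norm (c ((S t x - x) /\<^sub>R t - y) k) \<le> norm ((U k t (c x k) - c x k) /\<^sub>R t) + norm (c y k)"
            using elim norm_triangle_ineq4[of "(U k t (c x k) - c x k) /\<^sub>R t" "c y k"] by (simp add: c_S c_lin)
          moreover have "C * norm (c y k) \<le> \<bar>C\<bar> * norm (c y k)" by (rule mult_right_mono) auto
          ultimately show "norm (c ((S t x - x) /\<^sub>R t - y) k) \<le> (\<bar>C\<bar> + 1) * norm (c y k)"
            unfolding distrib_right mult_1_left by linarith
        qed
      qed
    qed simp
    then show "(x, y) \<in> generator S" by (simp add: generator_def LIM_zero_iff)
  qed
qed

text \<open>For \<open>x\<close> in the domain each coordinate of the orbit solves the block
  equation, which determines it. Finitely supported vectors lie in the domain and are dense. This
  makes \<open>semigroup_of\<close>, an arbitrary choice, computable.\<close>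

lemma semigroup_unique:
  assumes R: "C0_semigroup R" and g: "generator R = G" and t: "0 \<le> t"
  shows "c (R t x) k = U k t (c x k)"
proof -
  have dom: "c (R t x) k = U k t (c x k)" if xy: "(x, y) \<in> G" for x y
  proof (rule solution_unique[OF _ U_deriv _ t, of "\<lambda>t. c (R t x) k" k "c x k"])
    have xg: "(x, y) \<in> generator R" using xy g by simp
    fix s :: real assume s: "0 \<le> s"
    have "((\<lambda>s. c (R s x) k) has_vector_derivative c (R s y) k) (at s within {0..})"
      by (rule bounded_linear.has_vector_derivative[OF c C0_semigroup_orbit(1)[OF R xg s]])
    moreover have "(R s x, R s y) \<in> G" using C0_semigroup_orbit(2)[OF R xg s] g by simp
    ultimately show "((\<lambda>s. c (R s x) k) has_vector_derivative B k (c (R s x) k)) (at s within {0..})"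
      by (simp add: G_def)
  qed (simp_all add: C0_semigroupD(2)[OF R] U_0)
  have "\<exists>x'. \<forall>k. c x' k = (if k < N then c x k else 0)" for N
    by (rule c_surj) (rule dominated_square[of _ 1 x], simp)
  then obtain X where X: "\<And>N k. c (X N) k = (if k < N then c x k else 0)"
    using choice[of "\<lambda>N x'. \<forall>k. c x' k = (if k < N then c x k else 0)"] by blast
  have "(\<lambda>N. X N - x) \<longlonglongrightarrow> 0"
  proof (rule tendsto_from_coords[where y = x and D = 1])
    fix k
    have "\<forall>\<^sub>F N in sequentially. c (X N - x) k = 0"
      using eventually_gt_at_top[of k] by eventually_elim (simp add: c_lin X)
    then show "(\<lambda>N. c (X N - x) k) \<longlonglongrightarrow> 0" by (rule tendsto_eventually)
  next
    show "\<forall>\<^sub>F N in sequentially. \<forall>k. norm (c (X N - x) k) \<le> 1 * norm (c x k)"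
      by (rule always_eventually) (simp add: c_lin X)
  qed simp
  then have Xl: "X \<longlonglongrightarrow> x" by (simp add: LIM_zero_iff)
  have "(\<lambda>N. c (R t (X N)) k) \<longlonglongrightarrow> c (R t x) k"
    by (rule bounded_linear.tendsto[OF c bounded_linear.tendsto[OF C0_semigroupD(1)[OF R t] Xl]])
  moreover have "\<forall>\<^sub>F N in sequentially. c (R t (X N)) k = U k t (c x k)"
    using eventually_gt_at_top[of k]
  proof eventually_elim
    case (elim N)
    have "summable (\<lambda>k. (norm (B k (c (X N) k)))\<^sup>2)"
      by (rule summable_finite[of "{..<N}"]) (simp_all add: X linear_simps(3)[OF B])
    from c_surj[OF this] obtain y where "\<forall>k. c y k = B k (c (X N) k)" by blast
    then have "(X N, y) \<in> G" by (simp add: G_def)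
    from dom[OF this] show ?case using elim by (simp add: X)
  qed
  then have "(\<lambda>N. c (R t (X N)) k) \<longlonglongrightarrow> U k t (c x k)" by (rule tendsto_eventually)
  ultimately show ?thesis by (rule LIMSEQ_unique)
qed

lemma c_semigroup_of: "0 \<le> t \<Longrightarrow> c (semigroup_of G t x) k = U k t (c x k)"
proof -
  assume t: "0 \<le> t"
  have "C0_semigroup (semigroup_of G) \<and> generator (semigroup_of G) = G"
    unfolding semigroup_of_def by (rule someI[of _ S]) (simp add: semigroup_S generator_S)
  then show ?thesis using semigroup_unique t by blast
qed

lemma norm_semigroup_of: "0 \<le> t \<Longrightarrow> norm (semigroup_of G t x) \<le> \<bar>C\<bar> * norm x"
  using norm_S[of t x] c_inject[of "semigroup_of G t x" "S t x"] by (simp add: c_semigroup_of c_S)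

end

section \<open>Test functions and the Dirichlet Laplacian\<close>

lemma partial_eq: "(f has_derivative D) (at x) \<Longrightarrow> partial i f x = D i"
  unfolding partial_def by (subst frechet_derivative_at[symmetric]) auto

lemma differentiable_has_derivative:
  "f differentiable (at x) \<Longrightarrow> (f has_derivative frechet_derivative f (at x)) (at x)"
  by (simp add: frechet_derivative_works)

lemma partial_lin:
  fixes f g :: "'a::euclidean_space \<Rightarrow> real"
  assumes "f differentiable (at x)" "g differentiable (at x)"
  shows "partial i (\<lambda>x. f x + r * g x) x = partial i f x + r * partial i g x"
proof -
  have "((\<lambda>x. f x + r * g x) has_derivative
      (\<lambda>h. frechet_derivative f (at x) h + r * frechet_derivative g (at x) h)) (at x)"
    by (intro has_derivative_add has_derivative_mult_right differentiable_has_derivative assms)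
  from partial_eq[OF this] show ?thesis by (simp add: partial_def)
qed

lemma partial_mult:
  fixes f g :: "'a::euclidean_space \<Rightarrow> real"
  assumes "f differentiable (at x)" "g differentiable (at x)"
  shows "partial i (\<lambda>x. f x * g x) x = f x * partial i g x + partial i f x * g x"
proof -
  have "((\<lambda>x. f x * g x) has_derivative
      (\<lambda>h. f x * frechet_derivative g (at x) h + frechet_derivative f (at x) h * g x)) (at x)"
    by (intro has_derivative_mult differentiable_has_derivative assms)
  from partial_eq[OF this] show ?thesis by (simp add: partial_def)
qed

lemma C_k_lin:
  fixes f g :: "'a::euclidean_space \<Rightarrow> real"
  shows "C_k k f \<Longrightarrow> C_k k g \<Longrightarrow> C_k k (\<lambda>x. f x + r * g x)"
proof (induction k arbitrary: f g)
  case 0 then show ?case by (auto intro!: continuous_intros)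
next
  case (Suc k)
  have eq: "partial i (\<lambda>x. f x + r * g x) = (\<lambda>x. partial i f x + r * partial i g x)" for i
    using Suc.prems by (auto simp: partial_lin)
  show ?case unfolding C_k.simps eq
    using Suc by (auto intro!: differentiable_add differentiable_mult)
qed

lemma C_k_imp_continuous: "C_k k f \<Longrightarrow> continuous_on UNIV f"
  by (cases k) (auto intro!: continuous_at_imp_continuous_on differentiable_imp_continuous_within)

lemma partial_outside:
  fixes f :: "'a::euclidean_space \<Rightarrow> real"
  assumes "closed K" "\<And>x. x \<notin> K \<Longrightarrow> f x = 0" "x \<notin> K"
  shows "partial i f x = 0"
proof -
  have o: "open (- K)" using assms(1) by (simp add: open_Compl)
  have "(f has_derivative (\<lambda>_. 0)) (at x)"
    by (rule has_derivative_transform_within_open[OF has_derivative_const[of 0] o]) (use assms in auto)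
  from partial_eq[OF this] show ?thesis by simp
qed

lemma test_functionD:
  assumes "test_function \<Omega> \<phi>"
  shows "\<phi> differentiable (at x)" "continuous_on UNIV \<phi>"
    "i \<in> Basis \<Longrightarrow> test_function \<Omega> (partial i \<phi>)"
    "\<exists>K. compact K \<and> K \<subseteq> \<Omega> \<and> (\<forall>x. x \<notin> K \<longrightarrow> \<phi> x = 0)"
proof -
  have C: "C_k k \<phi>" for k using assms by (simp add: test_function_def)
  show "\<phi> differentiable (at x)" using C[of 1] by simp
  show "continuous_on UNIV \<phi>" by (rule C_k_imp_continuous[OF C])
  show K: "\<exists>K. compact K \<and> K \<subseteq> \<Omega> \<and> (\<forall>x. x \<notin> K \<longrightarrow> \<phi> x = 0)" using assms by (simp add: test_function_def)
  assume i: "i \<in> Basis"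
  obtain K where "compact K" "K \<subseteq> \<Omega>" "\<And>x. x \<notin> K \<Longrightarrow> \<phi> x = 0" using K by blast
  then have "\<forall>x. x \<notin> K \<longrightarrow> partial i \<phi> x = 0" using partial_outside[OF compact_imp_closed] by blast
  moreover have "C_k k (partial i \<phi>)" for k using C[of "Suc k"] i by simp
  ultimately show "test_function \<Omega> (partial i \<phi>)"
    unfolding test_function_def using \<open>compact K\<close> \<open>K \<subseteq> \<Omega>\<close> by blast
qed

lemma test_function_lin:
  assumes "test_function \<Omega> \<phi>" "test_function \<Omega> \<xi>"
  shows "test_function \<Omega> (\<lambda>x. \<phi> x + r * \<xi> x)"
proof -
  obtain K where K: "compact K" "K \<subseteq> \<Omega>" "\<And>x. x \<notin> K \<Longrightarrow> \<phi> x = 0" using test_functionD(4)[OF assms(1)] by blast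
  obtain L where L: "compact L" "L \<subseteq> \<Omega>" "\<And>x. x \<notin> L \<Longrightarrow> \<xi> x = 0" using test_functionD(4)[OF assms(2)] by blast
  have "compact (K \<union> L)" "K \<union> L \<subseteq> \<Omega>" "\<forall>x. x \<notin> K \<union> L \<longrightarrow> \<phi> x + r * \<xi> x = 0" using K L by auto
  then show ?thesis using assms C_k_lin unfolding test_function_def by blast
qed

lemma laplacian_lin:
  assumes "test_function \<Omega> \<phi>" "test_function \<Omega> \<xi>"
  shows "laplacian (\<lambda>x. \<phi> x + r * \<xi> x) x = laplacian \<phi> x + r * laplacian \<xi> x"
proof -
  have "partial i (\<lambda>x. \<phi> x + r * \<xi> x) = (\<lambda>x. partial i \<phi> x + r * partial i \<xi> x)" for i
    using test_functionD(1)[OF assms(1)] test_functionD(1)[OF assms(2)] by (auto simp: partial_lin)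
  then have "partial i (partial i (\<lambda>x. \<phi> x + r * \<xi> x)) x = partial i (partial i \<phi>) x + r * partial i (partial i \<xi>) x"
    if "i \<in> Basis" for i
    using test_functionD(1)[OF test_functionD(3)[OF assms(1) that]] test_functionD(1)[OF test_functionD(3)[OF assms(2) that]]
    by (simp add: partial_lin)
  then show ?thesis by (simp add: laplacian_def sum.distrib sum_distrib_left)
qed

section \<open>Integration by parts for test functions\<close>

lemma integrable_compact_support:
  fixes f :: "'a::euclidean_space \<Rightarrow> real"
  assumes "continuous_on UNIV f" "compact K" "\<And>x. x \<notin> K \<Longrightarrow> f x = 0"
  shows "integrable lborel f"
proof -
  have "integrable lborel (\<lambda>x. indicator K x *\<^sub>R f x)"
    by (rule borel_integrable_compact[OF assms(2) continuous_on_subset[OF assms(1)]]) simp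
  moreover have "(\<lambda>x. indicator K x *\<^sub>R f x) = f" using assms(3) by (auto simp: indicator_def fun_eq_iff)
  ultimately show ?thesis by simp
qed

text \<open>The integral of a difference quotient vanishes by translation invariance.\<close>

lemma integral_partial_eq_0:
  fixes f :: "'a::euclidean_space \<Rightarrow> real"
  assumes d: "\<And>x. f differentiable (at x)" and c: "continuous_on UNIV (partial i f)"
    and K: "compact K" "\<And>x. x \<notin> K \<Longrightarrow> f x = 0"
  shows "(\<integral>x. partial i f x \<partial>lborel) = 0"
proof -
  have cf: "continuous_on UNIV f"
    by (auto intro!: continuous_at_imp_continuous_on differentiable_imp_continuous_within d)
  have fi: "integrable lborel f" by (rule integrable_compact_support[OF cf K])
  have pK: "partial i f x = 0" if "x \<notin> K" for x by (rule partial_outside[OF compact_imp_closed[OF K(1)] K(2) that])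
  have line: "((\<lambda>t. f (x + t *\<^sub>R i)) has_real_derivative partial i f (x + t *\<^sub>R i)) (at t)" for x t
  proof -
    have lin: "linear (frechet_derivative f (at (x + t *\<^sub>R i)))" by (rule linear_frechet_derivative[OF d])
    have "((\<lambda>t. f (x + t *\<^sub>R i)) has_derivative (\<lambda>h. frechet_derivative f (at (x + t *\<^sub>R i)) (h *\<^sub>R i))) (at t)"
      by (rule has_derivative_compose[where g = f, OF _ differentiable_has_derivative[OF d]])
         (auto intro!: derivative_eq_intros)
    moreover have "(\<lambda>h. frechet_derivative f (at (x + t *\<^sub>R i)) (h *\<^sub>R i)) = (*) (partial i f (x + t *\<^sub>R i))"
      by (rule ext) (simp add: linear_scale[OF lin] partial_def)
    ultimately show ?thesis unfolding has_field_derivative_def by (simp only:)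
  qed
  have "compact (partial i f ` K)" by (intro compact_continuous_image continuous_on_subset[OF c] K) simp
  then obtain M where M: "\<forall>y\<in>partial i f ` K. norm y \<le> M"
    using compact_imp_bounded bounded_iff by blast
  have M': "\<bar>partial i f x\<bar> \<le> \<bar>M\<bar>" for x
  proof (cases "x \<in> K")
    case True
    then have "\<bar>partial i f x\<bar> \<le> M" using M by auto
    then show ?thesis by linarith
  qed (simp add: pK)
  obtain R where R: "\<forall>x\<in>K. norm x \<le> R" using compact_imp_bounded[OF K(1)] bounded_iff by blast
  define h where "h n = inverse (real (Suc n))" for n
  have h: "0 < h n" "h n \<le> 1" for n by (simp_all add: h_def inverse_le_1_iff)
  define q where "q n x = (f (x + h n *\<^sub>R i) - f x) / h n" for n x
  have mvt: "\<exists>z. \<bar>z\<bar> \<le> 1 \<and> q n x = partial i f (x + z *\<^sub>R i)" for n x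
  proof -
    obtain z where z: "0 < z" "z < h n" "f (x + h n *\<^sub>R i) - f (x + 0 *\<^sub>R i) = (h n - 0) * partial i f (x + z *\<^sub>R i)"
      using MVT2[of 0 "h n" "\<lambda>t. f (x + t *\<^sub>R i)" "\<lambda>t. partial i f (x + t *\<^sub>R i)", OF h(1) line] by blast
    then have "q n x = partial i f (x + z *\<^sub>R i)" using h(1)[of n] by (simp add: q_def)
    moreover have "\<bar>z\<bar> \<le> 1" using z h(2)[of n] by simp
    ultimately show ?thesis by blast
  qed
  \<comment> \<open>Each quotient is a partial derivative at a point at distance at most
    \<open>norm i\<close>, so the quotients are uniformly bounded and vanish outside one fixed
    ball.\<close>
  have bound: "norm (q n x) \<le> indicator (cball 0 (R + norm i)) x * \<bar>M\<bar>" for n x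
  proof -
    obtain z where z: "\<bar>z\<bar> \<le> 1" "q n x = partial i f (x + z *\<^sub>R i)" using mvt[of n x] by blast
    show ?thesis
    proof (cases "x \<in> cball 0 (R + norm i)")
      case True then show ?thesis using z(2) M' by simp
    next
      case False
      have "norm x \<le> norm (x + z *\<^sub>R i) + norm (z *\<^sub>R i)"
        using norm_triangle_ineq4[of "x + z *\<^sub>R i" "z *\<^sub>R i"] by simp
      moreover have "norm (z *\<^sub>R i) \<le> norm i" using z(1) by (simp add: mult_left_le_one_le)
      ultimately have "x + z *\<^sub>R i \<notin> K" using False R by auto
      then show ?thesis using z(2) pK by simp
    qed
  qed
  have tr: "integrable lborel (\<lambda>x. f (x + a))" "(\<integral>x. f (x + a) \<partial>lborel) = (\<integral>x. f x \<partial>lborel)" for a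
  proof -
    have b: "f \<in> borel_measurable borel" by (rule borel_measurable_continuous_onI[OF cf])
    have e: "distr lborel borel ((+) a) = lborel" by (rule lborel_distr_plus)
    have "integrable (distr lborel borel ((+) a)) f" using fi by (simp add: e)
    then show "integrable lborel (\<lambda>x. f (x + a))" using b by (simp add: integrable_distr_eq add.commute)
    have "(\<integral>x. f x \<partial>distr lborel borel ((+) a)) = (\<integral>x. f (a + x) \<partial>lborel)" using b by (intro integral_distr) auto
    then show "(\<integral>x. f (x + a) \<partial>lborel) = (\<integral>x. f x \<partial>lborel)" by (simp add: e add.commute)
  qed
  have q0: "(\<integral>x. q n x \<partial>lborel) = 0" for n
    unfolding q_def using tr fi by simp
  have "(\<lambda>n. \<integral>x. q n x \<partial>lborel) \<longlonglongrightarrow> (\<integral>x. partial i f x \<partial>lborel)"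
  proof (rule integral_dominated_convergence[where w = "\<lambda>x. indicator (cball 0 (R + norm i)) x * \<bar>M\<bar>"])
    show "partial i f \<in> borel_measurable lborel" using borel_measurable_continuous_onI[OF c] by simp
    show "q n \<in> borel_measurable lborel" for n
      unfolding q_def using tr(1)[of "h n *\<^sub>R i"] fi by simp
    show "integrable lborel (\<lambda>x. indicator (cball 0 (R + norm i)) x * \<bar>M\<bar>)"
    proof (rule integrable_mult_left, rule integrable_real_indicator)
      show "emeasure lborel (cball 0 (R + norm i)) < \<infinity>" by (rule emeasure_bounded_finite) simp
    qed simp
    show "AE x in lborel. norm (q n x) \<le> indicator (cball 0 (R + norm i)) x * \<bar>M\<bar>" for n using bound by simp
    show "AE x in lborel. (\<lambda>n. q n x) \<longlonglongrightarrow> partial i f x"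
    proof (rule AE_I2)
      fix x
      have "((\<lambda>t. (f (x + t *\<^sub>R i) - f x) / t) \<longlongrightarrow> partial i f x) (at 0)"
        using line[of x 0] by (simp add: has_field_derivative_iff)
      moreover have "filterlim h (at 0) sequentially"
        unfolding filterlim_at using h(1) LIMSEQ_inverse_real_of_nat by (auto simp: h_def[abs_def] less_imp_neq)
      ultimately show "(\<lambda>n. q n x) \<longlonglongrightarrow> partial i f x" unfolding q_def by (rule filterlim_compose)
    qed
  qed
  then show ?thesis unfolding q0 by (simp add: LIMSEQ_const_iff)
qed

lemma integral_lborel_lebesgue_on:
  fixes f :: "'a::euclidean_space \<Rightarrow> real"
  assumes "continuous_on UNIV f" "compact K" "K \<subseteq> \<Omega>" "open \<Omega>" "\<And>x. x \<notin> K \<Longrightarrow> f x = 0"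
  shows "integrable (lebesgue_on \<Omega>) f" "(\<integral>x. f x \<partial>lebesgue_on \<Omega>) = (\<integral>x. f x \<partial>lborel)"
proof -
  have O: "\<Omega> \<inter> space lebesgue \<in> sets lebesgue" using assms(4) by simp
  have e: "(\<lambda>x. indicator \<Omega> x *\<^sub>R f x) = f" using assms(3,5) by (auto simp: indicator_def fun_eq_iff)
  have b: "f \<in> borel_measurable lborel" using borel_measurable_continuous_onI[OF assms(1)] by simp
  have i: "integrable lborel f" by (rule integrable_compact_support[OF assms(1,2,5)])
  show "integrable (lebesgue_on \<Omega>) f"
    unfolding integrable_restrict_space[OF O] e using i b by (simp add: integrable_completion)
  show "(\<integral>x. f x \<partial>lebesgue_on \<Omega>) = (\<integral>x. f x \<partial>lborel)"
    unfolding integral_restrict_space[OF O] e by (rule integral_completion[OF b])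
qed

lemma test_functions_product:
  assumes "test_function \<Omega> \<phi>" "test_function \<Omega> \<xi>" "open \<Omega>"
  shows "integrable (lebesgue_on \<Omega>) (\<lambda>x. \<phi> x * \<xi> x)"
proof -
  obtain K where K: "compact K" "K \<subseteq> \<Omega>" "\<And>x. x \<notin> K \<Longrightarrow> \<phi> x = 0" using test_functionD(4)[OF assms(1)] by blast
  show ?thesis
    by (rule integral_lborel_lebesgue_on(1)[OF _ K(1,2) assms(3)])
      (use K(3) in \<open>auto intro!: continuous_intros test_functionD(2)[OF assms(1)] test_functionD(2)[OF assms(2)]\<close>)
qed

text \<open>The partial derivative of the product has integral 0, because the product has compact
  support in \<open>\<Omega>\<close>.\<close>

lemma integration_by_parts_test:
  assumes \<phi>: "test_function \<Omega> \<phi>" and \<xi>: "test_function \<Omega> \<xi>" and \<Omega>: "open \<Omega>" and i: "i \<in> Basis"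
  shows "(\<integral>x. \<phi> x * partial i \<xi> x \<partial>lebesgue_on \<Omega>) = - (\<integral>x. partial i \<phi> x * \<xi> x \<partial>lebesgue_on \<Omega>)"
proof -
  obtain K where K: "compact K" "K \<subseteq> \<Omega>" "\<And>x. x \<notin> K \<Longrightarrow> \<phi> x = 0" using test_functionD(4)[OF \<phi>] by blast
  let ?f = "\<lambda>x. \<phi> x * \<xi> x"
  have p: "partial i ?f = (\<lambda>x. \<phi> x * partial i \<xi> x + partial i \<phi> x * \<xi> x)"
    by (rule ext) (rule partial_mult[OF test_functionD(1)[OF \<phi>] test_functionD(1)[OF \<xi>]])
  have c: "continuous_on UNIV (partial i ?f)"
    unfolding p by (intro continuous_intros test_functionD(2)[OF \<phi>] test_functionD(2)[OF \<xi>]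
      test_functionD(2)[OF test_functionD(3)[OF \<phi> i]] test_functionD(2)[OF test_functionD(3)[OF \<xi> i]])
  have z: "?f x = 0" if "x \<notin> K" for x using K(3)[OF that] by simp
  have pz: "partial i ?f x = 0" if "x \<notin> K" for x by (rule partial_outside[OF compact_imp_closed[OF K(1)] z that])
  have df: "?f differentiable (at x)" for x
    by (intro differentiable_mult test_functionD(1)[OF \<phi>] test_functionD(1)[OF \<xi>])
  have "(\<integral>x. partial i ?f x \<partial>lebesgue_on \<Omega>) = 0"
    using integral_lborel_lebesgue_on(2)[OF c K(1,2) \<Omega> pz] integral_partial_eq_0[OF df c K(1) z] by (rule trans)
  then show ?thesis
    unfolding p using test_functions_product[OF \<phi> test_functionD(3)[OF \<xi> i] \<Omega>]
      test_functions_product[OF test_functionD(3)[OF \<phi> i] \<xi> \<Omega>] by simp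
qed

lemma green_test:
  assumes \<phi>: "test_function \<Omega> \<phi>" and \<xi>: "test_function \<Omega> \<xi>" and \<Omega>: "open \<Omega>"
  shows "(\<integral>x. \<phi> x * laplacian \<xi> x \<partial>lebesgue_on \<Omega>)
    = - (\<Sum>i\<in>Basis. \<integral>x. partial i \<phi> x * partial i \<xi> x \<partial>lebesgue_on \<Omega>)"
proof -
  have "(\<integral>x. \<phi> x * laplacian \<xi> x \<partial>lebesgue_on \<Omega>)
      = (\<Sum>i\<in>Basis. \<integral>x. \<phi> x * partial i (partial i \<xi>) x \<partial>lebesgue_on \<Omega>)"
    unfolding laplacian_def sum_distrib_left
    by (intro Bochner_Integration.integral_sum test_functions_product[OF \<phi> _ \<Omega>] test_functionD(3) \<xi>)
  also have "\<dots> = (\<Sum>i\<in>Basis. - (\<integral>x. partial i \<phi> x * partial i \<xi> x \<partial>lebesgue_on \<Omega>))"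
    by (intro sum.cong refl integration_by_parts_test[OF \<phi> test_functionD(3)[OF \<xi>] \<Omega>])
  finally show ?thesis by (simp add: sum_negf)
qed

lemma test_function_laplacian:
  assumes "test_function \<Omega> \<phi>"
  shows "continuous_on UNIV (laplacian \<phi>)"
    "\<exists>K. compact K \<and> K \<subseteq> \<Omega> \<and> (\<forall>x. x \<notin> K \<longrightarrow> laplacian \<phi> x = 0)"
proof -
  have t: "test_function \<Omega> (partial i (partial i \<phi>))" if "i \<in> Basis" for i
    by (intro test_functionD(3) assms that)
  show "continuous_on UNIV (laplacian \<phi>)"
    unfolding laplacian_def[abs_def] by (intro continuous_on_sum test_functionD(2)[OF t])
  obtain K where K: "compact K" "K \<subseteq> \<Omega>" "\<And>x. x \<notin> K \<Longrightarrow> \<phi> x = 0" using test_functionD(4)[OF assms] by blast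
  note o = partial_outside[OF compact_imp_closed[OF K(1)]]
  have "laplacian \<phi> x = 0" if "x \<notin> K" for x
    unfolding laplacian_def by (intro sum.neutral ballI o[OF o[OF K(3)]] that)
  then show "\<exists>K. compact K \<and> K \<subseteq> \<Omega> \<and> (\<forall>x. x \<notin> K \<longrightarrow> laplacian \<phi> x = 0)" using K(1,2) by blast
qed

lemma square_integrable_compact_support:
  fixes f :: "'a::euclidean_space \<Rightarrow> real"
  assumes "continuous_on UNIV f" "\<exists>K. compact K \<and> K \<subseteq> \<Omega> \<and> (\<forall>x. x \<notin> K \<longrightarrow> f x = 0)" "open \<Omega>"
  shows "square_integrable_on f \<Omega>"
proof -
  obtain K where K: "compact K" "K \<subseteq> \<Omega>" "\<And>x. x \<notin> K \<Longrightarrow> f x = 0" using assms(2) by blast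
  have "integrable (lebesgue_on \<Omega>) (\<lambda>x. (f x)\<^sup>2)"
    by (rule integral_lborel_lebesgue_on(1)[OF _ K(1,2) assms(3)])
      (use K(3) in \<open>auto intro!: continuous_intros assms(1)\<close>)
  moreover have "integrable (lebesgue_on \<Omega>) f"
    by (rule integral_lborel_lebesgue_on(1)[OF assms(1) K(1,2) assms(3) K(3)])
  ultimately show ?thesis by (simp add: square_integrable_on_def)
qed

text \<open>The Laplacian on test functions as a relation on \<open>'h\<close>. By Green's formula
  \<open>- inner a a'\<close> is the Dirichlet integral, so gradients can be traded for inner
  products.\<close>

definition test_pairs :: "'a::euclidean_space set \<Rightarrow> ('h::real_inner \<Rightarrow> 'a \<Rightarrow> real) \<Rightarrow> ('h \<times> 'h) set" where
  "test_pairs \<Omega> J = {(a, a'). \<exists>\<phi>. test_function \<Omega> \<phi> \<and> (AE x in lebesgue_on \<Omega>. J a x = \<phi> x) \<and>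
     (AE x in lebesgue_on \<Omega>. J a' x = laplacian \<phi> x)}"

text \<open>\<open>in_H10\<close> with the gradient norm expressed by the form of the test pairs;
  see \<open>weak_H10_iff\<close>.\<close>

definition weak_H10 :: "'a::euclidean_space set \<Rightarrow> ('h::real_inner \<Rightarrow> 'a \<Rightarrow> real) \<Rightarrow> 'h \<Rightarrow> bool" where
  "weak_H10 \<Omega> J u \<longleftrightarrow> (\<exists>a a'. (\<forall>n::nat. (a n, a' n) \<in> test_pairs \<Omega> J) \<and> a \<longlonglongrightarrow> u \<and>
     (\<forall>\<epsilon>>0. \<exists>N. \<forall>m\<ge>N. \<forall>n\<ge>N. - inner (a m - a n) (a' m - a' n) < \<epsilon>))"

section \<open>The Laplacian and its form through inner products\<close>

locale L2_space =
  fixes \<Omega> :: "'a::euclidean_space set" and J :: "'h::real_inner \<Rightarrow> 'a \<Rightarrow> real"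
  assumes open_\<Omega>: "open \<Omega>" and model: "L2_model \<Omega> J"
begin

abbreviation "M \<equiv> lebesgue_on \<Omega>"

lemma J_sq: "square_integrable_on (J u) \<Omega>"
  and J_ex: "square_integrable_on f \<Omega> \<Longrightarrow> \<exists>u. AE x in M. J u x = f x"
  and J_lin: "AE x in M. J (a *\<^sub>R u + b *\<^sub>R v) x = a * J u x + b * J v x"
  and J_inner: "inner u v = (\<integral>x. J u x * J v x \<partial>M)"
  using model unfolding L2_model_def by blast+

lemma J_meas [measurable]: "J u \<in> borel_measurable M"
  using J_sq by (simp add: square_integrable_on_def)

lemma J_add: "AE x in M. J (u + r *\<^sub>R v) x = J u x + r * J v x"
  using J_lin[of 1 u r v] by simp

lemma J_diff: "AE x in M. J (u - v) x = J u x - J v x"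
  using J_lin[of 1 u "-1" v] by simp

lemma cont_meas:
  fixes f :: "'a \<Rightarrow> real"
  assumes "continuous_on UNIV f" shows "f \<in> borel_measurable M"
  by (rule continuous_imp_measurable_on_sets_lebesgue[OF continuous_on_subset[OF assms]]) (simp_all add: open_\<Omega>)

lemma inner_eq:
  assumes "AE x in M. J u x = f x" "AE x in M. J v x = g x" and [measurable]: "f \<in> borel_measurable M" "g \<in> borel_measurable M"
  shows "inner u v = (\<integral>x. f x * g x \<partial>M)"
  unfolding J_inner
proof (rule integral_cong_AE)
  show "AE x in M. J u x * J v x = f x * g x" using assms(1,2) by eventually_elim simp
qed measurable

lemma norm_diff_eq:
  assumes "AE x in M. J u x = f x" and [measurable]: "f \<in> borel_measurable M"
  shows "(norm (u - v))\<^sup>2 = (\<integral>x. (f x - J v x)\<^sup>2 \<partial>M)"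
proof -
  have "AE x in M. J (u - v) x = f x - J v x" using assms(1) J_diff[of u v] by eventually_elim simp
  from inner_eq[OF this this] show ?thesis unfolding power2_norm_eq_inner by (simp add: power2_eq_square)
qed

lemma test_pair_ex:
  assumes t: "test_function \<Omega> \<phi>"
  shows "\<exists>a a'. (AE x in M. J a x = \<phi> x) \<and> (AE x in M. J a' x = laplacian \<phi> x)"
  using J_ex[OF square_integrable_compact_support[OF test_functionD(2)[OF t] test_functionD(4)[OF t] open_\<Omega>]]
    J_ex[OF square_integrable_compact_support[OF test_function_laplacian[OF t] open_\<Omega>]] by blast

lemma test_pairs_lin:
  assumes "(a, a') \<in> test_pairs \<Omega> J" "(b, b') \<in> test_pairs \<Omega> J"
  shows "(a + r *\<^sub>R b, a' + r *\<^sub>R b') \<in> test_pairs \<Omega> J"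
proof -
  obtain \<phi> where \<phi>: "test_function \<Omega> \<phi>" "AE x in M. J a x = \<phi> x" "AE x in M. J a' x = laplacian \<phi> x"
    using assms(1) by (auto simp: test_pairs_def)
  obtain \<xi> where \<xi>: "test_function \<Omega> \<xi>" "AE x in M. J b x = \<xi> x" "AE x in M. J b' x = laplacian \<xi> x"
    using assms(2) by (auto simp: test_pairs_def)
  have "AE x in M. J (a + r *\<^sub>R b) x = \<phi> x + r * \<xi> x" using J_add[of a r b] \<phi>(2) \<xi>(2) by eventually_elim simp
  moreover have "AE x in M. J (a' + r *\<^sub>R b') x = laplacian (\<lambda>x. \<phi> x + r * \<xi> x) x"
    using J_add[of a' r b'] \<phi>(3) \<xi>(3) by eventually_elim (simp add: laplacian_lin[OF \<phi>(1) \<xi>(1)])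
  ultimately show ?thesis using test_function_lin[OF \<phi>(1) \<xi>(1), of r] unfolding test_pairs_def by blast
qed

lemma test_pairs_green:
  assumes "test_function \<Omega> \<phi>" "AE x in M. J a x = \<phi> x" "test_function \<Omega> \<xi>" "AE x in M. J b' x = laplacian \<xi> x"
  shows "inner a b' = - (\<Sum>i\<in>Basis. \<integral>x. partial i \<phi> x * partial i \<xi> x \<partial>M)"
  using inner_eq[OF assms(2,4)] green_test[OF assms(1,3) open_\<Omega>]
    cont_meas[OF test_functionD(2)[OF assms(1)]] cont_meas[OF test_function_laplacian(1)[OF assms(3)]] by simp

lemma test_pairs_sym:
  assumes "(a, a') \<in> test_pairs \<Omega> J" "(b, b') \<in> test_pairs \<Omega> J"
  shows "inner a b' = inner a' b"
proof -
  obtain \<phi> where \<phi>: "test_function \<Omega> \<phi>" "AE x in M. J a x = \<phi> x" "AE x in M. J a' x = laplacian \<phi> x"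
    using assms(1) by (auto simp: test_pairs_def)
  obtain \<xi> where \<xi>: "test_function \<Omega> \<xi>" "AE x in M. J b x = \<xi> x" "AE x in M. J b' x = laplacian \<xi> x"
    using assms(2) by (auto simp: test_pairs_def)
  have "inner b a' = - (\<Sum>i\<in>Basis. \<integral>x. partial i \<xi> x * partial i \<phi> x \<partial>M)"
    by (rule test_pairs_green[OF \<xi>(1,2) \<phi>(1,3)])
  then show ?thesis
    using test_pairs_green[OF \<phi>(1,2) \<xi>(1,3)] by (simp add: inner_commute mult.commute)
qed

lemma test_pairs_nonneg: "(a, a') \<in> test_pairs \<Omega> J \<Longrightarrow> 0 \<le> - inner a a'"
proof -
  assume "(a, a') \<in> test_pairs \<Omega> J"
  then obtain \<phi> where \<phi>: "test_function \<Omega> \<phi>" "AE x in M. J a x = \<phi> x" "AE x in M. J a' x = laplacian \<phi> x"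
    by (auto simp: test_pairs_def)
  show ?thesis unfolding test_pairs_green[OF \<phi>(1,2,1,3)] by (simp add: sum_nonneg)
qed

text \<open>A quadratic polynomial in \<open>r\<close> is nonnegative everywhere. Only
  semidefiniteness of the form is available here, hence the separate case
  \<open>C = 0\<close>.\<close>

lemma test_pairs_Cauchy_Schwarz:
  assumes x: "(x, x') \<in> test_pairs \<Omega> J" and y: "(y, y') \<in> test_pairs \<Omega> J"
  shows "(inner x y')\<^sup>2 \<le> (- inner x x') * (- inner y y')"
proof -
  define A B C where "A = - inner x x'" and "B = - inner x y'" and "C = - inner y y'"
  have q: "0 \<le> A + 2 * r * B + r\<^sup>2 * C" for r
  proof -
    have "0 \<le> - inner (x + r *\<^sub>R y) (x' + r *\<^sub>R y')" by (rule test_pairs_nonneg[OF test_pairs_lin[OF x y]])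
    also have "\<dots> = A + 2 * r * B + r\<^sup>2 * C"
      using test_pairs_sym[OF x y]
      by (simp add: A_def B_def C_def inner_add_left inner_add_right power2_eq_square inner_commute[of y x'] distrib_left)
    finally show ?thesis .
  qed
  have "C \<ge> 0" unfolding C_def by (rule test_pairs_nonneg[OF y])
  show ?thesis
  proof (cases "C = 0")
    case True
    have "B = 0"
    proof (rule ccontr)
      assume "B \<noteq> 0"
      \<comment> \<open>At this \<open>r\<close> the linear polynomial \<open>A + 2 * r * B\<close>
        equals -1.\<close>
      then show False using q[of "- (A + 1) / (2 * B)"] True by (simp add: field_simps)
    qed
    then show ?thesis using True by (simp add: A_def B_def C_def)
  next
    case False
    then have C: "C > 0" using \<open>C \<ge> 0\<close> by simp
    have "0 \<le> A + 2 * (- B / C) * B + (- B / C)\<^sup>2 * C" by (rule q)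
    also have "\<dots> = A - B\<^sup>2 / C" using C by (simp add: field_simps power2_eq_square)
    finally have "B\<^sup>2 \<le> A * C" using C by (simp add: field_simps)
    then show ?thesis by (simp add: A_def B_def C_def)
  qed
qed

text \<open>Green's formula turns the sum of the squared partial derivatives of a difference of test
  functions into the form on the difference of their pairs.\<close>

lemma weak_H10_iff: "in_H10 \<Omega> (J u) \<longleftrightarrow> weak_H10 \<Omega> J u"
proof -
  have grad: "- inner (a - b) (a' - b') = (\<Sum>i\<in>Basis. \<integral>x. (partial i \<phi> x - partial i \<xi> x)\<^sup>2 \<partial>M)"
    if "test_function \<Omega> \<phi>" "AE x in M. J a x = \<phi> x" "AE x in M. J a' x = laplacian \<phi> x"
      "test_function \<Omega> \<xi>" "AE x in M. J b x = \<xi> x" "AE x in M. J b' x = laplacian \<xi> x" for a a' b b' \<phi> \<xi>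
  proof -
    let ?d = "\<lambda>x. \<phi> x + (-1) * \<xi> x"
    have t: "test_function \<Omega> ?d" by (rule test_function_lin[OF that(1,4)])
    have 1: "AE x in M. J (a - b) x = ?d x" using J_diff[of a b] that(2,5) by eventually_elim simp
    have 2: "AE x in M. J (a' - b') x = laplacian ?d x"
      using J_diff[of a' b'] that(3,6) by eventually_elim (subst laplacian_lin[OF that(1,4)], simp)
    have p: "partial i ?d x = partial i \<phi> x - partial i \<xi> x" for i x
      using partial_lin[OF test_functionD(1)[OF that(1)] test_functionD(1)[OF that(4)], of i "-1" x] by simp
    show ?thesis using test_pairs_green[OF t 1 t 2] unfolding p by (simp add: power2_eq_square)
  qed
  have le: "(\<integral>x. (partial i \<phi> x - partial i \<xi> x)\<^sup>2 \<partial>M) \<le> (\<Sum>i\<in>Basis. \<integral>x. (partial i \<phi> x - partial i \<xi> x)\<^sup>2 \<partial>M)"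
    if "i \<in> Basis" for i and \<phi> \<xi> :: "'a \<Rightarrow> real"
    using that by (intro member_le_sum) auto
  show ?thesis
  proof
    assume "in_H10 \<Omega> (J u)"
    then obtain \<phi> :: "nat \<Rightarrow> 'a \<Rightarrow> real" where \<phi>: "\<And>n. test_function \<Omega> (\<phi> n)"
      and lim: "(\<lambda>n. \<integral>x. (\<phi> n x - J u x)\<^sup>2 \<partial>M) \<longlonglongrightarrow> 0"
      and cau: "\<And>\<epsilon>. \<epsilon> > 0 \<Longrightarrow> \<exists>N. \<forall>m\<ge>N. \<forall>n\<ge>N. \<forall>i\<in>Basis. (\<integral>x. (partial i (\<phi> m) x - partial i (\<phi> n) x)\<^sup>2 \<partial>M) < \<epsilon>"
      unfolding in_H10_def by blast
    have "\<forall>n. \<exists>p. (AE x in M. J (fst p) x = \<phi> n x) \<and> (AE x in M. J (snd p) x = laplacian (\<phi> n) x)"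
    proof
      fix n
      obtain b b' where "(AE x in M. J b x = \<phi> n x) \<and> (AE x in M. J b' x = laplacian (\<phi> n) x)"
        using test_pair_ex[OF \<phi>[of n]] by blast
      then show "\<exists>p. (AE x in M. J (fst p) x = \<phi> n x) \<and> (AE x in M. J (snd p) x = laplacian (\<phi> n) x)"
        by (intro exI[of _ "(b, b')"]) simp
    qed
    then obtain P where P: "\<And>n. AE x in M. J (fst (P n)) x = \<phi> n x" "\<And>n. AE x in M. J (snd (P n)) x = laplacian (\<phi> n) x"
      using choice[of "\<lambda>n p. (AE x in M. J (fst p) x = \<phi> n x) \<and> (AE x in M. J (snd p) x = laplacian (\<phi> n) x)"] by blast
    have "(\<lambda>n. (norm (fst (P n) - u))\<^sup>2) \<longlonglongrightarrow> 0"
      using lim norm_diff_eq[OF P(1) cont_meas[OF test_functionD(2)[OF \<phi>]]] by simp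
    then have "(\<lambda>n. sqrt ((norm (fst (P n) - u))\<^sup>2)) \<longlonglongrightarrow> sqrt 0" by (rule tendsto_real_sqrt)
    then have "(\<lambda>n. fst (P n) - u) \<longlonglongrightarrow> 0" by (simp add: tendsto_norm_zero_iff)
    then have l: "(\<lambda>n. fst (P n)) \<longlonglongrightarrow> u" by (simp add: LIM_zero_iff)
    have "\<exists>N. \<forall>m\<ge>N. \<forall>n\<ge>N. - inner (fst (P m) - fst (P n)) (snd (P m) - snd (P n)) < \<epsilon>" if "\<epsilon> > 0" for \<epsilon>
    proof -
      \<comment> \<open>\<open>in_H10\<close> controls each partial derivative separately, the form
        their sum.\<close>
      have "0 < \<epsilon> / DIM('a)" using that by simp
      from cau[OF this] obtain N where N: "\<forall>m\<ge>N. \<forall>n\<ge>N. \<forall>i\<in>Basis.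
          (\<integral>x. (partial i (\<phi> m) x - partial i (\<phi> n) x)\<^sup>2 \<partial>M) < \<epsilon> / DIM('a)" by blast
      have "- inner (fst (P m) - fst (P n)) (snd (P m) - snd (P n)) < \<epsilon>" if "m \<ge> N" "n \<ge> N" for m n
      proof -
        have "(\<Sum>i\<in>Basis. \<integral>x. (partial i (\<phi> m) x - partial i (\<phi> n) x)\<^sup>2 \<partial>M) < (\<Sum>i\<in>(Basis::'a set). \<epsilon> / DIM('a))"
          using N that by (intro sum_strict_mono) auto
        then show ?thesis using grad[OF \<phi> P \<phi> P, of m n] by simp
      qed
      then show ?thesis by blast
    qed
    moreover have "(fst (P n), snd (P n)) \<in> test_pairs \<Omega> J" for n
      unfolding test_pairs_def using \<phi> P by blast
    ultimately show "weak_H10 \<Omega> J u"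
      unfolding weak_H10_def using l by (intro exI[of _ "\<lambda>n. fst (P n)"] exI[of _ "\<lambda>n. snd (P n)"]) blast
  next
    assume "weak_H10 \<Omega> J u"
    then obtain a a' where aT: "\<And>n::nat. (a n, a' n) \<in> test_pairs \<Omega> J" and lim: "a \<longlonglongrightarrow> u"
      and cau: "\<And>\<epsilon>. \<epsilon> > 0 \<Longrightarrow> \<exists>N. \<forall>m\<ge>N. \<forall>n\<ge>N. - inner (a m - a n) (a' m - a' n) < \<epsilon>"
      unfolding weak_H10_def by blast
    have "\<forall>n. \<exists>\<phi>. test_function \<Omega> \<phi> \<and> (AE x in M. J (a n) x = \<phi> x) \<and> (AE x in M. J (a' n) x = laplacian \<phi> x)"
      using aT unfolding test_pairs_def by blast
    then obtain \<phi> where \<phi>: "\<And>n. test_function \<Omega> (\<phi> n)" "\<And>n. AE x in M. J (a n) x = \<phi> n x"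
      "\<And>n. AE x in M. J (a' n) x = laplacian (\<phi> n) x"
      using choice[of "\<lambda>n \<phi>. test_function \<Omega> \<phi> \<and> (AE x in M. J (a n) x = \<phi> x) \<and> (AE x in M. J (a' n) x = laplacian \<phi> x)"]
      by blast
    have "(\<lambda>n. (norm (a n - u))\<^sup>2) \<longlonglongrightarrow> (norm (u - u))\<^sup>2" by (intro tendsto_intros lim)
    then have "(\<lambda>n. \<integral>x. (\<phi> n x - J u x)\<^sup>2 \<partial>M) \<longlonglongrightarrow> 0"
      using norm_diff_eq[OF \<phi>(2) cont_meas[OF test_functionD(2)[OF \<phi>(1)]]] by simp
    moreover have "\<exists>N. \<forall>m\<ge>N. \<forall>n\<ge>N. \<forall>i\<in>Basis. (\<integral>x. (partial i (\<phi> m) x - partial i (\<phi> n) x)\<^sup>2 \<partial>M) < \<epsilon>"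
      if "\<epsilon> > 0" for \<epsilon>
    proof -
      obtain N where N: "\<And>m n. m \<ge> N \<Longrightarrow> n \<ge> N \<Longrightarrow> - inner (a m - a n) (a' m - a' n) < \<epsilon>" using cau[OF \<open>\<epsilon> > 0\<close>] by blast
      have "(\<integral>x. (partial i (\<phi> m) x - partial i (\<phi> n) x)\<^sup>2 \<partial>M) < \<epsilon>" if "m \<ge> N" "n \<ge> N" "i \<in> Basis" for m n i
        using le[OF that(3), of "\<phi> m" "\<phi> n"] N[OF that(1,2)] grad[OF \<phi> \<phi>, of m n] by linarith
      then show ?thesis by blast
    qed
    ultimately show "in_H10 \<Omega> (J u)" unfolding in_H10_def using J_sq \<phi>(1) by blast
  qed
qed

text \<open>Test pairs carry both the test function and its Laplacian, so membership is expressed by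
  inner products in \<open>'h\<close> alone.\<close>

lemma dirichlet_laplacian_iff:
  "(u, f) \<in> dirichlet_laplacian \<Omega> J \<longleftrightarrow>
    weak_H10 \<Omega> J u \<and> (\<forall>b b'. (b, b') \<in> test_pairs \<Omega> J \<longrightarrow> inner u b' = inner f b)"
proof -
  have i: "inner u b' = (\<integral>x. J u x * laplacian \<phi> x \<partial>M)" "inner f b = (\<integral>x. J f x * \<phi> x \<partial>M)"
    if "test_function \<Omega> \<phi>" "AE x in M. J b x = \<phi> x" "AE x in M. J b' x = laplacian \<phi> x" for b b' \<phi>
    using inner_eq[of u "J u" b' "laplacian \<phi>"] inner_eq[of f "J f" b \<phi>] that
      cont_meas[OF test_functionD(2)[OF that(1)]] cont_meas[OF test_function_laplacian(1)[OF that(1)]] by simp_all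
  show ?thesis
    unfolding dirichlet_laplacian_def mem_Collect_eq prod.case weak_H10_iff
  proof (intro conj_cong refl iffI allI impI)
    fix b b' assume *: "\<forall>\<phi>. test_function \<Omega> \<phi> \<longrightarrow> (\<integral>x. J u x * laplacian \<phi> x \<partial>M) = (\<integral>x. J f x * \<phi> x \<partial>M)"
      and "(b, b') \<in> test_pairs \<Omega> J"
    then obtain \<phi> where \<phi>: "test_function \<Omega> \<phi>" "AE x in M. J b x = \<phi> x" "AE x in M. J b' x = laplacian \<phi> x"
      by (auto simp: test_pairs_def)
    then show "inner u b' = inner f b" using * i[OF \<phi>] by simp
  next
    fix \<phi> assume *: "\<forall>b b'. (b, b') \<in> test_pairs \<Omega> J \<longrightarrow> inner u b' = inner f b" and t: "test_function \<Omega> \<phi>"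
    obtain b b' where b: "AE x in M. J b x = \<phi> x" "AE x in M. J b' x = laplacian \<phi> x" using test_pair_ex[OF t] by blast
    have "(b, b') \<in> test_pairs \<Omega> J" unfolding test_pairs_def using t b by blast
    then show "(\<integral>x. J u x * laplacian \<phi> x \<partial>M) = (\<integral>x. J f x * \<phi> x \<partial>M)" using * i[OF t b] by simp
  qed
qed

lemma test_vectors_iff: "a \<in> test_vectors \<Omega> J \<longleftrightarrow> (\<exists>a'. (a, a') \<in> test_pairs \<Omega> J)"
proof
  assume "a \<in> test_vectors \<Omega> J"
  then obtain \<phi> where \<phi>: "test_function \<Omega> \<phi>" "AE x in M. J a x = \<phi> x" by (auto simp: test_vectors_def)
  obtain b a' where "AE x in M. J a' x = laplacian \<phi> x" using test_pair_ex[OF \<phi>(1)] by blast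
  then show "\<exists>a'. (a, a') \<in> test_pairs \<Omega> J" using \<phi> unfolding test_pairs_def by blast
qed (auto simp: test_pairs_def test_vectors_def)

end

section \<open>The Dirichlet Laplacian is diagonal\<close>

locale dirichlet = L2_space \<Omega> J + spectral e \<alpha>
  for \<Omega> :: "'a::euclidean_space set"
    and J :: "'h::{real_inner, complete_space, second_countable_topology} \<Rightarrow> 'a \<Rightarrow> real"
    and e :: "nat \<Rightarrow> 'h" and \<alpha> :: "nat \<Rightarrow> real" +
  assumes eigen: "\<And>k. (e k, - \<alpha> k *\<^sub>R e k) \<in> dirichlet_laplacian \<Omega> J"
begin

lemma dom_add:
  assumes "x \<in> dom_sqrt_A e \<alpha>" "y \<in> dom_sqrt_A e \<alpha>"
  shows "x + y \<in> dom_sqrt_A e \<alpha>" "stiff (x + y) \<le> 2 * stiff x + 2 * stiff y"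
proof -
  let ?a = "\<lambda>k. \<alpha> k * (inner x (e k))\<^sup>2" and ?b = "\<lambda>k. \<alpha> k * (inner y (e k))\<^sup>2"
  have le: "\<alpha> k * (inner (x + y) (e k))\<^sup>2 \<le> 2 * ?a k + 2 * ?b k" for k
  proof -
    have "(inner (x + y) (e k))\<^sup>2 \<le> 2 * (inner x (e k))\<^sup>2 + 2 * (inner y (e k))\<^sup>2"
      using sum_squares_bound[of "inner x (e k)" "inner y (e k)"] by (simp add: inner_add_left power2_sum)
    then have "\<alpha> k * (inner (x + y) (e k))\<^sup>2 \<le> \<alpha> k * (2 * (inner x (e k))\<^sup>2 + 2 * (inner y (e k))\<^sup>2)"
      using \<alpha>_pos[of k] by (intro mult_left_mono) simp_all
    then show ?thesis by (simp add: algebra_simps)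
  qed
  have s: "(\<lambda>k. 2 * ?a k + 2 * ?b k) sums (2 * stiff x + 2 * stiff y)"
    by (intro sums_add sums_mult stiff_sums assms)
  show "x + y \<in> dom_sqrt_A e \<alpha>" unfolding dom_iff
    by (rule summable_comparison_test'[OF sums_summable[OF s], of 0]) (use le \<alpha>_pos in \<open>simp add: less_imp_le\<close>)
  then show "stiff (x + y) \<le> 2 * stiff x + 2 * stiff y" by (rule sums_le[OF le stiff_sums s])
qed

text \<open>With \<open>a n\<close> and \<open>b m\<close> approximating \<open>u\<close> and
  \<open>v\<close> in the form sense, the numbers \<open>inner (a n) (b' m)\<close> tend to
  \<open>inner f v\<close> when \<open>n\<close> goes first and to \<open>inner g u\<close> when
  \<open>m\<close> goes first. The Cauchy-Schwarz inequality for the form makes the limit in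
  \<open>m\<close> uniform in \<open>n\<close>, so the two iterated limits agree.\<close>

lemma laplacian_symmetric:
  assumes uf: "(u, f) \<in> dirichlet_laplacian \<Omega> J" and vg: "(v, g) \<in> dirichlet_laplacian \<Omega> J"
  shows "inner f v = inner g u"
proof -
  obtain a a' where aT: "\<And>n::nat. (a n, a' n) \<in> test_pairs \<Omega> J" and al: "a \<longlonglongrightarrow> u"
    and ac: "\<And>\<epsilon>. \<epsilon> > 0 \<Longrightarrow> \<exists>N. \<forall>m\<ge>N. \<forall>n\<ge>N. - inner (a m - a n) (a' m - a' n) < \<epsilon>"
    using uf unfolding dirichlet_laplacian_iff weak_H10_def by blast
  obtain b b' where bT: "\<And>n::nat. (b n, b' n) \<in> test_pairs \<Omega> J" and bl: "b \<longlonglongrightarrow> v"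
    and bc: "\<And>\<epsilon>. \<epsilon> > 0 \<Longrightarrow> \<exists>N. \<forall>m\<ge>N. \<forall>n\<ge>N. - inner (b m - b n) (b' m - b' n) < \<epsilon>"
    using vg unfolding dirichlet_laplacian_iff weak_H10_def by blast
  have f: "inner u (b' m) = inner f (b m)" for m using uf bT unfolding dirichlet_laplacian_iff by blast
  have g: "inner v (a' n) = inner g (a n)" for n using vg aT unfolding dirichlet_laplacian_iff by blast
  have diff: "(x - y, x' - y') \<in> test_pairs \<Omega> J"
    if "(x, x') \<in> test_pairs \<Omega> J" "(y, y') \<in> test_pairs \<Omega> J" for x x' y y'
    using test_pairs_lin[OF that, of "-1"] by simp
  obtain N1 where N1: "\<And>n. n \<ge> N1 \<Longrightarrow> - inner (a n - a N1) (a' n - a' N1) < 1"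
    using ac[of 1] by (auto dest: spec[of _ "_::nat"])
  \<comment> \<open>Bound on the form of all \<open>a n\<close> beyond \<open>N1\<close>: the form
    of a sum is at most twice the sum of the forms, here of \<open>a n - a N1\<close> (below 1) and
    of \<open>a N1\<close>.\<close>
  define K where "K = 2 + 2 * (- inner (a N1) (a' N1))"
  have K: "- inner (a n) (a' n) \<le> K" if n: "n \<ge> N1" for n
  proof -
    let ?x = "a n - a N1" and ?x' = "a' n - a' N1"
    have "(?x - a N1, ?x' - a' N1) \<in> test_pairs \<Omega> J" by (intro diff aT)
    from test_pairs_nonneg[OF this] test_pairs_sym[OF diff[OF aT aT] aT, of n N1 N1]
    have "- inner (?x + a N1) (?x' + a' N1) \<le> 2 * (- inner ?x ?x') + 2 * (- inner (a N1) (a' N1))"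
      by (simp add: inner_add_left inner_add_right inner_diff_left inner_diff_right inner_commute)
    then show ?thesis using N1[OF n] by (simp add: K_def)
  qed
  have K0: "0 \<le> K" using test_pairs_nonneg[OF aT[of N1]] by (simp add: K_def)
  have main: "(inner f v - inner g u)\<^sup>2 \<le> K * \<epsilon>" if \<epsilon>: "\<epsilon> > 0" for \<epsilon>
  proof -
    obtain N2 where N2: "\<forall>m\<ge>N2. \<forall>n\<ge>N2. - inner (b m - b n) (b' m - b' n) < \<epsilon>" using bc[OF \<epsilon>] by blast
    have 1: "(inner (a n) (b' m) - inner (a n) (b' j))\<^sup>2 \<le> K * \<epsilon>" if "n \<ge> N1" "m \<ge> N2" "j \<ge> N2" for n m j
    proof -
      have "(inner (a n) (b' m - b' j))\<^sup>2 \<le> (- inner (a n) (a' n)) * (- inner (b m - b j) (b' m - b' j))"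
        by (rule test_pairs_Cauchy_Schwarz[OF aT diff[OF bT bT]])
      also have "\<dots> \<le> K * \<epsilon>"
        by (intro mult_mono K that K0 less_imp_le[OF N2[rule_format]] test_pairs_nonneg[OF diff[OF bT bT]])
      finally show ?thesis by (simp add: inner_diff_right)
    qed
    have 2: "(inner (a n) (b' m) - inner g (a n))\<^sup>2 \<le> K * \<epsilon>" if "n \<ge> N1" "m \<ge> N2" for n m
    proof (rule LIMSEQ_le_const2)
      have "(\<lambda>j. inner (a' n) (b j)) \<longlonglongrightarrow> inner (a' n) v" by (intro tendsto_intros bl)
      then have l: "(\<lambda>j. inner (a n) (b' j)) \<longlonglongrightarrow> inner g (a n)"
        using test_pairs_sym[OF aT bT] g[of n] by (simp add: inner_commute)
      show "(\<lambda>j. (inner (a n) (b' m) - inner (a n) (b' j))\<^sup>2) \<longlonglongrightarrow> (inner (a n) (b' m) - inner g (a n))\<^sup>2"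
        by (rule tendsto_power[OF tendsto_diff[OF tendsto_const l]])
      show "\<exists>N. \<forall>j\<ge>N. (inner (a n) (b' m) - inner (a n) (b' j))\<^sup>2 \<le> K * \<epsilon>" using 1[OF that] by blast
    qed
    have 3: "(inner f (b m) - inner g u)\<^sup>2 \<le> K * \<epsilon>" if "m \<ge> N2" for m
    proof (rule LIMSEQ_le_const2)
      show "(\<lambda>n. (inner (a n) (b' m) - inner g (a n))\<^sup>2) \<longlonglongrightarrow> (inner f (b m) - inner g u)\<^sup>2"
        unfolding f[symmetric] by (intro tendsto_intros al)
      show "\<exists>N. \<forall>n\<ge>N. (inner (a n) (b' m) - inner g (a n))\<^sup>2 \<le> K * \<epsilon>" using 2[OF _ that] by blast
    qed
    show ?thesis
    proof (rule LIMSEQ_le_const2)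
      show "(\<lambda>m. (inner f (b m) - inner g u)\<^sup>2) \<longlonglongrightarrow> (inner f v - inner g u)\<^sup>2" by (intro tendsto_intros bl)
      show "\<exists>N. \<forall>m\<ge>N. (inner f (b m) - inner g u)\<^sup>2 \<le> K * \<epsilon>" using 3 by blast
    qed
  qed
  have "(inner f v - inner g u)\<^sup>2 \<le> 0"
  proof (rule field_le_epsilon)
    fix \<epsilon> :: real assume "\<epsilon> > 0"
    then have "(inner f v - inner g u)\<^sup>2 \<le> K * (\<epsilon> / (K + 1))" using K0 by (intro main) simp
    also have "\<dots> \<le> \<epsilon>" using K0 \<open>\<epsilon> > 0\<close> by (simp add: field_simps)
    finally show "(inner f v - inner g u)\<^sup>2 \<le> 0 + \<epsilon>" by simp
  qed
  then show ?thesis by simp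
qed

lemma test_pairs_laplacian: "(a, a') \<in> test_pairs \<Omega> J \<Longrightarrow> (a, a') \<in> dirichlet_laplacian \<Omega> J"
proof -
  assume a: "(a, a') \<in> test_pairs \<Omega> J"
  have "weak_H10 \<Omega> J a"
    unfolding weak_H10_def by (rule exI[of _ "\<lambda>_. a"], rule exI[of _ "\<lambda>_. a'"]) (simp add: a)
  then show ?thesis unfolding dirichlet_laplacian_iff using test_pairs_sym[OF a] by blast
qed

lemma laplacian_coord: "(u, f) \<in> dirichlet_laplacian \<Omega> J \<Longrightarrow> inner f (e k) = - \<alpha> k * inner u (e k)"
  using laplacian_symmetric[OF _ eigen[of k], of u f] by (simp add: inner_commute)

text \<open>Parseval for \<open>inner u f\<close> is already the stiffness series up to sign; its
  convergence puts \<open>u\<close> into the form domain.\<close>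

lemma coord_dom:
  assumes "\<And>k. inner f (e k) = - \<alpha> k * inner u (e k)"
  shows "u \<in> dom_sqrt_A e \<alpha>" "- inner u f = stiff u"
proof -
  have s: "(\<lambda>k. - (inner u (e k) * inner f (e k))) sums (- inner u f)" by (intro sums_minus inner_sums)
  have e: "- (inner u (e k) * inner f (e k)) = \<alpha> k * (inner u (e k))\<^sup>2" for k
    unfolding assms by (simp add: power2_eq_square)
  show d: "u \<in> dom_sqrt_A e \<alpha>" unfolding dom_iff using s unfolding e by (rule sums_summable)
  show "- inner u f = stiff u" using s stiff_sums[OF d] unfolding e by (rule sums_unique2)
qed

lemma test_pairs_stiff:
  assumes "(a, a') \<in> test_pairs \<Omega> J"
  shows "a \<in> dom_sqrt_A e \<alpha>" "- inner a a' = stiff a"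
  using coord_dom[OF laplacian_coord[OF test_pairs_laplacian[OF assms]]] by simp_all

lemma test_pairs_diff:
  assumes "(a, a') \<in> test_pairs \<Omega> J" "(b, b') \<in> test_pairs \<Omega> J"
  shows "a - b \<in> dom_sqrt_A e \<alpha>" "- inner (a - b) (a' - b') = stiff (a - b)"
  using test_pairs_stiff[OF test_pairs_lin[OF assms, of "-1"]] by simp_all

text \<open>Lower semicontinuity: the partial sums of the stiffness of \<open>a m - a N\<close> are
  at most \<open>\<epsilon>\<close>, and this passes to the limit in \<open>m\<close>.\<close>

lemma weak_H10_approx:
  assumes "weak_H10 \<Omega> J u" "\<epsilon> > 0"
  shows "\<exists>a a'. (a, a') \<in> test_pairs \<Omega> J \<and> u - a \<in> dom_sqrt_A e \<alpha> \<and> stiff (u - a) \<le> \<epsilon>"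
proof -
  obtain a a' where aT: "\<And>n::nat. (a n, a' n) \<in> test_pairs \<Omega> J" and al: "a \<longlonglongrightarrow> u"
    and ac: "\<And>\<epsilon>. \<epsilon> > 0 \<Longrightarrow> \<exists>N. \<forall>m\<ge>N. \<forall>n\<ge>N. - inner (a m - a n) (a' m - a' n) < \<epsilon>"
    using assms(1) unfolding weak_H10_def by blast
  obtain N where N: "\<forall>m\<ge>N. \<forall>n\<ge>N. - inner (a m - a n) (a' m - a' n) < \<epsilon>" using ac[OF assms(2)] by blast
  have bd: "(\<Sum>k<j. \<alpha> k * (inner (u - a N) (e k))\<^sup>2) \<le> \<epsilon>" for j
  proof (rule LIMSEQ_le_const2)
    show "(\<lambda>m. \<Sum>k<j. \<alpha> k * (inner (a m - a N) (e k))\<^sup>2) \<longlonglongrightarrow> (\<Sum>k<j. \<alpha> k * (inner (u - a N) (e k))\<^sup>2)"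
      by (intro tendsto_intros al)
    have "(\<Sum>k<j. \<alpha> k * (inner (a m - a N) (e k))\<^sup>2) \<le> \<epsilon>" if "m \<ge> N" for m
    proof -
      note d = test_pairs_diff[OF aT[of m] aT[of N]]
      have "(\<Sum>k<j. \<alpha> k * (inner (a m - a N) (e k))\<^sup>2) \<le> stiff (a m - a N)"
        unfolding stiff_def using d(1) \<alpha>_pos
        by (intro sum_le_suminf) (simp_all add: dom_iff less_imp_le)
      also have "\<dots> < \<epsilon>" unfolding d(2)[symmetric] using N that by blast
      finally show ?thesis by simp
    qed
    then show "\<exists>M. \<forall>m\<ge>M. (\<Sum>k<j. \<alpha> k * (inner (a m - a N) (e k))\<^sup>2) \<le> \<epsilon>" by blast
  qed
  have "summable (\<lambda>k. \<alpha> k * (inner (u - a N) (e k))\<^sup>2)"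
    by (rule bounded_imp_summable[OF _ bd[of "Suc _", unfolded lessThan_Suc_atMost]])
      (use \<alpha>_pos in \<open>simp add: less_imp_le\<close>)
  then show ?thesis
    using aT[of N] suminf_le_const[OF _ bd] unfolding dom_iff stiff_def by blast
qed

text \<open>For the converse, the vectors approximable by test vectors in the form sense
  (\<open>A\<close> in the proof) contain the eigenvectors and form a linear space. The projections
  of \<open>u\<close> converge to \<open>u\<close> in stiffness, so \<open>u\<close> is approximable
  too.\<close>

lemma weak_H10_dom: "weak_H10 \<Omega> J u \<longleftrightarrow> u \<in> dom_sqrt_A e \<alpha>"
proof
  assume "weak_H10 \<Omega> J u"
  from weak_H10_approx[OF this, of 1] obtain a a' where a: "(a, a') \<in> test_pairs \<Omega> J" "u - a \<in> dom_sqrt_A e \<alpha>"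
    by auto
  from dom_add(1)[OF a(2) test_pairs_stiff(1)[OF a(1)]] show "u \<in> dom_sqrt_A e \<alpha>" by simp
next
  define A where "A u \<longleftrightarrow> (\<forall>\<epsilon>>0. \<exists>a a'. (a, a') \<in> test_pairs \<Omega> J \<and> u - a \<in> dom_sqrt_A e \<alpha> \<and> stiff (u - a) \<le> \<epsilon>)" for u
  have Ae: "A (e k)" for k
    using weak_H10_approx eigen[of k] unfolding A_def dirichlet_laplacian_iff by blast
  have scale: "stiff (r *\<^sub>R x) = r\<^sup>2 * stiff x" if "x \<in> dom_sqrt_A e \<alpha>" for r x
    unfolding stiff_def using suminf_mult[OF that[unfolded dom_iff], of "r\<^sup>2"]
    by (simp add: power_mult_distrib mult_ac)
  have Alin: "A (x + r *\<^sub>R y)" if x: "A x" and y: "A y" for x y r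
    unfolding A_def
  proof (intro allI impI)
    fix \<epsilon> :: real assume \<epsilon>: "\<epsilon> > 0"
    obtain a a' where a: "(a, a') \<in> test_pairs \<Omega> J" "x - a \<in> dom_sqrt_A e \<alpha>" "stiff (x - a) \<le> \<epsilon> / 4"
      using x[unfolded A_def, rule_format, of "\<epsilon> / 4"] \<epsilon> by auto
    have "\<epsilon> / (4 * (r\<^sup>2 + 1)) > 0" using \<epsilon> by (simp add: add_nonneg_pos)
    then obtain b b' where b: "(b, b') \<in> test_pairs \<Omega> J" "y - b \<in> dom_sqrt_A e \<alpha>" "stiff (y - b) \<le> \<epsilon> / (4 * (r\<^sup>2 + 1))"
      using y[unfolded A_def] by blast
    have e: "x + r *\<^sub>R y - (a + r *\<^sub>R b) = (x - a) + r *\<^sub>R (y - b)" by (simp add: scaleR_diff_right)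
    note d = dom_add[OF a(2) dom_scaleR[OF b(2), of r]]
    have "r\<^sup>2 * stiff (y - b) \<le> r\<^sup>2 * (\<epsilon> / (4 * (r\<^sup>2 + 1)))" by (rule mult_left_mono[OF b(3)]) simp
    also have "\<dots> = \<epsilon> / 4 * (r\<^sup>2 / (r\<^sup>2 + 1))" by simp
    also have "\<dots> \<le> \<epsilon> / 4 * 1"
    proof (rule mult_left_mono)
      have "0 < r\<^sup>2 + 1" by (rule add_nonneg_pos) simp_all
      then show "r\<^sup>2 / (r\<^sup>2 + 1) \<le> 1" by (simp add: divide_le_eq)
    qed (use \<epsilon> in simp)
    finally have "stiff ((x - a) + r *\<^sub>R (y - b)) \<le> \<epsilon>" using d(2) a(3) scale[OF b(2), of r] by simp
    then show "\<exists>c c'. (c, c') \<in> test_pairs \<Omega> J \<and> x + r *\<^sub>R y - c \<in> dom_sqrt_A e \<alpha> \<and> stiff (x + r *\<^sub>R y - c) \<le> \<epsilon>"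
      using test_pairs_lin[OF a(1) b(1), of r] d(1) unfolding e[symmetric] by blast
  qed
  have A0: "A 0" using Alin[OF Ae[of 0] Ae[of 0], of "-1"] by simp
  assume u: "u \<in> dom_sqrt_A e \<alpha>"
  have Ap: "A (proj N u)" for N
  proof (induction N)
    case 0 then show ?case using A0 by (simp add: proj_def)
  next
    case (Suc N)
    then show ?case using Alin[OF Suc Ae[of N], of "inner u (e N)"] by (simp add: proj_def)
  qed
  have tail: "u - proj N u \<in> dom_sqrt_A e \<alpha>" "stiff (u - proj N u) = stiff u - (\<Sum>k<N. \<alpha> k * (inner u (e k))\<^sup>2)" for N
  proof -
    have "(\<lambda>k. if k < N then \<alpha> k * (inner u (e k))\<^sup>2 else 0) sums (\<Sum>k<N. \<alpha> k * (inner u (e k))\<^sup>2)"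
      using sums_If_finite[of "\<lambda>k. k < N" "\<lambda>k. \<alpha> k * (inner u (e k))\<^sup>2"] by (simp add: lessThan_def)
    from sums_diff[OF stiff_sums[OF u] this]
    have s: "(\<lambda>k. \<alpha> k * (inner (u - proj N u) (e k))\<^sup>2) sums (stiff u - (\<Sum>k<N. \<alpha> k * (inner u (e k))\<^sup>2))"
      by (rule sums_cong[THEN iffD1, rotated]) (simp add: inner_diff_left proj_coord)
    show "u - proj N u \<in> dom_sqrt_A e \<alpha>" unfolding dom_iff by (rule sums_summable[OF s])
    show "stiff (u - proj N u) = stiff u - (\<Sum>k<N. \<alpha> k * (inner u (e k))\<^sup>2)"
      unfolding stiff_def[of "u - proj N u"] using s by (rule sums_unique[symmetric])
  qed
  have Au: "A u" unfolding A_def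
  proof (intro allI impI)
    fix \<epsilon> :: real assume \<epsilon>: "\<epsilon> > 0"
    have "(\<lambda>N. \<Sum>k<N. \<alpha> k * (inner u (e k))\<^sup>2) \<longlonglongrightarrow> stiff u" using stiff_sums[OF u] by (simp add: sums_def)
    from LIMSEQ_D[OF this, of "\<epsilon> / 4"] \<epsilon> obtain N where "\<bar>(\<Sum>k<N. \<alpha> k * (inner u (e k))\<^sup>2) - stiff u\<bar> < \<epsilon> / 4" by auto
    then have s: "stiff (u - proj N u) \<le> \<epsilon> / 4" using tail(2)[of N] by linarith
    obtain a a' where a: "(a, a') \<in> test_pairs \<Omega> J" "proj N u - a \<in> dom_sqrt_A e \<alpha>" "stiff (proj N u - a) \<le> \<epsilon> / 4"
      using Ap[of N, unfolded A_def, rule_format, of "\<epsilon> / 4"] \<epsilon> by auto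
    from dom_add[OF tail(1)[of N] a(2)] s a(3) have "u - a \<in> dom_sqrt_A e \<alpha>" "stiff (u - a) \<le> \<epsilon>" by simp_all
    then show "\<exists>a a'. (a, a') \<in> test_pairs \<Omega> J \<and> u - a \<in> dom_sqrt_A e \<alpha> \<and> stiff (u - a) \<le> \<epsilon>" using a(1) by blast
  qed
  have "\<forall>n. \<exists>p. (fst p, snd p) \<in> test_pairs \<Omega> J \<and> u - fst p \<in> dom_sqrt_A e \<alpha> \<and> stiff (u - fst p) \<le> inverse (real (Suc n))"
  proof
    fix n
    obtain a a' where "(a, a') \<in> test_pairs \<Omega> J \<and> u - a \<in> dom_sqrt_A e \<alpha> \<and> stiff (u - a) \<le> inverse (real (Suc n))"
      using Au[unfolded A_def, rule_format, of "inverse (real (Suc n))"] by auto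
    then show "\<exists>p. (fst p, snd p) \<in> test_pairs \<Omega> J \<and> u - fst p \<in> dom_sqrt_A e \<alpha> \<and> stiff (u - fst p) \<le> inverse (real (Suc n))"
      by (intro exI[of _ "(a, a')"]) simp
  qed
  then obtain P where P: "\<And>n. (fst (P n), snd (P n)) \<in> test_pairs \<Omega> J" "\<And>n. u - fst (P n) \<in> dom_sqrt_A e \<alpha>"
    "\<And>n. stiff (u - fst (P n)) \<le> inverse (real (Suc n))"
    using choice[of "\<lambda>n p. (fst p, snd p) \<in> test_pairs \<Omega> J \<and> u - fst p \<in> dom_sqrt_A e \<alpha> \<and> stiff (u - fst p) \<le> inverse (real (Suc n))"]
    by blast
  have "(\<lambda>n. (norm (u - fst (P n)))\<^sup>2) \<longlonglongrightarrow> 0"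
  proof (rule tendsto_sandwich[OF _ _ tendsto_const])
    show "\<forall>\<^sub>F n in sequentially. (norm (u - fst (P n)))\<^sup>2 \<le> inverse (real (Suc n)) / \<alpha> 0"
    proof (rule always_eventually, rule allI)
      fix n
      have "\<alpha> 0 * (norm (u - fst (P n)))\<^sup>2 \<le> inverse (real (Suc n))" using stiff_ge[OF P(2)] P(3) order_trans by blast
      then show "(norm (u - fst (P n)))\<^sup>2 \<le> inverse (real (Suc n)) / \<alpha> 0"
        using \<alpha>_pos0 by (simp add: pos_le_divide_eq mult.commute)
    qed
    have "(\<lambda>n. inverse (real (Suc n)) / \<alpha> 0) \<longlonglongrightarrow> 0 / \<alpha> 0"
      using \<alpha>_pos0 by (intro tendsto_intros LIMSEQ_inverse_real_of_nat) simp
    then show "(\<lambda>n. inverse (real (Suc n)) / \<alpha> 0) \<longlonglongrightarrow> 0" by simp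
  qed simp
  then have "(\<lambda>n. sqrt ((norm (u - fst (P n)))\<^sup>2)) \<longlonglongrightarrow> sqrt 0" by (rule tendsto_real_sqrt)
  then have "(\<lambda>n. norm (fst (P n) - u)) \<longlonglongrightarrow> 0" by (simp add: norm_minus_commute)
  then have l: "(\<lambda>n. fst (P n)) \<longlonglongrightarrow> u" by (simp add: tendsto_norm_zero_iff LIM_zero_iff)
  have "\<exists>N. \<forall>m\<ge>N. \<forall>n\<ge>N. - inner (fst (P m) - fst (P n)) (snd (P m) - snd (P n)) < \<epsilon>" if \<epsilon>: "\<epsilon> > 0" for \<epsilon>
  proof -
    obtain N :: nat where N: "inverse (real (Suc N)) < \<epsilon> / 4" using reals_Archimedean[of "\<epsilon> / 4"] \<epsilon> by auto
    have "- inner (fst (P m) - fst (P n)) (snd (P m) - snd (P n)) < \<epsilon>" if mn: "m \<ge> N" "n \<ge> N" for m n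
    proof -
      have r: "inverse (real (Suc j)) < \<epsilon> / 4" if "j \<ge> N" for j
      proof -
        have "inverse (real (Suc j)) \<le> inverse (real (Suc N))" using that by (intro le_imp_inverse_le) simp_all
        then show ?thesis using N by linarith
      qed
      have "stiff ((-1) *\<^sub>R (u - fst (P m))) = stiff (u - fst (P m))" by (simp only: scale[OF P(2)]) simp
      moreover have "stiff ((u - fst (P n)) + (-1) *\<^sub>R (u - fst (P m))) \<le> 2 * stiff (u - fst (P n)) + 2 * stiff ((-1) *\<^sub>R (u - fst (P m)))"
        by (rule dom_add(2)[OF P(2) dom_scaleR[OF P(2)]])
      moreover have "(u - fst (P n)) + (-1) *\<^sub>R (u - fst (P m)) = fst (P m) - fst (P n)" by simp
      ultimately have "stiff (fst (P m) - fst (P n)) < \<epsilon>"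
        using P(3)[of m] P(3)[of n] r[OF mn(1)] r[OF mn(2)] by simp
      then show ?thesis by (simp only: test_pairs_diff(2)[OF P(1) P(1)])
    qed
    then show ?thesis by blast
  qed
  then show "weak_H10 \<Omega> J u"
    unfolding weak_H10_def using P(1) l by (intro exI[of _ "\<lambda>n. fst (P n)"] exI[of _ "\<lambda>n. snd (P n)"]) blast
qed

text \<open>If \<open>(u, f)\<close> is diagonal, then \<open>inner u b'\<close> and
  \<open>inner f b\<close> have the same Parseval series for every test pair, so \<open>f\<close> is
  the weak Laplacian of \<open>u\<close>. Hence the operator is the maximal diagonal one, as
  \<open>block_diagonal\<close> requires.\<close>

lemma dirichlet_laplacian_diagonal:
  "dirichlet_laplacian \<Omega> J = {(u, f). \<forall>k. inner f (e k) = - \<alpha> k * inner u (e k)}"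
proof (rule set_eqI, clarify)
  fix u f
  show "(u, f) \<in> dirichlet_laplacian \<Omega> J \<longleftrightarrow> (u, f) \<in> {(u, f). \<forall>k. inner f (e k) = - \<alpha> k * inner u (e k)}"
  proof
    assume "(u, f) \<in> {(u, f). \<forall>k. inner f (e k) = - \<alpha> k * inner u (e k)}"
    then have c: "inner f (e k) = - \<alpha> k * inner u (e k)" for k by simp
    have "inner u b' = inner f b" if b: "(b, b') \<in> test_pairs \<Omega> J" for b b'
    proof -
      have "inner u (e k) * inner b' (e k) = inner f (e k) * inner b (e k)" for k
        by (simp add: laplacian_coord[OF test_pairs_laplacian[OF b]] c)
      then show ?thesis using inner_sums[of u b'] inner_sums[of f b] sums_unique2 by simp
    qed
    then show "(u, f) \<in> dirichlet_laplacian \<Omega> J"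
      unfolding dirichlet_laplacian_iff weak_H10_dom using coord_dom(1)[OF c] by blast
  qed (simp add: laplacian_coord)
qed

text \<open>Same approximating sequences as in \<open>weak_H10\<close>; \<open>H_norm\<close> is the
  square root of the form, so \<open>\<epsilon>\<close> is exchanged with its square.\<close>

lemma H_space_1: "H_space \<Omega> J e \<alpha> 1 = dom_sqrt_A e \<alpha>"
proof -
  have hn: "(H_norm e \<alpha> 1 (a - b) < \<epsilon>) = (- inner (a - b) (a' - b') < \<epsilon>\<^sup>2)"
    if "(a, a') \<in> test_pairs \<Omega> J" "(b, b') \<in> test_pairs \<Omega> J" "\<epsilon> > 0" for a a' b b' \<epsilon>
  proof -
    have "H_norm e \<alpha> 1 (a - b) = sqrt (stiff (a - b))"
      unfolding H_norm_def stiff_def using \<alpha>_pos by (simp add: less_imp_le)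
    moreover have "sqrt (stiff (a - b)) < \<epsilon> \<longleftrightarrow> stiff (a - b) < \<epsilon>\<^sup>2"
      using real_sqrt_less_iff[of "stiff (a - b)" "\<epsilon>\<^sup>2"] that(3) by simp
    ultimately show ?thesis unfolding test_pairs_diff(2)[OF that(1,2)] by simp
  qed
  have "u \<in> H_space \<Omega> J e \<alpha> 1 \<longleftrightarrow> weak_H10 \<Omega> J u" for u
  proof
    assume "u \<in> H_space \<Omega> J e \<alpha> 1"
    then obtain w where w: "\<And>n::nat. w n \<in> test_vectors \<Omega> J" "w \<longlonglongrightarrow> u"
      "\<And>\<epsilon>. \<epsilon> > 0 \<Longrightarrow> \<exists>N. \<forall>m\<ge>N. \<forall>n\<ge>N. H_norm e \<alpha> 1 (w m - w n) < \<epsilon>"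
      unfolding H_space_def by blast
    obtain w' where w': "\<And>n. (w n, w' n) \<in> test_pairs \<Omega> J"
      using w(1) choice[of "\<lambda>n a'. (w n, a') \<in> test_pairs \<Omega> J"] unfolding test_vectors_iff by blast
    have "\<exists>N. \<forall>m\<ge>N. \<forall>n\<ge>N. - inner (w m - w n) (w' m - w' n) < \<epsilon>" if "\<epsilon> > 0" for \<epsilon>
      using w(3)[of "sqrt \<epsilon>"] that hn[OF w' w', of "sqrt \<epsilon>"] by simp
    then show "weak_H10 \<Omega> J u" unfolding weak_H10_def using w' w(2) by blast
  next
    assume "weak_H10 \<Omega> J u"
    then obtain a a' where a: "\<And>n::nat. (a n, a' n) \<in> test_pairs \<Omega> J" "a \<longlonglongrightarrow> u"
      "\<And>\<epsilon>. \<epsilon> > 0 \<Longrightarrow> \<exists>N. \<forall>m\<ge>N. \<forall>n\<ge>N. - inner (a m - a n) (a' m - a' n) < \<epsilon>"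
      unfolding weak_H10_def by blast
    have "\<exists>N. \<forall>m\<ge>N. \<forall>n\<ge>N. H_norm e \<alpha> 1 (a m - a n) < \<epsilon>" if "\<epsilon> > 0" for \<epsilon>
      using a(3)[of "\<epsilon>\<^sup>2"] that hn[OF a(1) a(1), of \<epsilon>] by simp
    moreover have "a n \<in> test_vectors \<Omega> J" for n using a(1) test_vectors_iff by blast
    ultimately show "u \<in> H_space \<Omega> J e \<alpha> 1" unfolding H_space_def using a(2) by blast
  qed
  then show ?thesis using weak_H10_dom by blast
qed

end

lemma (in hilbert_basis) vec_sums:
  assumes "summable (\<lambda>k. (c k)\<^sup>2)" shows "(\<lambda>k. c k *\<^sub>R e k) sums vec c"
  using proj_tendsto[of "vec c"] unfolding proj_def sums_def by (simp add: vec_coord[OF assms])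

section \<open>The space of order \<open>-1\<close> and the two semigroups\<close>

sublocale dirichlet \<subseteq> heat: block_diagonal "\<lambda>x k. inner x (e k)" "\<lambda>k b. - \<alpha> k * b" "\<lambda>k t b. exp (- \<alpha> k * t) * b" 1
proof (rule block_diagonal.intro)
  show "bounded_linear (\<lambda>x. inner x (e k))" for k by (rule bounded_linear_inner_left)
  show "(\<lambda>k. (norm (inner x (e k)))\<^sup>2) sums (norm x)\<^sup>2" for x using parseval[of x] by simp
  show "\<exists>x. \<forall>k. inner x (e k) = s k" if "summable (\<lambda>k. (norm (s k))\<^sup>2)" for s :: "nat \<Rightarrow> real"
    using riesz_fischer[of s] that by simp
  show "bounded_linear (\<lambda>b. - \<alpha> k * b)" for k by (rule bounded_linear_mult_right)
  show "((\<lambda>t. exp (- \<alpha> k * t) * b) has_vector_derivative - \<alpha> k * (exp (- \<alpha> k * t) * b)) (at t within {0..})" for k t b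
    unfolding has_real_derivative_iff_has_vector_derivative[symmetric] by (auto intro!: derivative_eq_intros)
  show "norm (exp (- \<alpha> k * t) * b) \<le> 1 * norm b" if "0 \<le> t" for k t b
    using that \<alpha>_pos[of k] by (simp add: abs_mult mult_left_le_one_le)
qed simp

lemma (in dirichlet) heat_semigroup:
  assumes "0 \<le> t"
  shows "inner (semigroup_of (dirichlet_laplacian \<Omega> J) t x) (e k) = exp (- \<alpha> k * t) * inner x (e k)"
    "norm (semigroup_of (dirichlet_laplacian \<Omega> J) t x) \<le> norm x"
proof -
  have G: "heat.G = dirichlet_laplacian \<Omega> J" unfolding heat.G_def dirichlet_laplacian_diagonal ..
  show "inner (semigroup_of (dirichlet_laplacian \<Omega> J) t x) (e k) = exp (- \<alpha> k * t) * inner x (e k)"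
    using heat.c_semigroup_of[OF assms, of x k] unfolding G .
  show "norm (semigroup_of (dirichlet_laplacian \<Omega> J) t x) \<le> norm x"
    using heat.norm_semigroup_of[OF assms, of x] unfolding G by simp
qed

locale completed = dirichlet \<Omega> J e \<alpha>
  for \<Omega> :: "'a::euclidean_space set"
    and J :: "'h::{real_inner, complete_space, second_countable_topology} \<Rightarrow> 'a \<Rightarrow> real"
    and e :: "nat \<Rightarrow> 'h" and \<alpha> :: "nat \<Rightarrow> real" +
  fixes \<iota> :: "'h \<Rightarrow> 'm::{real_inner, complete_space, second_countable_topology}" and \<mu> :: real
  assumes completion: "H_completion \<Omega> J e \<alpha> (-1) \<iota>" and \<mu>_pos: "0 < \<mu>"
begin

section \<open>Coordinates in the space of order -1\<close>

lemma \<iota>: "bounded_linear \<iota>" using completion by (simp add: H_completion_def)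

lemma norm_\<iota>: "(\<lambda>k. (inner u (e k))\<^sup>2 / \<alpha> k) sums (norm (\<iota> u))\<^sup>2"
proof -
  have pw: "\<alpha> k powr (-1) * (inner u (e k))\<^sup>2 = (inner u (e k))\<^sup>2 / \<alpha> k" for k
    using \<alpha>_pos[of k] by (simp add: powr_minus divide_inverse mult.commute)
  have pos: "0 \<le> (inner u (e k))\<^sup>2 / \<alpha> k" for k using \<alpha>_pos[of k] by simp
  have s: "summable (\<lambda>k. (inner u (e k))\<^sup>2 / \<alpha> k)"
  proof (rule summable_comparison_test'[OF summable_divide[OF coord_summable[of u], of "\<alpha> 0"], of 0])
    fix k
    have "(inner u (e k))\<^sup>2 / \<alpha> k \<le> (inner u (e k))\<^sup>2 / \<alpha> 0"
      by (intro divide_left_mono \<alpha>_ge mult_pos_pos \<alpha>_pos \<alpha>_pos0) simp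
    then show "norm ((inner u (e k))\<^sup>2 / \<alpha> k) \<le> (inner u (e k))\<^sup>2 / \<alpha> 0" using pos[of k] by simp
  qed
  have "norm (\<iota> u) = H_norm e \<alpha> (-1) u" using completion by (simp add: H_completion_def)
  then have "norm (\<iota> u) = sqrt (\<Sum>k. (inner u (e k))\<^sup>2 / \<alpha> k)" unfolding H_norm_def pw .
  then have "(norm (\<iota> u))\<^sup>2 = (\<Sum>k. (inner u (e k))\<^sup>2 / \<alpha> k)" using suminf_nonneg[OF s pos] by simp
  then show ?thesis using s by (simp add: sums_iff)
qed

text \<open>Polarization of \<open>norm_\<iota>\<close>.\<close>

lemma inner_\<iota>: "(\<lambda>k. inner u (e k) * inner v (e k) / \<alpha> k) sums inner (\<iota> u) (\<iota> v)"
proof -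
  have "(\<lambda>k. ((inner (u + v) (e k))\<^sup>2 / \<alpha> k - (inner (u - v) (e k))\<^sup>2 / \<alpha> k) / 4)
    sums (((norm (\<iota> (u + v)))\<^sup>2 - (norm (\<iota> (u - v)))\<^sup>2) / 4)"
    by (intro sums_divide sums_diff norm_\<iota>)
  moreover have "((inner (u + v) (e k))\<^sup>2 / \<alpha> k - (inner (u - v) (e k))\<^sup>2 / \<alpha> k) / 4 = inner u (e k) * inner v (e k) / \<alpha> k" for k
    using \<alpha>_pos[of k] by (simp add: inner_add_left inner_diff_left power2_eq_square field_simps)
  moreover have "((norm (\<iota> (u + v)))\<^sup>2 - (norm (\<iota> (u - v)))\<^sup>2) / 4 = inner (\<iota> u) (\<iota> v)"
    unfolding linear_simps(1,2)[OF \<iota>] power2_norm_eq_inner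
    by (simp add: inner_add_left inner_add_right inner_diff_left inner_diff_right inner_commute[of "\<iota> v" "\<iota> u"])
  ultimately show ?thesis by simp
qed

text \<open>\<open>\<iota> (e k)\<close> has squared norm \<open>1 / \<alpha> k\<close> in the
  completion; these are the normalised images, an orthonormal basis there.\<close>

definition en :: "nat \<Rightarrow> 'm" where "en k = sqrt (\<alpha> k) *\<^sub>R \<iota> (e k)"

lemma \<iota>_coord: "inner (\<iota> u) (en k) = inner u (e k) / sqrt (\<alpha> k)"
proof -
  have "(\<lambda>j. inner u (e j) * inner (e k) (e j) / \<alpha> j) = (\<lambda>j. if j = k then inner u (e k) / \<alpha> k else 0)"
    by (auto simp: ortho fun_eq_iff)
  then have "(\<lambda>j. inner u (e j) * inner (e k) (e j) / \<alpha> j) sums (inner u (e k) / \<alpha> k)"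
    using sums_single[of k "\<lambda>_. inner u (e k) / \<alpha> k"] by simp
  with inner_\<iota>[of u "e k"] have "inner (\<iota> u) (\<iota> (e k)) = inner u (e k) / \<alpha> k" by (rule sums_unique2)
  moreover have "sqrt (\<alpha> k) * (inner u (e k) / \<alpha> k) = inner u (e k) / sqrt (\<alpha> k)"
    using \<alpha>_pos[of k] real_sqrt_mult_self[of "\<alpha> k"] by (simp add: field_simps)
  ultimately show ?thesis by (simp add: en_def)
qed

lemma en_ortho: "inner (en i) (en j) = (if i = j then 1 else 0)"
proof -
  have "inner (en i) (en j) = sqrt (\<alpha> i) * (inner (e i) (e j) / sqrt (\<alpha> j))"
    using \<iota>_coord[of "e i" j] by (simp add: en_def[of i])
  then show ?thesis using \<alpha>_pos[of j] by (simp add: ortho)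
qed

text \<open>Each \<open>\<iota> u\<close> is the limit of \<open>\<iota> (proj N u)\<close>, and the
  image of the test vectors is dense by assumption.\<close>

lemma en_total: "closure (span (range en)) = UNIV"
proof -
  have sp: "\<iota> (proj N u) \<in> span (range en)" for N u
  proof -
    have "\<iota> (proj N u) = (\<Sum>k<N. (inner u (e k) / sqrt (\<alpha> k)) *\<^sub>R en k)"
      unfolding proj_def linear_sum[OF bounded_linear.linear[OF \<iota>]] linear_simps(5)[OF \<iota>] en_def
      using \<alpha>_pos by (intro sum.cong refl) (simp add: less_imp_neq[symmetric])
    then show ?thesis by (simp add: span_sum span_scale span_base)
  qed
  have "\<iota> u \<in> closure (span (range en))" for u
    unfolding closure_sequential
    using sp bounded_linear.tendsto[OF \<iota> proj_tendsto[of u]] by (intro exI[of _ "\<lambda>N. \<iota> (proj N u)"]) simp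
  then have "\<iota> ` test_vectors \<Omega> J \<subseteq> closure (span (range en))" by blast
  then have "closure (\<iota> ` test_vectors \<Omega> J) \<subseteq> closure (span (range en))" by (rule closure_minimal) simp
  then show ?thesis using completion by (auto simp: H_completion_def)
qed

sublocale W: hilbert_basis en
  by unfold_locales (rule en_ortho, rule en_total)

text \<open>Both components in orthonormal coordinates, so that the norm of the product space
  becomes the sum of squares needed by \<open>block_diagonal\<close>.\<close>

definition cw :: "'h \<times> 'm \<Rightarrow> nat \<Rightarrow> real \<times> real" where
  "cw z k = (inner (fst z) (e k), inner (snd z) (en k))"

text \<open>Since \<open>inner (\<iota> v) (en k) = inner v (e k) / sqrt (\<alpha> k)\<close>, the
  square root appears in both off-diagonal entries; their contributions cancel in the energy used
  for \<open>Uw_bound\<close>.\<close>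

definition Bw :: "nat \<Rightarrow> real \<times> real \<Rightarrow> real \<times> real" where
  "Bw k b = (sqrt (\<alpha> k) * snd b, - (sqrt (\<alpha> k) * fst b + snd b) / \<mu>)"

text \<open>The free solution of \<open>mode_free_wave\<close> with initial position
  \<open>fst b\<close> and initial velocity \<open>sqrt (\<alpha> k) * snd b\<close>, its velocity
  divided by \<open>sqrt (\<alpha> k)\<close>.\<close>

definition Uw :: "nat \<Rightarrow> real \<Rightarrow> real \<times> real \<Rightarrow> real \<times> real" where
  "Uw k t b = ((kern' \<mu> (\<alpha> k) t + kern \<mu> (\<alpha> k) t / \<mu>) * fst b + sqrt (\<alpha> k) * kern \<mu> (\<alpha> k) t * snd b,
    - (sqrt (\<alpha> k) / \<mu>) * kern \<mu> (\<alpha> k) t * fst b + kern' \<mu> (\<alpha> k) t * snd b)"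

lemma Uw_deriv:
  "((\<lambda>t. fst (Uw k t b)) has_real_derivative sqrt (\<alpha> k) * snd (Uw k t b)) (at t within S)"
  "((\<lambda>t. snd (Uw k t b)) has_real_derivative - (sqrt (\<alpha> k) * fst (Uw k t b) + snd (Uw k t b)) / \<mu>) (at t within S)"
proof -
  note kd = wave_kernel(1,2)[OF \<mu>_pos, of "\<alpha> k", THEN has_field_derivative_at_within]
  have sq: "sqrt (\<alpha> k) * sqrt (\<alpha> k) = \<alpha> k" using \<alpha>_pos[of k] by simp
  show "((\<lambda>t. fst (Uw k t b)) has_real_derivative sqrt (\<alpha> k) * snd (Uw k t b)) (at t within S)"
    unfolding Uw_def fst_conv snd_conv
  proof (rule DERIV_cong)
    show "((\<lambda>t. (kern' \<mu> (\<alpha> k) t + kern \<mu> (\<alpha> k) t / \<mu>) * fst b + sqrt (\<alpha> k) * kern \<mu> (\<alpha> k) t * snd b)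
      has_real_derivative (- (kern' \<mu> (\<alpha> k) t + \<alpha> k * kern \<mu> (\<alpha> k) t) / \<mu> + kern' \<mu> (\<alpha> k) t / \<mu>) * fst b
        + sqrt (\<alpha> k) * kern' \<mu> (\<alpha> k) t * snd b) (at t within S)"
      by (intro DERIV_add DERIV_cmult_right DERIV_cmult DERIV_cdivide kd)
    define r x x' where "r = sqrt (\<alpha> k)" and "x = kern \<mu> (\<alpha> k) t" and "x' = kern' \<mu> (\<alpha> k) t"
    have "(- (x' + (r * r) * x) / \<mu> + x' / \<mu>) * fst b + r * x' * snd b = r * (- (r / \<mu>) * x * fst b + x' * snd b)"
      using \<mu>_pos by (simp add: field_simps)
    then show "(- (kern' \<mu> (\<alpha> k) t + \<alpha> k * kern \<mu> (\<alpha> k) t) / \<mu> + kern' \<mu> (\<alpha> k) t / \<mu>) * fst b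
        + sqrt (\<alpha> k) * kern' \<mu> (\<alpha> k) t * snd b
      = sqrt (\<alpha> k) * (- (sqrt (\<alpha> k) / \<mu>) * kern \<mu> (\<alpha> k) t * fst b + kern' \<mu> (\<alpha> k) t * snd b)"
      by (simp only: r_def x_def x'_def sq)
  qed
  show "((\<lambda>t. snd (Uw k t b)) has_real_derivative - (sqrt (\<alpha> k) * fst (Uw k t b) + snd (Uw k t b)) / \<mu>) (at t within S)"
    unfolding Uw_def fst_conv snd_conv
  proof (rule DERIV_cong)
    show "((\<lambda>t. - (sqrt (\<alpha> k) / \<mu>) * kern \<mu> (\<alpha> k) t * fst b + kern' \<mu> (\<alpha> k) t * snd b)
      has_real_derivative - (sqrt (\<alpha> k) / \<mu>) * kern' \<mu> (\<alpha> k) t * fst b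
        + (- (kern' \<mu> (\<alpha> k) t + \<alpha> k * kern \<mu> (\<alpha> k) t) / \<mu>) * snd b) (at t within S)"
      by (intro DERIV_add DERIV_cmult_right DERIV_cmult kd)
    define s x x' where "s = sqrt (\<alpha> k)" and "x = kern \<mu> (\<alpha> k) t" and "x' = kern' \<mu> (\<alpha> k) t"
    have "- (s / \<mu>) * x' * fst b + (- (x' + (s * s) * x) / \<mu>) * snd b
      = - (s * ((x' + x / \<mu>) * fst b + s * x * snd b) + (- (s / \<mu>) * x * fst b + x' * snd b)) / \<mu>"
      using \<mu>_pos by (simp add: field_simps)
    then show "- (sqrt (\<alpha> k) / \<mu>) * kern' \<mu> (\<alpha> k) t * fst b
        + (- (kern' \<mu> (\<alpha> k) t + \<alpha> k * kern \<mu> (\<alpha> k) t) / \<mu>) * snd b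
      = - (sqrt (\<alpha> k) * ((kern' \<mu> (\<alpha> k) t + kern \<mu> (\<alpha> k) t / \<mu>) * fst b + sqrt (\<alpha> k) * kern \<mu> (\<alpha> k) t * snd b)
        + (- (sqrt (\<alpha> k) / \<mu>) * kern \<mu> (\<alpha> k) t * fst b + kern' \<mu> (\<alpha> k) t * snd b)) / \<mu>"
      by (simp only: s_def x_def x'_def sq)
  qed
qed

lemma Uw_0: "Uw k 0 b = b"
  by (simp add: Uw_def wave_kernel[OF \<mu>_pos])

text \<open>Comparison constant between the Euclidean norm and the energy with weight
  \<open>\<mu>\<close> on the second component.\<close>

definition Cw :: real where "Cw = sqrt (max 1 \<mu> / min 1 \<mu>)"

text \<open>The energy \<open>E\<close> has derivative minus twice the squared second component,
  whatever \<open>\<alpha> k\<close> is; hence a bound uniform in \<open>k\<close>.\<close>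

lemma Uw_bound:
  assumes t: "0 \<le> t" shows "norm (Uw k t b) \<le> Cw * norm b"
proof -
  define E where "E t = (fst (Uw k t b))\<^sup>2 + \<mu> * (snd (Uw k t b))\<^sup>2" for t
  have "(E has_real_derivative - (2 * (snd (Uw k s b))\<^sup>2)) (at s)" for s
  proof -
    have "(E has_real_derivative (2 * fst (Uw k s b) * (sqrt (\<alpha> k) * snd (Uw k s b))
        + \<mu> * (2 * snd (Uw k s b) * (- (sqrt (\<alpha> k) * fst (Uw k s b) + snd (Uw k s b)) / \<mu>)))) (at s)"
    proof -
      have sq: "((\<lambda>t. (f t)\<^sup>2) has_real_derivative 2 * f s * D) (at s)" if "(f has_real_derivative D) (at s)" for f D
        using DERIV_power[OF that, of 2] by (simp add: mult_ac)
      show ?thesis unfolding E_def by (intro DERIV_add DERIV_cmult sq Uw_deriv)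
    qed
    also have "2 * fst (Uw k s b) * (sqrt (\<alpha> k) * snd (Uw k s b))
        + \<mu> * (2 * snd (Uw k s b) * (- (sqrt (\<alpha> k) * fst (Uw k s b) + snd (Uw k s b)) / \<mu>))
      = - (2 * (snd (Uw k s b))\<^sup>2)"
      using \<mu>_pos by (simp add: field_simps power2_eq_square)
    finally show ?thesis .
  qed
  then have "E t \<le> E 0" by (intro DERIV_nonpos_imp_nonincreasing[OF t] exI conjI) auto
  also have "E 0 = (fst b)\<^sup>2 + \<mu> * (snd b)\<^sup>2" by (simp add: E_def Uw_0)
  also have "\<dots> \<le> max 1 \<mu> * (fst b)\<^sup>2 + max 1 \<mu> * (snd b)\<^sup>2"
    using mult_right_mono[of 1 "max 1 \<mu>" "(fst b)\<^sup>2"] mult_right_mono[of \<mu> "max 1 \<mu>" "(snd b)\<^sup>2"] by simp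
  also have "\<dots> = max 1 \<mu> * (norm b)\<^sup>2" by (simp add: norm_prod_def distrib_left)
  finally have 1: "E t \<le> max 1 \<mu> * (norm b)\<^sup>2" .
  have "min 1 \<mu> * (norm (Uw k t b))\<^sup>2 = min 1 \<mu> * (fst (Uw k t b))\<^sup>2 + min 1 \<mu> * (snd (Uw k t b))\<^sup>2"
    by (simp add: norm_prod_def distrib_left)
  also have "\<dots> \<le> E t"
    using mult_right_mono[of "min 1 \<mu>" 1 "(fst (Uw k t b))\<^sup>2"] mult_right_mono[of "min 1 \<mu>" \<mu> "(snd (Uw k t b))\<^sup>2"]
    by (simp add: E_def)
  finally have "min 1 \<mu> * (norm (Uw k t b))\<^sup>2 \<le> max 1 \<mu> * (norm b)\<^sup>2" using 1 by linarith
  moreover have m: "0 < min 1 \<mu>" "0 < max 1 \<mu>" using \<mu>_pos by auto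
  ultimately have "(norm (Uw k t b))\<^sup>2 \<le> max 1 \<mu> / min 1 \<mu> * (norm b)\<^sup>2" by (simp add: field_simps)
  also have "\<dots> = (Cw * norm b)\<^sup>2" using m by (simp add: Cw_def power_mult_distrib)
  finally show ?thesis by (rule power2_le_imp_le) (use m in \<open>simp add: Cw_def\<close>)
qed

sublocale wave: block_diagonal cw Bw Uw Cw
proof (rule block_diagonal.intro)
  show "bounded_linear (\<lambda>x. cw x k)" for k
    unfolding cw_def
    by (intro bounded_linear_Pair bounded_linear_compose[OF bounded_linear_inner_left] bounded_linear_fst bounded_linear_snd)
  show "(\<lambda>k. (norm (cw x k))\<^sup>2) sums (norm x)\<^sup>2" for x
    using sums_add[OF parseval[of "fst x"] W.parseval[of "snd x"]] by (simp add: cw_def norm_prod_def)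
  show "\<exists>x. \<forall>k. cw x k = s k" if "summable (\<lambda>k. (norm (s k))\<^sup>2)" for s :: "nat \<Rightarrow> real \<times> real"
  proof -
    have "summable (\<lambda>k. (fst (s k))\<^sup>2)" "summable (\<lambda>k. (snd (s k))\<^sup>2)"
      by (rule summable_comparison_test'[OF that, of 0], simp add: norm_prod_def)+
    then obtain u w where "\<forall>k. inner u (e k) = fst (s k)" "\<forall>k. inner w (en k) = snd (s k)"
      using riesz_fischer[of "\<lambda>k. fst (s k)"] W.riesz_fischer[of "\<lambda>k. snd (s k)"] by blast
    then show ?thesis by (intro exI[of _ "(u, w)"]) (simp add: cw_def)
  qed
  show "bounded_linear (Bw k)" for k
    unfolding Bw_def[abs_def]
    by (intro bounded_linear_Pair bounded_linear_compose[OF bounded_linear_mult_right]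
      bounded_linear_compose[OF bounded_linear_divide] bounded_linear_minus bounded_linear_add bounded_linear_fst bounded_linear_snd)
  show "((\<lambda>t. Uw k t b) has_vector_derivative Bw k (Uw k t b)) (at t within {0..})" for k t b
    using has_vector_derivative_Pair[OF Uw_deriv[of k b t "{0..}", unfolded has_real_derivative_iff_has_vector_derivative]]
    by (simp add: Bw_def)
qed (simp_all add: Uw_0 Uw_bound)

text \<open>In the normalised basis the coefficients of the series are
  \<open>- sqrt (\<alpha> k) * inner u (e k)\<close>, square-summable exactly on the form domain, so
  the series converges there.\<close>

lemma A_ext_coord:
  assumes u: "u \<in> dom_sqrt_A e \<alpha>"
  shows "inner (A_ext e \<alpha> \<iota> u) (en k) = - sqrt (\<alpha> k) * inner u (e k)"
proof -
  define c where "c k = - sqrt (\<alpha> k) * inner u (e k)" for k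
  have c2: "(c k)\<^sup>2 = \<alpha> k * (inner u (e k))\<^sup>2" for k
    using \<alpha>_pos[of k] by (simp add: c_def power_mult_distrib)
  have s: "summable (\<lambda>k. (c k)\<^sup>2)" unfolding c2 using u by (simp add: dom_iff)
  have "c k *\<^sub>R en k = (- \<alpha> k * inner u (e k)) *\<^sub>R \<iota> (e k)" for k
    using \<alpha>_pos[of k] by (simp add: c_def en_def)
  then have "A_ext e \<alpha> \<iota> u = W.vec c"
    using W.vec_sums[OF s] unfolding A_ext_def by (simp add: sums_iff)
  then have "inner (A_ext e \<alpha> \<iota> u) (en k) = c k" using W.vec_coord[OF s, of k] by simp
  then show ?thesis by (simp add: c_def)
qed

text \<open>The first block equation says that the second component is \<open>\<iota> v\<close>, the
  second one determines \<open>y\<close>. What has to be recovered from the blocks is that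
  \<open>u\<close> lies in the form domain.\<close>

lemma A_mu_diagonal: "A_mu \<Omega> J e \<alpha> \<iota> \<mu> = wave.G"
proof (rule set_eqI, clarify)
  fix u w v y
  have G: "((u, w), (v, y)) \<in> wave.G \<longleftrightarrow> (\<forall>k. inner v (e k) = sqrt (\<alpha> k) * inner w (en k) \<and>
      inner y (en k) = - (sqrt (\<alpha> k) * inner u (e k) + inner w (en k)) / \<mu>)"
    by (simp add: wave.G_def cw_def Bw_def)
  have w_iff: "(\<forall>k. inner v (e k) = sqrt (\<alpha> k) * inner w (en k)) \<longleftrightarrow> w = \<iota> v"
  proof
    assume *: "\<forall>k. inner v (e k) = sqrt (\<alpha> k) * inner w (en k)"
    show "w = \<iota> v"
    proof (rule W.coord_eqI)
      show "inner w (en k) = inner (\<iota> v) (en k)" for k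
        using *[rule_format, of k] \<alpha>_pos[of k] by (simp add: \<iota>_coord)
    qed
  next
    assume "w = \<iota> v"
    then show "\<forall>k. inner v (e k) = sqrt (\<alpha> k) * inner w (en k)"
      using \<alpha>_pos by (simp add: \<iota>_coord less_imp_neq[symmetric])
  qed
  let ?y = "(1 / \<mu>) *\<^sub>R A_ext e \<alpha> \<iota> u - (1 / \<mu>) *\<^sub>R w"
  have yc: "inner ?y (en k) = - (sqrt (\<alpha> k) * inner u (e k) + inner w (en k)) / \<mu>" if "u \<in> dom_sqrt_A e \<alpha>" for k
    using A_ext_coord[OF that, of k] \<mu>_pos by (simp add: inner_diff_left field_simps)
  have "((u, w), (v, y)) \<in> A_mu \<Omega> J e \<alpha> \<iota> \<mu> \<longleftrightarrow> u \<in> dom_sqrt_A e \<alpha> \<and> w = \<iota> v \<and> y = ?y"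
    unfolding A_mu_def H_space_1 by auto
  also have "\<dots> \<longleftrightarrow> ((u, w), (v, y)) \<in> wave.G"
  proof
    assume *: "u \<in> dom_sqrt_A e \<alpha> \<and> w = \<iota> v \<and> y = ?y"
    then have u: "u \<in> dom_sqrt_A e \<alpha>" and w: "w = \<iota> v" and y: "y = ?y" by simp_all
    show "((u, w), (v, y)) \<in> wave.G"
      unfolding G using w_iff w yc[OF u] y by blast
  next
    assume "((u, w), (v, y)) \<in> wave.G"
    then have w: "w = \<iota> v" and y: "\<And>k. inner y (en k) = - (sqrt (\<alpha> k) * inner u (e k) + inner w (en k)) / \<mu>"
      unfolding G using w_iff by blast+
    \<comment> \<open>The numbers whose squares make up the stiffness of \<open>u\<close> are
      coordinates of a vector of the completion, hence square-summable.\<close>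
    have "sqrt (\<alpha> k) * inner u (e k) = inner (- \<mu> *\<^sub>R y - w) (en k)" for k
      using y[of k] \<mu>_pos by (simp add: inner_diff_left field_simps)
    then have "(inner (- \<mu> *\<^sub>R y - w) (en k))\<^sup>2 = (sqrt (\<alpha> k))\<^sup>2 * (inner u (e k))\<^sup>2" for k
      by (simp flip: power_mult_distrib)
    then have "\<alpha> k * (inner u (e k))\<^sup>2 = (inner (- \<mu> *\<^sub>R y - w) (en k))\<^sup>2" for k
      using \<alpha>_pos[of k] by simp
    then have u: "u \<in> dom_sqrt_A e \<alpha>" unfolding dom_iff using W.coord_summable[of "- \<mu> *\<^sub>R y - w"] by simp
    have "y = ?y" by (rule W.coord_eqI) (simp only: yc[OF u] y)
    then show "u \<in> dom_sqrt_A e \<alpha> \<and> w = \<iota> v \<and> y = ?y" using u w by blast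
  qed
  finally show "((u, w), (v, y)) \<in> A_mu \<Omega> J e \<alpha> \<iota> \<mu> \<longleftrightarrow> ((u, w), (v, y)) \<in> wave.G" .
qed

lemma wave_semigroup:
  assumes "0 \<le> t"
  shows "cw (semigroup_of (A_mu \<Omega> J e \<alpha> \<iota> \<mu>) t z) k = Uw k t (cw z k)"
    "norm (semigroup_of (A_mu \<Omega> J e \<alpha> \<iota> \<mu>) t z) \<le> \<bar>Cw\<bar> * norm z"
  unfolding A_mu_diagonal using wave.c_semigroup_of[OF assms] wave.norm_semigroup_of[OF assms] by simp_all

end

section \<open>Mild solutions\<close>

lemma L2on_norm: "L2on T f \<Longrightarrow> L2on T (\<lambda>s. norm (f s))"
  using measurable_compose[of f _ borel norm borel] by (auto simp: L2on_def intro: borel_measurable_continuous_onI continuous_intros)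

text \<open>Coordinates give measurability of the integrand, contractivity its integrability; the
  coordinate functional is then moved under the Bochner integral.\<close>

lemma (in dirichlet) heat_convolution:
  assumes x: "L2on T x" and t: "t \<in> {0..T}"
  shows "inner (\<integral>s. semigroup_of (dirichlet_laplacian \<Omega> J) (t - s) (x s) \<partial>lebesgue_on {0..t}) (e k)
    = (\<integral>s. exp (- \<alpha> k * (t - s)) * inner (x s) (e k) \<partial>lebesgue_on {0..t})"
proof -
  let ?M = "lebesgue_on {0..t}" and ?S = "\<lambda>s. semigroup_of (dirichlet_laplacian \<Omega> J) (t - s) (x s)"
  have xt: "L2on t x" by (rule L2on_sub[OF x]) (use t in simp)
  have coord: "inner (?S s) (e k) = exp (- \<alpha> k * (t - s)) * inner (x s) (e k)" if "s \<in> {0..t}" for s k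
    using heat_semigroup(1)[of "t - s" "x s" k] that by simp
  have "?S \<in> borel_measurable ?M"
  proof (rule measurable_coords)
    fix k
    have "L2on t (\<lambda>s. exp (- \<alpha> k * (t - s)) *\<^sub>R inner (x s) (e k))"
      by (intro L2on_mult_continuous L2on_inner_const xt continuous_intros)
    then have "(\<lambda>s. exp (- \<alpha> k * (t - s)) * inner (x s) (e k)) \<in> borel_measurable ?M" by (simp add: L2on_def)
    then show "(\<lambda>s. inner (?S s) (e k)) \<in> borel_measurable ?M"
      by (subst measurable_lebesgue_cong[OF coord])
  qed
  moreover have "norm (?S s) \<le> norm (x s)" if "s \<in> space ?M" for s
    using heat_semigroup(2)[of "t - s" "x s"] that by simp
  ultimately have "integrable ?M ?S" by (rule integrable_complete[OF _ L2on_integrable[OF L2on_norm[OF xt]]])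
  then have "inner (\<integral>s. ?S s \<partial>?M) (e k) = (\<integral>s. inner (?S s) (e k) \<partial>?M)"
    by (intro integral_bounded_linear[OF bounded_linear_inner_left, symmetric])
  also have "\<dots> = (\<integral>s. exp (- \<alpha> k * (t - s)) * inner (x s) (e k) \<partial>?M)"
    by (rule integral_lebesgue_on_cong[OF coord])
  finally show ?thesis .
qed

text \<open>A velocity impulse produces the impulse response in the position and its derivative in
  the velocity, the latter rescaled by the basis of the completion.\<close>

lemma (in completed) wave_convolution:
  assumes x: "L2on T x" and t: "t \<in> {0..T}"
  shows "cw (\<integral>s. semigroup_of (A_mu \<Omega> J e \<alpha> \<iota> \<mu>) (t - s) (0, \<iota> (x s)) \<partial>lebesgue_on {0..t}) k
    = (\<integral>s. kern \<mu> (\<alpha> k) (t - s) * inner (x s) (e k) \<partial>lebesgue_on {0..t},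
       (\<integral>s. kern' \<mu> (\<alpha> k) (t - s) * inner (x s) (e k) \<partial>lebesgue_on {0..t}) / sqrt (\<alpha> k))"
proof -
  let ?M = "lebesgue_on {0..t}" and ?S = "\<lambda>s. semigroup_of (A_mu \<Omega> J e \<alpha> \<iota> \<mu>) (t - s) (0, \<iota> (x s))"
  have xt: "L2on t x" by (rule L2on_sub[OF x]) (use t in simp)
  have coord: "inner (fst (?S s)) (e k) = kern \<mu> (\<alpha> k) (t - s) * inner (x s) (e k)"
    "inner (snd (?S s)) (en k) = kern' \<mu> (\<alpha> k) (t - s) * inner (x s) (e k) / sqrt (\<alpha> k)" if "s \<in> {0..t}" for s k
    using wave_semigroup(1)[of "t - s" "(0, \<iota> (x s))" k] that \<alpha>_pos[of k]
    by (simp_all add: cw_def Uw_def \<iota>_coord less_imp_neq[symmetric])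
  have c: "continuous_on S (\<lambda>s. kern \<mu> (\<alpha> k) (t - s))" "continuous_on S (\<lambda>s. kern' \<mu> (\<alpha> k) (t - s))" for S k
    using continuous_on_compose2[OF continuous_kern(1)[OF \<mu>_pos, of UNIV "\<alpha> k"], of S "\<lambda>s. t - s"]
      continuous_on_compose2[OF continuous_kern(2)[OF \<mu>_pos, of UNIV "\<alpha> k"], of S "\<lambda>s. t - s"]
    by (simp_all add: continuous_on_diff)
  have L: "L2on t (\<lambda>s. kern \<mu> (\<alpha> k) (t - s) *\<^sub>R inner (x s) (e k))" "L2on t (\<lambda>s. kern' \<mu> (\<alpha> k) (t - s) *\<^sub>R inner (x s) (e k))" for k
    by (intro L2on_mult_continuous L2on_inner_const xt c)+
  have "(\<lambda>s. fst (?S s)) \<in> borel_measurable ?M"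
  proof (rule measurable_coords)
    show "(\<lambda>s. inner (fst (?S s)) (e k)) \<in> borel_measurable ?M" for k
      using L(1)[of k] by (subst measurable_lebesgue_cong[OF coord(1)]) (simp_all add: L2on_def)
  qed
  moreover have "(\<lambda>s. snd (?S s)) \<in> borel_measurable ?M"
  proof (rule W.measurable_coords)
    fix k
    have "(\<lambda>s. kern' \<mu> (\<alpha> k) (t - s) * inner (x s) (e k)) \<in> borel_measurable ?M" using L(2)[of k] by (simp add: L2on_def)
    then have "(\<lambda>s. kern' \<mu> (\<alpha> k) (t - s) * inner (x s) (e k) / sqrt (\<alpha> k)) \<in> borel_measurable ?M"
      by (intro borel_measurable_divide borel_measurable_const)
    then show "(\<lambda>s. inner (snd (?S s)) (en k)) \<in> borel_measurable ?M"
      by (subst measurable_lebesgue_cong[OF coord(2)])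
  qed
  ultimately have "(\<lambda>s. (fst (?S s), snd (?S s))) \<in> borel_measurable ?M" by (rule borel_measurable_Pair)
  then have m: "?S \<in> borel_measurable ?M" by simp
  have Lx: "L2on t (\<lambda>s. (0 :: 'h, \<iota> (x s)))"
    by (rule L2on_bounded_linear[OF xt bounded_linear_Pair[OF bounded_linear_zero \<iota>]])
  have "integrable ?M ?S"
  proof (rule integrable_complete[OF m])
    show "integrable ?M (\<lambda>s. \<bar>Cw\<bar> * norm (0 :: 'h, \<iota> (x s)))"
      by (intro integrable_mult_right L2on_integrable L2on_norm Lx)
    show "norm (?S s) \<le> \<bar>Cw\<bar> * norm (0 :: 'h, \<iota> (x s))" if "s \<in> space ?M" for s
      by (rule wave_semigroup(2)) (use that in simp)
  qed
  note bl = integral_bounded_linear[OF _ this, symmetric]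
  have "inner (fst (\<integral>s. ?S s \<partial>?M)) (e k) = (\<integral>s. inner (fst (?S s)) (e k) \<partial>?M)"
    by (rule bl[OF bounded_linear_compose[OF bounded_linear_inner_left bounded_linear_fst]])
  moreover have "inner (snd (\<integral>s. ?S s \<partial>?M)) (en k) = (\<integral>s. inner (snd (?S s)) (en k) \<partial>?M)"
    by (rule bl[OF bounded_linear_compose[OF bounded_linear_inner_left bounded_linear_snd]])
  moreover have "(\<integral>s. inner (fst (?S s)) (e k) \<partial>?M) = (\<integral>s. kern \<mu> (\<alpha> k) (t - s) * inner (x s) (e k) \<partial>?M)"
    by (rule integral_lebesgue_on_cong[OF coord(1)])
  moreover have "(\<integral>s. inner (snd (?S s)) (en k) \<partial>?M) = (\<integral>s. kern' \<mu> (\<alpha> k) (t - s) * inner (x s) (e k) / sqrt (\<alpha> k) \<partial>?M)"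
    by (rule integral_lebesgue_on_cong[OF coord(2)])
  ultimately show ?thesis by (simp add: cw_def)
qed

text \<open>The two endpoints are a null set for the integrals; measurability on the closed interval
  is checked on the open interval and the two singletons.\<close>

lemma L2_control_L2on:
  fixes \<psi> :: "real \<Rightarrow> 'b::{real_normed_vector, second_countable_topology}"
  shows "L2_control T \<psi> \<longleftrightarrow> L2on T \<psi>"
    and "L2on T \<psi> \<Longrightarrow> L2_norm_sq T \<psi> = (\<integral>s. (norm (\<psi> s))\<^sup>2 \<partial>lebesgue_on {0..T})"
proof -
  let ?f = "\<lambda>s. (norm (\<psi> s))\<^sup>2"
  have m: "\<psi> \<in> borel_measurable (lebesgue_on {0..T})" if "\<psi> \<in> borel_measurable (lebesgue_on {0<..<T})"
  proof (rule measurable_piecewise_restrict[where C = "{{0<..<T}, {0}, {T}}"])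
    fix \<Omega> assume "\<Omega> \<in> {{0<..<T}, {0}, {T}}"
    then consider "\<Omega> = {0<..<T}" | x where "\<Omega> = {x}" by auto
    then show "\<psi> \<in> borel_measurable (restrict_space (lebesgue_on {0..T}) \<Omega>)"
    proof cases
      case c: 1
      then have "{0..T} \<inter> \<Omega> = {0<..<T}" by auto
      then show ?thesis using that by (subst restrict_restrict_space) (auto simp: c)
    next
      case c: (2 x)
      have "\<psi> \<in> borel_measurable (lebesgue_on ({0..T} \<inter> \<Omega>))"
        by (subst measurable_lebesgue_cong[of _ _ "\<lambda>_. \<psi> x"]) (auto simp: c)
      then show ?thesis by (subst restrict_restrict_space) (auto simp: c)
    qed
  qed (auto simp: sets_restrict_space_iff)
  have m': "\<psi> \<in> borel_measurable (lebesgue_on {0<..<T})" if "\<psi> \<in> borel_measurable (lebesgue_on {0..T})"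
    by (rule measurable_lebesgue_on_sub[OF that]) auto
  have "AE x in lebesgue. x \<notin> {0, T}" by (rule AE_not_in) simp
  then have ae: "AE x in lebesgue. indicator {0<..<T} x *\<^sub>R ?f x = indicator {0..T} x *\<^sub>R ?f x"
    by (rule eventually_mono) (auto simp: indicator_def)
  have mm: "(\<lambda>x. indicator {0..T} x *\<^sub>R ?f x) \<in> borel_measurable lebesgue"
    "(\<lambda>x. indicator {0<..<T} x *\<^sub>R ?f x) \<in> borel_measurable lebesgue"
    if p: "\<psi> \<in> borel_measurable (lebesgue_on {0..T})"
  proof -
    have "?f \<in> borel_measurable (lebesgue_on {0..T})" "?f \<in> borel_measurable (lebesgue_on {0<..<T})"
      using p m'[OF p] by simp_all
    then show "(\<lambda>x. indicator {0..T} x *\<^sub>R ?f x) \<in> borel_measurable lebesgue"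
      "(\<lambda>x. indicator {0<..<T} x *\<^sub>R ?f x) \<in> borel_measurable lebesgue"
      by (simp_all add: borel_measurable_restrict_space_iff)
  qed
  have "integrable (lebesgue_on {0<..<T}) ?f \<longleftrightarrow> integrable (lebesgue_on {0..T}) ?f"
    if "\<psi> \<in> borel_measurable (lebesgue_on {0..T})"
    using integrable_cong_AE[OF mm(2)[OF that] mm(1)[OF that] ae] by (simp add: integrable_restrict_space)
  then show "L2_control T \<psi> \<longleftrightarrow> L2on T \<psi>"
    unfolding L2_control_def L2on_def using m m' by blast
  show "L2_norm_sq T \<psi> = (\<integral>s. (norm (\<psi> s))\<^sup>2 \<partial>lebesgue_on {0..T})" if "L2on T \<psi>"
    using integral_cong_AE[OF mm(2) mm(1) ae] that
    by (simp add: L2_norm_sq_def integral_restrict_space L2on_def)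
qed

section \<open>The quasi-potentials\<close>

locale diagonal_operator = hilbert_basis e for e :: "nat \<Rightarrow> 'h::{real_inner, complete_space, second_countable_topology}" +
  fixes Q :: "'h \<Rightarrow> 'h" and l :: "nat \<Rightarrow> real"
  assumes Q: "bounded_linear Q" and Q_e: "\<And>k. Q (e k) = l k *\<^sub>R e k"
begin

lemma Q_0 [simp]: "Q 0 = 0" by (rule linear_simps(3)[OF Q])

lemma Q_coord: "inner (Q x) (e k) = l k * inner x (e k)"
proof -
  have "inner (Q (proj N x)) (e k) = l k * inner x (e k)" if "k < N" for N
  proof -
    have "Q (proj N x) = (\<Sum>i<N. inner x (e i) *\<^sub>R (l i *\<^sub>R e i))"
      unfolding proj_def linear_sum[OF bounded_linear.linear[OF Q]] linear_simps(5)[OF Q] Q_e ..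
    then have "inner (Q (proj N x)) (e k) = (\<Sum>i<N. inner x (e i) * (l i * (if i = k then 1 else 0)))"
      by (simp add: inner_sum_left ortho mult.assoc)
    also have "\<dots> = (\<Sum>i<N. if i = k then l k * inner x (e k) else 0)" by (rule sum.cong) auto
    finally show ?thesis using that by simp
  qed
  then have "\<forall>\<^sub>F N in sequentially. inner (Q (proj N x)) (e k) = l k * inner x (e k)"
    by (intro eventually_sequentiallyI[of "Suc k"]) simp
  then have "(\<lambda>N. inner (Q (proj N x)) (e k)) \<longlonglongrightarrow> l k * inner x (e k)" by (rule tendsto_eventually)
  moreover have "(\<lambda>N. inner (Q (proj N x)) (e k)) \<longlonglongrightarrow> inner (Q x) (e k)"
    by (intro tendsto_inner tendsto_const bounded_linear.tendsto[OF Q] proj_tendsto)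
  ultimately show ?thesis using LIMSEQ_unique by blast
qed

lemma Q_sym: "inner (Q x) y = inner x (Q y)"
proof (rule sums_unique2[OF inner_sums])
  show "(\<lambda>k. inner (Q x) (e k) * inner y (e k)) sums inner x (Q y)"
    using inner_sums[of x "Q y"] by (simp add: Q_coord mult_ac)
qed

text \<open>The kernel is the closed span of the \<open>e k\<close> with \<open>l k = 0\<close>, so
  the preimage orthogonal to it arises from any preimage \<open>y\<close> by deleting these
  coordinates.\<close>

lemma pinv:
  shows pinv_coord: "inner (pinv Q (Q y)) (e k) = (if l k = 0 then 0 else inner y (e k))"
    and Q_pinv: "Q (pinv Q (Q y)) = Q y"
proof -
  define c where "c k = (if l k = 0 then 0 else inner y (e k))" for k
  have "\<bar>c k\<bar> \<le> 1 * \<bar>inner y (e k)\<bar>" for k by (simp add: c_def)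
  from vec_coord[OF vec_bound(1)[OF this]] have w: "inner (vec c) (e k) = c k" for k .
  have Qw: "Q (vec c) = Q y" by (rule coord_eqI) (simp add: Q_coord w c_def)
  have "pinv Q (Q y) = vec c"
    unfolding pinv_def
  proof (rule the_equality, intro conjI allI impI Qw)
    fix n assume "Q n = 0"
    then have n: "l k * inner n (e k) = 0" for k by (simp flip: Q_coord)
    have vn: "inner (vec c) (e k) * inner n (e k) = 0" for k using n[of k] by (auto simp: w c_def)
    show "inner (vec c) n = 0" using inner_sums[of "vec c" n] unfolding vn by (rule sums_unique2[OF _ sums_zero])
  next
    fix u assume u: "Q u = Q y \<and> (\<forall>n. Q n = 0 \<longrightarrow> inner u n = 0)"
    show "u = vec c"
    proof (rule coord_eqI)
      fix k
      show "inner u (e k) = inner (vec c) (e k)"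
      proof (cases "l k = 0")
        case True
        then show ?thesis using u Q_e[of k] by (simp add: w c_def)
      next
        case False
        then show ?thesis using u Q_coord[of u k] Q_coord[of y k] by (simp add: w c_def)
      qed
    qed
  qed
  then show "inner (pinv Q (Q y)) (e k) = (if l k = 0 then 0 else inner y (e k))" "Q (pinv Q (Q y)) = Q y"
    using w Qw by (simp_all add: c_def)
qed

lemma norm_pinv: "(norm (pinv Q (Q y)))\<^sup>2 \<le> (norm y)\<^sup>2"
  by (rule sums_le[OF _ parseval parseval]) (simp add: pinv_coord)

lemma pinv_0: "pinv Q 0 = 0"
  using norm_pinv[of 0] by simp

end

lemma (in spectral) norm_sqrt_A:
  assumes "x \<in> dom_sqrt_A e \<alpha>" shows "(norm (sqrt_A e \<alpha> x))\<^sup>2 = stiff x"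
proof -
  define c where "c k = sqrt (\<alpha> k) * inner x (e k)" for k
  have c2: "(c k)\<^sup>2 = \<alpha> k * (inner x (e k))\<^sup>2" for k
    using \<alpha>_pos[of k] by (simp add: c_def power_mult_distrib)
  have s: "summable (\<lambda>k. (c k)\<^sup>2)" using assms by (simp add: c2 dom_iff)
  have "sqrt_A e \<alpha> x = vec c" unfolding sqrt_A_def c_def[symmetric] using vec_sums[OF s] by (simp add: sums_iff)
  then show ?thesis using norm_vec[OF s] by (simp add: c2 stiff_def)
qed

locale perturbed = dirichlet \<Omega> J e \<alpha> + diagonal_operator e Q l
  for \<Omega> :: "'a::euclidean_space set"
    and J :: "'h::{real_inner, complete_space, second_countable_topology} \<Rightarrow> 'a \<Rightarrow> real"
    and e :: "nat \<Rightarrow> 'h" and \<alpha> :: "nat \<Rightarrow> real" and Q :: "'h \<Rightarrow> 'h" and l :: "nat \<Rightarrow> real" +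
  fixes F :: "'h \<Rightarrow> real" and DF :: "'h \<Rightarrow> 'h" and \<kappa> :: real
  assumes F_grad: "\<And>x. GDERIV F x :> DF x" and DF_cont: "continuous_on UNIV DF"
    and F_0: "F 0 = 0" and F_nonneg: "\<And>x. F x \<ge> 0" and F_radial: "\<And>x. inner (DF x) x \<ge> 0"
    and \<kappa>_nonneg: "\<kappa> \<ge> 0" and DF_lip: "\<And>x y. norm (DF x - DF y) \<le> \<kappa> * norm (x - y)"
begin

text \<open>The substitution \<open>\<phi> = Q p\<close> turns the controlled equations into gradient systems for \<open>F \<circ> Q\<close>,
  whose gradient is \<open>Q \<circ> DF \<circ> Q\<close>, driven by noise with identity covariance.\<close>

lemma system:
  assumes "0 \<le> \<mu>"
  shows "gradient_system e \<alpha> (\<lambda>x. F (Q x)) (\<lambda>x. Q (DF (Q x))) (onorm Q * (\<kappa> * onorm Q)) \<mu>"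
proof unfold_locales
  show "GDERIV (\<lambda>x. F (Q x)) x :> Q (DF (Q x))" for x
  proof -
    have "((\<lambda>x. F (Q x)) has_derivative (\<lambda>h. inner (Q h) (DF (Q x)))) (at x)"
      by (rule has_derivative_compose[OF bounded_linear_imp_has_derivative[OF Q] F_grad[unfolded gderiv_def]])
    then show ?thesis by (simp add: gderiv_def Q_sym)
  qed
  show "norm (Q (DF (Q x)) - Q (DF (Q y))) \<le> onorm Q * (\<kappa> * onorm Q) * norm (x - y)" for x y
  proof -
    have "norm (Q (DF (Q x) - DF (Q y))) \<le> onorm Q * norm (DF (Q x) - DF (Q y))" by (rule onorm[OF Q])
    also have "\<dots> \<le> onorm Q * (\<kappa> * norm (Q (x - y)))"
      using DF_lip[of "Q x" "Q y"] by (intro mult_left_mono onorm_pos_le[OF Q]) (simp add: linear_simps(2)[OF Q])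
    also have "\<dots> \<le> onorm Q * (\<kappa> * (onorm Q * norm (x - y)))"
      by (intro mult_left_mono onorm_pos_le[OF Q] \<kappa>_nonneg onorm[OF Q])
    finally show ?thesis by (simp add: linear_simps(2)[OF Q] mult_ac)
  qed
  show "0 \<le> inner (Q (DF (Q x))) x" for x using F_radial[of "Q x"] by (simp add: Q_sym)
qed (simp_all add: F_0 F_nonneg \<kappa>_nonneg onorm_pos_le[OF Q] assms)

sublocale parabolic: gradient_system e \<alpha> "\<lambda>x. F (Q x)" "\<lambda>x. Q (DF (Q x))" "onorm Q * (\<kappa> * onorm Q)" 0
  by (rule system) simp

text \<open>Passing to the pseudo-inverse only deletes coordinates of \<open>p\<close>.\<close>

lemma pinv_stiff:
  assumes "p \<in> dom_sqrt_A e \<alpha>"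
  shows "pinv Q (Q p) \<in> dom_sqrt_A e \<alpha>" and "stiff (pinv Q (Q p)) \<le> stiff p"
proof -
  have le: "\<alpha> k * (inner (pinv Q (Q p)) (e k))\<^sup>2 \<le> \<alpha> k * (inner p (e k))\<^sup>2" for k
    using \<alpha>_pos[of k] by (simp add: pinv_coord)
  have "norm (\<alpha> k * (inner (pinv Q (Q p)) (e k))\<^sup>2) \<le> \<alpha> k * (inner p (e k))\<^sup>2" for k
    using le[of k] \<alpha>_pos[of k] by simp
  then show *: "pinv Q (Q p) \<in> dom_sqrt_A e \<alpha>"
    using assms unfolding dom_iff by (rule summable_comparison_test'[where N = 0, rotated])
  show "stiff (pinv Q (Q p)) \<le> stiff p" by (rule sums_le[OF le stiff_sums[OF *] stiff_sums[OF assms]])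
qed

section \<open>Mild solutions as images of damped paths\<close>

lemma convolution_diff:
  assumes c: "continuous_on {0..t} c" and f: "L2on T f" and g: "L2on T g" and t: "t \<in> {0..T}"
  shows "(\<integral>s. c s * inner (f s - g s) (e k) \<partial>lebesgue_on {0..t})
    = (\<integral>s. c s * inner (f s) (e k) \<partial>lebesgue_on {0..t}) - (\<integral>s. c s * inner (g s) (e k) \<partial>lebesgue_on {0..t})"
proof -
  have i: "integrable (lebesgue_on {0..t}) (\<lambda>s. c s * inner (h s) (e k))" if "L2on T h" for h
    using L2on_integrable[OF L2on_mult_continuous[OF L2on_inner_const[OF L2on_sub[OF that, of t]] c, of "e k"]] t by simp
  show ?thesis
    unfolding inner_diff_left right_diff_distrib by (rule Bochner_Integration.integral_diff[OF i[OF f] i[OF g]])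
qed

text \<open>The nonlinear term is passed as a given function \<open>v\<close>, so only uniqueness of
  the linear modes is needed. The same formula serves a given solution, with \<open>v\<close>
  computed from it, and a constructed path, with \<open>v\<close> computed from that path.\<close>

lemma heat_mild:
  assumes d: "damped 0 T p q (\<lambda>s. \<psi> s - v s)" and p0: "p 0 = 0" and \<psi>: "L2on T \<psi>" and v: "L2on T v"
    and t: "t \<in> {0..T}"
  shows "Q (p t) = semigroup_of (dirichlet_laplacian \<Omega> J) t 0
    - (\<integral>s. semigroup_of (dirichlet_laplacian \<Omega> J) (t - s) (Q (v s)) \<partial>lebesgue_on {0..t})
    + (\<integral>s. semigroup_of (dirichlet_laplacian \<Omega> J) (t - s) (Q (\<psi> s)) \<partial>lebesgue_on {0..t})"
proof (rule coord_eqI)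
  fix k
  let ?c = "\<lambda>s. exp (- \<alpha> k * (t - s))"
  have conv: "inner (\<integral>s. semigroup_of (dirichlet_laplacian \<Omega> J) (t - s) (Q (f s)) \<partial>lebesgue_on {0..t}) (e k)
      = l k * (\<integral>s. ?c s * inner (f s) (e k) \<partial>lebesgue_on {0..t})" if "L2on T f" for f
    unfolding heat_convolution[OF L2on_bounded_linear[OF that Q] t] Q_coord
    by (simp add: mult.left_commute[of _ "l k"])
  have "inner (p t) (e k) = (\<integral>s. ?c s * inner (\<psi> s - v s) (e k) \<partial>lebesgue_on {0..t})"
    by (rule damped_unique_coords(1)[OF d order_refl p0 _ mode_convolution_heat[OF L2on_inner_const[OF dampedD(3)[OF d]]] _ _ t])
      (simp_all add: integral_eq_zero_null_sets)
  also have "\<dots> = (\<integral>s. ?c s * inner (\<psi> s) (e k) \<partial>lebesgue_on {0..t}) - (\<integral>s. ?c s * inner (v s) (e k) \<partial>lebesgue_on {0..t})"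
    by (rule convolution_diff[OF _ \<psi> v t]) (intro continuous_intros)
  finally show "inner (Q (p t)) (e k) = inner (semigroup_of (dirichlet_laplacian \<Omega> J) t 0
    - (\<integral>s. semigroup_of (dirichlet_laplacian \<Omega> J) (t - s) (Q (v s)) \<partial>lebesgue_on {0..t})
    + (\<integral>s. semigroup_of (dirichlet_laplacian \<Omega> J) (t - s) (Q (\<psi> s)) \<partial>lebesgue_on {0..t})) (e k)"
    using heat_semigroup(1)[of t 0 k] t
    by (simp add: Q_coord inner_add_left inner_diff_left conv[OF \<psi>] conv[OF v] right_diff_distrib)
qed

lemma L2on_force: "continuous_on {0..T} \<phi> \<Longrightarrow> L2on T (\<lambda>s. Q (DF (\<phi> s)))"
  by (intro L2on_continuous bounded_linear.continuous_on[OF Q] continuous_on_compose2[OF DF_cont]) auto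

lemma residual_control:
  assumes "\<And>t. t \<in> {0..T} \<Longrightarrow> \<phi> t = Q (p t)" and "L2on T \<psi>"
  shows "parabolic.residual T p (\<lambda>s. \<psi> s - Q (DF (\<phi> s))) = L2_norm_sq T \<psi>"
  unfolding L2_control_L2on(2)[OF assms(2)] parabolic.residual_def
  by (rule integral_lebesgue_on_cong) (simp add: assms(1))

text \<open>The given solution fixes its gradient term. The linear equation with that term as
  forcing has a path \<open>p\<close>, and \<open>heat_mild\<close> shows
  \<open>\<phi> = Q p\<close>; so \<open>p\<close> is a path of the gradient system with the same
  control, and \<open>lower_bound\<close> applies.\<close>

lemma heat_lower:
  assumes T: "0 < T" and c: "L2_control T \<psi>" and sol: "heat_solution \<Omega> J Q DF T \<psi> \<phi>" and \<phi>0: "\<phi> 0 = 0"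
  obtains a where "a \<in> dom_sqrt_A e \<alpha>" "\<phi> T = Q a" "stiff a + 2 * F (Q a) \<le> L2_norm_sq T \<psi> / 2"
proof -
  have \<psi>: "L2on T \<psi>" using c by (simp add: L2_control_L2on)
  have v: "L2on T (\<lambda>s. Q (DF (\<phi> s)))" using sol by (intro L2on_force) (simp add: heat_solution_def)
  obtain p q where d: "damped 0 T p q (\<lambda>s. \<psi> s - Q (DF (\<phi> s)))" and p0: "p 0 = 0"
    using damped_exists[OF order_refl _ L2on_diff[OF \<psi> v] dom_0] T by (metis less_imp_le)
  have path: "\<phi> t = Q (p t)" if "t \<in> {0..T}" for t
    using sol that heat_mild[OF d p0 \<psi> v that] by (simp add: heat_solution_def Let_def \<phi>0)
  have "parabolic.total (p T) (q T) \<le> L2_norm_sq T \<psi> / 2"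
    using parabolic.lower_bound[OF d p0] residual_control[OF path \<psi>] by simp
  then show thesis
    using that[of "p T"] dampedD(4)[OF d, of T] path[of T] T by (simp add: parabolic.total_def energy_def)
qed

lemma heat_upper:
  assumes a: "a \<in> dom_sqrt_A e \<alpha>" and \<epsilon>: "0 < \<epsilon>"
  obtains T \<psi> \<phi> where "0 < T" "L2_control T \<psi>" "heat_solution \<Omega> J Q DF T \<psi> \<phi>" "\<phi> 0 = 0" "\<phi> T = Q a"
    "L2_norm_sq T \<psi> / 2 \<le> stiff a + 2 * F (Q a) + \<epsilon>"
proof -
  obtain T p q g where T: "0 < T" and d: "damped 0 T p q g" and p: "p 0 = 0" "p T = a"
    and r: "parabolic.residual T p g / 2 \<le> parabolic.total a 0 + \<epsilon>"
    using parabolic.near_optimal_control[OF a \<epsilon>] by metis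
  let ?\<phi> = "\<lambda>t. Q (p t)" and ?\<psi> = "\<lambda>t. g t + Q (DF (Q (p t)))"
  have cont: "continuous_on {0..T} ?\<phi>" by (rule bounded_linear.continuous_on[OF Q damped_continuous[OF d]])
  note v = L2on_force[OF cont]
  have \<psi>: "L2on T ?\<psi>" by (rule L2on_add[OF dampedD(3)[OF d] v])
  have d': "damped 0 T p q (\<lambda>s. ?\<psi> s - Q (DF (Q (p s))))" using d by simp
  have "heat_solution \<Omega> J Q DF T ?\<psi> ?\<phi>"
    unfolding heat_solution_def Let_def using cont heat_mild[OF d' p(1) \<psi> v] by (simp add: p(1))
  moreover have "L2_norm_sq T ?\<psi> = parabolic.residual T p g"
    using residual_control[of T ?\<phi> p ?\<psi>] \<psi> by simp
  ultimately show thesis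
    using that[of T ?\<psi> ?\<phi>] T \<psi> p r by (simp add: L2_control_L2on parabolic.total_def energy_def)
qed

end

locale perturbed_wave = completed \<Omega> J e \<alpha> \<iota> \<mu> + perturbed \<Omega> J e \<alpha> Q l F DF \<kappa>
  for \<Omega> :: "'a::euclidean_space set"
    and J :: "'h::{real_inner, complete_space, second_countable_topology} \<Rightarrow> 'a \<Rightarrow> real"
    and e :: "nat \<Rightarrow> 'h" and \<alpha> :: "nat \<Rightarrow> real"
    and \<iota> :: "'h \<Rightarrow> 'm::{real_inner, complete_space, second_countable_topology}" and \<mu> :: real
    and Q :: "'h \<Rightarrow> 'h" and l :: "nat \<Rightarrow> real" and F :: "'h \<Rightarrow> real" and DF :: "'h \<Rightarrow> 'h" and \<kappa> :: real
begin

sublocale hyperbolic: gradient_system e \<alpha> "\<lambda>x. F (Q x)" "\<lambda>x. Q (DF (Q x))" "onorm Q * (\<kappa> * onorm Q)" \<mu>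
  by (rule system) (use \<mu>_pos in simp)

lemma \<iota>_inject: "\<iota> u = \<iota> v \<Longrightarrow> u = v"
proof (rule coord_eqI)
  fix k assume "\<iota> u = \<iota> v"
  then show "inner u (e k) = inner v (e k)" using \<iota>_coord[of u k] \<iota>_coord[of v k] \<alpha>_pos[of k] by simp
qed

text \<open>The factor \<open>1 / \<mu>\<close> in the Duhamel formula of the modes is the one in
  \<open>Q_mu\<close>; the velocity coordinate is divided by \<open>sqrt (\<alpha> k)\<close> on
  both sides because it is taken in the completion.\<close>

lemma wave_mild:
  assumes d: "damped \<mu> T p q (\<lambda>s. \<psi> s - v s)" and 0: "p 0 = 0" "q 0 = 0" and \<psi>: "L2on T \<psi>" and v: "L2on T v"
    and t: "t \<in> {0..T}"
  shows "(Q (p t), \<iota> (Q (q t))) = semigroup_of (A_mu \<Omega> J e \<alpha> \<iota> \<mu>) t 0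
    - (\<integral>s. semigroup_of (A_mu \<Omega> J e \<alpha> \<iota> \<mu>) (t - s) (Q_mu \<iota> Q \<mu> (v s)) \<partial>lebesgue_on {0..t})
    + (\<integral>s. semigroup_of (A_mu \<Omega> J e \<alpha> \<iota> \<mu>) (t - s) (Q_mu \<iota> Q \<mu> (\<psi> s)) \<partial>lebesgue_on {0..t})"
proof (rule wave.c_inject)
  fix k
  let ?S = "semigroup_of (A_mu \<Omega> J e \<alpha> \<iota> \<mu>)"
  let ?I = "\<lambda>f. \<integral>s. kern \<mu> (\<alpha> k) (t - s) / \<mu> * inner (f s) (e k) \<partial>lebesgue_on {0..t}"
  let ?I' = "\<lambda>f. \<integral>s. kern' \<mu> (\<alpha> k) (t - s) / \<mu> * inner (f s) (e k) \<partial>lebesgue_on {0..t}"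
  have Qm: "Q_mu \<iota> Q \<mu> x = (0, \<iota> ((1 / \<mu>) *\<^sub>R Q x))" for x
    by (simp add: Q_mu_def linear_simps(5)[OF \<iota>])
  have conv: "cw (\<integral>s. ?S (t - s) (Q_mu \<iota> Q \<mu> (f s)) \<partial>lebesgue_on {0..t}) k = (l k * ?I f, l k * ?I' f / sqrt (\<alpha> k))"
    if "L2on T f" for f
  proof -
    have r: "c * inner ((1 / \<mu>) *\<^sub>R Q x) (e k) = l k * (c / \<mu> * inner x (e k))" for c x
      by (simp add: Q_coord)
    show ?thesis
      unfolding Qm wave_convolution[OF L2on_scaleR[OF L2on_bounded_linear[OF that Q]] t] r by simp
  qed
  have c: "continuous_on {0..t} (\<lambda>s. kern \<mu> (\<alpha> k) (t - s) / \<mu>)" "continuous_on {0..t} (\<lambda>s. kern' \<mu> (\<alpha> k) (t - s) / \<mu>)"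
    using continuous_on_compose2[OF continuous_kern(1)[OF \<mu>_pos, of UNIV "\<alpha> k"], of "{0..t}" "\<lambda>s. t - s"]
      continuous_on_compose2[OF continuous_kern(2)[OF \<mu>_pos, of UNIV "\<alpha> k"], of "{0..t}" "\<lambda>s. t - s"] \<mu>_pos
    by (simp_all add: continuous_on_diff continuous_on_divide)
  have m: "mode \<mu> (\<alpha> k) T (\<lambda>t. \<integral>s. kern \<mu> (\<alpha> k) (t - s) * (inner (\<psi> s - v s) (e k) / \<mu>) \<partial>lebesgue_on {0..t})
      (\<lambda>t. \<integral>s. kern' \<mu> (\<alpha> k) (t - s) * (inner (\<psi> s - v s) (e k) / \<mu>) \<partial>lebesgue_on {0..t}) (\<lambda>s. inner (\<psi> s - v s) (e k))"
    by (rule mode_convolution_wave[OF \<mu>_pos L2on_inner_const[OF dampedD(3)[OF d]]])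
  note u = damped_unique_coords[OF d less_imp_le[OF \<mu>_pos] 0 m _ _ t]
  have "inner (p t) (e k) = (\<integral>s. kern \<mu> (\<alpha> k) (t - s) * (inner (\<psi> s - v s) (e k) / \<mu>) \<partial>lebesgue_on {0..t})"
    by (rule u(1)) (simp_all add: integral_eq_zero_null_sets)
  also have "\<dots> = ?I (\<lambda>s. \<psi> s - v s)" by simp
  also have "\<dots> = ?I \<psi> - ?I v" by (rule convolution_diff[OF c(1) \<psi> v t])
  finally have p: "inner (p t) (e k) = ?I \<psi> - ?I v" .
  have "inner (q t) (e k) = (\<integral>s. kern' \<mu> (\<alpha> k) (t - s) * (inner (\<psi> s - v s) (e k) / \<mu>) \<partial>lebesgue_on {0..t})"
    by (rule u(2)) (use \<mu>_pos in \<open>simp_all add: integral_eq_zero_null_sets\<close>)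
  also have "\<dots> = ?I' (\<lambda>s. \<psi> s - v s)" by simp
  also have "\<dots> = ?I' \<psi> - ?I' v" by (rule convolution_diff[OF c(2) \<psi> v t])
  finally have q: "inner (q t) (e k) = ?I' \<psi> - ?I' v" .
  have S0: "cw (?S t 0) k = 0" using wave_semigroup(1)[of t 0 k] t by (simp add: cw_def Uw_def zero_prod_def)
  show "cw (Q (p t), \<iota> (Q (q t))) k = cw (?S t 0 - (\<integral>s. ?S (t - s) (Q_mu \<iota> Q \<mu> (v s)) \<partial>lebesgue_on {0..t})
    + (\<integral>s. ?S (t - s) (Q_mu \<iota> Q \<mu> (\<psi> s)) \<partial>lebesgue_on {0..t})) k"
    unfolding wave.c_lin conv[OF \<psi>] conv[OF v] S0
    by (simp add: cw_def \<iota>_coord Q_coord p q right_diff_distrib diff_divide_distrib)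
qed

text \<open>Same reduction as for the heat equation. It also shows that every controlled end
  velocity has the form \<open>\<iota> (Q b)\<close>.\<close>

lemma wave_lower:
  assumes T: "0 < T" and c: "L2_control T \<psi>" and sol: "wave_solution \<Omega> J e \<alpha> \<iota> Q DF \<mu> T \<psi> z" and z0: "z 0 = 0"
  obtains a b where "a \<in> dom_sqrt_A e \<alpha>" "z T = (Q a, \<iota> (Q b))"
    "stiff a + \<mu> * (norm b)\<^sup>2 + 2 * F (Q a) \<le> L2_norm_sq T \<psi> / 2"
proof -
  have \<psi>: "L2on T \<psi>" using c by (simp add: L2_control_L2on)
  have v: "L2on T (\<lambda>s. Q (DF (fst (z s))))"
    using sol by (intro L2on_force continuous_on_fst) (simp add: wave_solution_def)
  obtain p q where d: "damped \<mu> T p q (\<lambda>s. \<psi> s - Q (DF (fst (z s))))" and 0: "p 0 = 0" "q 0 = 0"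
    using damped_exists[OF less_imp_le[OF \<mu>_pos] _ L2on_diff[OF \<psi> v] dom_0] T \<mu>_pos by (metis less_imp_le less_irrefl)
  have path: "z t = (Q (p t), \<iota> (Q (q t)))" if "t \<in> {0..T}" for t
    using sol that wave_mild[OF d 0 \<psi> v that] by (simp add: wave_solution_def Let_def z0)
  have "hyperbolic.total (p T) (q T) \<le> L2_norm_sq T \<psi> / 2"
    using hyperbolic.lower_bound[OF d 0] residual_control[of T "\<lambda>t. fst (z t)" p \<psi>] path \<psi> by simp
  then show thesis
    using that[of "p T" "q T"] dampedD(4)[OF d, of T] path[of T] T by (simp add: hyperbolic.total_def energy_def)
qed

lemma wave_upper:
  assumes a: "a \<in> dom_sqrt_A e \<alpha>" and \<epsilon>: "0 < \<epsilon>"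
  obtains T \<psi> z where "0 < T" "L2_control T \<psi>" "wave_solution \<Omega> J e \<alpha> \<iota> Q DF \<mu> T \<psi> z" "z 0 = 0"
    "z T = (Q a, \<iota> (Q b))" "L2_norm_sq T \<psi> / 2 \<le> stiff a + \<mu> * (norm b)\<^sup>2 + 2 * F (Q a) + \<epsilon>"
proof -
  obtain T p q g where T: "0 < T" and d: "damped \<mu> T p q g" and 0: "p 0 = 0" "q 0 = 0" and T': "p T = a" "q T = b"
    and r: "hyperbolic.residual T p g / 2 \<le> hyperbolic.total a b + \<epsilon>"
    using hyperbolic.near_optimal_control[OF a \<epsilon>, of b] \<mu>_pos by (metis less_irrefl)
  let ?z = "\<lambda>t. (Q (p t), \<iota> (Q (q t)))" and ?\<psi> = "\<lambda>t. g t + Q (DF (Q (p t)))"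
  have cp: "continuous_on {0..T} (\<lambda>t. Q (p t))" by (rule bounded_linear.continuous_on[OF Q damped_continuous[OF d]])
  have cont: "continuous_on {0..T} ?z"
    by (intro continuous_on_Pair cp bounded_linear.continuous_on[OF \<iota>] bounded_linear.continuous_on[OF Q]
      damped_velocity_continuous[OF d \<mu>_pos])
  note v = L2on_force[OF cp]
  have \<psi>: "L2on T ?\<psi>" by (rule L2on_add[OF dampedD(3)[OF d] v])
  have d': "damped \<mu> T p q (\<lambda>s. ?\<psi> s - Q (DF (Q (p s))))" using d by simp
  have z0: "?z 0 = 0" by (simp add: 0 linear_simps(3)[OF \<iota>] zero_prod_def)
  have "wave_solution \<Omega> J e \<alpha> \<iota> Q DF \<mu> T ?\<psi> ?z"
    unfolding wave_solution_def Let_def z0 fst_conv using cont wave_mild[OF d' 0 \<psi> v] by blast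
  moreover have "L2_norm_sq T ?\<psi> = hyperbolic.residual T p g"
    using residual_control[of T "\<lambda>t. Q (p t)" p ?\<psi>] \<psi> by simp
  ultimately show thesis
    using that[of T ?\<psi> ?z] T \<psi> z0 T' r by (simp add: L2_control_L2on hyperbolic.total_def energy_def)
qed

end

text \<open>A path without admissible control has infinite inner infimum and satisfies the bound
  trivially, so only pairs of a path and a control have to be considered.\<close>

lemma Inf_half_ge:
  assumes "\<And>T z \<psi>. P T z \<Longrightarrow> R T \<psi> z \<Longrightarrow> V \<le> L T \<psi> / 2"
  shows "ereal V \<le> Inf {ereal (1 / 2) * Inf {ereal (L T \<psi>) | \<psi>. R T \<psi> z} | T z. P T z}"
proof (rule Inf_greatest, clarify)
  fix T z assume "P T z"
  then have "2 * V \<le> L T \<psi>" if "R T \<psi> z" for \<psi> using assms[of T z \<psi>] that by simp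
  then have "ereal (2 * V) \<le> Inf {ereal (L T \<psi>) | \<psi>. R T \<psi> z}" by (intro Inf_greatest) auto
  then have "ereal (1 / 2) * ereal (2 * V) \<le> ereal (1 / 2) * Inf {ereal (L T \<psi>) | \<psi>. R T \<psi> z}"
    by (rule ereal_mult_left_mono) simp
  then show "ereal V \<le> ereal (1 / 2) * Inf {ereal (L T \<psi>) | \<psi>. R T \<psi> z}" by simp
qed

lemma Inf_half_le:
  assumes "\<And>\<epsilon>. 0 < \<epsilon> \<Longrightarrow> \<exists>T z \<psi>. P T z \<and> R T \<psi> z \<and> L T \<psi> / 2 \<le> V + \<epsilon>"
  shows "Inf {ereal (1 / 2) * Inf {ereal (L T \<psi>) | \<psi>. R T \<psi> z} | T z. P T z} \<le> ereal V"
proof (rule ereal_le_epsilon2)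
  fix \<epsilon> :: real assume "0 < \<epsilon>"
  then obtain T z \<psi> where *: "P T z" "R T \<psi> z" "L T \<psi> / 2 \<le> V + \<epsilon>" using assms by blast
  have "Inf {ereal (1 / 2) * Inf {ereal (L T \<psi>) | \<psi>. R T \<psi> z} | T z. P T z}
      \<le> ereal (1 / 2) * Inf {ereal (L T \<psi>) | \<psi>. R T \<psi> z}"
    by (rule Inf_lower) (use * in blast)
  also have "\<dots> \<le> ereal (1 / 2) * ereal (L T \<psi>)"
    by (intro ereal_mult_left_mono Inf_lower) (use * in auto)
  also have "\<dots> \<le> ereal V + ereal \<epsilon>" using * by simp
  finally show "Inf {ereal (1 / 2) * Inf {ereal (L T \<psi>) | \<psi>. R T \<psi> z} | T z. P T z} \<le> ereal V + ereal \<epsilon>" .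
qed

section \<open>The formulas for the quasi-potentials\<close>

context perturbed
begin

lemma dom_pinvE:
  assumes "x \<in> dom_sqrt_A_pinv e \<alpha> Q"
  obtains a where "a = pinv Q x" "a \<in> dom_sqrt_A e \<alpha>" "Q a = x" "(norm (sqrt_A e \<alpha> (pinv Q x)))\<^sup>2 = stiff a"
proof (rule that[OF refl])
  show d: "pinv Q x \<in> dom_sqrt_A e \<alpha>" using assms by (simp add: dom_sqrt_A_pinv_def)
  show "Q (pinv Q x) = x" using assms Q_pinv by (auto simp: dom_sqrt_A_pinv_def)
  show "(norm (sqrt_A e \<alpha> (pinv Q x)))\<^sup>2 = stiff (pinv Q x)" by (rule norm_sqrt_A[OF d])
qed

theorem heat_quasipotential_eq:
  assumes "x \<in> dom_sqrt_A_pinv e \<alpha> Q"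
  shows "heat_quasipotential \<Omega> J Q DF x = ereal ((norm (sqrt_A e \<alpha> (pinv Q x)))\<^sup>2 + 2 * F x)"
proof (rule antisym)
  obtain a where a: "a = pinv Q x" "a \<in> dom_sqrt_A e \<alpha>" "Q a = x" "(norm (sqrt_A e \<alpha> (pinv Q x)))\<^sup>2 = stiff a"
    using assms by (rule dom_pinvE)
  show "ereal ((norm (sqrt_A e \<alpha> (pinv Q x)))\<^sup>2 + 2 * F x) \<le> heat_quasipotential \<Omega> J Q DF x"
    unfolding heat_quasipotential_def heat_action_def
  proof (rule Inf_half_ge, elim conjE)
    fix T \<phi> \<psi>
    assume T: "0 < T" and \<phi>: "\<phi> 0 = 0" "\<phi> T = x"
      and sol: "L2_control T \<psi>" "heat_solution \<Omega> J Q DF T \<psi> \<phi>"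
    obtain b where b: "b \<in> dom_sqrt_A e \<alpha>" "\<phi> T = Q b" "stiff b + 2 * F (Q b) \<le> L2_norm_sq T \<psi> / 2"
      using heat_lower[OF T sol \<phi>(1)] .
    have "stiff (pinv Q (Q b)) \<le> stiff b" by (rule pinv_stiff(2)[OF b(1)])
    then show "(norm (sqrt_A e \<alpha> (pinv Q x)))\<^sup>2 + 2 * F x \<le> L2_norm_sq T \<psi> / 2"
      using a(1,4) b \<phi>(2) by simp
  qed
  show "heat_quasipotential \<Omega> J Q DF x \<le> ereal ((norm (sqrt_A e \<alpha> (pinv Q x)))\<^sup>2 + 2 * F x)"
    unfolding heat_quasipotential_def heat_action_def
  proof (rule Inf_half_le)
    fix \<epsilon> :: real assume "0 < \<epsilon>"
    then obtain T \<psi> \<phi> where *: "0 < T" "L2_control T \<psi>" "heat_solution \<Omega> J Q DF T \<psi> \<phi>" "\<phi> 0 = 0" "\<phi> T = Q a"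
      "L2_norm_sq T \<psi> / 2 \<le> stiff a + 2 * F (Q a) + \<epsilon>"
      by (rule heat_upper[OF a(2)])
    moreover have "continuous_on {0..T} \<phi>" using *(3) by (simp add: heat_solution_def)
    ultimately show "\<exists>T \<phi> \<psi>. (0 < T \<and> continuous_on {0..T} \<phi> \<and> \<phi> 0 = 0 \<and> \<phi> T = x) \<and>
        (L2_control T \<psi> \<and> heat_solution \<Omega> J Q DF T \<psi> \<phi>) \<and>
        L2_norm_sq T \<psi> / 2 \<le> (norm (sqrt_A e \<alpha> (pinv Q x)))\<^sup>2 + 2 * F x + \<epsilon>"
      using a(3,4) by (intro exI[of _ T] exI[of _ \<phi>] exI[of _ \<psi>]) simp
  qed
qed

end

context perturbed_wave
begin

text \<open>\<open>B\<close> is any lower bound for the cost of the end velocity over all its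
  preimages. The value at the pseudo-inverse gives the formula, \<open>B = 0\<close> the infimum
  over all \<open>y\<close>; if \<open>y\<close> has no preimage the condition is empty.\<close>

lemma wave_quasipotential_ge:
  assumes "x \<in> dom_sqrt_A_pinv e \<alpha> Q"
    and B: "\<And>b. y = \<iota> (Q b) \<Longrightarrow> B \<le> \<mu> * (norm b)\<^sup>2"
  shows "ereal ((norm (sqrt_A e \<alpha> (pinv Q x)))\<^sup>2 + 2 * F x + B) \<le> wave_quasipotential \<Omega> J e \<alpha> \<iota> Q DF \<mu> x y"
  unfolding wave_quasipotential_def wave_action_def
proof (rule Inf_half_ge, elim conjE)
  obtain a where a: "a = pinv Q x" "a \<in> dom_sqrt_A e \<alpha>" "Q a = x" "(norm (sqrt_A e \<alpha> (pinv Q x)))\<^sup>2 = stiff a"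
    using assms(1) by (rule dom_pinvE)
  fix T z \<psi>
  assume T: "0 < T" and z: "z 0 = 0" "z T = (x, y)"
    and sol: "L2_control T \<psi>" "wave_solution \<Omega> J e \<alpha> \<iota> Q DF \<mu> T \<psi> z"
  obtain c b where b: "c \<in> dom_sqrt_A e \<alpha>" "z T = (Q c, \<iota> (Q b))"
    "stiff c + \<mu> * (norm b)\<^sup>2 + 2 * F (Q c) \<le> L2_norm_sq T \<psi> / 2"
    using wave_lower[OF T sol z(1)] .
  have "stiff (pinv Q (Q c)) \<le> stiff c" by (rule pinv_stiff(2)[OF b(1)])
  moreover have "B \<le> \<mu> * (norm b)\<^sup>2" using B z(2) b(2) by simp
  ultimately show "(norm (sqrt_A e \<alpha> (pinv Q x)))\<^sup>2 + 2 * F x + B \<le> L2_norm_sq T \<psi> / 2"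
    using a(1,4) b z(2) by simp
qed

theorem wave_quasipotential_eq:
  assumes x: "x \<in> dom_sqrt_A_pinv e \<alpha> Q" and y: "y \<in> range Q"
  shows "wave_quasipotential \<Omega> J e \<alpha> \<iota> Q DF \<mu> x (\<iota> y) =
    ereal ((norm (sqrt_A e \<alpha> (pinv Q x)))\<^sup>2 + 2 * F x + \<mu> * (norm (pinv Q y))\<^sup>2)"
proof (rule antisym)
  show "ereal ((norm (sqrt_A e \<alpha> (pinv Q x)))\<^sup>2 + 2 * F x + \<mu> * (norm (pinv Q y))\<^sup>2)
      \<le> wave_quasipotential \<Omega> J e \<alpha> \<iota> Q DF \<mu> x (\<iota> y)"
  proof (rule wave_quasipotential_ge[OF x])
    fix b assume "\<iota> y = \<iota> (Q b)"
    then have "y = Q b" by (rule \<iota>_inject)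
    then show "\<mu> * (norm (pinv Q y))\<^sup>2 \<le> \<mu> * (norm b)\<^sup>2"
      using norm_pinv[of b] \<mu>_pos by simp
  qed
  obtain a where a: "a = pinv Q x" "a \<in> dom_sqrt_A e \<alpha>" "Q a = x" "(norm (sqrt_A e \<alpha> (pinv Q x)))\<^sup>2 = stiff a"
    using x by (rule dom_pinvE)
  have b: "Q (pinv Q y) = y" using y Q_pinv by auto
  show "wave_quasipotential \<Omega> J e \<alpha> \<iota> Q DF \<mu> x (\<iota> y)
      \<le> ereal ((norm (sqrt_A e \<alpha> (pinv Q x)))\<^sup>2 + 2 * F x + \<mu> * (norm (pinv Q y))\<^sup>2)"
    unfolding wave_quasipotential_def wave_action_def
  proof (rule Inf_half_le)
    fix \<epsilon> :: real assume "0 < \<epsilon>"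
    then obtain T \<psi> z where *: "0 < T" "L2_control T \<psi>" "wave_solution \<Omega> J e \<alpha> \<iota> Q DF \<mu> T \<psi> z" "z 0 = 0"
      "z T = (Q a, \<iota> (Q (pinv Q y)))"
      "L2_norm_sq T \<psi> / 2 \<le> stiff a + \<mu> * (norm (pinv Q y))\<^sup>2 + 2 * F (Q a) + \<epsilon>"
      by (rule wave_upper[OF a(2)])
    moreover have "continuous_on {0..T} z" using *(3) by (simp add: wave_solution_def)
    ultimately show "\<exists>T z \<psi>. (0 < T \<and> continuous_on {0..T} z \<and> z 0 = 0 \<and> z T = (x, \<iota> y)) \<and>
        (L2_control T \<psi> \<and> wave_solution \<Omega> J e \<alpha> \<iota> Q DF \<mu> T \<psi> z) \<and>
        L2_norm_sq T \<psi> / 2 \<le> (norm (sqrt_A e \<alpha> (pinv Q x)))\<^sup>2 + 2 * F x + \<mu> * (norm (pinv Q y))\<^sup>2 + \<epsilon>"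
      using a(3,4) b by (intro exI[of _ T] exI[of _ z] exI[of _ \<psi>]) simp
  qed
qed

text \<open>At \<open>y = 0\<close> the velocity cost vanishes, and
  \<open>wave_quasipotential_ge\<close> with \<open>B = 0\<close> shows that no other
  \<open>y\<close> is cheaper.\<close>

lemma wave_quasipotential_0:
  assumes x: "x \<in> dom_sqrt_A_pinv e \<alpha> Q"
  shows "wave_quasipotential \<Omega> J e \<alpha> \<iota> Q DF \<mu> x 0 = heat_quasipotential \<Omega> J Q DF x"
    and "(INF y. wave_quasipotential \<Omega> J e \<alpha> \<iota> Q DF \<mu> x y) = wave_quasipotential \<Omega> J e \<alpha> \<iota> Q DF \<mu> x 0"
proof -
  let ?V = "(norm (sqrt_A e \<alpha> (pinv Q x)))\<^sup>2 + 2 * F x"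
  have "0 \<in> range Q" by (rule range_eqI[of _ _ 0]) simp
  from wave_quasipotential_eq[OF x this] have V: "wave_quasipotential \<Omega> J e \<alpha> \<iota> Q DF \<mu> x 0 = ereal ?V"
    by (simp add: pinv_0 linear_simps(3)[OF \<iota>])
  then show "wave_quasipotential \<Omega> J e \<alpha> \<iota> Q DF \<mu> x 0 = heat_quasipotential \<Omega> J Q DF x"
    by (simp add: heat_quasipotential_eq[OF x])
  have "ereal ?V \<le> wave_quasipotential \<Omega> J e \<alpha> \<iota> Q DF \<mu> x y" for y
    using wave_quasipotential_ge[OF x, of y 0] \<mu>_pos by simp
  then show "(INF y. wave_quasipotential \<Omega> J e \<alpha> \<iota> Q DF \<mu> x y) = wave_quasipotential \<Omega> J e \<alpha> \<iota> Q DF \<mu> x 0"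
    unfolding V[symmetric] by (intro antisym INF_lower INF_greatest) simp_all
qed

end

theorem theorem4p1:
  fixes \<Omega> :: "'a::euclidean_space set"
    and J :: "'h::{real_inner, complete_space, second_countable_topology} \<Rightarrow> 'a \<Rightarrow> real"
    and e :: "nat \<Rightarrow> 'h" and \<alpha> :: "nat \<Rightarrow> real"
    and \<iota> :: "'h \<Rightarrow> 'm::{real_inner, complete_space, second_countable_topology}"
    and Q :: "'h \<Rightarrow> 'h" and l :: "nat \<Rightarrow> real"
    and F :: "'h \<Rightarrow> real" and DF :: "'h \<Rightarrow> 'h" and \<kappa> :: real
  assumes "bounded_domain \<Omega>" and "lipschitz_boundary \<Omega>"
    and "L2_model \<Omega> J"
    and "dirichlet_eigenbasis \<Omega> J e \<alpha>"
    and "H_completion \<Omega> J e \<alpha> (-1) \<iota>"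
    and "bounded_linear Q" and "\<And>k. Q (e k) = l k *\<^sub>R e k"
    and "summable (\<lambda>k. (l k)\<^sup>2 / \<alpha> k)"
    and "\<And>x. GDERIV F x :> DF x" and "continuous_on UNIV DF"
    and "F 0 = 0" and "\<And>x. F x \<ge> 0" and "\<And>x. inner (DF x) x \<ge> 0"
    and "\<kappa> \<ge> 0" and "\<And>x y. norm (DF x - DF y) \<le> \<kappa> * norm (x - y)"
  shows "(\<forall>\<mu>>0. \<forall>x\<in>dom_sqrt_A_pinv e \<alpha> Q. \<forall>y\<in>range Q.
            wave_quasipotential \<Omega> J e \<alpha> \<iota> Q DF \<mu> x (\<iota> y) =
              ereal ((norm (sqrt_A e \<alpha> (pinv Q x)))\<^sup>2 + 2 * F x + \<mu> * (norm (pinv Q y))\<^sup>2)) \<and>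
         (\<forall>x\<in>dom_sqrt_A_pinv e \<alpha> Q.
            heat_quasipotential \<Omega> J Q DF x =
              ereal ((norm (sqrt_A e \<alpha> (pinv Q x)))\<^sup>2 + 2 * F x)) \<and>
         (\<forall>\<mu>>0. \<forall>x\<in>dom_sqrt_A_pinv e \<alpha> Q.
            (INF y. wave_quasipotential \<Omega> J e \<alpha> \<iota> Q DF \<mu> x y) =
              wave_quasipotential \<Omega> J e \<alpha> \<iota> Q DF \<mu> x 0 \<and>
            wave_quasipotential \<Omega> J e \<alpha> \<iota> Q DF \<mu> x 0 = heat_quasipotential \<Omega> J Q DF x)"
proof -
  interpret perturbed \<Omega> J e \<alpha> Q l F DF \<kappa>
  proof (intro perturbed.intro dirichlet.intro L2_space.intro spectral.intro diagonal_operator.intro hilbert_basis.intro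
      spectral_axioms.intro dirichlet_axioms.intro diagonal_operator_axioms.intro perturbed_axioms.intro)
    show "open \<Omega>" using assms(1) by (simp add: bounded_domain_def)
  qed (use assms in \<open>simp_all add: dirichlet_eigenbasis_def\<close>)
  have wave: "perturbed_wave \<Omega> J e \<alpha> \<iota> \<mu> Q l F DF \<kappa>" if "\<mu> > 0" for \<mu>
    using assms(5) that
    by (intro perturbed_wave.intro completed.intro completed_axioms.intro dirichlet_axioms perturbed_axioms) (fact | assumption)+
  show ?thesis
    using heat_quasipotential_eq perturbed_wave.wave_quasipotential_eq[OF wave] perturbed_wave.wave_quasipotential_0[OF wave]
    by blast
qed

end
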